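(* Let $(\mathbf U(t),\mathbf V(t))_{t\in[0,T]}$ be the solution of the compact finite difference semi-discrete scheme $$d\mathbf U=\mathbf V\,dt,\qquad d\mathbf V=\mathbf A^{-1}\mathbf D\,\mathbf U\,dt-F(\mathbf U)\,dt+G(\mathbf U)\,\mathbf E\,\boldsymbol\Lambda\,d\boldsymbol\beta(t).$$ Define the discrete energy $$\bar H(\mathbf U,\mathbf V)=\frac12\sum_{i=1}^{M-1}hV_i^2-\frac12\sum_{i=1}^{M-1}hU_i\,(\mathbf A^{-1}\mathbf D\,\mathbf U)_i+\sum_{i=1}^{M-1}h\,\widetilde f(U_i).$$ Then for every $t\in[0,T]$, $$\mathbb E\big[\bar H(\mathbf U(t),\mathbf V(t))\big]=\mathbb E\big[\bar H(\mathbf U(0),\mathbf V(0))\big]+\frac h2\,\mathbb E\left[\int_0^t \mathrm{Tr}\big(G^2(\mathbf U(s))\,\mathbf E\,\boldsymbol\Lambda^2\,\mathbf E^\top\big)\,ds\right].$$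
   Context: The scheme is a spatial discretization of the stochastic wave equation $du=v\,dt$, $dv=\Delta u\,dt-f(u)\,dt+g(u)\,dW(t)$ on $(a,b)\times(0,T]$ with homogeneous Dirichlet boundary condition and deterministic real-valued initial data $u_0,v_0$. Here $W(t)=\sum_{k\ge1}\sqrt{q_k}\,e_k\,\beta_k(t)$ is a $Q$-Wiener process on $L^2([a,b];\mathbb R)$, where $Q$ is symmetric, positive definite and of finite trace, with eigenpairs $(q_k,e_k)$ and orthonormal eigenfunctions $e_k$ (real functions on $[a,b]$ that can be evaluated at the grid points). The $\beta_k$ are independent real standard Brownian motions on a filtered probability space $(\Omega,\mathcal F,\{\mathcal F_t\},\mathbb P)$ with a normal filtration. The functions $f,g:\mathbb R\to\mathbb R$ are globally Lipschitz, and $\widetilde f:\mathbb R\to\mathbb R$ is an antiderivative of $f$, i.e. $\widetilde f'=f$. Discretization: $M$ is a positive integer ($M\ge2$), $h=(b-a)/M$, $x_i=a+ih$ for $0\le i\le M$, and $P\ge1$ is an integer (noise truncation). The unknowns are $\mathbf U=(U_1,\dots,U_{M-1})^\top$ and $\mathbf V=(V_1,\dots,V_{M-1})^\top$, where $U_i(t)$, $V_i(t)$ approximate $u(x_i,t)$, $v(x_i,t)$, with deterministic initial values. Matrices: $\mathbf D$ is the $(M-1)\times(M-1)$ tridiagonal matrix $\frac1{h^2}\,\mathrm{tridiag}(1,-2,1)$ (diagonal entries $-2/h^2$, first off-diagonal entries $1/h^2$). $\mathbf A$ is the $(M-1)\times(M-1)$ tridiagonal matrix $\mathrm{tridiag}(\frac1{12},\frac{10}{12},\frac1{12})$.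 Further, $F(\mathbf U)=(f(U_1),\dots,f(U_{M-1}))^\top$, $G(\mathbf U)=\mathrm{diag}\{g(U_1),\dots,g(U_{M-1})\}$, $\boldsymbol\Lambda=\mathrm{diag}\{\sqrt{q_1},\dots,\sqrt{q_P}\}$, $\boldsymbol\beta=(\beta_1,\dots,\beta_P)^\top$, and $\mathbf E$ is the $(M-1)\times P$ matrix with entries $\mathbf E_{ik}=e_k(x_i)$. *)

theory Defs
  imports
    "HOL-Probability.Probability"
    "Jordan_Normal_Form.Gauss_Jordan_Elimination"
begin

unbundle no vec_syntax

section \<open>Filtered probability space and Wiener process\<close>

definition normal_filtration :: "'w measure \<Rightarrow> (real \<Rightarrow> 'w measure) \<Rightarrow> bool" where
  "normal_filtration \<P> \<F> \<longleftrightarrow>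
     (\<forall>t\<ge>0. subalgebra \<P> (\<F> t)) \<and>
     (\<forall>s t. 0 \<le> s \<longrightarrow> s \<le> t \<longrightarrow> sets (\<F> s) \<subseteq> sets (\<F> t)) \<and>
     null_sets \<P> \<subseteq> sets (\<F> 0) \<and>
     (\<forall>t\<ge>0. sets (\<F> t) = (\<Inter>s\<in>{t<..}. sets (\<F> s)))"

definition standard_brownian_motion ::
  "'w measure \<Rightarrow> (real \<Rightarrow> 'w measure) \<Rightarrow> (real \<Rightarrow> 'w \<Rightarrow> real) \<Rightarrow> bool" where
  "standard_brownian_motion \<P> \<F> B \<longleftrightarrow>
     (\<forall>t\<ge>0. B t \<in> borel_measurable (\<F> t)) \<and>
     (AE \<omega> in \<P>. B 0 \<omega> = 0) \<and>
     (AE \<omega> in \<P>. continuous_on {0..} (\<lambda>t. B t \<omega>)) \<and>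
     (\<forall>s t. 0 \<le> s \<longrightarrow> s < t \<longrightarrow>
        distributed \<P> lborel (\<lambda>\<omega>. B t \<omega> - B s \<omega>) (normal_density 0 (sqrt (t - s))) \<and>
        prob_space.indep_set \<P> (sets (\<F> s))
          {(\<lambda>\<omega>. B t \<omega> - B s \<omega>) -` A \<inter> space \<P> | A. A \<in> sets borel})"

text \<open>
  The coordinates \<open>\<beta> k\<close> of a Wiener process with respect to the filtration. The last clause says
  that the increments of the whole process, and not only those of each coordinate, are independent
  of the past, as in the definition of a Wiener process relative to a filtration.
\<close>

definition wiener_coordinates ::
  "'w measure \<Rightarrow> (real \<Rightarrow> 'w measure) \<Rightarrow> (nat \<Rightarrow> real \<Rightarrow> 'w \<Rightarrow> real) \<Rightarrow> bool" where
  "wiener_coordinates \<P> \<F> \<beta> \<longleftrightarrow>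
     (\<forall>k. standard_brownian_motion \<P> \<F> (\<beta> k)) \<and>
     prob_space.indep_vars \<P> (\<lambda>k. PiM {0..} (\<lambda>t. borel)) (\<lambda>k \<omega>. \<lambda>t\<in>{0..}. \<beta> k t \<omega>) UNIV \<and>
     (\<forall>s t. 0 \<le> s \<longrightarrow> s < t \<longrightarrow>
        prob_space.indep_set \<P> (sets (\<F> s))
          {(\<lambda>\<omega> k. \<beta> k t \<omega> - \<beta> k s \<omega>) -` A \<inter> space \<P> | A. A \<in> sets (PiM UNIV (\<lambda>k. borel))})"

section \<open>The covariance operator\<close>

text \<open>
  Elements of \<open>L\<^sup>2([a,b])\<close> are represented by functions on the real line; only their restriction to
  \<open>{a..b}\<close> matters, and equality in \<open>L\<^sup>2\<close> is equality almost everywhere.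
\<close>

definition L2fun :: "real \<Rightarrow> real \<Rightarrow> (real \<Rightarrow> real) set" where
  "L2fun a b = {\<phi> \<in> borel_measurable (lebesgue_on {a..b}).
     integrable (lebesgue_on {a..b}) (\<lambda>x. (\<phi> x)\<^sup>2)}"

definition L2inner :: "real \<Rightarrow> real \<Rightarrow> (real \<Rightarrow> real) \<Rightarrow> (real \<Rightarrow> real) \<Rightarrow> real" where
  "L2inner a b \<phi> \<psi> = (\<integral>x. \<phi> x * \<psi> x \<partial>lebesgue_on {a..b})"

definition L2eq :: "real \<Rightarrow> real \<Rightarrow> (real \<Rightarrow> real) \<Rightarrow> (real \<Rightarrow> real) \<Rightarrow> bool" where
  "L2eq a b \<phi> \<psi> \<longleftrightarrow> (AE x in lebesgue_on {a..b}. \<phi> x = \<psi> x)"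

definition orthonormal_basis_L2 :: "real \<Rightarrow> real \<Rightarrow> (nat \<Rightarrow> real \<Rightarrow> real) \<Rightarrow> bool" where
  "orthonormal_basis_L2 a b e \<longleftrightarrow>
     (\<forall>k. e k \<in> L2fun a b) \<and>
     (\<forall>j k. L2inner a b (e j) (e k) = (if j = k then 1 else 0)) \<and>
     (\<forall>\<phi>\<in>L2fun a b. (\<forall>k. L2inner a b \<phi> (e k) = 0) \<longrightarrow> L2eq a b \<phi> (\<lambda>x. 0))"

text \<open>
  \<open>Q\<close> is a symmetric positive definite linear operator on \<open>L\<^sup>2([a,b])\<close> of finite trace, with eigenpairs
  \<open>(q k, e k)\<close>. The eigenpairs are numbered from 0, so \<open>(q k, e k)\<close> is the pair with number \<open>k + 1\<close>
  of a numbering that starts at 1. By the spectral theorem the eigenfunctions form an orthonormal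
  basis, in which the trace is computed.
\<close>

definition covariance_operator ::
  "real \<Rightarrow> real \<Rightarrow> ((real \<Rightarrow> real) \<Rightarrow> (real \<Rightarrow> real)) \<Rightarrow> (nat \<Rightarrow> real) \<Rightarrow> (nat \<Rightarrow> real \<Rightarrow> real) \<Rightarrow> bool" where
  "covariance_operator a b Q q e \<longleftrightarrow>
     (\<forall>\<phi>\<in>L2fun a b. Q \<phi> \<in> L2fun a b) \<and>
     (\<forall>\<phi>\<in>L2fun a b. \<forall>\<psi>\<in>L2fun a b. L2eq a b \<phi> \<psi> \<longrightarrow> L2eq a b (Q \<phi>) (Q \<psi>)) \<and>
     (\<forall>\<phi>\<in>L2fun a b. \<forall>\<psi>\<in>L2fun a b. \<forall>c d.
        L2eq a b (Q (\<lambda>x. c * \<phi> x + d * \<psi> x)) (\<lambda>x. c * Q \<phi> x + d * Q \<psi> x)) \<and>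
     (\<forall>\<phi>\<in>L2fun a b. \<forall>\<psi>\<in>L2fun a b. L2inner a b (Q \<phi>) \<psi> = L2inner a b \<phi> (Q \<psi>)) \<and>
     (\<forall>\<phi>\<in>L2fun a b. \<not> L2eq a b \<phi> (\<lambda>x. 0) \<longrightarrow> L2inner a b (Q \<phi>) \<phi> > 0) \<and>
     orthonormal_basis_L2 a b e \<and>
     (\<forall>k. L2eq a b (Q (e k)) (\<lambda>x. q k * e k x)) \<and>
     summable (\<lambda>k. L2inner a b (Q (e k)) (e k))"

section \<open>The It\^o integral\<close>

definition conv_in_prob :: "'w measure \<Rightarrow> (nat \<Rightarrow> 'w \<Rightarrow> real) \<Rightarrow> ('w \<Rightarrow> real) \<Rightarrow> bool" where
  "conv_in_prob \<P> X Y \<longleftrightarrow>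
     (\<forall>\<epsilon>>0. (\<lambda>n. measure \<P> {\<omega> \<in> space \<P>. \<bar>X n \<omega> - Y \<omega>\<bar> > \<epsilon>}) \<longlonglongrightarrow> 0)"

definition progressively_measurable ::
  "(real \<Rightarrow> 'w measure) \<Rightarrow> real \<Rightarrow> (real \<Rightarrow> 'w \<Rightarrow> real) \<Rightarrow> bool" where
  "progressively_measurable \<F> T \<phi> \<longleftrightarrow>
     (\<forall>t\<in>{0..T}. (\<lambda>(s, \<omega>). \<phi> s \<omega>) \<in> borel_measurable (restrict_space borel {0..t} \<Otimes>\<^sub>M \<F> t))"

text \<open>A simple process has the value \<open>\<xi> j\<close> on \<open>{\<tau> j<..\<tau> (Suc j)}\<close> for \<open>j < n\<close>.\<close>

definition simple_process ::
  "'w measure \<Rightarrow> (real \<Rightarrow> 'w measure) \<Rightarrow> real \<Rightarrow> nat \<Rightarrow> (nat \<Rightarrow> real) \<Rightarrow> (nat \<Rightarrow> 'w \<Rightarrow> real) \<Rightarrow> bool" where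
  "simple_process \<P> \<F> T n \<tau> \<xi> \<longleftrightarrow>
     \<tau> 0 = 0 \<and> \<tau> n = T \<and> (\<forall>j<n. \<tau> j < \<tau> (Suc j)) \<and>
     (\<forall>j<n. \<xi> j \<in> borel_measurable (\<F> (\<tau> j)) \<and> (\<exists>C. \<forall>\<omega>\<in>space \<P>. \<bar>\<xi> j \<omega>\<bar> \<le> C))"

definition simple_value ::
  "nat \<Rightarrow> (nat \<Rightarrow> real) \<Rightarrow> (nat \<Rightarrow> 'w \<Rightarrow> real) \<Rightarrow> real \<Rightarrow> 'w \<Rightarrow> real" where
  "simple_value n \<tau> \<xi> s \<omega> = (\<Sum>j<n. \<xi> j \<omega> * indicator {\<tau> j<..\<tau> (Suc j)} s)"

definition simple_integral ::
  "nat \<Rightarrow> (nat \<Rightarrow> real) \<Rightarrow> (nat \<Rightarrow> 'w \<Rightarrow> real) \<Rightarrow> (real \<Rightarrow> 'w \<Rightarrow> real) \<Rightarrow> real \<Rightarrow> 'w \<Rightarrow> real" where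
  "simple_integral n \<tau> \<xi> B t \<omega> =
     (\<Sum>j<n. \<xi> j \<omega> * (B (min t (\<tau> (Suc j))) \<omega> - B (min t (\<tau> j)) \<omega>))"

text \<open>
  \<open>I\<close> is (a continuous version of) the It\^o integral process of \<open>\<phi>\<close> against \<open>B\<close> on \<open>[0,T]\<close>, for
  progressively measurable integrands whose square is almost surely integrable in time; no moment
  of the integrand is assumed. The limit does not depend on the approximating simple processes.
\<close>

definition has_ito_integral ::
  "'w measure \<Rightarrow> (real \<Rightarrow> 'w measure) \<Rightarrow> real \<Rightarrow> (real \<Rightarrow> 'w \<Rightarrow> real) \<Rightarrow>
     (real \<Rightarrow> 'w \<Rightarrow> real) \<Rightarrow> (real \<Rightarrow> 'w \<Rightarrow> real) \<Rightarrow> bool" where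
  "has_ito_integral \<P> \<F> T B \<phi> I \<longleftrightarrow>
     progressively_measurable \<F> T \<phi> \<and>
     (AE \<omega> in \<P>. set_integrable lborel {0..T} (\<lambda>s. (\<phi> s \<omega>)\<^sup>2)) \<and>
     (\<forall>t\<in>{0..T}. I t \<in> borel_measurable (\<F> t)) \<and>
     (AE \<omega> in \<P>. continuous_on {0..T} (\<lambda>t. I t \<omega>)) \<and>
     (\<exists>n \<tau> \<xi>.
        (\<forall>r. simple_process \<P> \<F> T (n r) (\<tau> r) (\<xi> r)) \<and>
        conv_in_prob \<P>
          (\<lambda>r \<omega>. LBINT s:{0..T}. (simple_value (n r) (\<tau> r) (\<xi> r) s \<omega> - \<phi> s \<omega>)\<^sup>2) (\<lambda>\<omega>. 0) \<and>
        (\<forall>t\<in>{0..T}. conv_in_prob \<P> (\<lambda>r. simple_integral (n r) (\<tau> r) (\<xi> r) B t) (I t)))"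

section \<open>The compact finite difference scheme\<close>

text \<open>
  Vectors and matrices are indexed from 0: the entry \<open>i < M - 1\<close> belongs to the interior grid point
  \<open>gridpt a b M (Suc i)\<close>.
\<close>

definition mesh :: "real \<Rightarrow> real \<Rightarrow> nat \<Rightarrow> real" where
  "mesh a b M = (b - a) / real M"

definition gridpt :: "real \<Rightarrow> real \<Rightarrow> nat \<Rightarrow> nat \<Rightarrow> real" where
  "gridpt a b M i = a + real i * mesh a b M"

definition tridiag :: "nat \<Rightarrow> real \<Rightarrow> real \<Rightarrow> real \<Rightarrow> real mat" where
  "tridiag m l d u = Matrix.mat m m
     (\<lambda>(i, j). if i = j then d else if i = Suc j then l else if j = Suc i then u else 0)"

definition D_mat :: "real \<Rightarrow> real \<Rightarrow> nat \<Rightarrow> real mat" where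
  "D_mat a b M = (1 / (mesh a b M)\<^sup>2) \<cdot>\<^sub>m tridiag (M - 1) 1 (-2) 1"

definition A_mat :: "nat \<Rightarrow> real mat" where
  "A_mat M = tridiag (M - 1) (1 / 12) (10 / 12) (1 / 12)"

text \<open>
  \<open>A_mat M\<close> is strictly diagonally dominant, hence invertible, so \<open>mat_inverse\<close> does not return \<open>None\<close>.
\<close>

definition AinvD_mat :: "real \<Rightarrow> real \<Rightarrow> nat \<Rightarrow> real mat" where
  "AinvD_mat a b M = the (mat_inverse (A_mat M)) * D_mat a b M"

definition F_vec :: "(real \<Rightarrow> real) \<Rightarrow> nat \<Rightarrow> real vec \<Rightarrow> real vec" where
  "F_vec f M u = Matrix.vec (M - 1) (\<lambda>i. f (u $ i))"

definition G_mat :: "(real \<Rightarrow> real) \<Rightarrow> nat \<Rightarrow> real vec \<Rightarrow> real mat" where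
  "G_mat g M u = mat_diag (M - 1) (\<lambda>i. g (u $ i))"

definition Lambda_mat :: "(nat \<Rightarrow> real) \<Rightarrow> nat \<Rightarrow> real mat" where
  "Lambda_mat q P = mat_diag P (\<lambda>k. sqrt (q k))"

definition E_mat :: "real \<Rightarrow> real \<Rightarrow> nat \<Rightarrow> (nat \<Rightarrow> real \<Rightarrow> real) \<Rightarrow> nat \<Rightarrow> real mat" where
  "E_mat a b M e P = Matrix.mat (M - 1) P (\<lambda>(i, k). e k (gridpt a b M (Suc i)))"

definition mat_trace :: "real mat \<Rightarrow> real" where
  "mat_trace X = (\<Sum>i<dim_row X. X $$ (i, i))"

definition continuous_adapted_vec_process ::
  "'w measure \<Rightarrow> (real \<Rightarrow> 'w measure) \<Rightarrow> real \<Rightarrow> nat \<Rightarrow> (real \<Rightarrow> 'w \<Rightarrow> real vec) \<Rightarrow> bool" where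
  "continuous_adapted_vec_process \<P> \<F> T m X \<longleftrightarrow>
     (\<forall>t\<in>{0..T}. \<forall>\<omega>\<in>space \<P>. X t \<omega> \<in> carrier_vec m) \<and>
     (\<forall>i<m. \<forall>t\<in>{0..T}. (\<lambda>\<omega>. X t \<omega> $ i) \<in> borel_measurable (\<F> t)) \<and>
     (\<forall>i<m. \<forall>\<omega>\<in>space \<P>. continuous_on {0..T} (\<lambda>t. X t \<omega> $ i))"

text \<open>
  Solutions of
  \<open>dU = V dt, dV = A\<^sup>-\<^sup>1 D U dt - F(U) dt + G(U) E \<Lambda> d\<beta>\<close> on \<open>[0,T]\<close> with deterministic initial values
  \<open>u0\<close>, \<open>v0\<close>, in integrated form and written by components; \<open>I i k\<close> is the It\^o integral of the
  \<open>(i, k)\<close> entry of \<open>G(U) E \<Lambda>\<close> against \<open>\<beta> k\<close>.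
\<close>

definition cfd_solution ::
  "'w measure \<Rightarrow> (real \<Rightarrow> 'w measure) \<Rightarrow> (nat \<Rightarrow> real \<Rightarrow> 'w \<Rightarrow> real) \<Rightarrow> real \<Rightarrow>
     real \<Rightarrow> real \<Rightarrow> nat \<Rightarrow> nat \<Rightarrow> (nat \<Rightarrow> real) \<Rightarrow> (nat \<Rightarrow> real \<Rightarrow> real) \<Rightarrow>
     (real \<Rightarrow> real) \<Rightarrow> (real \<Rightarrow> real) \<Rightarrow> real vec \<Rightarrow> real vec \<Rightarrow>
     (real \<Rightarrow> 'w \<Rightarrow> real vec) \<Rightarrow> (real \<Rightarrow> 'w \<Rightarrow> real vec) \<Rightarrow> bool" where
  "cfd_solution \<P> \<F> \<beta> T a b M P q e f g u0 v0 U V \<longleftrightarrow>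
     continuous_adapted_vec_process \<P> \<F> T (M - 1) U \<and>
     continuous_adapted_vec_process \<P> \<F> T (M - 1) V \<and>
     (AE \<omega> in \<P>. U 0 \<omega> = u0 \<and> V 0 \<omega> = v0) \<and>
     (\<forall>t\<in>{0..T}. \<forall>i<M - 1. AE \<omega> in \<P>.
        U t \<omega> $ i = U 0 \<omega> $ i + (LBINT s:{0..t}. V s \<omega> $ i)) \<and>
     (\<exists>I. (\<forall>i<M - 1. \<forall>k<P. has_ito_integral \<P> \<F> T (\<beta> k)
              (\<lambda>s \<omega>. (G_mat g M (U s \<omega>) * E_mat a b M e P * Lambda_mat q P) $$ (i, k)) (I i k)) \<and>
          (\<forall>t\<in>{0..T}. \<forall>i<M - 1. AE \<omega> in \<P>.
             V t \<omega> $ i = V 0 \<omega> $ i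
               + (LBINT s:{0..t}. (AinvD_mat a b M *\<^sub>v U s \<omega>) $ i)
               - (LBINT s:{0..t}. F_vec f M (U s \<omega>) $ i)
               + (\<Sum>k<P. I i k t \<omega>)))"

definition discrete_energy ::
  "real \<Rightarrow> real \<Rightarrow> nat \<Rightarrow> (real \<Rightarrow> real) \<Rightarrow> real vec \<Rightarrow> real vec \<Rightarrow> real" where
  "discrete_energy a b M ft u v =
     1 / 2 * (\<Sum>i<M - 1. mesh a b M * (v $ i)\<^sup>2)
     - 1 / 2 * (\<Sum>i<M - 1. mesh a b M * (u $ i) * ((AinvD_mat a b M *\<^sub>v u) $ i))
     + (\<Sum>i<M - 1. mesh a b M * ft (u $ i))"

definition noise_trace ::
  "real \<Rightarrow> real \<Rightarrow> nat \<Rightarrow> nat \<Rightarrow> (nat \<Rightarrow> real) \<Rightarrow> (nat \<Rightarrow> real \<Rightarrow> real) \<Rightarrow> (real \<Rightarrow> real) \<Rightarrow> real vec \<Rightarrow> real" where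
  "noise_trace a b M P q e g u =
     mat_trace ((G_mat g M u ^\<^sub>m 2) * E_mat a b M e P * (Lambda_mat q P ^\<^sub>m 2)
       * transpose_mat (E_mat a b M e P))"

end

theory Submission
  imports Defs "Jordan_Normal_Form.Determinant"
begin

text \<open>
  The It\^o formula is not needed. Write \<open>V = R + N\<close> with the pathwise continuously differentiable
  drift part \<open>R\<close> and the stochastic integral \<open>N\<close>. Since \<open>N\<close> is a martingale,
  \<open>E[R'(s) N(t)] = E[R'(s) N(s)]\<close> for \<open>s \<le> t\<close>; with the It\^o isometry for \<open>E[N\<^sup>2]\<close> this gives
  \<open>E[V\<^sup>2] = v\<^sub>0\<^sup>2 + 2 E[\<integral>R' V] + E[\<integral>\<sigma>\<^sup>2]\<close>. Here \<open>R' \<cdot> V\<close> is the time derivative of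
  \<open>1/2 U \<cdot> A\<^sup>-\<^sup>1 D U - \<Sum> ft(U\<^sub>i)\<close>, because \<open>U' = V\<close> and \<open>A\<^sup>-\<^sup>1 D\<close> is symmetric.

  As no moments are assumed, second moments have to be shown finite first. On the events
  \<open>{sup\<^bsub>[0,t]\<^esub> |U| \<le> R}\<close> all coefficients are bounded, Gronwall's inequality gives a bound that
  does not depend on \<open>R\<close>, and Fatou's lemma lets \<open>R\<close> tend to infinity. To work on these events
  without stopping times, the simple integrands that approximate \<open>\<sigma>\<close> are refined to grids of
  vanishing mesh, multiplied by the event indicator at the left end of each interval, and clipped.
\<close>

section \<open>Square integrable functions\<close>

text \<open>The obstacle is that the definition of the stochastic integral offers only convergence
  in probability along some unspecified simple integrands, while the argument needs second moments.
  Decreasing events \<open>A t\<close> can replace a stopping time for this reason: if a simple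
  integrand is multiplied at each grid time by the indicator of the event at that time, then on
  \<open>A t\<close> its integral up to t is unchanged, since \<open>A t\<close> is contained in all
  earlier events and later intervals have no increment before t. Only U is truncated, as the
  coefficients depend on U alone; U being the time integral of V closes the loop between the two.
  Truncated moments obey only inequalities, which suffices for a bound uniform in R. Once the
  moments are finite, the same approximation with the trivial events \<open>space M\<close> gives
  mean square convergence of the integrals, and with it the exact isometry. The martingale property
  is used in tested form, against square integrable variables known at time s; the test variable
  R'(s) then settles the covariance of R and N without a product rule.\<close>

definition sq_integrable :: "'a measure \<Rightarrow> ('a \<Rightarrow> real) \<Rightarrow> bool" where
  "sq_integrable N f \<longleftrightarrow> f \<in> borel_measurable N \<and> integrable N (\<lambda>x. (f x)\<^sup>2)"

lemma sq_integrableI: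
  "f \<in> borel_measurable N \<Longrightarrow> integrable N (\<lambda>x. (f x)\<^sup>2) \<Longrightarrow> sq_integrable N f"
  by (simp add: sq_integrable_def)

lemma sq_integrableD:
  assumes "sq_integrable N f"
  shows "f \<in> borel_measurable N" "integrable N (\<lambda>x. (f x)\<^sup>2)"
  using assms by (auto simp: sq_integrable_def)

lemma sq_integrable_bound:
  fixes f g :: "'a \<Rightarrow> real"
  assumes "sq_integrable N g" "f \<in> borel_measurable N" "AE x in N. \<bar>f x\<bar> \<le> \<bar>g x\<bar>"
  shows "sq_integrable N f"
proof -
  have "integrable N (\<lambda>x. (f x)\<^sup>2)"
    by (rule Bochner_Integration.integrable_bound[OF sq_integrableD(2)[OF assms(1)]])
       (use assms in \<open>auto simp: abs_le_square_iff\<close>)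
  then show ?thesis using assms by (simp add: sq_integrable_def)
qed

lemma sq_integrable_mult:
  assumes "sq_integrable N f" "sq_integrable N g"
  shows "integrable N (\<lambda>x. f x * g x)"
proof (rule Bochner_Integration.integrable_bound)
  show "integrable N (\<lambda>x. (f x)\<^sup>2 + (g x)\<^sup>2)"
    using assms by (auto simp: sq_integrable_def)
  show "(\<lambda>x. f x * g x) \<in> borel_measurable N"
    using assms by (auto simp: sq_integrable_def)
  have "\<bar>a * b\<bar> \<le> a\<^sup>2 + b\<^sup>2" for a b :: real
  proof -
    have "2 * (\<bar>a\<bar> * \<bar>b\<bar>) \<le> a\<^sup>2 + b\<^sup>2"
      using sum_squares_bound[of "\<bar>a\<bar>" "\<bar>b\<bar>"] by (simp add: mult.assoc)
    moreover have "0 \<le> \<bar>a\<bar> * \<bar>b\<bar>" by simp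
    ultimately show ?thesis unfolding abs_mult by linarith
  qed
  then show "AE x in N. norm (f x * g x) \<le> norm ((f x)\<^sup>2 + (g x)\<^sup>2)"
    by auto
qed

lemma sq_integrable_add:
  assumes "sq_integrable N f" "sq_integrable N g"
  shows "sq_integrable N (\<lambda>x. f x + g x)"
proof -
  have "integrable N (\<lambda>x. (f x)\<^sup>2 + (g x)\<^sup>2 + 2 * (f x * g x))"
    using assms sq_integrable_mult[OF assms] by (auto simp: sq_integrable_def)
  also have "(\<lambda>x. (f x)\<^sup>2 + (g x)\<^sup>2 + 2 * (f x * g x)) = (\<lambda>x. (f x + g x)\<^sup>2)"
    by (simp add: power2_sum mult.assoc)
  finally show ?thesis using assms by (auto simp: sq_integrable_def)
qed

lemma sq_integrable_cmult:
  assumes "sq_integrable N f" shows "sq_integrable N (\<lambda>x. c * f x)"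
  using assms by (auto simp: sq_integrable_def power_mult_distrib)

lemma sq_integrable_diff:
  assumes "sq_integrable N f" "sq_integrable N g"
  shows "sq_integrable N (\<lambda>x. f x - g x)"
  using sq_integrable_add[OF assms(1) sq_integrable_cmult[OF assms(2), of "-1"]] by simp

lemma sq_integrable_zero: "sq_integrable N (\<lambda>x. 0)"
  by (simp add: sq_integrable_def)

lemma sq_integrable_sum:
  assumes "\<And>i. i \<in> I \<Longrightarrow> sq_integrable N (f i)"
  shows "sq_integrable N (\<lambda>x. \<Sum>i\<in>I. f i x)"
proof (cases "finite I")
  case True
  from this assms show ?thesis
    by (induction I) (auto intro!: sq_integrable_add simp: sq_integrable_zero)
next
  case False then show ?thesis by (simp add: sq_integrable_zero)
qed

lemma sq_integrable_cong_AE: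
  assumes "sq_integrable N f" "g \<in> borel_measurable N" "AE x in N. f x = g x"
  shows "sq_integrable N g"
  by (rule sq_integrable_bound[OF assms(1,2)]) (use assms(3) in auto)

lemma sq_integrable_bounded:
  assumes "finite_measure N" "f \<in> borel_measurable N" "\<And>x. x \<in> space N \<Longrightarrow> \<bar>f x\<bar> \<le> C"
  shows "sq_integrable N f"
proof -
  interpret finite_measure N by fact
  have "sq_integrable N (\<lambda>x. C)" by (simp add: sq_integrable_def)
  then show ?thesis by (rule sq_integrable_bound) (use assms in force)+
qed

lemma sq_integrable_imp_integrable:
  assumes "finite_measure N" "sq_integrable N f"
  shows "integrable N f"
proof -
  interpret finite_measure N by fact
  have "sq_integrable N (\<lambda>x. 1)" by (simp add: sq_integrable_def)
  from sq_integrable_mult[OF assms(2) this] show ?thesis by simp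
qed

text \<open>Young's inequality with a free weight: a large \<open>c\<close> trades a small second
  moment of \<open>f\<close> against a merely bounded one of \<open>g\<close>. The factor 2 gained
  from the square is discarded.\<close>

lemma integral_mult_weighted_le:
  assumes "sq_integrable N f" "sq_integrable N g" "c > 0"
  shows "\<bar>\<integral>x. f x * g x \<partial>N\<bar> \<le> c * (\<integral>x. (f x)\<^sup>2 \<partial>N) + (\<integral>x. (g x)\<^sup>2 \<partial>N) / c"
proof -
  have p: "\<bar>a * b\<bar> \<le> c * a\<^sup>2 + b\<^sup>2 / c" for a b :: real
  proof -
    have "0 \<le> (c * \<bar>a\<bar> - \<bar>b\<bar>)\<^sup>2 / c" using assms(3) by simp
    also have "\<dots> = c * a\<^sup>2 + b\<^sup>2 / c - 2 * \<bar>a * b\<bar>"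
      using assms(3) by (simp add: power2_diff power_mult_distrib abs_mult field_simps) (simp add: power2_eq_square)
    finally show ?thesis by (smt (verit) abs_ge_zero)
  qed
  have i: "integrable N (\<lambda>x. c * (f x)\<^sup>2 + (g x)\<^sup>2 / c)"
    using assms by (auto simp: sq_integrable_def)
  have "\<bar>\<integral>x. f x * g x \<partial>N\<bar> \<le> (\<integral>x. \<bar>f x * g x\<bar> \<partial>N)" by (rule integral_abs_bound)
  also have "\<dots> \<le> (\<integral>x. c * (f x)\<^sup>2 + (g x)\<^sup>2 / c \<partial>N)"
    by (rule integral_mono[OF _ i]) (use p sq_integrable_mult[OF assms(1,2)] in auto)
  also have "\<dots> = c * (\<integral>x. (f x)\<^sup>2 \<partial>N) + (\<integral>x. (g x)\<^sup>2 \<partial>N) / c"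
    using assms by (auto simp: sq_integrable_def)
  finally show ?thesis .
qed

lemma integral_mult_tendsto_0:
  assumes f: "\<And>r. sq_integrable N (f r)" and g: "\<And>r. sq_integrable N (g r)"
    and lim: "(\<lambda>r. \<integral>x. (f r x)\<^sup>2 \<partial>N) \<longlonglongrightarrow> 0"
    and bnd: "\<And>r. (\<integral>x. (g r x)\<^sup>2 \<partial>N) \<le> K"
  shows "(\<lambda>r. \<integral>x. f r x * g r x \<partial>N) \<longlonglongrightarrow> 0"
proof (rule LIMSEQ_I)
  fix \<epsilon> :: real assume \<epsilon>: "\<epsilon> > 0"
  have K: "K \<ge> 0" using bnd[of 0] by (rule order_trans[rotated]) simp
  \<comment> \<open>With this weight the bounded factor contributes \<open>K / c\<close>, at most
    half of \<open>\<epsilon>\<close>; the summand 1 keeps \<open>c\<close> positive when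
    \<open>K = 0\<close>.\<close>
  define c where "c = 2 * (K + 1) / \<epsilon>"
  have c: "c > 0" using K \<epsilon> by (simp add: c_def)
  have "\<epsilon> / (2 * c) > 0" using c \<epsilon> by simp
  from LIMSEQ_D[OF lim this] obtain r0 where r0: "\<And>r. r \<ge> r0 \<Longrightarrow> (\<integral>x. (f r x)\<^sup>2 \<partial>N) < \<epsilon> / (2 * c)"
    by (force simp: abs_less_iff)
  show "\<exists>no. \<forall>r\<ge>no. norm ((\<integral>x. f r x * g r x \<partial>N) - 0) < \<epsilon>"
  proof (intro exI[of _ r0] allI impI)
    fix r assume "r \<ge> r0"
    have "\<bar>\<integral>x. f r x * g r x \<partial>N\<bar> \<le> c * (\<integral>x. (f r x)\<^sup>2 \<partial>N) + (\<integral>x. (g r x)\<^sup>2 \<partial>N) / c"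
      by (rule integral_mult_weighted_le[OF f g c])
    moreover have "c * (\<integral>x. (f r x)\<^sup>2 \<partial>N) < \<epsilon> / 2"
      using r0[OF \<open>r \<ge> r0\<close>] c by (simp add: field_simps)
    moreover have "(\<integral>x. (g r x)\<^sup>2 \<partial>N) / c \<le> K / c" using bnd c by (simp add: divide_right_mono)
    moreover have "K / c \<le> \<epsilon> / 2" using K \<epsilon> by (simp add: c_def field_simps)
    ultimately have "\<bar>\<integral>x. f r x * g r x \<partial>N\<bar> < \<epsilon> / 2 + \<epsilon> / 2" by linarith
    then show "norm ((\<integral>x. f r x * g r x \<partial>N) - 0) < \<epsilon>" by simp
  qed
qed

section \<open>Convergence in mean square\<close>

definition L2_conv :: "'a measure \<Rightarrow> (nat \<Rightarrow> 'a \<Rightarrow> real) \<Rightarrow> ('a \<Rightarrow> real) \<Rightarrow> bool" where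
  "L2_conv N X Y \<longleftrightarrow> (\<forall>r. sq_integrable N (X r)) \<and> sq_integrable N Y \<and>
     (\<lambda>r. \<integral>x. (X r x - Y x)\<^sup>2 \<partial>N) \<longlonglongrightarrow> 0"

lemma L2_convD:
  assumes "L2_conv N X Y"
  shows "sq_integrable N (X r)" "sq_integrable N Y" "(\<lambda>r. \<integral>x. (X r x - Y x)\<^sup>2 \<partial>N) \<longlonglongrightarrow> 0"
  using assms by (auto simp: L2_conv_def)

text \<open>Expansion around the limits leaves three remainders, each the product of a factor that
  vanishes in mean square and one with bounded second moment.\<close>

lemma L2_conv_inner:
  assumes X: "L2_conv N X Y" and X': "L2_conv N X' Y'"
  shows "(\<lambda>r. \<integral>x. X r x * X' r x \<partial>N) \<longlonglongrightarrow> (\<integral>x. Y x * Y' x \<partial>N)"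
proof -
  note sX = L2_convD(1)[OF X] and sY = L2_convD(2)[OF X]
    and sX' = L2_convD(1)[OF X'] and sY' = L2_convD(2)[OF X']
  have d: "sq_integrable N (\<lambda>x. X r x - Y x)" "sq_integrable N (\<lambda>x. X' r x - Y' x)" for r
    using sX sY sX' sY' by (auto intro: sq_integrable_diff)
  have "Bseq (\<lambda>r. \<integral>x. (X' r x - Y' x)\<^sup>2 \<partial>N)"
    by (rule convergent_imp_Bseq[OF convergentI[OF L2_convD(3)[OF X']]])
  then obtain K where "\<forall>r. norm (\<integral>x. (X' r x - Y' x)\<^sup>2 \<partial>N) \<le> K"
    by (rule BseqE)
  then have K: "(\<integral>x. (X' r x - Y' x)\<^sup>2 \<partial>N) \<le> K" for r
    by (simp add: abs_le_iff)
  have l1: "(\<lambda>r. \<integral>x. (X r x - Y x) * (X' r x - Y' x) \<partial>N) \<longlonglongrightarrow> 0"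
    by (rule integral_mult_tendsto_0[OF d L2_convD(3)[OF X] K])
  have l2: "(\<lambda>r. \<integral>x. (X r x - Y x) * Y' x \<partial>N) \<longlonglongrightarrow> 0"
    by (rule integral_mult_tendsto_0[OF d(1) sY' L2_convD(3)[OF X] order_refl])
  have l3: "(\<lambda>r. \<integral>x. (X' r x - Y' x) * Y x \<partial>N) \<longlonglongrightarrow> 0"
    by (rule integral_mult_tendsto_0[OF d(2) sY L2_convD(3)[OF X'] order_refl])
  have eq: "(\<integral>x. X r x * X' r x \<partial>N) = (\<integral>x. (X r x - Y x) * (X' r x - Y' x) \<partial>N)
      + (\<integral>x. (X r x - Y x) * Y' x \<partial>N) + (\<integral>x. (X' r x - Y' x) * Y x \<partial>N) + (\<integral>x. Y x * Y' x \<partial>N)" for r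
  proof -
    have "(\<lambda>x. X r x * X' r x) = (\<lambda>x. (X r x - Y x) * (X' r x - Y' x) + (X r x - Y x) * Y' x
       + (X' r x - Y' x) * Y x + Y x * Y' x)" by (auto simp: algebra_simps)
    then show ?thesis
      using sq_integrable_mult[OF d(1) d(2)] sq_integrable_mult[OF d(1) sY'] sq_integrable_mult[OF d(2) sY]
        sq_integrable_mult[OF sY sY'] by simp
  qed
  show ?thesis unfolding eq
    using tendsto_add[OF tendsto_add[OF tendsto_add[OF l1 l2] l3] tendsto_const[of "\<integral>x. Y x * Y' x \<partial>N"]] by simp
qed

lemma L2_conv_const: "sq_integrable N Y \<Longrightarrow> L2_conv N (\<lambda>r. Y) Y"
  by (simp add: L2_conv_def)

lemma nonneg_tendsto_0:
  fixes a b :: "nat \<Rightarrow> real"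
  assumes "\<And>r. 0 \<le> a r" "\<And>r. a r \<le> b r" "b \<longlonglongrightarrow> 0"
  shows "a \<longlonglongrightarrow> 0"
  by (rule tendsto_sandwich[OF _ _ tendsto_const assms(3)]) (simp_all add: assms)

lemma sq_diff_le: "(x - y)\<^sup>2 \<le> 2 * (x - z)\<^sup>2 + 2 * (z - y)\<^sup>2" for x y z :: real
  using sum_squares_bound[of "x - z" "z - y"] by (simp add: power2_eq_square algebra_simps)

lemma sq_add_le: "(x + y)\<^sup>2 \<le> 2 * x\<^sup>2 + 2 * y\<^sup>2" for x y :: real
  using sum_squares_bound[of x y] by (simp add: power2_eq_square algebra_simps)

text \<open>Intended for indicators as multipliers, in particular for restricting time to
  \<open>{..t}\<close>.\<close>

lemma L2_conv_mult_bounded: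
  assumes "L2_conv N X Y" "p \<in> borel_measurable N" "\<And>x. x \<in> space N \<Longrightarrow> \<bar>p x\<bar> \<le> 1"
  shows "L2_conv N (\<lambda>r x. p x * X r x) (\<lambda>x. p x * Y x)"
proof -
  have p1: "(p x * y)\<^sup>2 \<le> y\<^sup>2" "\<bar>p x * y\<bar> \<le> \<bar>y\<bar>" if "x \<in> space N" for x y
  proof -
    show "\<bar>p x * y\<bar> \<le> \<bar>y\<bar>" using assms(3)[OF that] by (simp add: abs_mult mult_left_le_one_le)
    then show "(p x * y)\<^sup>2 \<le> y\<^sup>2" by (simp only: abs_le_square_iff)
  qed
  have sq: "sq_integrable N (\<lambda>x. p x * Z x)" if "sq_integrable N Z" for Z
    by (rule sq_integrable_bound[OF that]) (use that assms(2) p1 in \<open>auto simp: sq_integrable_def\<close>)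
  have s: "sq_integrable N (\<lambda>x. X r x - Y x)" for r
    using assms(1) by (auto intro: sq_integrable_diff simp: L2_conv_def)
  have "(\<integral>x. (p x * X r x - p x * Y x)\<^sup>2 \<partial>N) \<le> (\<integral>x. (X r x - Y x)\<^sup>2 \<partial>N)" for r
  proof (rule integral_mono)
    show "integrable N (\<lambda>x. (p x * X r x - p x * Y x)\<^sup>2)"
      using sq_integrableD(2)[OF sq[OF s]] by (simp add: algebra_simps)
    show "integrable N (\<lambda>x. (X r x - Y x)\<^sup>2)" using s by (rule sq_integrableD)
    show "(p x * X r x - p x * Y x)\<^sup>2 \<le> (X r x - Y x)\<^sup>2" if "x \<in> space N" for x
      using p1(1)[OF that, of "X r x - Y x"] by (simp add: algebra_simps)
  qed
  then have "(\<lambda>r. \<integral>x. (p x * X r x - p x * Y x)\<^sup>2 \<partial>N) \<longlonglongrightarrow> 0"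
    by (rule nonneg_tendsto_0[rotated 1, OF _ L2_convD(3)[OF assms(1)]]) simp
  then show ?thesis
    using sq L2_convD(1,2)[OF assms(1)] unfolding L2_conv_def by blast
qed

section \<open>Wiener increments\<close>

lemma (in prob_space) indep_set_mono:
  assumes "indep_set A B" "A' \<subseteq> A" "B' \<subseteq> B"
  shows "indep_set A' B'"
  unfolding indep_set_def
  by (rule indep_sets_mono_sets[OF assms(1)[unfolded indep_set_def]])
     (use assms(2,3) in \<open>auto split: bool.split\<close>)

locale wiener_space = prob_space M for M :: "'w measure" +
  fixes \<F> :: "real \<Rightarrow> 'w measure" and \<beta> :: "nat \<Rightarrow> real \<Rightarrow> 'w \<Rightarrow> real" and T :: real
  assumes T_pos: "0 < T"
    and normal: "normal_filtration M \<F>" and wiener: "wiener_coordinates M \<F> \<beta>"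
begin

lemma subalgebra_filtration: "0 \<le> t \<Longrightarrow> subalgebra M (\<F> t)"
  using normal[unfolded normal_filtration_def, THEN conjunct1] by simp

lemma space_filtration: "0 \<le> t \<Longrightarrow> space (\<F> t) = space M"
  using subalgebra_filtration[of t] by (simp add: subalgebra_def)

lemma sets_filtration: "0 \<le> t \<Longrightarrow> sets (\<F> t) \<subseteq> sets M"
  using subalgebra_filtration[of t] by (simp add: subalgebra_def)

lemma filtration_mono: "0 \<le> s \<Longrightarrow> s \<le> t \<Longrightarrow> sets (\<F> s) \<subseteq> sets (\<F> t)"
  using normal[unfolded normal_filtration_def, THEN conjunct2, THEN conjunct1] by simp

lemma borel_measurable_filtration_mono:
  fixes f :: "'w \<Rightarrow> real"
  assumes "0 \<le> s" "s \<le> t" "f \<in> borel_measurable (\<F> s)"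
  shows "f \<in> borel_measurable (\<F> t)"
  using assms filtration_mono[of s t] space_filtration[of s] space_filtration[of t]
  by (auto simp: measurable_def)

lemma borel_measurable_filtration:
  fixes f :: "'w \<Rightarrow> real"
  assumes "0 \<le> t" "f \<in> borel_measurable (\<F> t)"
  shows "f \<in> borel_measurable M"
  using assms sets_filtration[of t] space_filtration[of t]
  by (auto simp: measurable_def)

lemma brownian: "standard_brownian_motion M \<F> (\<beta> k)"
  using wiener by (simp add: wiener_coordinates_def)

lemma borel_measurable_brownian: "0 \<le> t \<Longrightarrow> \<beta> k t \<in> borel_measurable (\<F> t)"
  using brownian[of k] by (simp add: standard_brownian_motion_def)

section \<open>Moments of the increments and their independence from the past\<close>

definition incr :: "nat \<Rightarrow> real \<Rightarrow> real \<Rightarrow> 'w \<Rightarrow> real" where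
  "incr k s t \<omega> = \<beta> k t \<omega> - \<beta> k s \<omega>"

lemma incr_self: "incr k s s \<omega> = 0"
  by (simp add: incr_def)

lemma incr_self_fun: "incr k s s = (\<lambda>_. 0)"
  by (simp add: incr_def fun_eq_iff)

lemma borel_measurable_incr:
  assumes "0 \<le> s" "s \<le> t" shows "incr k s t \<in> borel_measurable (\<F> t)"
proof -
  have "\<beta> k s \<in> borel_measurable (\<F> t)" "\<beta> k t \<in> borel_measurable (\<F> t)"
    using borel_measurable_filtration_mono[OF assms borel_measurable_brownian[OF assms(1)]]
      borel_measurable_brownian[of t k] assms by auto
  then show ?thesis unfolding incr_def[abs_def] by (intro borel_measurable_diff)
qed

lemma borel_measurable_incr_M: "0 \<le> s \<Longrightarrow> s \<le> t \<Longrightarrow> incr k s t \<in> borel_measurable M"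
  by (rule borel_measurable_filtration[OF _ borel_measurable_incr]) auto

lemma incr_distributed:
  assumes "0 \<le> s" "s < t"
  shows "distributed M lborel (incr k s t) (normal_density 0 (sqrt (t - s)))"
  using brownian[of k, unfolded standard_brownian_motion_def, THEN conjunct2, THEN conjunct2,
      THEN conjunct2, rule_format, OF assms] by (simp add: incr_def[abs_def])

lemma sq_integrable_incr:
  assumes "0 \<le> s" "s \<le> t" shows "sq_integrable M (incr k s t)"
\<comment> \<open>The law of an increment is prescribed only for \<open>s < t\<close>; for
  \<open>s = t\<close> the increment is the zero function.\<close>
proof (cases "s = t")
  case True then show ?thesis by (simp add: incr_self_fun sq_integrable_zero)
next
  case False
  then have "s < t" using assms by simp
  note D = incr_distributed[OF assms(1) this, of k]
  have "integrable M (\<lambda>x. (incr k s t x)\<^sup>2)"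
    using distributed_integrable[OF D, of "\<lambda>x. x\<^sup>2"]
      integrable_normal_moment[of "sqrt (t - s)" 0 2] \<open>s < t\<close> by simp
  then show ?thesis
    using borel_measurable_incr_M[OF assms] by (simp add: sq_integrable_def)
qed

lemma integrable_incr: "0 \<le> s \<Longrightarrow> s \<le> t \<Longrightarrow> integrable M (incr k s t)"
  using sq_integrable_imp_integrable[OF _ sq_integrable_incr] finite_measure_axioms by blast

lemma expectation_incr: "0 \<le> s \<Longrightarrow> s \<le> t \<Longrightarrow> expectation (incr k s t) = 0"
proof (cases "s = t")
  case False
  assume "0 \<le> s" "s \<le> t"
  then show ?thesis
    using normal_distributed_expectation[OF _ incr_distributed[of s t k]] False by simp
qed (simp add: incr_self_fun)

lemma expectation_incr_sq:
  assumes "0 \<le> s" "s \<le> t" shows "expectation (\<lambda>\<omega>. (incr k s t \<omega>)\<^sup>2) = t - s"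
proof (cases "s = t")
  case True then show ?thesis by (simp add: incr_self_fun)
next
  case False
  then have "s < t" using assms by simp
  then show ?thesis
    using normal_distributed_variance[OF _ incr_distributed[OF assms(1) \<open>s < t\<close>], of k]
      expectation_incr[OF assms] by simp
qed

lemma expectation_incr_incr:
  assumes "0 \<le> s" "s \<le> t"
  shows "expectation (\<lambda>\<omega>. incr k s t \<omega> * incr l s t \<omega>) = (if k = l then t - s else 0)"
proof (cases "k = l")
  case True then show ?thesis using expectation_incr_sq[OF assms] by (simp add: power2_eq_square)
next
  case False
  have "indep_vars (\<lambda>k. PiM {0..} (\<lambda>t. borel :: real measure)) (\<lambda>k \<omega>. \<lambda>t\<in>{0..}. \<beta> k t \<omega>) UNIV"
    using wiener by (simp add: wiener_coordinates_def)
  \<comment> \<open>The increment over [s,t] is a measurable functional of the whole path, and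
    independence of the paths is inherited by such functionals.\<close>
  then have "indep_vars (\<lambda>k. borel) (\<lambda>k \<omega>. (\<lambda>x. x t - x s) (\<lambda>t\<in>{0..}. \<beta> k t \<omega>)) UNIV"
    by (rule indep_vars_compose2) (use assms in \<open>auto intro!: borel_measurable_diff measurable_component_singleton\<close>)
  then have "indep_vars (\<lambda>k. borel) (\<lambda>k. incr k s t) UNIV"
    using assms by (simp add: incr_def[abs_def])
  then have "indep_vars (\<lambda>k. borel) (\<lambda>k. incr k s t) {k, l}"
    by (rule indep_vars_subset) simp
  from indep_vars_lebesgue_integral[OF _ this] show ?thesis
    using False integrable_incr[OF assms] expectation_incr[OF assms] by auto
qed

text \<open>A function \<open>h\<close> of all coordinates is allowed because the product of
  increments of two different coordinates must also be independent of the past; independence of each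
  coordinate separately would not give this.\<close>

lemma indep_var_incr:
  assumes "0 \<le> s" "s < t" and Z: "Z \<in> borel_measurable (\<F> s)"
    and h: "h \<in> borel_measurable (PiM UNIV (\<lambda>k. borel :: real measure))"
  shows "indep_var borel Z borel (\<lambda>\<omega>. h (\<lambda>k. incr k s t \<omega>) :: real)"
  unfolding indep_var_eq
proof (intro conjI)
  let ?Y = "\<lambda>\<omega> k. incr k s t \<omega>"
  have Y: "?Y \<in> M \<rightarrow>\<^sub>M PiM UNIV (\<lambda>k. borel)"
    by (rule measurable_PiM_single') (use borel_measurable_incr_M[of s t] assms in auto)
  show hY: "random_variable borel (\<lambda>\<omega>. h (?Y \<omega>))" by (rule measurable_compose[OF Y h])
  show ZM: "random_variable borel Z" using borel_measurable_filtration[OF assms(1) Z] .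
  have ind: "indep_set (sets (\<F> s)) {?Y -` A \<inter> space M | A. A \<in> sets (PiM UNIV (\<lambda>k. borel))}"
    using wiener[unfolded wiener_coordinates_def, THEN conjunct2, THEN conjunct2, rule_format, OF assms(1,2)]
    by (simp add: incr_def)
  \<comment> \<open>Preimages of the Borel sets already form a sigma-algebra, which removes the
    closures from the definition of independence.\<close>
  have eq: "sigma_sets (space M) {f -` A \<inter> space M |A. A \<in> sets borel} = {f -` A \<inter> space M |A. A \<in> sets borel}"
    for f :: "'w \<Rightarrow> real"
    using sets.sigma_sets_eq[of "vimage_algebra (space M) f (borel :: real measure)"]
    by (simp add: sets_vimage_algebra2)
  have "{Z -` A \<inter> space M |A. A \<in> sets borel} \<subseteq> sets (\<F> s)"
    using Z space_filtration[OF assms(1)] by (auto simp: measurable_def)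
  moreover have "{(\<lambda>\<omega>. h (?Y \<omega>)) -` A \<inter> space M |A. A \<in> sets borel} \<subseteq> {?Y -` A \<inter> space M | A. A \<in> sets (PiM UNIV (\<lambda>k. borel))}"
  proof safe
    fix A :: "real set" assume "A \<in> sets borel"
    then have "h -` A \<inter> space (PiM UNIV (\<lambda>k. borel)) \<in> sets (PiM UNIV (\<lambda>k. borel))"
      using h by (rule measurable_sets[rotated])
    then show "\<exists>B. (\<lambda>\<omega>. h (?Y \<omega>)) -` A \<inter> space M = ?Y -` B \<inter> space M \<and> B \<in> sets (PiM UNIV (\<lambda>k. borel))"
      by (intro exI[of _ "h -` A \<inter> space (PiM UNIV (\<lambda>k. borel))"]) (auto simp: space_PiM)
  qed
  ultimately show "indep_set (sigma_sets (space M) {Z -` A \<inter> space M |A. A \<in> sets borel})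
     (sigma_sets (space M) {(\<lambda>\<omega>. h (?Y \<omega>)) -` A \<inter> space M |A. A \<in> sets borel})"
    unfolding eq by (rule indep_set_mono[OF ind])
qed

lemma mult_incr:
  assumes "0 \<le> s" "s \<le> t" and Z: "Z \<in> borel_measurable (\<F> s)" "integrable M Z"
  shows "integrable M (\<lambda>\<omega>. Z \<omega> * incr k s t \<omega>)" "expectation (\<lambda>\<omega>. Z \<omega> * incr k s t \<omega>) = 0"
proof -
  have "integrable M (\<lambda>\<omega>. Z \<omega> * incr k s t \<omega>) \<and> expectation (\<lambda>\<omega>. Z \<omega> * incr k s t \<omega>) = 0"
  proof (cases "s = t")
    case True then show ?thesis by (simp add: incr_self)
  next
    case False
    then have "s < t" using assms by simp
    have "indep_var borel Z borel (\<lambda>\<omega>. (\<lambda>x. x k) (\<lambda>k. incr k s t \<omega>))"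
      by (rule indep_var_incr[OF assms(1) \<open>s < t\<close> Z(1)]) (simp add: measurable_component_singleton)
    then have "indep_var borel Z borel (incr k s t)" by simp
    from indep_var_integrable[OF this Z(2) integrable_incr] indep_var_lebesgue_integral[OF this Z(2) integrable_incr]
    show ?thesis using assms expectation_incr[OF assms(1,2)] by simp
  qed
  then show "integrable M (\<lambda>\<omega>. Z \<omega> * incr k s t \<omega>)" "expectation (\<lambda>\<omega>. Z \<omega> * incr k s t \<omega>) = 0"
    by auto
qed

lemma mult_incr_incr:
  assumes "0 \<le> s" "s \<le> t" and Z: "Z \<in> borel_measurable (\<F> s)" "integrable M Z"
  shows "integrable M (\<lambda>\<omega>. Z \<omega> * (incr k s t \<omega> * incr l s t \<omega>))"
    "expectation (\<lambda>\<omega>. Z \<omega> * (incr k s t \<omega> * incr l s t \<omega>)) = (if k = l then expectation Z * (t - s) else 0)"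
proof -
  have "integrable M (\<lambda>\<omega>. Z \<omega> * (incr k s t \<omega> * incr l s t \<omega>)) \<and>
     expectation (\<lambda>\<omega>. Z \<omega> * (incr k s t \<omega> * incr l s t \<omega>)) = (if k = l then expectation Z * (t - s) else 0)"
  proof (cases "s = t")
    case True then show ?thesis by (simp add: incr_self)
  next
    case False
    then have "s < t" using assms by simp
    have "indep_var borel Z borel (\<lambda>\<omega>. (\<lambda>x. x k * x l) (\<lambda>k. incr k s t \<omega>))"
      by (rule indep_var_incr[OF assms(1) \<open>s < t\<close> Z(1)])
         (intro borel_measurable_times measurable_component_singleton; simp)
    then have i: "indep_var borel Z borel (\<lambda>\<omega>. incr k s t \<omega> * incr l s t \<omega>)" by simp
    have "integrable M (\<lambda>\<omega>. incr k s t \<omega> * incr l s t \<omega>)"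
      by (rule sq_integrable_mult; rule sq_integrable_incr) (use assms in auto)
    from indep_var_integrable[OF i Z(2) this] indep_var_lebesgue_integral[OF i Z(2) this]
    show ?thesis using expectation_incr_incr[OF assms(1,2)] by simp
  qed
  then show "integrable M (\<lambda>\<omega>. Z \<omega> * (incr k s t \<omega> * incr l s t \<omega>))"
    "expectation (\<lambda>\<omega>. Z \<omega> * (incr k s t \<omega> * incr l s t \<omega>)) = (if k = l then expectation Z * (t - s) else 0)"
    by blast+
qed

text \<open>The admissible coefficients of an elementary integral. Boundedness keeps them harmless
  as multipliers of square integrable variables, and the class is closed under products.\<close>

definition bounded_rv :: "real \<Rightarrow> ('w \<Rightarrow> real) \<Rightarrow> bool" where
  "bounded_rv t \<xi> \<longleftrightarrow> \<xi> \<in> borel_measurable (\<F> t) \<and> (\<exists>C. \<forall>\<omega>\<in>space M. \<bar>\<xi> \<omega>\<bar> \<le> C)"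

lemma bounded_rv_mono: "0 \<le> s \<Longrightarrow> s \<le> t \<Longrightarrow> bounded_rv s \<xi> \<Longrightarrow> bounded_rv t \<xi>"
  by (simp add: bounded_rv_def borel_measurable_filtration_mono[of s t])

lemma bounded_rv_mult:
  assumes "bounded_rv t \<xi>" "bounded_rv t \<zeta>" shows "bounded_rv t (\<lambda>\<omega>. \<xi> \<omega> * \<zeta> \<omega>)"
proof -
  obtain C D where "\<And>\<omega>. \<omega>\<in>space M \<Longrightarrow> \<bar>\<xi> \<omega>\<bar> \<le> C" "\<And>\<omega>. \<omega>\<in>space M \<Longrightarrow> \<bar>\<zeta> \<omega>\<bar> \<le> D"
    using assms unfolding bounded_rv_def by blast
  then have "\<forall>\<omega>\<in>space M. \<bar>\<xi> \<omega> * \<zeta> \<omega>\<bar> \<le> C * D"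
    by (simp add: abs_mult) (meson abs_ge_zero mult_mono order_trans)
  moreover have "(\<lambda>\<omega>. \<xi> \<omega> * \<zeta> \<omega>) \<in> borel_measurable (\<F> t)"
    using assms by (intro borel_measurable_times) (simp_all add: bounded_rv_def)
  ultimately show ?thesis unfolding bounded_rv_def by blast
qed

lemma integrable_bounded_rv: "0 \<le> t \<Longrightarrow> bounded_rv t \<xi> \<Longrightarrow> integrable M \<xi>"
proof -
  assume "0 \<le> t" and \<xi>: "bounded_rv t \<xi>"
  obtain C where "\<And>\<omega>. \<omega>\<in>space M \<Longrightarrow> \<bar>\<xi> \<omega>\<bar> \<le> C"
    using \<xi> unfolding bounded_rv_def by blast
  then have "AE \<omega> in M. norm (\<xi> \<omega>) \<le> C" by (intro AE_I2) simp
  moreover have "\<xi> \<in> borel_measurable M"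
    using \<xi> by (intro borel_measurable_filtration[OF \<open>0 \<le> t\<close>]) (simp add: bounded_rv_def)
  ultimately show ?thesis by (rule integrable_const_bound)
qed

lemma sq_integrable_bounded_rv_mult:
  assumes "0 \<le> t" "bounded_rv t \<xi>" "sq_integrable M X"
  shows "sq_integrable M (\<lambda>\<omega>. \<xi> \<omega> * X \<omega>)"
proof -
  obtain C where C: "\<And>\<omega>. \<omega>\<in>space M \<Longrightarrow> \<bar>\<xi> \<omega>\<bar> \<le> C"
    using assms unfolding bounded_rv_def by blast
  show ?thesis
  proof (rule sq_integrable_bound[OF sq_integrable_cmult[OF assms(3), of C]])
    show "(\<lambda>\<omega>. \<xi> \<omega> * X \<omega>) \<in> borel_measurable M"
      by (intro borel_measurable_times sq_integrableD(1)[OF assms(3)] borel_measurable_filtration[OF assms(1)])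
         (use assms(2) in \<open>simp add: bounded_rv_def\<close>)
    show "AE x in M. \<bar>\<xi> x * X x\<bar> \<le> \<bar>C * X x\<bar>"
    proof (rule AE_I2)
      fix x assume "x \<in> space M"
      from order_trans[OF C[OF this] abs_ge_self]
      show "\<bar>\<xi> x * X x\<bar> \<le> \<bar>C * X x\<bar>" unfolding abs_mult by (rule mult_right_mono) simp
    qed
  qed
qed

section \<open>Inner products of elementary integrals\<close>

lemma sq_integrable_elementary:
  "0 \<le> a \<Longrightarrow> a \<le> b \<Longrightarrow> bounded_rv a \<xi> \<Longrightarrow> sq_integrable M (\<lambda>\<omega>. \<xi> \<omega> * incr k a b \<omega>)"
  by (rule sq_integrable_bounded_rv_mult[OF _ _ sq_integrable_incr])

text \<open>All factors except the later increment are known at time \<open>c\<close>, and that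
  increment is centred and independent of the past.\<close>

lemma elementary_orthogonal:
  assumes "0 \<le> a" "a \<le> b" "b \<le> c" "c \<le> d" "bounded_rv a \<xi>" "bounded_rv c \<zeta>"
  shows "expectation (\<lambda>\<omega>. (\<xi> \<omega> * incr k a b \<omega>) * (\<zeta> \<omega> * incr l c d \<omega>)) = 0"
proof -
  let ?Z = "\<lambda>\<omega>. (\<xi> \<omega> * incr k a b \<omega>) * \<zeta> \<omega>"
  have z: "bounded_rv c \<xi>" using bounded_rv_mono[of a c \<xi>] assms by simp
  have "expectation (\<lambda>\<omega>. ?Z \<omega> * incr l c d \<omega>) = 0"
  proof (rule mult_incr)
    have "incr k a b \<in> borel_measurable (\<F> c)"
      by (rule borel_measurable_filtration_mono[OF _ _ borel_measurable_incr]) (use assms in auto)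
    moreover have "\<xi> \<in> borel_measurable (\<F> c)" "\<zeta> \<in> borel_measurable (\<F> c)"
      using z assms(6) unfolding bounded_rv_def by simp_all
    ultimately show "?Z \<in> borel_measurable (\<F> c)" by (intro borel_measurable_times)
    have "integrable M (\<lambda>\<omega>. (\<xi> \<omega> * \<zeta> \<omega>) * incr k a b \<omega>)"
      by (rule sq_integrable_imp_integrable[OF finite_measure_axioms])
         (rule sq_integrable_bounded_rv_mult[OF _ bounded_rv_mult[OF z assms(6)] sq_integrable_incr],
          use assms in auto)
    then show "integrable M ?Z" by (simp add: mult_ac)
  qed (use assms in auto)
  then show ?thesis by (simp add: mult.assoc)
qed

text \<open>With a common left end, the longer increment is split where the shorter one ends; the
  surplus lies in the future of everything else and drops out.\<close>

lemma elementary_overlap: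
  assumes "0 \<le> c" "c \<le> b" "c \<le> d" "bounded_rv c Z"
  shows "expectation (\<lambda>\<omega>. Z \<omega> * (incr k c b \<omega> * incr l c d \<omega>))
    = (if k = l then expectation Z * (min b d - c) else 0)"
proof -
  have *: "expectation (\<lambda>\<omega>. Z \<omega> * (incr k c b \<omega> * incr l c d \<omega>))
    = (if k = l then expectation Z * (b - c) else 0)" if bd: "b \<le> d" "c \<le> b" for k l b d
  proof -
    have Z: "bounded_rv b Z" using bounded_rv_mono[of c b Z] assms bd by auto
    have one: "bounded_rv b (\<lambda>_. 1)" unfolding bounded_rv_def by auto
    have "expectation (\<lambda>\<omega>. (Z \<omega> * incr k c b \<omega>) * (1 * incr l b d \<omega>)) = 0"
      by (rule elementary_orthogonal) (use assms bd one in auto)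
    moreover have i1: "integrable M (\<lambda>\<omega>. (Z \<omega> * incr k c b \<omega>) * (1 * incr l b d \<omega>))"
      by (intro sq_integrable_mult sq_integrable_elementary) (use assms bd one in auto)
    moreover note i2 = mult_incr_incr[OF assms(1) bd(2), of Z k l]
    have i3: "Z \<in> borel_measurable (\<F> c)" "integrable M Z"
      using assms(4) integrable_bounded_rv[OF assms(1,4)] by (simp_all add: bounded_rv_def)
    have "expectation (\<lambda>\<omega>. Z \<omega> * (incr k c b \<omega> * incr l c d \<omega>))
      = expectation (\<lambda>\<omega>. Z \<omega> * (incr k c b \<omega> * incr l c b \<omega>) + (Z \<omega> * incr k c b \<omega>) * (1 * incr l b d \<omega>))"
      by (rule arg_cong[where f="integral\<^sup>L M"]) (auto simp: incr_def algebra_simps)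
    moreover have "expectation (\<lambda>\<omega>. Z \<omega> * (incr k c b \<omega> * incr l c b \<omega>) + (Z \<omega> * incr k c b \<omega>) * (1 * incr l b d \<omega>))
      = expectation (\<lambda>\<omega>. Z \<omega> * (incr k c b \<omega> * incr l c b \<omega>))
        + expectation (\<lambda>\<omega>. (Z \<omega> * incr k c b \<omega>) * (1 * incr l b d \<omega>))"
      by (rule Bochner_Integration.integral_add[OF i2(1)[OF i3] i1])
    ultimately show ?thesis using i2(2)[OF i3] by simp
  qed
  show ?thesis
  proof (cases "b \<le> d")
    case True then show ?thesis using *[of b d k l] assms by simp
  next
    case False then show ?thesis using *[of d b l k] assms by (simp add: mult.commute)
  qed
qed

text \<open>The earlier increment is split at \<open>c\<close>: its part before \<open>c\<close> is
  orthogonal to the later one, and the rest has the same left end. The \<open>max 0\<close>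
  expression is the length of the intersection of the two intervals.\<close>

lemma elementary_inner_wlog:
  assumes "0 \<le> a" "a \<le> b" "c \<le> d" "bounded_rv a \<xi>" "bounded_rv c \<zeta>" "a \<le> c"
  shows "expectation (\<lambda>\<omega>. (\<xi> \<omega> * incr k a b \<omega>) * (\<zeta> \<omega> * incr l c d \<omega>))
    = (if k = l then expectation (\<lambda>\<omega>. \<xi> \<omega> * \<zeta> \<omega>) * max 0 (min b d - max a c) else 0)"
proof (cases "b \<le> c")
  case True
  then show ?thesis using elementary_orthogonal[of a b c d \<xi> \<zeta> k l] assms by simp
next
  case False
  have x: "bounded_rv c \<xi>" using bounded_rv_mono[of a c \<xi>] assms by simp
  have z: "bounded_rv c (\<lambda>\<omega>. \<xi> \<omega> * \<zeta> \<omega>)" using bounded_rv_mult[OF x assms(5)] .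
  let ?A = "\<lambda>\<omega>. (\<xi> \<omega> * incr k a c \<omega>) * (\<zeta> \<omega> * incr l c d \<omega>)"
    and ?B = "\<lambda>\<omega>. (\<xi> \<omega> * incr k c b \<omega>) * (\<zeta> \<omega> * incr l c d \<omega>)"
  have 1: "integrable M ?A" "integrable M ?B"
    by (intro sq_integrable_mult sq_integrable_elementary; use assms x False in auto)+
  have 2: "expectation ?A = 0" by (rule elementary_orthogonal) (use assms in auto)
  have "?B = (\<lambda>\<omega>. (\<xi> \<omega> * \<zeta> \<omega>) * (incr k c b \<omega> * incr l c d \<omega>))" by (simp add: mult_ac)
  then have 3: "expectation ?B = (if k = l then expectation (\<lambda>\<omega>. \<xi> \<omega> * \<zeta> \<omega>) * (min b d - c) else 0)"
    using elementary_overlap[OF _ _ _ z, of b d k l] False assms by simp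
  have "(\<lambda>\<omega>. (\<xi> \<omega> * incr k a b \<omega>) * (\<zeta> \<omega> * incr l c d \<omega>)) = (\<lambda>\<omega>. ?A \<omega> + ?B \<omega>)"
    by (auto simp: incr_def algebra_simps)
  then have "expectation (\<lambda>\<omega>. (\<xi> \<omega> * incr k a b \<omega>) * (\<zeta> \<omega> * incr l c d \<omega>)) = expectation ?A + expectation ?B"
    using Bochner_Integration.integral_add[OF 1] by simp
  moreover have "max 0 (min b d - max a c) = min b d - c"
    using False assms by (auto simp: max_def min_def)
  ultimately show ?thesis using 2 3 by simp
qed

lemma elementary_inner:
  assumes "0 \<le> a" "a \<le> b" "0 \<le> c" "c \<le> d" "bounded_rv a \<xi>" "bounded_rv c \<zeta>"
  shows "expectation (\<lambda>\<omega>. (\<xi> \<omega> * incr k a b \<omega>) * (\<zeta> \<omega> * incr l c d \<omega>))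
    = (if k = l then expectation (\<lambda>\<omega>. \<xi> \<omega> * \<zeta> \<omega>) * max 0 (min b d - max a c) else 0)"
proof (cases "a \<le> c")
  case True then show ?thesis using elementary_inner_wlog[of a b c d \<xi> \<zeta> k l] assms by simp
next
  case False
  then show ?thesis using elementary_inner_wlog[of c d a b \<zeta> \<xi> l k] assms
    by (simp add: mult.commute min.commute max.commute)
qed

end

section \<open>Simple integrals\<close>

lemma integral_double_sum:
  fixes f :: "'i \<Rightarrow> 'j \<Rightarrow> 'a \<Rightarrow> real"
  assumes "\<And>i j. i \<in> I \<Longrightarrow> j \<in> J \<Longrightarrow> integrable N (f i j)"
  shows "(\<integral>x. (\<Sum>i\<in>I. \<Sum>j\<in>J. f i j x) \<partial>N) = (\<Sum>i\<in>I. \<Sum>j\<in>J. \<integral>x. f i j x \<partial>N)"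
proof -
  have "(\<integral>x. (\<Sum>i\<in>I. \<Sum>j\<in>J. f i j x) \<partial>N) = (\<Sum>i\<in>I. \<integral>x. (\<Sum>j\<in>J. f i j x) \<partial>N)"
    by (rule Bochner_Integration.integral_sum) (use assms in \<open>auto intro: Bochner_Integration.integrable_sum\<close>)
  also have "\<dots> = (\<Sum>i\<in>I. \<Sum>j\<in>J. \<integral>x. f i j x \<partial>N)"
    by (rule sum.cong[OF refl], rule Bochner_Integration.integral_sum) (use assms in auto)
  finally show ?thesis .
qed

context wiener_space
begin

text \<open>A finite measure, so that its product with the probability measure is finite too. An
  upper limit t is imposed by the factor \<open>indicator {..t}\<close> and not by the measure; one
  product space thus serves all t.\<close>

definition timeM :: "real measure" where
  "timeM = restrict_space lborel {0..T}"

definition prodM :: "(real \<times> 'w) measure" where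
  "prodM = timeM \<Otimes>\<^sub>M M"

lemma space_timeM: "space timeM = {0..T}"
  by (simp add: timeM_def space_restrict_space)

lemma space_prodM: "space prodM = {0..T} \<times> space M"
  by (simp add: prodM_def space_pair_measure space_timeM)

lemma finite_measure_timeM: "finite_measure timeM"
proof (rule finite_measureI)
  have "emeasure timeM (space timeM) = emeasure lborel {0..T}"
    unfolding space_timeM unfolding timeM_def by (subst emeasure_restrict_space) auto
  then show "emeasure timeM (space timeM) \<noteq> \<infinity>" using T_pos by simp
qed

sublocale tm: finite_measure timeM
  by (rule finite_measure_timeM)

sublocale pm: pair_sigma_finite timeM M
  by unfold_locales

sublocale fp: finite_measure prodM
proof (rule finite_measureI)
  have "emeasure prodM (space timeM \<times> space M) = emeasure timeM (space timeM) * emeasure M (space M)"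
    unfolding prodM_def by (rule emeasure_pair_measure_Times) auto
  then show "emeasure prodM (space prodM) \<noteq> \<infinity>"
    using tm.emeasure_finite[of "space timeM"]
    by (simp add: space_prodM space_timeM emeasure_space_1)
qed

lemma measurable_timeM: "f \<in> borel_measurable borel \<Longrightarrow> f \<in> borel_measurable timeM"
  unfolding timeM_def by (rule measurable_restrict_space1) simp

lemma measurable_fst_prodM: "f \<in> borel_measurable borel \<Longrightarrow> (\<lambda>x. f (fst x)) \<in> borel_measurable prodM"
  unfolding prodM_def by (rule measurable_compose[OF measurable_fst measurable_timeM])

lemma measurable_snd_prodM: "f \<in> borel_measurable M \<Longrightarrow> (\<lambda>x. f (snd x)) \<in> borel_measurable prodM"
  unfolding prodM_def by (rule measurable_compose[OF measurable_snd])

lemma integral_timeM: "(\<integral>s. f s \<partial>timeM) = (LBINT s:{0..T}. (f s :: real))"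
  unfolding timeM_def by (simp add: integral_restrict_space set_lebesgue_integral_def)

lemma integrable_timeM: "integrable timeM f \<longleftrightarrow> set_integrable lborel {0..T} (f :: real \<Rightarrow> real)"
  unfolding timeM_def by (simp add: integrable_restrict_space set_integrable_def)

lemma integral_upto:
  assumes "t \<in> {0..T}"
  shows "(\<integral>s. indicator {..t} s * f s \<partial>timeM) = (LBINT s:{0..t}. (f s :: real))"
  unfolding integral_timeM set_lebesgue_integral_def
  by (rule Bochner_Integration.integral_cong) (use assms in \<open>auto simp: indicator_def\<close>)

lemma integral_prodM:
  assumes "integrable prodM (\<lambda>x. f (fst x) (snd x) :: real)"
  shows "(\<integral>x. f (fst x) (snd x) \<partial>prodM) = (\<integral>s. (\<integral>\<omega>. f s \<omega> \<partial>M) \<partial>timeM)"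
    and "(\<integral>x. f (fst x) (snd x) \<partial>prodM) = (\<integral>\<omega>. (\<integral>s. f s \<omega> \<partial>timeM) \<partial>M)"
    and "integrable timeM (\<lambda>s. \<integral>\<omega>. f s \<omega> \<partial>M)"
    and "integrable M (\<lambda>\<omega>. \<integral>s. f s \<omega> \<partial>timeM)"
    and "AE \<omega> in M. integrable timeM (\<lambda>s. f s \<omega>)"
    and "AE s in timeM. integrable M (\<lambda>\<omega>. f s \<omega>)"
proof -
  have i: "integrable (timeM \<Otimes>\<^sub>M M) (case_prod f)"
    using assms by (simp add: prodM_def case_prod_beta')
  have c: "(\<lambda>x. f (fst x) (snd x)) = case_prod f" by auto
  show "(\<integral>x. f (fst x) (snd x) \<partial>prodM) = (\<integral>s. (\<integral>\<omega>. f s \<omega> \<partial>M) \<partial>timeM)"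
    unfolding prodM_def c using pm.integral_fst[OF i] by simp
  show "(\<integral>x. f (fst x) (snd x) \<partial>prodM) = (\<integral>\<omega>. (\<integral>s. f s \<omega> \<partial>timeM) \<partial>M)"
    unfolding prodM_def c using pm.integral_snd[OF i] by simp
  show "integrable timeM (\<lambda>s. \<integral>\<omega>. f s \<omega> \<partial>M)" by (rule pm.integrable_fst[OF i])
  show "integrable M (\<lambda>\<omega>. \<integral>s. f s \<omega> \<partial>timeM)" by (rule pm.integrable_snd[OF i])
  show "AE \<omega> in M. integrable timeM (\<lambda>s. f s \<omega>)" by (rule pm.AE_integrable_snd[OF i])
  show "AE s in timeM. integrable M (\<lambda>\<omega>. f s \<omega>)" by (rule pm.AE_integrable_fst[OF i])
qed

lemma integral_prodM_times:
  assumes f: "integrable timeM f" and g: "integrable M g"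
  shows "integrable prodM (\<lambda>x. f (fst x) * g (snd x) :: real)"
    "(\<integral>x. f (fst x) * g (snd x) \<partial>prodM) = (\<integral>s. f s \<partial>timeM) * (\<integral>\<omega>. g \<omega> \<partial>M)"
proof -
  show i: "integrable prodM (\<lambda>x. f (fst x) * g (snd x))"
    unfolding prodM_def
  proof (rule pm.Fubini_integrable)
    show "(\<lambda>x. f (fst x) * g (snd x)) \<in> borel_measurable (timeM \<Otimes>\<^sub>M M)"
      using f g by (auto intro!: borel_measurable_times measurable_compose[OF measurable_fst]
          measurable_compose[OF measurable_snd])
    show "integrable timeM (\<lambda>x. \<integral>y. norm (f (fst (x, y)) * g (snd (x, y))) \<partial>M)"
      using f by (simp add: abs_mult)
    show "AE x in timeM. integrable M (\<lambda>y. f (fst (x, y)) * g (snd (x, y)))"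
      using g by simp
  qed
  show "(\<integral>x. f (fst x) * g (snd x) \<partial>prodM) = (\<integral>s. f s \<partial>timeM) * (\<integral>\<omega>. g \<omega> \<partial>M)"
    using integral_prodM(1)[OF i] by simp
qed

section \<open>Simple integrals and their isometry\<close>

lemma simple_processD:
  assumes "simple_process M \<F> T n \<tau> \<xi>"
  shows "\<tau> 0 = 0" "\<tau> n = T" "\<And>j. j < n \<Longrightarrow> \<tau> j < \<tau> (Suc j)" "\<And>j. j < n \<Longrightarrow> bounded_rv (\<tau> j) (\<xi> j)"
    "\<And>j. j \<le> n \<Longrightarrow> 0 \<le> \<tau> j" "\<And>j. j \<le> n \<Longrightarrow> \<tau> j \<le> T" "\<And>i j. i \<le> j \<Longrightarrow> j \<le> n \<Longrightarrow> \<tau> i \<le> \<tau> j"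
proof -
  show 1: "\<tau> 0 = 0" "\<tau> n = T" and 2: "\<And>j. j < n \<Longrightarrow> \<tau> j < \<tau> (Suc j)"
    and "\<And>j. j < n \<Longrightarrow> bounded_rv (\<tau> j) (\<xi> j)"
    using assms by (auto simp: simple_process_def bounded_rv_def)
  show 3: "\<tau> i \<le> \<tau> j" if "i \<le> j" "j \<le> n" for i j
    using that by (induction j rule: dec_induct) (auto dest: 2 intro: order_trans[OF _ less_imp_le[OF 2]])
  show "\<And>j. j \<le> n \<Longrightarrow> 0 \<le> \<tau> j" "\<And>j. j \<le> n \<Longrightarrow> \<tau> j \<le> T"
    using 3[of 0] 3[of _ n] 1 by auto
qed

text \<open>For an interval that starts after \<open>t\<close> the increment between the capped ends
  vanishes, so the coefficient may be set to 0 there. This makes it measurable at the capped left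
  end \<open>min t a\<close>, which the coefficient itself need not be.\<close>

definition cut :: "real \<Rightarrow> real \<Rightarrow> ('w \<Rightarrow> real) \<Rightarrow> 'w \<Rightarrow> real" where
  "cut t a \<xi> \<omega> = (if a \<le> t then \<xi> \<omega> else 0)"

lemma bounded_rv_cut: "bounded_rv a \<xi> \<Longrightarrow> bounded_rv (min t a) (cut t a \<xi>)"
proof (cases "a \<le> t")
  case False
  then have "cut t a \<xi> = (\<lambda>_. 0)" by (simp add: cut_def fun_eq_iff)
  then show ?thesis unfolding bounded_rv_def by auto
qed (simp add: cut_def[abs_def] min_def)

lemma simple_integral_cut:
  "simple_integral n \<tau> \<xi> (\<beta> k) t \<omega> =
    (\<Sum>j<n. cut t (\<tau> j) (\<xi> j) \<omega> * incr k (min t (\<tau> j)) (min t (\<tau> (Suc j))) \<omega>)"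
  if "simple_process M \<F> T n \<tau> \<xi>"
  unfolding simple_integral_def
proof (rule sum.cong[OF refl])
  fix j assume "j \<in> {..<n}"
  then have "\<tau> j < \<tau> (Suc j)" using simple_processD(3)[OF that] by simp
  then show "\<xi> j \<omega> * (\<beta> k (min t (\<tau> (Suc j))) \<omega> - \<beta> k (min t (\<tau> j)) \<omega>) =
    cut t (\<tau> j) (\<xi> j) \<omega> * incr k (min t (\<tau> j)) (min t (\<tau> (Suc j))) \<omega>"
    by (auto simp: cut_def incr_def)
qed

lemma sq_integrable_simple_integral:
  assumes S: "simple_process M \<F> T n \<tau> \<xi>" and t: "t \<in> {0..T}"
  shows "sq_integrable M (simple_integral n \<tau> \<xi> (\<beta> k) t)"
proof -
  have "sq_integrable M (\<lambda>\<omega>. \<Sum>j<n. cut t (\<tau> j) (\<xi> j) \<omega> * incr k (min t (\<tau> j)) (min t (\<tau> (Suc j))) \<omega>)"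
  proof (rule sq_integrable_sum, rule sq_integrable_elementary)
    fix j assume "j \<in> {..<n}"
    then have j: "j < n" by simp
    show "0 \<le> min t (\<tau> j)" using simple_processD(5)[OF S, of j] j t by simp
    show "min t (\<tau> j) \<le> min t (\<tau> (Suc j))" using simple_processD(3)[OF S j] by simp
    show "bounded_rv (min t (\<tau> j)) (cut t (\<tau> j) (\<xi> j))"
      by (rule bounded_rv_cut[OF simple_processD(4)[OF S j]])
  qed
  moreover have "simple_integral n \<tau> \<xi> (\<beta> k) t =
      (\<lambda>\<omega>. \<Sum>j<n. cut t (\<tau> j) (\<xi> j) \<omega> * incr k (min t (\<tau> j)) (min t (\<tau> (Suc j))) \<omega>)"
    by (rule ext) (rule simple_integral_cut[OF S])
  ultimately show ?thesis by simp
qed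

definition sv :: "nat \<Rightarrow> (nat \<Rightarrow> real) \<Rightarrow> (nat \<Rightarrow> 'w \<Rightarrow> real) \<Rightarrow> real \<times> 'w \<Rightarrow> real" where
  "sv n \<tau> \<xi> x = simple_value n \<tau> \<xi> (fst x) (snd x)"

lemma simple_value_bounded:
  assumes "\<And>j. j < n \<Longrightarrow> \<bar>\<xi> j \<omega>\<bar> \<le> C"
  shows "\<bar>simple_value n \<tau> \<xi> s \<omega>\<bar> \<le> real n * \<bar>C\<bar>"
proof -
  have "\<bar>simple_value n \<tau> \<xi> s \<omega>\<bar> \<le> (\<Sum>j<n. \<bar>\<xi> j \<omega> * indicator {\<tau> j<..\<tau> (Suc j)} s\<bar>)"
    unfolding simple_value_def by (rule sum_abs)
  also have "\<dots> \<le> (\<Sum>j<n. \<bar>C\<bar>)"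
  proof (rule sum_mono)
    fix j assume "j \<in> {..<n}"
    then have "\<bar>\<xi> j \<omega>\<bar> \<le> \<bar>C\<bar>" using assms[of j] by simp
    then show "\<bar>\<xi> j \<omega> * indicator {\<tau> j<..\<tau> (Suc j)} s\<bar> \<le> \<bar>C\<bar>"
      by (auto simp: abs_mult indicator_def)
  qed
  finally show ?thesis by simp
qed

lemma simple_process_rv:
  assumes S: "simple_process M \<F> T n \<tau> \<xi>"
  shows "j < n \<Longrightarrow> \<xi> j \<in> borel_measurable M"
  by (rule borel_measurable_filtration[of "\<tau> j"])
     (use simple_processD(4,5)[OF S, of j] in \<open>simp_all add: bounded_rv_def\<close>)

lemma simple_process_bounded:
  assumes S: "simple_process M \<F> T n \<tau> \<xi>"
  shows "\<exists>C\<ge>0. \<forall>j<n. \<forall>\<omega>\<in>space M. \<bar>\<xi> j \<omega>\<bar> \<le> C"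
proof -
  have "\<forall>j. \<exists>C. j < n \<longrightarrow> (\<forall>\<omega>\<in>space M. \<bar>\<xi> j \<omega>\<bar> \<le> C)"
    using S by (auto simp: simple_process_def)
  then obtain C where C: "\<And>j \<omega>. j < n \<Longrightarrow> \<omega> \<in> space M \<Longrightarrow> \<bar>\<xi> j \<omega>\<bar> \<le> C j" by metis
  show ?thesis
  proof (intro exI[of _ "\<Sum>j<n. \<bar>C j\<bar>"] conjI allI impI ballI)
    fix j \<omega> assume "j < n" "\<omega> \<in> space M"
    then have "\<bar>\<xi> j \<omega>\<bar> \<le> \<bar>C j\<bar>" using C[of j \<omega>] by simp
    also have "\<dots> \<le> (\<Sum>j<n. \<bar>C j\<bar>)" by (rule member_le_sum) (use \<open>j < n\<close> in auto)
    finally show "\<bar>\<xi> j \<omega>\<bar> \<le> (\<Sum>j<n. \<bar>C j\<bar>)" .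
  qed (simp add: sum_nonneg)
qed

lemma borel_measurable_sv:
  assumes S: "simple_process M \<F> T n \<tau> \<xi>"
  shows "sv n \<tau> \<xi> \<in> borel_measurable prodM"
  unfolding sv_def[abs_def] simple_value_def
proof (rule borel_measurable_sum, rule borel_measurable_times)
  fix j assume "j \<in> {..<n}"
  then show "(\<lambda>x. \<xi> j (snd x)) \<in> borel_measurable prodM"
    using measurable_snd_prodM[OF simple_process_rv[OF S]] by simp
  show "(\<lambda>x. indicator {\<tau> j<..\<tau> (Suc j)} (fst x) :: real) \<in> borel_measurable prodM"
    by (rule measurable_fst_prodM) simp
qed

lemma sq_integrable_sv:
  assumes S: "simple_process M \<F> T n \<tau> \<xi>"
  shows "sq_integrable prodM (sv n \<tau> \<xi>)"
proof -
  obtain C where C: "\<forall>j<n. \<forall>\<omega>\<in>space M. \<bar>\<xi> j \<omega>\<bar> \<le> C"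
    using simple_process_bounded[OF S] by blast
  show ?thesis
  proof (rule sq_integrable_bounded[OF fp.finite_measure_axioms borel_measurable_sv[OF S]])
    fix x assume "x \<in> space prodM"
    then show "\<bar>sv n \<tau> \<xi> x\<bar> \<le> real n * \<bar>C\<bar>"
      unfolding sv_def by (intro simple_value_bounded) (use C in \<open>auto simp: space_prodM\<close>)
  qed
qed

text \<open>Every endpoint on the right is capped at \<open>t\<close>, to match
  \<open>elementary_inner\<close> for the capped intervals that occur in a simple integral at time
  \<open>t\<close>.\<close>

lemma integral_indicators:
  assumes t: "t \<in> {0..T}" and ab: "0 \<le> a" "a \<le> b" "0 \<le> c" "c \<le> d"
  shows "(\<integral>s. indicator {..t} s * indicator {a<..b} s * indicator {c<..d} s \<partial>timeM)
    = max 0 (min (min t b) (min t d) - max (min t a) (min t c))"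
    "integrable timeM (\<lambda>s. indicator {..t} s * indicator {a<..b} s * indicator {c<..d} s :: real)"
proof -
  let ?L = "max a c" and ?U = "min t (min b d)"
  have "(\<integral>s. indicator {..t} s * indicator {a<..b} s * indicator {c<..d} s \<partial>timeM) =
      (\<integral>s. (indicator {?L<..?U} s :: real) \<partial>lborel)"
    unfolding integral_timeM set_lebesgue_integral_def
    by (rule Bochner_Integration.integral_cong) (use assms in \<open>auto split: split_indicator\<close>)
  also have "\<dots> = max 0 (?U - ?L)" by (cases "?L \<le> ?U") auto
  also have "\<dots> = max 0 (min (min t b) (min t d) - max (min t a) (min t c))"
    using ab by (cases "a \<le> t"; cases "c \<le> t") (auto simp: min_def max_def)
  finally show "(\<integral>s. indicator {..t} s * indicator {a<..b} s * indicator {c<..d} s \<partial>timeM)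
    = max 0 (min (min t b) (min t d) - max (min t a) (min t c))" .
  show "integrable timeM (\<lambda>s. indicator {..t} s * indicator {a<..b} s * indicator {c<..d} s :: real)"
  proof (rule tm.integrable_const_bound[of _ 1])
    show "(\<lambda>s. indicator {..t} s * indicator {a<..b} s * indicator {c<..d} s :: real) \<in> borel_measurable timeM"
      by (rule measurable_timeM) simp
  qed (auto simp: indicator_def)
qed

lemma simple_isometry:
  assumes S: "simple_process M \<F> T n \<tau> \<xi>" and S': "simple_process M \<F> T n' \<tau>' \<xi>'" and t: "t \<in> {0..T}"
  shows "expectation (\<lambda>\<omega>. simple_integral n \<tau> \<xi> (\<beta> k) t \<omega> * simple_integral n' \<tau>' \<xi>' (\<beta> l) t \<omega>) =
    (if k = l then (\<integral>x. indicator {..t} (fst x) * (sv n \<tau> \<xi> x * sv n' \<tau>' \<xi>' x) \<partial>prodM) else 0)"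
proof -
  let ?e = "\<lambda>j \<omega>. cut t (\<tau> j) (\<xi> j) \<omega> * incr k (min t (\<tau> j)) (min t (\<tau> (Suc j))) \<omega>"
  let ?f = "\<lambda>j \<omega>. cut t (\<tau>' j) (\<xi>' j) \<omega> * incr l (min t (\<tau>' j)) (min t (\<tau>' (Suc j))) \<omega>"
  let ?m = "\<lambda>i j. max 0 (min (min t (\<tau> (Suc i))) (min t (\<tau>' (Suc j))) - max (min t (\<tau> i)) (min t (\<tau>' j)))"
  let ?g = "\<lambda>i j s. indicator {..t} s * indicator {\<tau> i<..\<tau> (Suc i)} s * indicator {\<tau>' j<..\<tau>' (Suc j)} s :: real"
  note a = simple_processD[OF S] and b = simple_processD[OF S']
  have o: "0 \<le> min t (\<tau> i)" "min t (\<tau> i) \<le> min t (\<tau> (Suc i))"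
    "bounded_rv (min t (\<tau> i)) (cut t (\<tau> i) (\<xi> i))" if "i < n" for i
    using a(3,5)[of i] that t bounded_rv_cut[OF a(4)[OF that]] by auto
  have o': "0 \<le> min t (\<tau>' i)" "min t (\<tau>' i) \<le> min t (\<tau>' (Suc i))"
    "bounded_rv (min t (\<tau>' i)) (cut t (\<tau>' i) (\<xi>' i))" if "i < n'" for i
    using b(3,5)[of i] that t bounded_rv_cut[OF b(4)[OF that]] by auto
  have p: "integrable M (\<lambda>\<omega>. \<xi> i \<omega> * \<xi>' j \<omega>)" if "i < n" "j < n'" for i j
  proof -
    have "bounded_rv T (\<xi> i)" "bounded_rv T (\<xi>' j)"
      using bounded_rv_mono[of _ T] a(4,5,6)[of i] b(4,5,6)[of j] that by auto
    from bounded_rv_mult[OF this] show ?thesis using T_pos by (intro integrable_bounded_rv[of T]) auto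
  qed
  have ef: "integrable M (\<lambda>\<omega>. ?e i \<omega> * ?f j \<omega>)" if "i < n" "j < n'" for i j
    by (intro sq_integrable_mult sq_integrable_elementary o o' that)
  have E: "expectation (\<lambda>\<omega>. ?e i \<omega> * ?f j \<omega>) = (if k = l then expectation (\<lambda>\<omega>. \<xi> i \<omega> * \<xi>' j \<omega>) * ?m i j else 0)"
    if "i < n" "j < n'" for i j
  proof -
    have "expectation (\<lambda>\<omega>. ?e i \<omega> * ?f j \<omega>) =
        (if k = l then expectation (\<lambda>\<omega>. cut t (\<tau> i) (\<xi> i) \<omega> * cut t (\<tau>' j) (\<xi>' j) \<omega>) * ?m i j else 0)"
      by (intro elementary_inner o o' that)
    also have "\<dots> = (if k = l then expectation (\<lambda>\<omega>. \<xi> i \<omega> * \<xi>' j \<omega>) * ?m i j else 0)"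
    \<comment> \<open>An interval that starts after \<open>t\<close> has no overlap up to
      \<open>t\<close>, so replacing \<open>cut\<close> by the coefficient itself changes
      nothing.\<close>
    proof (cases "\<tau> i \<le> t \<and> \<tau>' j \<le> t")
      case True then show ?thesis by (simp add: cut_def)
    next
      case False
      then have "?m i j = 0" using a(3)[OF that(1)] b(3)[OF that(2)] by (auto simp: min_def max_def)
      then show ?thesis by simp
    qed
    finally show ?thesis .
  qed
  have "expectation (\<lambda>\<omega>. simple_integral n \<tau> \<xi> (\<beta> k) t \<omega> * simple_integral n' \<tau>' \<xi>' (\<beta> l) t \<omega>) =
      expectation (\<lambda>\<omega>. \<Sum>i<n. \<Sum>j<n'. ?e i \<omega> * ?f j \<omega>)"
    unfolding simple_integral_cut[OF S] simple_integral_cut[OF S'] by (simp add: sum_product)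
  also have "\<dots> = (\<Sum>i<n. \<Sum>j<n'. expectation (\<lambda>\<omega>. ?e i \<omega> * ?f j \<omega>))"
    by (rule integral_double_sum) (use ef in auto)
  also have "\<dots> = (\<Sum>i<n. \<Sum>j<n'. (if k = l then expectation (\<lambda>\<omega>. \<xi> i \<omega> * \<xi>' j \<omega>) * ?m i j else 0))"
    using E by (intro sum.cong refl) auto
  finally have L: "expectation (\<lambda>\<omega>. simple_integral n \<tau> \<xi> (\<beta> k) t \<omega> * simple_integral n' \<tau>' \<xi>' (\<beta> l) t \<omega>) =
    (if k = l then (\<Sum>i<n. \<Sum>j<n'. expectation (\<lambda>\<omega>. \<xi> i \<omega> * \<xi>' j \<omega>) * ?m i j) else 0)" by simp
  have G: "integrable timeM (?g i j)" "(\<integral>s. ?g i j s \<partial>timeM) = ?m i j" if "i < n" "j < n'" for i j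
    using integral_indicators[OF t, of "\<tau> i" "\<tau> (Suc i)" "\<tau>' j" "\<tau>' (Suc j)"]
      a(3,5)[of i] b(3,5)[of j] that by auto
  have "(\<integral>x. indicator {..t} (fst x) * (sv n \<tau> \<xi> x * sv n' \<tau>' \<xi>' x) \<partial>prodM)
     = (\<integral>x. (\<Sum>i<n. \<Sum>j<n'. ?g i j (fst x) * (\<lambda>\<omega>. \<xi> i \<omega> * \<xi>' j \<omega>) (snd x)) \<partial>prodM)"
    unfolding sv_def simple_value_def
    by (rule Bochner_Integration.integral_cong[OF refl])
       (subst sum_product, simp only: sum_distrib_left, intro sum.cong refl, simp only: mult_ac)
  also have "\<dots> = (\<Sum>i<n. \<Sum>j<n'. (\<integral>x. ?g i j (fst x) * (\<lambda>\<omega>. \<xi> i \<omega> * \<xi>' j \<omega>) (snd x) \<partial>prodM))"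
    by (rule integral_double_sum, rule integral_prodM_times(1)) (use G(1) p in auto)
  also have "\<dots> = (\<Sum>i<n. \<Sum>j<n'. ?m i j * expectation (\<lambda>\<omega>. \<xi> i \<omega> * \<xi>' j \<omega>))"
    using integral_prodM_times(2)[OF G(1) p] G(2) by (intro sum.cong refl) simp
  finally show ?thesis unfolding L by (simp add: mult.commute)
qed

end

section \<open>Convergence in probability\<close>

lemma tendsto_0D:
  fixes a :: "nat \<Rightarrow> real"
  assumes "a \<longlonglongrightarrow> 0" "0 < e"
  shows "\<exists>r0. \<forall>r\<ge>r0. a r < e"
  using order_tendstoD(2)[OF assms] by (simp add: eventually_sequentially)

section \<open>Clipping, and pointwise operations on simple processes\<close>

definition clip :: "real \<Rightarrow> real \<Rightarrow> real" where
  "clip c x = max (- c) (min c x)"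

lemma clip_bound: "0 \<le> c \<Longrightarrow> \<bar>clip c x\<bar> \<le> c"
  by (auto simp: clip_def)

lemma clip_lipschitz: "\<bar>clip c x - clip c y\<bar> \<le> \<bar>x - y\<bar>"
  by (auto simp: clip_def max_def min_def)

lemma clip_0: "0 \<le> c \<Longrightarrow> clip c 0 = 0"
  by (simp add: clip_def)

lemma clip_diff_le: "0 \<le> c \<Longrightarrow> \<bar>clip c x - x\<bar> \<le> \<bar>x\<bar>"
  by (auto simp: clip_def max_def min_def)

lemma clip_id: "\<bar>x\<bar> \<le> c \<Longrightarrow> clip c x = x"
  by (auto simp: clip_def)

lemma borel_measurable_clip: "f \<in> borel_measurable N \<Longrightarrow> (\<lambda>x. clip c (f x)) \<in> borel_measurable N"
  unfolding clip_def by (intro borel_measurable_max borel_measurable_min borel_measurable_const)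

lemma simple_value_eq:
  assumes mono: "\<And>i j. i \<le> j \<Longrightarrow> j \<le> n \<Longrightarrow> \<tau> i \<le> \<tau> j" and j: "j < n" and s: "s \<in> {\<tau> j<..\<tau> (Suc j)}"
  shows "simple_value n \<tau> \<xi> s \<omega> = \<xi> j \<omega>"
proof -
  have "simple_value n \<tau> \<xi> s \<omega> = (\<Sum>i<n. if i = j then \<xi> i \<omega> else 0)"
    unfolding simple_value_def
  proof (rule sum.cong[OF refl])
    fix i assume i: "i \<in> {..<n}"
    show "\<xi> i \<omega> * indicator {\<tau> i<..\<tau> (Suc i)} s = (if i = j then \<xi> i \<omega> else 0)"
    proof (cases "i = j")
      case True then show ?thesis using s by simp
    next
      case False
      then have "Suc i \<le> j \<or> Suc j \<le> i" by auto
      then have "s \<notin> {\<tau> i<..\<tau> (Suc i)}"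
      proof
        assume "Suc i \<le> j"
        then have "\<tau> (Suc i) \<le> \<tau> j" using mono j by auto
        then show ?thesis using s by auto
      next
        assume "Suc j \<le> i"
        then have "\<tau> (Suc j) \<le> \<tau> i" using mono i by auto
        then show ?thesis using s by auto
      qed
      then show ?thesis using False by simp
    qed
  qed
  then show ?thesis using j by simp
qed

lemma simple_value_outside:
  assumes "\<And>j. j < n \<Longrightarrow> s \<notin> {\<tau> j<..\<tau> (Suc j)}"
  shows "simple_value n \<tau> \<xi> s \<omega> = 0"
  unfolding simple_value_def using assms by (intro sum.neutral) auto

text \<open>At any time at most one summand of a simple process is alive, so pointwise operations
  act on the coefficients. The condition on \<open>h\<close> settles the times outside all
  intervals, where the value is 0.\<close>

lemma simple_value_map2:
  assumes mono: "\<And>i j. i \<le> j \<Longrightarrow> j \<le> n \<Longrightarrow> \<tau> i \<le> \<tau> j" and "h 0 0 = (0::real)"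
  shows "simple_value n \<tau> (\<lambda>j \<omega>. h (\<xi> j \<omega>) (\<zeta> j \<omega>)) s \<omega> =
    h (simple_value n \<tau> \<xi> s \<omega>) (simple_value n \<tau> \<zeta> s \<omega>)"
proof (cases "\<exists>j<n. s \<in> {\<tau> j<..\<tau> (Suc j)}")
  case True
  then obtain j where j: "j < n" "s \<in> {\<tau> j<..\<tau> (Suc j)}" by blast
  show ?thesis by (simp only: simple_value_eq[OF mono j])
next
  case False
  then have "\<And>j. j < n \<Longrightarrow> s \<notin> {\<tau> j<..\<tau> (Suc j)}" by blast
  then have o: "simple_value n \<tau> \<chi> s \<omega> = 0" for \<chi> by (rule simple_value_outside)
  show ?thesis unfolding o using assms(2) by simp
qed

context wiener_space
begin

lemma borel_measurable_time_integral:
  fixes f :: "real \<times> 'w \<Rightarrow> real"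
  assumes "f \<in> borel_measurable prodM"
  shows "(\<lambda>\<omega>. \<integral>s. f (s, \<omega>) \<partial>timeM) \<in> borel_measurable M"
proof -
  have "(\<lambda>(\<omega>, s). f (s, \<omega>)) \<in> borel_measurable (M \<Otimes>\<^sub>M timeM)"
    using measurable_pair_swap[of f timeM M borel] assms by (simp add: prodM_def)
  then show ?thesis by (rule tm.borel_measurable_lebesgue_integral)
qed

section \<open>Rules for convergence in probability\<close>

lemma conv_in_prob_mono:
  assumes "conv_in_prob M Z (\<lambda>_. 0)" and Z: "\<And>r. Z r \<in> borel_measurable M"
    and le: "\<And>r. AE \<omega> in M. \<bar>g r \<omega>\<bar> \<le> \<bar>Z r \<omega>\<bar>"
  shows "conv_in_prob M g (\<lambda>_. 0)"
  unfolding conv_in_prob_def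
proof (intro allI impI)
  fix \<epsilon> :: real assume "\<epsilon> > 0"
  have "prob {\<omega> \<in> space M. \<bar>g r \<omega> - 0\<bar> > \<epsilon>} \<le> prob {\<omega> \<in> space M. \<bar>Z r \<omega> - 0\<bar> > \<epsilon>}" for r
  proof (rule finite_measure_mono_AE)
    show "AE x in M. x \<in> {\<omega> \<in> space M. \<bar>g r \<omega> - 0\<bar> > \<epsilon>} \<longrightarrow> x \<in> {\<omega> \<in> space M. \<bar>Z r \<omega> - 0\<bar> > \<epsilon>}"
      using le[of r] by (rule eventually_mono) auto
    show "{\<omega> \<in> space M. \<bar>Z r \<omega> - 0\<bar> > \<epsilon>} \<in> events"
      using Z[of r] by measurable
  qed
  then show "(\<lambda>r. prob {\<omega> \<in> space M. \<bar>g r \<omega> - 0\<bar> > \<epsilon>}) \<longlonglongrightarrow> 0"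
    by (rule nonneg_tendsto_0[rotated 1])
       (use assms(1) \<open>\<epsilon> > 0\<close> in \<open>auto simp: conv_in_prob_def\<close>)
qed

lemma conv_in_prob_add:
  assumes X: "conv_in_prob M X (\<lambda>_. 0)" "\<And>r. X r \<in> borel_measurable M"
    and Y: "conv_in_prob M Y (\<lambda>_. 0)" "\<And>r. Y r \<in> borel_measurable M"
  shows "conv_in_prob M (\<lambda>r \<omega>. X r \<omega> + Y r \<omega>) (\<lambda>_. 0)"
  unfolding conv_in_prob_def
proof (intro allI impI)
  fix \<epsilon> :: real assume "\<epsilon> > 0"
  then have e: "\<epsilon> / 2 > 0" by simp
  have m: "{\<omega> \<in> space M. \<bar>X r \<omega> - 0\<bar> > \<epsilon> / 2} \<in> events" "{\<omega> \<in> space M. \<bar>Y r \<omega> - 0\<bar> > \<epsilon> / 2} \<in> events" for r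
    using X(2)[of r] Y(2)[of r] by measurable
  have "prob {\<omega> \<in> space M. \<bar>X r \<omega> + Y r \<omega> - 0\<bar> > \<epsilon>} \<le>
      prob {\<omega> \<in> space M. \<bar>X r \<omega> - 0\<bar> > \<epsilon> / 2} + prob {\<omega> \<in> space M. \<bar>Y r \<omega> - 0\<bar> > \<epsilon> / 2}" for r
  proof -
    have "prob {\<omega> \<in> space M. \<bar>X r \<omega> + Y r \<omega> - 0\<bar> > \<epsilon>} \<le>
      prob ({\<omega> \<in> space M. \<bar>X r \<omega> - 0\<bar> > \<epsilon> / 2} \<union> {\<omega> \<in> space M. \<bar>Y r \<omega> - 0\<bar> > \<epsilon> / 2})"
      by (rule finite_measure_mono) (use m in auto)
    also have "\<dots> \<le> prob {\<omega> \<in> space M. \<bar>X r \<omega> - 0\<bar> > \<epsilon> / 2} + prob {\<omega> \<in> space M. \<bar>Y r \<omega> - 0\<bar> > \<epsilon> / 2}"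
      by (rule measure_Un_le[OF m])
    finally show ?thesis .
  qed
  moreover have "(\<lambda>r. prob {\<omega> \<in> space M. \<bar>X r \<omega> - 0\<bar> > \<epsilon> / 2} + prob {\<omega> \<in> space M. \<bar>Y r \<omega> - 0\<bar> > \<epsilon> / 2}) \<longlonglongrightarrow> 0 + 0"
    by (rule tendsto_add)
       (use X(1)[unfolded conv_in_prob_def, rule_format, OF e] Y(1)[unfolded conv_in_prob_def, rule_format, OF e] in auto)
  ultimately show "(\<lambda>r. prob {\<omega> \<in> space M. \<bar>X r \<omega> + Y r \<omega> - 0\<bar> > \<epsilon>}) \<longlonglongrightarrow> 0"
    by (intro nonneg_tendsto_0[where a="\<lambda>r. prob {\<omega> \<in> space M. \<bar>X r \<omega> + Y r \<omega> - 0\<bar> > \<epsilon>}"]) auto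
qed

lemma markov_bound:
  assumes "integrable M g" "\<And>\<omega>. \<omega> \<in> space M \<Longrightarrow> 0 \<le> g \<omega>" "\<epsilon> > 0"
  shows "prob {\<omega> \<in> space M. g \<omega> > \<epsilon>} \<le> expectation g / \<epsilon>"
proof -
  have "prob {\<omega> \<in> space M. g \<omega> > \<epsilon>} \<le> prob {\<omega> \<in> space M. \<epsilon> \<le> g \<omega>}"
    by (rule finite_measure_mono) (use assms(1) in auto)
  also have "\<dots> \<le> expectation g / \<epsilon>"
    by (rule integral_Markov_inequality_measure[OF assms(1)]) (use assms in auto)
  finally show ?thesis .
qed

lemma conv_in_prob_L1:
  assumes "\<And>r. integrable M (g r)" "\<And>r \<omega>. \<omega> \<in> space M \<Longrightarrow> 0 \<le> g r \<omega>"
    and "(\<lambda>r. expectation (g r)) \<longlonglongrightarrow> 0"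
  shows "conv_in_prob M g (\<lambda>_. 0)"
  unfolding conv_in_prob_def
proof (intro allI impI)
  fix \<epsilon> :: real assume e: "\<epsilon> > 0"
  have "prob {\<omega> \<in> space M. \<bar>g r \<omega> - 0\<bar> > \<epsilon>} \<le> expectation (g r) / \<epsilon>" for r
  proof -
    have "{\<omega> \<in> space M. \<bar>g r \<omega> - 0\<bar> > \<epsilon>} = {\<omega> \<in> space M. g r \<omega> > \<epsilon>}"
      using assms(2)[of _ r] by auto
    then show ?thesis using markov_bound[OF assms(1,2) e] by simp
  qed
  then show "(\<lambda>r. prob {\<omega> \<in> space M. \<bar>g r \<omega> - 0\<bar> > \<epsilon>}) \<longlonglongrightarrow> 0"
    by (rule nonneg_tendsto_0[rotated 1]) (use tendsto_divide[OF assms(3) tendsto_const[of \<epsilon>]] e in auto)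
qed

text \<open>Bounded convergence under convergence in probability: the expectation is split along the
  event that \<open>g r\<close> exceeds half the tolerance, and the bound \<open>B\<close> is spent
  only on that event.\<close>

lemma expectation_conv_bounded:
  assumes g: "\<And>r. g r \<in> borel_measurable M" "\<And>r \<omega>. \<omega> \<in> space M \<Longrightarrow> 0 \<le> g r \<omega>"
    "\<And>r \<omega>. \<omega> \<in> space M \<Longrightarrow> g r \<omega> \<le> B"
    and conv: "conv_in_prob M g (\<lambda>_. 0)"
  shows "(\<lambda>r. expectation (g r)) \<longlonglongrightarrow> 0"
proof (rule LIMSEQ_I)
  fix \<epsilon> :: real assume e: "\<epsilon> > 0"
  have ig: "integrable M (g r)" for r
    by (rule integrable_const_bound[of _ B]) (use g in auto)
  \<comment> \<open>A strictly positive bound, fit for division.\<close>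
  define B' where "B' = \<bar>B\<bar> + 1"
  have B': "B' > 0" "B \<le> B'" by (auto simp: B'_def)
  have E: "expectation (g r) \<le> \<epsilon> / 2 + B' * prob {\<omega> \<in> space M. \<bar>g r \<omega> - 0\<bar> > \<epsilon> / 2}" for r
  proof -
    let ?A = "{\<omega> \<in> space M. \<bar>g r \<omega> - 0\<bar> > \<epsilon> / 2}"
    have A: "?A \<in> events" using g(1)[of r] by measurable
    have iA: "integrable M (indicator ?A :: 'w \<Rightarrow> real)"
      by (rule integrable_real_indicator[OF A]) (simp add: less_top[symmetric])
    have "expectation (g r) \<le> expectation (\<lambda>\<omega>. \<epsilon> / 2 + B' * indicator ?A \<omega>)"
    proof (rule integral_mono[OF ig])
      show "integrable M (\<lambda>\<omega>. \<epsilon> / 2 + B' * indicator ?A \<omega>)"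
        by (intro Bochner_Integration.integrable_add integrable_mult_right integrable_const iA)
      fix \<omega> assume "\<omega> \<in> space M"
      then show "g r \<omega> \<le> \<epsilon> / 2 + B' * indicator ?A \<omega>"
        using g(2,3)[of \<omega> r] e B' by (auto simp: indicator_def)
    qed
    also have "\<dots> = \<epsilon> / 2 + B' * prob ?A"
      by (subst Bochner_Integration.integral_add[OF integrable_const integrable_mult_right[OF iA]])
         (simp add: prob_space Int_absorb2)
    finally show ?thesis .
  qed
  have "\<epsilon> / (2 * B') > 0" using e B' by simp
  moreover have "(\<lambda>r. prob {\<omega> \<in> space M. \<bar>g r \<omega> - 0\<bar> > \<epsilon> / 2}) \<longlonglongrightarrow> 0"
    using conv[unfolded conv_in_prob_def, rule_format, of "\<epsilon> / 2"] e by simp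
  ultimately obtain r0 where r0: "\<forall>r\<ge>r0. prob {\<omega> \<in> space M. \<bar>g r \<omega> - 0\<bar> > \<epsilon> / 2} < \<epsilon> / (2 * B')"
    using tendsto_0D by blast
  show "\<exists>no. \<forall>r\<ge>no. norm (expectation (g r) - 0) < \<epsilon>"
  proof (intro exI[of _ r0] allI impI)
    fix r assume "r \<ge> r0"
    have "B' * prob {\<omega> \<in> space M. \<bar>g r \<omega> - 0\<bar> > \<epsilon> / 2} < \<epsilon> / 2"
      using r0[rule_format, OF \<open>r \<ge> r0\<close>] B' by (simp add: field_simps)
    then have "expectation (g r) < \<epsilon>" using E[of r] by simp
    moreover have "expectation (g r) \<ge> 0" by (rule Bochner_Integration.integral_nonneg) (rule g(2))
    ultimately show "norm (expectation (g r) - 0) < \<epsilon>" by simp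
  qed
qed

section \<open>Tail bound for simple integrals\<close>

lemma simple_value_sq_integral:
  assumes S: "simple_process M \<F> T n \<tau> \<xi>"
  shows "(\<integral>s. (simple_value n \<tau> \<xi> s \<omega>)\<^sup>2 \<partial>timeM) = (\<Sum>j<n. (\<xi> j \<omega>)\<^sup>2 * (\<tau> (Suc j) - \<tau> j))"
proof -
  note a = simple_processD[OF S]
  have "(\<lambda>s. (simple_value n \<tau> \<xi> s \<omega>)\<^sup>2) = (\<lambda>s. simple_value n \<tau> (\<lambda>j \<omega>. (\<xi> j \<omega>)\<^sup>2) s \<omega>)"
    using simple_value_map2[of n \<tau> "\<lambda>x y. x\<^sup>2" \<xi> \<xi> _ \<omega>, OF a(7)] by (simp add: fun_eq_iff)
  then have "(\<integral>s. (simple_value n \<tau> \<xi> s \<omega>)\<^sup>2 \<partial>timeM) =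
      (\<integral>s. (\<Sum>j<n. (\<xi> j \<omega>)\<^sup>2 * indicator {\<tau> j<..\<tau> (Suc j)} s) \<partial>timeM)"
    by (simp add: simple_value_def)
  also have "\<dots> = (\<Sum>j<n. \<integral>s. (\<xi> j \<omega>)\<^sup>2 * indicator {\<tau> j<..\<tau> (Suc j)} s \<partial>timeM)"
  proof (rule Bochner_Integration.integral_sum)
    fix j show "integrable timeM (\<lambda>s. (\<xi> j \<omega>)\<^sup>2 * indicator {\<tau> j<..\<tau> (Suc j)} s)"
    proof (rule tm.integrable_const_bound[of _ "(\<xi> j \<omega>)\<^sup>2"])
      show "(\<lambda>s. (\<xi> j \<omega>)\<^sup>2 * indicator {\<tau> j<..\<tau> (Suc j)} s :: real) \<in> borel_measurable timeM"
        by (rule measurable_timeM) simp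
    qed (auto simp: indicator_def)
  qed
  also have "\<dots> = (\<Sum>j<n. (\<xi> j \<omega>)\<^sup>2 * (\<tau> (Suc j) - \<tau> j))"
  proof (rule sum.cong[OF refl])
    fix j assume "j \<in> {..<n}"
    then have j: "0 \<le> \<tau> j" "\<tau> (Suc j) \<le> T" "\<tau> j < \<tau> (Suc j)" using a(3,5,6) by auto
    have "(\<integral>s. indicator {\<tau> j<..\<tau> (Suc j)} s \<partial>timeM) = (\<integral>s. (indicator {\<tau> j<..\<tau> (Suc j)} s :: real) \<partial>lborel)"
      unfolding integral_timeM set_lebesgue_integral_def
      by (rule Bochner_Integration.integral_cong) (use j in \<open>auto split: split_indicator\<close>)
    then show "(\<integral>s. (\<xi> j \<omega>)\<^sup>2 * indicator {\<tau> j<..\<tau> (Suc j)} s \<partial>timeM) = (\<xi> j \<omega>)\<^sup>2 * (\<tau> (Suc j) - \<tau> j)"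
      using j by simp
  qed
  finally show ?thesis .
qed

lemma simple_integral_second_moment:
  assumes S: "simple_process M \<F> T n \<tau> \<xi>" and t: "t \<in> {0..T}"
    and B: "\<And>\<omega>. \<omega> \<in> space M \<Longrightarrow> (\<Sum>j<n. (\<xi> j \<omega>)\<^sup>2 * (\<tau> (Suc j) - \<tau> j)) \<le> B"
  shows "expectation (\<lambda>\<omega>. (simple_integral n \<tau> \<xi> (\<beta> k) t \<omega>)\<^sup>2) \<le> B"
proof -
  have q: "integrable prodM (\<lambda>x. (sv n \<tau> \<xi> x)\<^sup>2)" using sq_integrable_sv[OF S] by (rule sq_integrableD)
  have q': "integrable prodM (\<lambda>x. (simple_value n \<tau> \<xi> (fst x) (snd x))\<^sup>2)"
    using q by (simp add: sv_def)
  have "expectation (\<lambda>\<omega>. (simple_integral n \<tau> \<xi> (\<beta> k) t \<omega>)\<^sup>2) =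
      (\<integral>x. indicator {..t} (fst x) * (sv n \<tau> \<xi> x)\<^sup>2 \<partial>prodM)"
    using simple_isometry[OF S S t, of k k] by (simp add: power2_eq_square)
  also have "\<dots> \<le> (\<integral>x. (sv n \<tau> \<xi> x)\<^sup>2 \<partial>prodM)"
  proof (rule integral_mono_AE[OF _ q])
    show "integrable prodM (\<lambda>x. indicator {..t} (fst x) * (sv n \<tau> \<xi> x)\<^sup>2)"
      by (rule Bochner_Integration.integrable_bound[OF q])
         (use measurable_fst_prodM[of "indicator {..t}"] q in \<open>auto intro!: borel_measurable_times simp: indicator_def\<close>)
    show "AE x in prodM. indicator {..t} (fst x) * (sv n \<tau> \<xi> x)\<^sup>2 \<le> (sv n \<tau> \<xi> x)\<^sup>2"
      by (rule AE_I2) (simp add: indicator_def)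
  qed
  also have "\<dots> = (\<integral>\<omega>. \<integral>s. (simple_value n \<tau> \<xi> s \<omega>)\<^sup>2 \<partial>timeM \<partial>M)"
    unfolding sv_def by (rule integral_prodM(2)[OF q'])
  also have "\<dots> \<le> (\<integral>\<omega>. B \<partial>M)"
  proof (rule integral_mono)
    show "integrable M (\<lambda>\<omega>. \<integral>s. (simple_value n \<tau> \<xi> s \<omega>)\<^sup>2 \<partial>timeM)" by (rule integral_prodM(4)[OF q'])
  qed (use B in \<open>auto simp: simple_value_sq_integral[OF S]\<close>)
  also have "\<dots> = B" by (simp add: prob_space)
  finally show ?thesis .
qed

lemma sum_stopped_le:
  fixes x :: "nat \<Rightarrow> real"
  assumes "\<And>j. j < n \<Longrightarrow> 0 \<le> x j" "0 \<le> \<delta>"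
  shows "(\<Sum>j<n. if (\<Sum>i<Suc j. x i) \<le> \<delta> then x j else 0) \<le> \<delta>"
proof -
  let ?S = "\<lambda>k. \<Sum>j<k. if (\<Sum>i<Suc j. x i) \<le> \<delta> then x j else 0"
  have "?S k \<le> \<delta> \<and> ?S k \<le> (\<Sum>i<k. x i)" if "k \<le> n" for k
    using that
  proof (induction k)
    case (Suc k)
    then have "?S k \<le> \<delta>" "?S k \<le> (\<Sum>i<k. x i)" "0 \<le> x k" using assms(1) by auto
    then show ?case by auto
  qed (use assms(2) in simp)
  then show ?thesis by simp
qed

text \<open>The integrand is switched off at the first grid time after which its square would integrate to
  more than \<open>\<delta>\<close>; this decision is known at the left end of each interval.\<close>

lemma simple_integral_tail:
  assumes S: "simple_process M \<F> T n \<tau> \<xi>" and t: "t \<in> {0..T}" and \<epsilon>: "\<epsilon> > 0" and \<delta>: "\<delta> \<ge> 0"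
  shows "prob {\<omega> \<in> space M. \<bar>simple_integral n \<tau> \<xi> (\<beta> k) t \<omega>\<bar> > \<epsilon>} \<le>
    \<delta> / \<epsilon>\<^sup>2 + prob {\<omega> \<in> space M. (\<integral>s. (simple_value n \<tau> \<xi> s \<omega>)\<^sup>2 \<partial>timeM) > \<delta>}"
proof -
  note a = simple_processD[OF S]
  let ?x = "\<lambda>\<omega> j. (\<xi> j \<omega>)\<^sup>2 * (\<tau> (Suc j) - \<tau> j)"
  define \<zeta> where "\<zeta> j \<omega> = (if (\<Sum>i<Suc j. ?x \<omega> i) \<le> \<delta> then \<xi> j \<omega> else 0)" for j \<omega>
  let ?I = "\<lambda>\<xi>. simple_integral n \<tau> \<xi> (\<beta> k) t"
  have S': "simple_process M \<F> T n \<tau> \<zeta>"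
    unfolding simple_process_def
  proof (intro conjI allI impI a(1-3))
    fix j assume j: "j < n"
    have xi: "\<xi> i \<in> borel_measurable (\<F> (\<tau> j))" if "i < Suc j" for i
      by (rule borel_measurable_filtration_mono[of "\<tau> i"])
         (use a(4)[of i] a(5)[of i] a(7)[of i j] j that in \<open>simp_all add: bounded_rv_def\<close>)
    have "(\<lambda>\<omega>. \<Sum>i<Suc j. ?x \<omega> i) \<in> borel_measurable (\<F> (\<tau> j))"
      by (intro borel_measurable_sum borel_measurable_times borel_measurable_power xi) auto
    then show "\<zeta> j \<in> borel_measurable (\<F> (\<tau> j))"
      unfolding \<zeta>_def[abs_def]
      by (intro measurable_If xi borel_measurable_const borel_measurable_pred_less pred_intros_logic
          borel_measurable_le) auto
    obtain C where "\<forall>\<omega>\<in>space M. \<bar>\<xi> j \<omega>\<bar> \<le> C" using a(4)[OF j] by (auto simp: bounded_rv_def)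
    then have "\<forall>\<omega>\<in>space M. \<bar>\<zeta> j \<omega>\<bar> \<le> \<bar>C\<bar>" unfolding \<zeta>_def by auto
    then show "\<exists>C. \<forall>\<omega>\<in>space M. \<bar>\<zeta> j \<omega>\<bar> \<le> C" ..
  qed
  have x0: "0 \<le> ?x \<omega> j" if "j < n" for j \<omega> using a(3)[OF that] by simp
  have z: "(\<Sum>j<n. (\<zeta> j \<omega>)\<^sup>2 * (\<tau> (Suc j) - \<tau> j)) \<le> \<delta>" for \<omega>
  proof -
    have "(\<Sum>j<n. (\<zeta> j \<omega>)\<^sup>2 * (\<tau> (Suc j) - \<tau> j)) = (\<Sum>j<n. if (\<Sum>i<Suc j. ?x \<omega> i) \<le> \<delta> then ?x \<omega> j else 0)"
      by (rule sum.cong) (auto simp: \<zeta>_def)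
    then show ?thesis using sum_stopped_le[of n "?x \<omega>" \<delta>] x0 \<delta> by simp
  qed
  have eq: "?I \<zeta> \<omega> = ?I \<xi> \<omega>" if "(\<integral>s. (simple_value n \<tau> \<xi> s \<omega>)\<^sup>2 \<partial>timeM) \<le> \<delta>" for \<omega>
  proof -
    have "\<zeta> j \<omega> = \<xi> j \<omega>" if "j < n" for j
    proof -
      have "(\<Sum>i<Suc j. ?x \<omega> i) \<le> (\<Sum>i<n. ?x \<omega> i)"
        by (rule sum_mono2) (use that x0 in auto)
      then show ?thesis using \<open>(\<integral>s. _ \<partial>timeM) \<le> \<delta>\<close>
        by (simp add: simple_value_sq_integral[OF S] \<zeta>_def)
    qed
    then show ?thesis unfolding simple_integral_def by (intro sum.cong) auto
  qed
  note sq = sq_integrable_simple_integral[OF S' t, of k]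
  have m1: "{\<omega> \<in> space M. (?I \<zeta> \<omega>)\<^sup>2 > \<epsilon>\<^sup>2} \<in> events"
    using sq_integrableD(2)[OF sq] by measurable
  have m2: "{\<omega> \<in> space M. (\<integral>s. (simple_value n \<tau> \<xi> s \<omega>)\<^sup>2 \<partial>timeM) > \<delta>} \<in> events"
  proof -
    have "(\<lambda>\<omega>. \<integral>s. (sv n \<tau> \<xi> (s, \<omega>))\<^sup>2 \<partial>timeM) \<in> borel_measurable M"
      by (rule borel_measurable_time_integral[where f="\<lambda>x. (sv n \<tau> \<xi> x)\<^sup>2"])
         (intro borel_measurable_power borel_measurable_sv[OF S])
    then have "(\<lambda>\<omega>. \<integral>s. (simple_value n \<tau> \<xi> s \<omega>)\<^sup>2 \<partial>timeM) \<in> borel_measurable M" by (simp add: sv_def)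
    then show ?thesis by measurable
  qed
  \<comment> \<open>Either the switched integral is already large, which Markov's inequality and the
    second moment bound control, or the switch has acted, which happens only if the integral of the
    square exceeds \<open>\<delta>\<close>.\<close>
  have "prob {\<omega> \<in> space M. \<bar>?I \<xi> \<omega>\<bar> > \<epsilon>} \<le> prob ({\<omega> \<in> space M. (?I \<zeta> \<omega>)\<^sup>2 > \<epsilon>\<^sup>2} \<union>
      {\<omega> \<in> space M. (\<integral>s. (simple_value n \<tau> \<xi> s \<omega>)\<^sup>2 \<partial>timeM) > \<delta>})"
  proof (rule finite_measure_mono)
    show "{\<omega> \<in> space M. \<bar>?I \<xi> \<omega>\<bar> > \<epsilon>} \<subseteq> {\<omega> \<in> space M. (?I \<zeta> \<omega>)\<^sup>2 > \<epsilon>\<^sup>2} \<union>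
      {\<omega> \<in> space M. (\<integral>s. (simple_value n \<tau> \<xi> s \<omega>)\<^sup>2 \<partial>timeM) > \<delta>}"
    proof
      fix \<omega> assume w: "\<omega> \<in> {\<omega> \<in> space M. \<bar>?I \<xi> \<omega>\<bar> > \<epsilon>}"
      then have "(?I \<xi> \<omega>)\<^sup>2 > \<epsilon>\<^sup>2" using \<epsilon> using power_strict_mono[of \<epsilon> "\<bar>?I \<xi> \<omega>\<bar>" 2] by simp
      then show "\<omega> \<in> {\<omega> \<in> space M. (?I \<zeta> \<omega>)\<^sup>2 > \<epsilon>\<^sup>2} \<union>
         {\<omega> \<in> space M. (\<integral>s. (simple_value n \<tau> \<xi> s \<omega>)\<^sup>2 \<partial>timeM) > \<delta>}"
        using w eq[of \<omega>] by (cases "(\<integral>s. (simple_value n \<tau> \<xi> s \<omega>)\<^sup>2 \<partial>timeM) \<le> \<delta>") auto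
    qed
  qed (use m1 m2 in auto)
  also have "\<dots> \<le> prob {\<omega> \<in> space M. (?I \<zeta> \<omega>)\<^sup>2 > \<epsilon>\<^sup>2} +
      prob {\<omega> \<in> space M. (\<integral>s. (simple_value n \<tau> \<xi> s \<omega>)\<^sup>2 \<partial>timeM) > \<delta>}"
    by (rule measure_Un_le[OF m1 m2])
  also have "prob {\<omega> \<in> space M. (?I \<zeta> \<omega>)\<^sup>2 > \<epsilon>\<^sup>2} \<le> expectation (\<lambda>\<omega>. (?I \<zeta> \<omega>)\<^sup>2) / \<epsilon>\<^sup>2"
    by (rule markov_bound[OF sq_integrableD(2)[OF sq]]) (use \<epsilon> in auto)
  also have "\<dots> \<le> \<delta> / \<epsilon>\<^sup>2"
    by (rule divide_right_mono[OF simple_integral_second_moment[OF S' t z]]) simp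
  finally show ?thesis by simp
qed

lemma simple_integral_conv_0:
  assumes S: "\<And>r. simple_process M \<F> T (n r) (\<tau> r) (\<xi> r)" and t: "t \<in> {0..T}"
    and conv: "conv_in_prob M (\<lambda>r \<omega>. \<integral>s. (simple_value (n r) (\<tau> r) (\<xi> r) s \<omega>)\<^sup>2 \<partial>timeM) (\<lambda>_. 0)"
  shows "conv_in_prob M (\<lambda>r. simple_integral (n r) (\<tau> r) (\<xi> r) (\<beta> k) t) (\<lambda>_. 0)"
  unfolding conv_in_prob_def
proof (intro allI impI)
  fix \<epsilon> :: real assume \<epsilon>: "\<epsilon> > 0"
  let ?Q = "\<lambda>r \<omega>. \<integral>s. (simple_value (n r) (\<tau> r) (\<xi> r) s \<omega>)\<^sup>2 \<partial>timeM"
  show "(\<lambda>r. prob {\<omega> \<in> space M. \<bar>simple_integral (n r) (\<tau> r) (\<xi> r) (\<beta> k) t \<omega> - 0\<bar> > \<epsilon>}) \<longlonglongrightarrow> 0"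
  proof (rule LIMSEQ_I)
    fix \<eta> :: real assume \<eta>: "\<eta> > 0"
    \<comment> \<open>Chosen so that the Markov term of the tail bound equals
      \<open>\<eta> / 2\<close>.\<close>
    define \<delta> where "\<delta> = \<eta> * \<epsilon>\<^sup>2 / 2"
    have \<delta>: "\<delta> > 0" "\<delta> / \<epsilon>\<^sup>2 = \<eta> / 2" using \<eta> \<epsilon> by (auto simp: \<delta>_def)
    have "(\<lambda>r. prob {\<omega> \<in> space M. \<bar>?Q r \<omega> - 0\<bar> > \<delta>}) \<longlonglongrightarrow> 0"
      using conv \<delta> by (simp add: conv_in_prob_def)
    moreover have "\<eta> / 2 > 0" using \<eta> by simp
    ultimately obtain r0 where r0: "\<forall>r\<ge>r0. prob {\<omega> \<in> space M. \<bar>?Q r \<omega> - 0\<bar> > \<delta>} < \<eta> / 2"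
      using tendsto_0D by blast
    show "\<exists>no. \<forall>r\<ge>no. norm (prob {\<omega> \<in> space M. \<bar>simple_integral (n r) (\<tau> r) (\<xi> r) (\<beta> k) t \<omega> - 0\<bar> > \<epsilon>} - 0) < \<eta>"
    proof (intro exI[of _ r0] allI impI)
      fix r assume "r \<ge> r0"
      have "?Q r \<omega> \<ge> 0" for \<omega> by simp
      then have "{\<omega> \<in> space M. ?Q r \<omega> > \<delta>} = {\<omega> \<in> space M. \<bar>?Q r \<omega> - 0\<bar> > \<delta>}" by simp
      then have "prob {\<omega> \<in> space M. ?Q r \<omega> > \<delta>} < \<eta> / 2" using r0 \<open>r \<ge> r0\<close> by simp
      then show "norm (prob {\<omega> \<in> space M. \<bar>simple_integral (n r) (\<tau> r) (\<xi> r) (\<beta> k) t \<omega> - 0\<bar> > \<epsilon>} - 0) < \<eta>"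
        using simple_integral_tail[OF S[of r] t \<epsilon>, of \<delta> k] \<delta> by simp
    qed
  qed
qed

end

section \<open>Refinement of grids and approximation in mean square\<close>

lemma clip_le_abs: "0 \<le> c \<Longrightarrow> \<bar>clip c x\<bar> \<le> \<bar>x\<bar>"
  by (auto simp: clip_def max_def min_def)

lemma sq_le_sq_of_abs_le: "\<bar>x\<bar> \<le> \<bar>y\<bar> \<Longrightarrow> x\<^sup>2 \<le> (y::real)\<^sup>2"
  by (simp add: abs_le_square_iff)

text \<open>Fine indices with the same \<open>l div N\<close> share a coefficient, and their
  differences telescope. Leaving \<open>b\<close> free covers both the integral, with the path
  capped at time t, and the value, with indicators of half-lines.\<close>

lemma sum_refine:
  fixes b :: "nat \<Rightarrow> real"
  assumes "0 < N"
  shows "(\<Sum>l<n * N. x (l div N) * (b (Suc l) - b l)) = (\<Sum>j<n. x j * (b (Suc j * N) - b (j * N)))"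
proof -
  have "(\<Sum>l<n * N. x (l div N) * (b (Suc l) - b l)) =
      (\<Sum>j<n. \<Sum>l = j * N..<j * N + N. x (l div N) * (b (Suc l) - b l))"
    by (rule sum.nat_group[symmetric])
  also have "\<dots> = (\<Sum>j<n. x j * (b (Suc j * N) - b (j * N)))"
  proof (rule sum.cong[OF refl])
    fix j
    have "(\<Sum>l = j * N..<j * N + N. x (l div N) * (b (Suc l) - b l)) =
        (\<Sum>l = j * N..<j * N + N. x j * (b (Suc l) - b l))"
    proof (rule sum.cong[OF refl])
      fix l assume "l \<in> {j * N..<j * N + N}"
      then have "l div N = j" using assms by (intro div_nat_eqI) (auto simp: algebra_simps)
      then show "x (l div N) * (b (Suc l) - b l) = x j * (b (Suc l) - b l)" by simp
    qed
    also have "\<dots> = x j * (b (j * N + N) - b (j * N))"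
      by (simp only: sum_distrib_left[symmetric]) (simp add: sum_Suc_diff')
    finally show "(\<Sum>l = j * N..<j * N + N. x (l div N) * (b (Suc l) - b l)) = x j * (b (Suc j * N) - b (j * N))"
      by (simp add: add.commute)
  qed
  finally show ?thesis .
qed

lemma simple_integral_diff:
  "simple_integral n \<tau> (\<lambda>j \<omega>. \<xi> j \<omega> - \<zeta> j \<omega>) B t =
    (\<lambda>\<omega>. simple_integral n \<tau> \<xi> B t \<omega> - simple_integral n \<tau> \<zeta> B t \<omega>)"
  by (rule ext) (simp add: simple_integral_def left_diff_distrib sum_subtractf)

text \<open>At the final index \<open>n * N\<close> of a grid with \<open>n\<close> intervals the
  fraction is 0, so the meaningless value \<open>\<tau> (Suc n)\<close> beyond the grid has no
  effect.\<close>

definition refine_grid :: "nat \<Rightarrow> (nat \<Rightarrow> real) \<Rightarrow> nat \<Rightarrow> real" where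
  "refine_grid N \<tau> l = \<tau> (l div N) + real (l mod N) / real N * (\<tau> (Suc (l div N)) - \<tau> (l div N))"

lemma refine_grid_eq:
  assumes "0 < N" "i \<le> N"
  shows "refine_grid N \<tau> (j * N + i) = \<tau> j + real i / real N * (\<tau> (Suc j) - \<tau> j)"
proof (cases "i = N")
  case True
  \<comment> \<open>The last point of coarse interval \<open>j\<close> is computed as the first
    point of interval \<open>Suc j\<close>.\<close>
  have "j * N + N = Suc j * N" by simp
  then show ?thesis using True assms by (simp add: refine_grid_def del: mult_Suc)
next
  case False
  then have "i < N" using assms by simp
  then have "(j * N + i) div N = j" "(j * N + i) mod N = i" by auto
  then show ?thesis by (simp add: refine_grid_def)
qed

lemma refine_grid_mult: "0 < N \<Longrightarrow> refine_grid N \<tau> (j * N) = \<tau> j"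
  using refine_grid_eq[of N 0 \<tau> j] by simp

lemma refine_grid_step:
  assumes "0 < N"
  shows "refine_grid N \<tau> (Suc l) - refine_grid N \<tau> l = (\<tau> (Suc (l div N)) - \<tau> (l div N)) / real N"
proof -
  let ?j = "l div N" and ?i = "l mod N"
  have l: "l = ?j * N + ?i" "Suc l = ?j * N + Suc ?i" by simp_all
  have i: "?i \<le> N" "Suc ?i \<le> N" using assms by (auto simp: Suc_leI less_imp_le)
  have "refine_grid N \<tau> l = \<tau> ?j + real ?i / real N * (\<tau> (Suc ?j) - \<tau> ?j)"
    using refine_grid_eq[OF assms i(1), of \<tau> ?j] by simp
  moreover have "refine_grid N \<tau> (Suc l) = \<tau> ?j + real (Suc ?i) / real N * (\<tau> (Suc ?j) - \<tau> ?j)"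
    by (subst l(2)) (rule refine_grid_eq[OF assms i(2)])
  ultimately show ?thesis using assms by (simp add: field_simps)
qed

context wiener_space
begin

lemma measure_timeM: "measure timeM (space timeM) = T"
proof -
  have "emeasure timeM (space timeM) = emeasure lborel {0..T}"
    unfolding space_timeM unfolding timeM_def by (subst emeasure_restrict_space) auto
  then show ?thesis using T_pos by (simp add: measure_def)
qed

text \<open>The lower bound on \<open>\<rho>\<close> already makes it tend to infinity. This suits
  an index that is chosen separately for each \<open>c\<close>, with no monotonicity built
  in.\<close>

lemma conv_in_prob_subseq:
  assumes "conv_in_prob M X Y" "\<And>c. c \<le> \<rho> c"
  shows "conv_in_prob M (\<lambda>c. X (\<rho> c)) Y"
  unfolding conv_in_prob_def
proof (intro allI impI)
  fix \<epsilon> :: real assume e: "0 < \<epsilon>"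
  have "filterlim \<rho> at_top sequentially"
    by (rule filterlim_at_top_mono[OF filterlim_ident]) (simp add: assms(2))
  from filterlim_compose[OF assms(1)[unfolded conv_in_prob_def, rule_format, OF e] this]
  show "(\<lambda>c. prob {\<omega> \<in> space M. \<epsilon> < \<bar>X (\<rho> c) \<omega> - Y \<omega>\<bar>}) \<longlonglongrightarrow> 0" .
qed

lemma conv_in_prob_AE:
  assumes g: "\<And>r. g r \<in> borel_measurable M" and lim: "AE \<omega> in M. (\<lambda>r. g r \<omega>) \<longlonglongrightarrow> 0"
  shows "conv_in_prob M g (\<lambda>_. 0)"
  unfolding conv_in_prob_def
proof (intro allI impI)
  fix \<epsilon> :: real assume e: "0 < \<epsilon>"
  let ?A = "\<lambda>r. {\<omega> \<in> space M. \<epsilon> < \<bar>g r \<omega> - 0\<bar>}"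
  have A: "?A r \<in> events" for r using g[of r] by measurable
  have "(\<lambda>r. \<integral>\<omega>. indicator (?A r) \<omega> \<partial>M) \<longlonglongrightarrow> (\<integral>\<omega>. (0::real) \<partial>M)"
  proof (rule integral_dominated_convergence[where w="\<lambda>_. 1"])
    show "(\<lambda>\<omega>. indicator (?A r) \<omega> :: real) \<in> borel_measurable M" for r
      using A by (rule borel_measurable_indicator)
    show "AE \<omega> in M. (\<lambda>r. indicator (?A r) \<omega> :: real) \<longlonglongrightarrow> 0"
      using lim
    proof (rule eventually_mono)
      fix \<omega> assume "(\<lambda>r. g r \<omega>) \<longlonglongrightarrow> 0"
      then have "eventually (\<lambda>r. \<bar>g r \<omega>\<bar> < \<epsilon>) sequentially"
        using e by (auto dest: tendstoD)
      then have "eventually (\<lambda>r. indicator (?A r) \<omega> = (0::real)) sequentially"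
        by (rule eventually_mono) (simp add: indicator_def)
      then show "(\<lambda>r. indicator (?A r) \<omega> :: real) \<longlonglongrightarrow> 0" by (rule tendsto_eventually)
    qed
  qed (auto simp: indicator_def)
  then show "(\<lambda>r. prob (?A r)) \<longlonglongrightarrow> 0"
    using A by (simp add: Int_absorb2)
qed

lemma sq_integrable_prodM_section:
  assumes "sq_integrable prodM f"
  shows "AE \<omega> in M. integrable timeM (\<lambda>s. (f (s, \<omega>))\<^sup>2)"
  using integral_prodM(5)[of "\<lambda>s \<omega>. (f (s, \<omega>))\<^sup>2"] sq_integrableD(2)[OF assms] by simp

lemma sq_integrable_prodM_expectation:
  assumes "sq_integrable prodM f"
  shows "(\<integral>x. (f x)\<^sup>2 \<partial>prodM) = (\<integral>\<omega>. \<integral>s. (f (s, \<omega>))\<^sup>2 \<partial>timeM \<partial>M)"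
    "integrable M (\<lambda>\<omega>. \<integral>s. (f (s, \<omega>))\<^sup>2 \<partial>timeM)"
  using integral_prodM(2,4)[of "\<lambda>s \<omega>. (f (s, \<omega>))\<^sup>2"] sq_integrableD(2)[OF assms] by simp_all

lemma simple_process_map:
  assumes S: "simple_process M \<F> T n \<tau> \<xi>" and S': "simple_process M \<F> T n \<tau> \<zeta>"
  shows "simple_process M \<F> T n \<tau> (\<lambda>j \<omega>. clip c (\<xi> j \<omega>))"
    and "simple_process M \<F> T n \<tau> (\<lambda>j \<omega>. \<xi> j \<omega> - \<zeta> j \<omega>)"
    and "simple_process M \<F> T n \<tau> (\<lambda>j \<omega>. \<xi> j \<omega> * \<zeta> j \<omega>)"
proof -
  note a = simple_processD[OF S] and b = simple_processD[OF S']
  have m: "\<xi> j \<in> borel_measurable (\<F> (\<tau> j))" "\<zeta> j \<in> borel_measurable (\<F> (\<tau> j))" if "j < n" for j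
    using a(4)[OF that] b(4)[OF that] by (simp_all add: bounded_rv_def)
  obtain C where C: "\<forall>j<n. \<forall>\<omega>\<in>space M. \<bar>\<xi> j \<omega>\<bar> \<le> C" using simple_process_bounded[OF S] by blast
  obtain D where D: "\<forall>j<n. \<forall>\<omega>\<in>space M. \<bar>\<zeta> j \<omega>\<bar> \<le> D" using simple_process_bounded[OF S'] by blast
  have c: "\<bar>clip c x\<bar> \<le> \<bar>c\<bar>" for x by (auto simp: clip_def)
  show "simple_process M \<F> T n \<tau> (\<lambda>j \<omega>. clip c (\<xi> j \<omega>))"
    unfolding simple_process_def
    by (intro conjI allI impI a(1-3) borel_measurable_clip m(1) exI[of _ "\<bar>c\<bar>"] ballI c)
  have "\<forall>\<omega>\<in>space M. \<bar>\<xi> j \<omega> - \<zeta> j \<omega>\<bar> \<le> C + D" if "j < n" for j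
  proof
    fix \<omega> assume "\<omega> \<in> space M"
    then have "\<bar>\<xi> j \<omega>\<bar> \<le> C" "\<bar>\<zeta> j \<omega>\<bar> \<le> D" using C D that by auto
    then show "\<bar>\<xi> j \<omega> - \<zeta> j \<omega>\<bar> \<le> C + D" by linarith
  qed
  then show "simple_process M \<F> T n \<tau> (\<lambda>j \<omega>. \<xi> j \<omega> - \<zeta> j \<omega>)"
    unfolding simple_process_def
    by (intro conjI allI impI a(1-3) borel_measurable_diff m exI[of _ "C + D"]) auto
  show "simple_process M \<F> T n \<tau> (\<lambda>j \<omega>. \<xi> j \<omega> * \<zeta> j \<omega>)"
    unfolding simple_process_def
  proof (intro conjI allI impI a(1-3))
    fix j assume "j < n"
    from bounded_rv_mult[OF a(4)[OF this] b(4)[OF this]]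
    show "(\<lambda>\<omega>. \<xi> j \<omega> * \<zeta> j \<omega>) \<in> borel_measurable (\<F> (\<tau> j))" "\<exists>C. \<forall>\<omega>\<in>space M. \<bar>\<xi> j \<omega> * \<zeta> j \<omega>\<bar> \<le> C"
      by (simp_all add: bounded_rv_def)
  qed
qed

lemma time_integral_sq_diff_le:
  assumes f: "sq_integrable prodM f" and g: "sq_integrable prodM g" and h: "h \<in> borel_measurable prodM"
    and le: "\<And>x. (h x)\<^sup>2 \<le> 2 * (f x)\<^sup>2 + 2 * (g x)\<^sup>2"
  shows "AE \<omega> in M. (\<integral>s. (h (s, \<omega>))\<^sup>2 \<partial>timeM) \<le>
    2 * (\<integral>s. (f (s, \<omega>))\<^sup>2 \<partial>timeM) + 2 * (\<integral>s. (g (s, \<omega>))\<^sup>2 \<partial>timeM)"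
  using sq_integrable_prodM_section[OF f] sq_integrable_prodM_section[OF g]
proof eventually_elim
  fix \<omega> assume i: "integrable timeM (\<lambda>s. (f (s, \<omega>))\<^sup>2)" "integrable timeM (\<lambda>s. (g (s, \<omega>))\<^sup>2)"
  have "(\<integral>s. (h (s, \<omega>))\<^sup>2 \<partial>timeM) \<le> (\<integral>s. 2 * (f (s, \<omega>))\<^sup>2 + 2 * (g (s, \<omega>))\<^sup>2 \<partial>timeM)"
    by (rule integral_mono') (use i le in auto)
  then show "(\<integral>s. (h (s, \<omega>))\<^sup>2 \<partial>timeM) \<le>
    2 * (\<integral>s. (f (s, \<omega>))\<^sup>2 \<partial>timeM) + 2 * (\<integral>s. (g (s, \<omega>))\<^sup>2 \<partial>timeM)"
    using i by simp
qed

text \<open>Clipping at level \<open>c\<close> turns the convergence of the integrands in probability into convergence in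
  \<open>L\<^sup>2\<close>; the index \<open>\<rho> c\<close> is chosen after \<open>c\<close>, and the tail bound above controls the change of the
  integrals.\<close>

lemma simple_L2_approx:
  assumes S: "\<And>r. simple_process M \<F> T (n r) (\<tau> r) (\<xi> r)"
    and psi: "sq_integrable prodM \<psi>"
    and conv: "conv_in_prob M (\<lambda>r \<omega>. \<integral>s. (simple_value (n r) (\<tau> r) (\<xi> r) s \<omega> - \<psi> (s, \<omega>))\<^sup>2 \<partial>timeM) (\<lambda>_. 0)"
  shows "\<exists>\<rho> \<zeta>. (\<forall>c. c \<le> \<rho> c) \<and> (\<forall>c. simple_process M \<F> T (n (\<rho> c)) (\<tau> (\<rho> c)) (\<zeta> c)) \<and>
    L2_conv prodM (\<lambda>c. sv (n (\<rho> c)) (\<tau> (\<rho> c)) (\<zeta> c)) \<psi> \<and>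
    (\<forall>k. \<forall>t\<in>{0..T}. conv_in_prob M
      (\<lambda>c \<omega>. simple_integral (n (\<rho> c)) (\<tau> (\<rho> c)) (\<xi> (\<rho> c)) (\<beta> k) t \<omega>
         - simple_integral (n (\<rho> c)) (\<tau> (\<rho> c)) (\<zeta> c) (\<beta> k) t \<omega>) (\<lambda>_. 0))"
proof -
  let ?sv = "\<lambda>r. sv (n r) (\<tau> r) (\<xi> r)"
  define z where "z c r j \<omega> = clip (real c) (\<xi> r j \<omega>)" for c r j \<omega>
  let ?z = "\<lambda>c r. sv (n r) (\<tau> r) (z c r)"
  have Sz: "simple_process M \<F> T (n r) (\<tau> r) (z c r)" for c r
    using simple_process_map(1)[OF S S, of r "real c"] by (simp add: z_def[abs_def])
  have svz: "?z c r x = clip (real c) (?sv r x)" for c r x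
    unfolding sv_def z_def[abs_def]
    by (rule simple_value_map2[where h="\<lambda>x y. clip (real c) x", OF simple_processD(7)[OF S]]) (simp_all add: clip_0)
  have pm: "\<psi> \<in> borel_measurable prodM" using psi by (rule sq_integrableD)
  have psic: "sq_integrable prodM (\<lambda>x. clip (real c) (\<psi> x))" for c
    by (rule sq_integrable_bound[OF psi borel_measurable_clip[OF pm]]) (simp add: clip_le_abs)
  have sqD: "sq_integrable prodM (\<lambda>x. ?sv r x - \<psi> x)" for r
    by (rule sq_integrable_diff[OF sq_integrable_sv[OF S] psi])
  have sqE: "sq_integrable prodM (\<lambda>x. ?z c r x - clip (real c) (\<psi> x))" for c r
    by (rule sq_integrable_diff[OF sq_integrable_sv[OF Sz] psic])
  let ?Z = "\<lambda>r \<omega>. \<integral>s. (?sv r (s, \<omega>) - \<psi> (s, \<omega>))\<^sup>2 \<partial>timeM"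
  let ?W = "\<lambda>c r. \<integral>x. (?z c r x - clip (real c) (\<psi> x))\<^sup>2 \<partial>prodM"
  have convZ: "conv_in_prob M ?Z (\<lambda>_. 0)" using conv by (simp add: sv_def)
  have mZ: "?Z r \<in> borel_measurable M" for r
    using sq_integrable_prodM_expectation(2)[OF sqD] by simp
  \<comment> \<open>For fixed \<open>c\<close>, clipping is 1-Lipschitz, so the clipped errors are
    dominated by the unclipped ones and vanish in probability; being bounded by
    \<open>(2 * real c)\<^sup>2 * T\<close>, they vanish in mean as well.\<close>
  have W: "(\<lambda>r. ?W c r) \<longlonglongrightarrow> 0" for c
  proof -
    let ?g = "\<lambda>r \<omega>. \<integral>s. (?z c r (s, \<omega>) - clip (real c) (\<psi> (s, \<omega>)))\<^sup>2 \<partial>timeM"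
    have "(\<lambda>r. expectation (?g r)) \<longlonglongrightarrow> 0"
    proof (rule expectation_conv_bounded)
      show "?g r \<in> borel_measurable M" for r
        using sq_integrable_prodM_expectation(2)[OF sqE] by simp
      show "0 \<le> ?g r \<omega>" for r \<omega> by simp
      show "?g r \<omega> \<le> (2 * real c)\<^sup>2 * T" for r \<omega>
      proof -
        have "?g r \<omega> \<le> (\<integral>s. (2 * real c)\<^sup>2 \<partial>timeM)"
        proof (rule integral_mono')
          fix s
          have "\<bar>clip (real c) x - clip (real c) y\<bar> \<le> \<bar>2 * real c\<bar>" for x y
            using clip_bound[of "real c" x] clip_bound[of "real c" y] by simp
          then show "(?z c r (s, \<omega>) - clip (real c) (\<psi> (s, \<omega>)))\<^sup>2 \<le> (2 * real c)\<^sup>2"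
            unfolding svz by (rule sq_le_sq_of_abs_le)
        qed auto
        then show ?thesis by (simp add: measure_timeM mult.commute)
      qed
      show "conv_in_prob M ?g (\<lambda>_. 0)"
      proof (rule conv_in_prob_mono[OF convZ mZ])
        fix r
        show "AE \<omega> in M. \<bar>?g r \<omega>\<bar> \<le> \<bar>?Z r \<omega>\<bar>"
          using sq_integrable_prodM_section[OF sqD[of r]]
        proof (rule eventually_mono)
          fix \<omega> assume "integrable timeM (\<lambda>s. (?sv r (s, \<omega>) - \<psi> (s, \<omega>))\<^sup>2)"
          then have "?g r \<omega> \<le> ?Z r \<omega>"
            by (rule integral_mono') (auto simp: svz intro: sq_le_sq_of_abs_le clip_lipschitz)
          then show "\<bar>?g r \<omega>\<bar> \<le> \<bar>?Z r \<omega>\<bar>" by simp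
        qed
      qed
    qed
    moreover have "?W c r = expectation (?g r)" for r
      by (rule sq_integrable_prodM_expectation(1)[OF sqE])
    ultimately show ?thesis by simp
  qed
  \<comment> \<open>Diagonal choice: the index is taken after \<open>c\<close>, and at least
    \<open>c\<close>, so that it tends to infinity while the error does not exceed a null
    sequence.\<close>
  have "\<exists>r\<ge>c. ?W c r < 1 / real (Suc c)" for c
  proof -
    obtain r0 where "\<forall>r\<ge>r0. ?W c r < 1 / real (Suc c)"
      using tendsto_0D[OF W[of c], of "1 / real (Suc c)"] by auto
    then show ?thesis by (intro exI[of _ "max c r0"]) auto
  qed
  then obtain \<rho> where rho: "\<And>c. c \<le> \<rho> c" "\<And>c. ?W c (\<rho> c) < 1 / real (Suc c)" by metis
  define \<zeta> where "\<zeta> c = z c (\<rho> c)" for c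
  have Szeta: "simple_process M \<F> T (n (\<rho> c)) (\<tau> (\<rho> c)) (\<zeta> c)" for c
    unfolding \<zeta>_def by (rule Sz)
  let ?y = "\<lambda>c. sv (n (\<rho> c)) (\<tau> (\<rho> c)) (\<zeta> c)"
  let ?E = "\<lambda>c. \<integral>x. (?y c x - \<psi> x)\<^sup>2 \<partial>prodM"
  have sqF: "sq_integrable prodM (\<lambda>x. clip (real c) (\<psi> x) - \<psi> x)" for c
    by (rule sq_integrable_diff[OF psic psi])
  have sqY: "sq_integrable prodM (\<lambda>x. ?y c x - \<psi> x)" for c
    by (rule sq_integrable_diff[OF sq_integrable_sv[OF Szeta] psi])
  have W'0: "(\<lambda>c. ?W c (\<rho> c)) \<longlonglongrightarrow> 0"
  proof (rule nonneg_tendsto_0)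
    show "?W c (\<rho> c) \<le> 1 / real (Suc c)" for c using rho(2)[of c] by simp
    show "(\<lambda>c. 1 / real (Suc c)) \<longlonglongrightarrow> 0" using LIMSEQ_inverse_real_of_nat by (simp add: inverse_eq_divide)
  qed simp
  \<comment> \<open>Clipping the limit \<open>\<psi>\<close> itself costs at most its own absolute
    value and nothing once \<open>c\<close> exceeds it, so dominated convergence applies.\<close>
  have dom: "(\<lambda>c. \<integral>x. (clip (real c) (\<psi> x) - \<psi> x)\<^sup>2 \<partial>prodM) \<longlonglongrightarrow> (\<integral>x. 0 \<partial>prodM)"
  proof (rule integral_dominated_convergence[where w="\<lambda>x. (\<psi> x)\<^sup>2"])
    show "integrable prodM (\<lambda>x. (\<psi> x)\<^sup>2)" using psi by (rule sq_integrableD)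
    show "(\<lambda>x. (clip (real c) (\<psi> x) - \<psi> x)\<^sup>2) \<in> borel_measurable prodM" for c
      by (intro borel_measurable_power borel_measurable_diff borel_measurable_clip pm)
    show "AE x in prodM. norm ((clip (real c) (\<psi> x) - \<psi> x)\<^sup>2) \<le> (\<psi> x)\<^sup>2" for c
      using sq_le_sq_of_abs_le[OF clip_diff_le[of "real c"]] by simp
    show "AE x in prodM. (\<lambda>c. (clip (real c) (\<psi> x) - \<psi> x)\<^sup>2) \<longlonglongrightarrow> 0"
    proof (rule AE_I2)
      fix x
      have "eventually (\<lambda>c. (clip (real c) (\<psi> x) - \<psi> x)\<^sup>2 = 0) sequentially"
        using eventually_ge_at_top[of "nat \<lceil>\<bar>\<psi> x\<bar>\<rceil>"]
        by (rule eventually_mono) (simp add: clip_id nat_ceiling_le_eq)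
      then show "(\<lambda>c. (clip (real c) (\<psi> x) - \<psi> x)\<^sup>2) \<longlonglongrightarrow> 0" by (rule tendsto_eventually)
    qed
  qed simp
  have Ele: "?E c \<le> 2 * ?W c (\<rho> c) + 2 * (\<integral>x. (clip (real c) (\<psi> x) - \<psi> x)\<^sup>2 \<partial>prodM)" for c
  proof -
    have "?E c \<le> (\<integral>x. 2 * (?y c x - clip (real c) (\<psi> x))\<^sup>2 + 2 * (clip (real c) (\<psi> x) - \<psi> x)\<^sup>2 \<partial>prodM)"
      by (rule integral_mono')
         (use sq_integrableD(2)[OF sqE] sq_integrableD(2)[OF sqF] in \<open>auto simp: \<zeta>_def intro: sq_diff_le\<close>)
    also have "\<dots> = 2 * ?W c (\<rho> c) + 2 * (\<integral>x. (clip (real c) (\<psi> x) - \<psi> x)\<^sup>2 \<partial>prodM)"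
      using sq_integrableD(2)[OF sqE] sq_integrableD(2)[OF sqF] by (simp add: \<zeta>_def)
    finally show ?thesis .
  qed
  have E0: "?E \<longlonglongrightarrow> 0"
  proof (rule nonneg_tendsto_0[OF _ Ele])
    show "(\<lambda>c. 2 * ?W c (\<rho> c) + 2 * (\<integral>x. (clip (real c) (\<psi> x) - \<psi> x)\<^sup>2 \<partial>prodM)) \<longlonglongrightarrow> 0"
      using tendsto_add[OF tendsto_mult[OF tendsto_const[of 2] W'0] tendsto_mult[OF tendsto_const[of 2] dom]] by simp
  qed simp
  have L2: "L2_conv prodM ?y \<psi>"
    unfolding L2_conv_def using sq_integrable_sv[OF Szeta] psi E0 by blast
  \<comment> \<open>Unclipped and clipped integrands both approach \<open>\<psi>\<close>, the former
    in probability and the latter in mean square. Hence their difference is small in probability,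
    and the tail bound carries this over to the integrals.\<close>
  have "conv_in_prob M (\<lambda>c \<omega>. simple_integral (n (\<rho> c)) (\<tau> (\<rho> c)) (\<xi> (\<rho> c)) (\<beta> k) t \<omega>
         - simple_integral (n (\<rho> c)) (\<tau> (\<rho> c)) (\<zeta> c) (\<beta> k) t \<omega>) (\<lambda>_. 0)" if t: "t \<in> {0..T}" for k t
  proof -
    let ?d = "\<lambda>c j \<omega>. \<xi> (\<rho> c) j \<omega> - \<zeta> c j \<omega>"
    have Sd: "simple_process M \<F> T (n (\<rho> c)) (\<tau> (\<rho> c)) (?d c)" for c
      by (rule simple_process_map(2)[OF S Szeta])
    have svd: "simple_value (n (\<rho> c)) (\<tau> (\<rho> c)) (?d c) s \<omega> = ?sv (\<rho> c) (s, \<omega>) - ?y c (s, \<omega>)" for c s \<omega>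
      unfolding sv_def fst_conv snd_conv
      by (rule simple_value_map2[where h="\<lambda>x y. x - y", OF simple_processD(7)[OF S]]) simp_all
    let ?Y = "\<lambda>c \<omega>. \<integral>s. (?y c (s, \<omega>) - \<psi> (s, \<omega>))\<^sup>2 \<partial>timeM"
    have mY: "integrable M (?Y c)" "expectation (?Y c) = ?E c" for c
      using sq_integrable_prodM_expectation[OF sqY[of c]] by simp_all
    have convY: "conv_in_prob M ?Y (\<lambda>_. 0)"
      by (rule conv_in_prob_L1) (use mY E0 in auto)
    have convZ': "conv_in_prob M (\<lambda>c. ?Z (\<rho> c)) (\<lambda>_. 0)" by (rule conv_in_prob_subseq[OF convZ rho(1)])
    note m1 = mZ borel_measurable_integrable[OF mY(1)]
    \<comment> \<open>The constants 2 of the square estimate are spelled out as repeated summands,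
      so that the rule for sums covers them.\<close>
    have "conv_in_prob M (\<lambda>c \<omega>. (?Z (\<rho> c) \<omega> + ?Z (\<rho> c) \<omega>) + (?Y c \<omega> + ?Y c \<omega>)) (\<lambda>_. 0)"
      by (intro conv_in_prob_add convY convZ' borel_measurable_add m1)
    then have "conv_in_prob M (\<lambda>c \<omega>. \<integral>s. (simple_value (n (\<rho> c)) (\<tau> (\<rho> c)) (?d c) s \<omega>)\<^sup>2 \<partial>timeM) (\<lambda>_. 0)"
    proof (rule conv_in_prob_mono)
      show "(\<lambda>\<omega>. (?Z (\<rho> c) \<omega> + ?Z (\<rho> c) \<omega>) + (?Y c \<omega> + ?Y c \<omega>)) \<in> borel_measurable M" for c
        by (intro borel_measurable_add m1)
      fix c
      have "AE \<omega> in M. (\<integral>s. ((\<lambda>x. ?sv (\<rho> c) x - ?y c x) (s, \<omega>))\<^sup>2 \<partial>timeM) \<le>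
          2 * (\<integral>s. ((\<lambda>x. ?sv (\<rho> c) x - \<psi> x) (s, \<omega>))\<^sup>2 \<partial>timeM) + 2 * (\<integral>s. ((\<lambda>x. ?y c x - \<psi> x) (s, \<omega>))\<^sup>2 \<partial>timeM)"
      proof (rule time_integral_sq_diff_le[OF sqD sqY])
        show "(\<lambda>x. ?sv (\<rho> c) x - ?y c x) \<in> borel_measurable prodM"
          by (intro borel_measurable_diff borel_measurable_sv S Szeta)
        show "(?sv (\<rho> c) x - ?y c x)\<^sup>2 \<le> 2 * (?sv (\<rho> c) x - \<psi> x)\<^sup>2 + 2 * (?y c x - \<psi> x)\<^sup>2" for x
          using sq_diff_le[of "?sv (\<rho> c) x" "?y c x" "\<psi> x"] by (simp add: power2_commute)
      qed
      then show "AE \<omega> in M. \<bar>\<integral>s. (simple_value (n (\<rho> c)) (\<tau> (\<rho> c)) (?d c) s \<omega>)\<^sup>2 \<partial>timeM\<bar> \<le>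
         \<bar>(?Z (\<rho> c) \<omega> + ?Z (\<rho> c) \<omega>) + (?Y c \<omega> + ?Y c \<omega>)\<bar>"
        by (rule eventually_mono) (simp add: svd)
    qed
    from simple_integral_conv_0[OF Sd t this]
    have "conv_in_prob M (\<lambda>c. simple_integral (n (\<rho> c)) (\<tau> (\<rho> c)) (?d c) (\<beta> k) t) (\<lambda>_. 0)" .
    then show ?thesis unfolding simple_integral_diff .
  qed
  then show ?thesis using rho(1) Szeta L2 by blast
qed

lemma simple_process_refine:
  assumes S: "simple_process M \<F> T n \<tau> \<xi>" and N: "0 < N"
  defines "\<tau>' \<equiv> refine_grid N \<tau>" and "\<xi>' \<equiv> \<lambda>l. \<xi> (l div N)"
  shows "simple_process M \<F> T (n * N) \<tau>' \<xi>'"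
    and "simple_value (n * N) \<tau>' \<xi>' s \<omega> = simple_value n \<tau> \<xi> s \<omega>"
    and "simple_integral (n * N) \<tau>' \<xi>' B t \<omega> = simple_integral n \<tau> \<xi> B t \<omega>"
    and "l < n * N \<Longrightarrow> \<tau>' (Suc l) - \<tau>' l \<le> T / real N"
proof -
  note a = simple_processD[OF S]
  have dl: "l div N < n" if "l < n * N" for l using that by (simp add: less_mult_imp_div_less)
  have step: "\<tau>' l < \<tau>' (Suc l)" if "l < n * N" for l
  proof -
    have "(\<tau> (Suc (l div N)) - \<tau> (l div N)) / real N > 0" using a(3)[OF dl[OF that]] N by simp
    then show ?thesis using refine_grid_step[OF N, of \<tau> l] unfolding \<tau>'_def by linarith
  qed
  show "l < n * N \<Longrightarrow> \<tau>' (Suc l) - \<tau>' l \<le> T / real N"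
    unfolding \<tau>'_def refine_grid_step[OF N]
    using a(6)[of "Suc (l div N)"] a(5)[of "l div N"] dl[of l] N by (intro divide_right_mono) auto
  have le: "\<tau> (l div N) \<le> \<tau>' l" if "l < n * N" for l
    using a(3)[OF dl[OF that]] unfolding \<tau>'_def refine_grid_def by simp
  show "simple_process M \<F> T (n * N) \<tau>' \<xi>'"
    unfolding simple_process_def
  proof (intro conjI allI impI)
    show "\<tau>' 0 = 0" "\<tau>' (n * N) = T"
      using refine_grid_mult[OF N, of \<tau> 0] refine_grid_mult[OF N, of \<tau> n] a(1,2) by (simp_all add: \<tau>'_def)
    fix l assume l: "l < n * N"
    show "\<tau>' l < \<tau>' (Suc l)" by (rule step[OF l])
    note b = a(4)[OF dl[OF l]]
    show "\<xi>' l \<in> borel_measurable (\<F> (\<tau>' l))"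
      unfolding \<xi>'_def
      by (rule borel_measurable_filtration_mono[OF _ le[OF l]])
         (use b a(5)[of "l div N"] dl[OF l] in \<open>simp_all add: bounded_rv_def\<close>)
    show "\<exists>C. \<forall>\<omega>\<in>space M. \<bar>\<xi>' l \<omega>\<bar> \<le> C" using b by (simp add: bounded_rv_def \<xi>'_def)
  qed
  have g: "\<tau>' (j * N) = \<tau> j" for j unfolding \<tau>'_def by (rule refine_grid_mult[OF N])
  show "simple_integral (n * N) \<tau>' \<xi>' B t \<omega> = simple_integral n \<tau> \<xi> B t \<omega>"
    using sum_refine[OF N, where n=n and x="\<lambda>j. \<xi> j \<omega>" and b="\<lambda>l. B (min t (\<tau>' l)) \<omega>"]
    by (simp only: simple_integral_def \<xi>'_def g)
  \<comment> \<open>Indicators of half-open intervals become increments of negated half-line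
    indicators, the form in which \<open>sum_refine\<close> telescopes.\<close>
  have ind: "indicator {x<..y} s = (- indicator {y<..} s) - (- indicator {x<..} s :: real)" if "x \<le> y" for x y
    using that by (auto simp: indicator_def)
  have "simple_value (n * N) \<tau>' \<xi>' s \<omega> =
      (\<Sum>l<n * N. \<xi> (l div N) \<omega> * ((- indicator {\<tau>' (Suc l)<..} s) - (- indicator {\<tau>' l<..} s)))"
    unfolding simple_value_def \<xi>'_def
    by (rule sum.cong[OF refl]) (use ind step in \<open>simp add: less_imp_le\<close>)
  also have "\<dots> = (\<Sum>j<n. \<xi> j \<omega> * ((- indicator {\<tau>' (Suc j * N)<..} s) - (- indicator {\<tau>' (j * N)<..} s)))"
    by (rule sum_refine[OF N])
  also have "\<dots> = simple_value n \<tau> \<xi> s \<omega>"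
    unfolding simple_value_def g
    by (rule sum.cong[OF refl]) (use ind a(3) in \<open>simp add: less_imp_le\<close>)
  finally show "simple_value (n * N) \<tau>' \<xi>' s \<omega> = simple_value n \<tau> \<xi> s \<omega>" .
qed

end

section \<open>Truncation by decreasing events\<close>

lemma simple_process_cover:
  fixes \<tau> :: "nat \<Rightarrow> real"
  assumes "\<tau> 0 < s" "s \<le> \<tau> n"
  shows "\<exists>j<n. s \<in> {\<tau> j<..\<tau> (Suc j)}"
proof -
  define k where "k = (LEAST k. s \<le> \<tau> k)"
  have k: "s \<le> \<tau> k" "k \<le> n" using assms(2) LeastI[of "\<lambda>k. s \<le> \<tau> k"] Least_le[of "\<lambda>k. s \<le> \<tau> k"]
    by (auto simp: k_def)
  have "k \<noteq> 0" using k(1) assms(1) by (cases "k = 0") auto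
  then obtain j where j: "k = Suc j" by (cases k) auto
  have "\<not> s \<le> \<tau> j" using not_less_Least[of j "\<lambda>k. s \<le> \<tau> k"] j by (simp add: k_def)
  then show ?thesis using k j by (intro exI[of _ j]) auto
qed

context wiener_space
begin

lemma measurable_prodM_progressive:
  assumes "(\<lambda>(s, \<omega>). \<phi> s \<omega>) \<in> borel_measurable (restrict_space borel {0..T} \<Otimes>\<^sub>M \<F> T)"
  shows "(\<lambda>x. \<phi> (fst x) (snd x) :: real) \<in> borel_measurable prodM"
proof -
  have 1: "fst \<in> prodM \<rightarrow>\<^sub>M restrict_space borel {0..T}"
  proof -
    have "fst \<in> prodM \<rightarrow>\<^sub>M timeM" unfolding prodM_def by (rule measurable_fst)
    moreover have "sets timeM = sets (restrict_space borel {0..T})"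
      unfolding timeM_def by (rule sets_restrict_space_cong) simp
    ultimately show ?thesis by (subst measurable_cong_sets[OF refl, of _ timeM]) simp_all
  qed
  have 2: "snd \<in> prodM \<rightarrow>\<^sub>M \<F> T"
  proof (rule measurableI)
    have T0: "0 \<le> T" using T_pos by simp
    show "snd x \<in> space (\<F> T)" if "x \<in> space prodM" for x
      unfolding space_filtration[OF T0] using that unfolding space_prodM by auto
    fix B assume "B \<in> sets (\<F> T)"
    then have "B \<in> sets M" by (rule subsetD[OF sets_filtration[OF T0]])
    have "snd \<in> prodM \<rightarrow>\<^sub>M M" unfolding prodM_def by (rule measurable_snd)
    from measurable_sets[OF this \<open>B \<in> sets M\<close>] show "snd -` B \<inter> space prodM \<in> sets prodM" .
  qed
  have "(\<lambda>x. (fst x, snd x)) \<in> prodM \<rightarrow>\<^sub>M restrict_space borel {0..T} \<Otimes>\<^sub>M \<F> T"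
    by (rule measurable_Pair[OF 1 2])
  from measurable_compose[OF this assms] show ?thesis by (simp add: case_prod_beta')
qed

definition ind :: "(real \<Rightarrow> 'w set) \<Rightarrow> real \<times> 'w \<Rightarrow> real" where
  "ind A x = indicator (A (fst x)) (snd x)"

text \<open>A stand-in for a stopping time: \<open>A s\<close> plays the part of the event that it
  has not occurred before s, and \<open>ind A\<close> that of the indicator of the corresponding
  stochastic interval. Joint measurability is a clause of its own, as it does not follow from
  measurability at each single time.\<close>

definition decreasing_events :: "(real \<Rightarrow> 'w set) \<Rightarrow> bool" where
  "decreasing_events A \<longleftrightarrow> (\<forall>s\<in>{0..T}. A s \<in> sets (\<F> s)) \<and> (\<forall>s t. 0 \<le> s \<longrightarrow> s \<le> t \<longrightarrow> t \<le> T \<longrightarrow> A t \<subseteq> A s) \<and>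
    ind A \<in> borel_measurable prodM"

lemma decreasing_eventsD:
  assumes "decreasing_events A"
  shows "\<And>s. s \<in> {0..T} \<Longrightarrow> A s \<in> sets (\<F> s)" "\<And>s t. 0 \<le> s \<Longrightarrow> s \<le> t \<Longrightarrow> t \<le> T \<Longrightarrow> A t \<subseteq> A s"
    "ind A \<in> borel_measurable prodM"
  using assms unfolding decreasing_events_def by blast+

lemma ind_cases: "ind A x = 0 \<or> ind A x = 1"
  by (simp add: ind_def indicator_def)

text \<open>For a fixed sample point, membership in \<open>A s\<close> can only be lost as s grows,
  so it changes at one time at most. Away from that time and from 0, sampling slightly to the left
  eventually gives the right value.\<close>

lemma decreasing_indicator_limit:
  assumes dec: "\<And>s t. 0 \<le> s \<Longrightarrow> s \<le> t \<Longrightarrow> t \<le> T \<Longrightarrow> A t \<subseteq> A s"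
    and p: "\<And>s r. s \<in> {0<..T} \<Longrightarrow> \<exists>u\<in>{0..<s}. s - T / real (Suc r) \<le> u \<and> p r s = indicator (A u) \<omega>"
  shows "AE s in timeM. (\<lambda>r. p r s - indicator (A s) \<omega> :: real) \<longlonglongrightarrow> 0"
proof -
  \<comment> \<open>The possible times of loss. Between two of them the sample point would be both
    inside and outside, so there is at most one.\<close>
  define E where "E = {s \<in> {0..T}. (\<forall>u\<in>{0..<s}. \<omega> \<in> A u) \<and> (\<forall>u\<in>{s<..T}. \<omega> \<notin> A u)}"
  have "x = y" if "x \<in> E" "y \<in> E" for x y
  proof -
    have False if "x < y" "x \<in> E" "y \<in> E" for x y
    proof -
      obtain u where "x < u" "u < y" using \<open>x < y\<close> dense by blast
      then have "u \<in> {0..<y}" "u \<in> {x<..T}" using that by (auto simp: E_def)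
      then show False using that(2,3) unfolding E_def by blast
    qed
    then show ?thesis using that by (metis linorder_neqE)
  qed
  then obtain e where e: "E \<subseteq> {e}" by blast
  have "{0, e} \<in> null_sets lborel" by (intro finite_imp_null_set_lborel) simp
  then have "AE s in lborel. s \<notin> {0, e}" by (rule AE_not_in)
  then have ae: "AE s in timeM. s \<noteq> 0 \<and> s \<noteq> e"
    unfolding timeM_def by (subst AE_restrict_space_iff) auto
  have "AE s in timeM. s \<in> space timeM" by (rule AE_I2)
  with ae show ?thesis
  proof eventually_elim
    fix s assume "s \<noteq> 0 \<and> s \<noteq> e" "s \<in> space timeM"
    then have s: "s \<in> {0<..T}" "s \<noteq> e" by (auto simp: space_timeM)
    then have "s \<notin> E" using e by auto
    \<comment> \<open>Off the jump, the point is either still inside at some later time, hence at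
      all samples, or outside at some earlier time, which the samples eventually pass.\<close>
    then consider u where "u \<in> {s<..T}" "\<omega> \<in> A u" | u where "u \<in> {0..<s}" "\<omega> \<notin> A u"
      using s by (auto simp: E_def)
    then show "(\<lambda>r. p r s - indicator (A s) \<omega> :: real) \<longlonglongrightarrow> 0"
    proof cases
      case 1
      have "p r s - indicator (A s) \<omega> = 0" for r
      proof -
        obtain v where v: "v \<in> {0..<s}" "p r s = indicator (A v) \<omega>" using p[OF s(1)] by blast
        have "\<omega> \<in> A v" "\<omega> \<in> A s" using dec[of v u] dec[of s u] 1 v s by auto
        then show ?thesis using v by simp
      qed
      then show ?thesis by simp
    next
      case 2
      have "\<omega> \<notin> A s" using dec[of u s] 2 s by auto
      have "(\<lambda>r. T / real (Suc r)) \<longlonglongrightarrow> 0"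
        using tendsto_mult[OF tendsto_const[of T] LIMSEQ_inverse_real_of_nat] by (simp add: divide_inverse)
      then have "eventually (\<lambda>r. T / real (Suc r) < s - u) sequentially"
        using 2 by (intro order_tendstoD(2)[of _ 0]) auto
      then have "eventually (\<lambda>r. p r s - indicator (A s) \<omega> = 0) sequentially"
      proof (rule eventually_mono)
        fix r assume r: "T / real (Suc r) < s - u"
        obtain v where v: "v \<in> {0..<s}" "s - T / real (Suc r) \<le> v" "p r s = indicator (A v) \<omega>" using p[OF s(1)] by blast
        have "u \<le> v" "v \<le> T" using v r s by auto
        then have "A v \<subseteq> A u" using dec[of u v] 2 by auto
        then have "\<omega> \<notin> A v" using 2 by blast
        then show "p r s - indicator (A s) \<omega> = 0" using v \<open>\<omega> \<notin> A s\<close> by simp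
      qed
      then show ?thesis by (rule tendsto_eventually)
    qed
  qed
qed

text \<open>With the left-end indicators \<open>?p\<close> the error splits into \<open>?p\<close>
  times the old error plus \<open>?p - ind A\<close> times \<open>\<phi>\<close>. The first part
  inherits the assumed convergence since \<open>?p\<close> is bounded by 1. The second vanishes
  along almost every path by dominated convergence, because the square of \<open>\<phi>\<close> is
  almost surely integrable in time.\<close>

lemma truncated_conv:
  fixes \<phi> :: "real \<Rightarrow> 'w \<Rightarrow> real"
  assumes A: "decreasing_events A"
    and phi: "(\<lambda>x. \<phi> (fst x) (snd x)) \<in> borel_measurable prodM"
    and phi2: "AE \<omega> in M. integrable timeM (\<lambda>s. (\<phi> s \<omega>)\<^sup>2)"
    and S: "\<And>r. simple_process M \<F> T (n r) (\<tau> r) (\<xi> r)"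
    and mesh: "\<And>r l. l < n r \<Longrightarrow> \<tau> r (Suc l) - \<tau> r l \<le> T / real (Suc r)"
    and conv: "conv_in_prob M (\<lambda>r \<omega>. \<integral>s. (simple_value (n r) (\<tau> r) (\<xi> r) s \<omega> - \<phi> s \<omega>)\<^sup>2 \<partial>timeM) (\<lambda>_. 0)"
  shows "\<And>r. simple_process M \<F> T (n r) (\<tau> r) (\<lambda>l \<omega>. indicator (A (\<tau> r l)) \<omega> * \<xi> r l \<omega>)"
    and "conv_in_prob M (\<lambda>r \<omega>. \<integral>s. (simple_value (n r) (\<tau> r) (\<lambda>l \<omega>. indicator (A (\<tau> r l)) \<omega> * \<xi> r l \<omega>) s \<omega>
        - ind A (s, \<omega>) * \<phi> s \<omega>)\<^sup>2 \<partial>timeM) (\<lambda>_. 0)"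
proof -
  note Ad = decreasing_eventsD[OF A]
  define \<pi> where "\<pi> r l \<omega> = (indicator (A (\<tau> r l)) \<omega> :: real)" for r l \<omega>
  have Sp: "simple_process M \<F> T (n r) (\<tau> r) (\<pi> r)" for r
    unfolding simple_process_def
  proof (intro conjI allI impI simple_processD(1-3)[OF S])
    fix j assume "j < n r"
    then have "\<tau> r j \<in> {0..T}" using simple_processD(5,6)[OF S, of j] by auto
    then show "\<pi> r j \<in> borel_measurable (\<F> (\<tau> r j))"
      unfolding \<pi>_def[abs_def] by (intro borel_measurable_indicator Ad(1))
    show "\<exists>C. \<forall>\<omega>\<in>space M. \<bar>\<pi> r j \<omega>\<bar> \<le> C" by (intro exI[of _ 1]) (simp add: \<pi>_def indicator_def)
  qed
  let ?H = "\<lambda>r. simple_value (n r) (\<tau> r) (\<xi> r)" and ?p = "\<lambda>r. simple_value (n r) (\<tau> r) (\<pi> r)"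
    and ?G = "\<lambda>r. simple_value (n r) (\<tau> r) (\<lambda>l \<omega>. \<pi> r l \<omega> * \<xi> r l \<omega>)"
  have SG: "simple_process M \<F> T (n r) (\<tau> r) (\<lambda>l \<omega>. \<pi> r l \<omega> * \<xi> r l \<omega>)" for r
    by (rule simple_process_map(3)[OF Sp S])
  then show "\<And>r. simple_process M \<F> T (n r) (\<tau> r) (\<lambda>l \<omega>. indicator (A (\<tau> r l)) \<omega> * \<xi> r l \<omega>)"
    by (simp add: \<pi>_def)
  have G: "?G r s \<omega> = ?p r s \<omega> * ?H r s \<omega>" for r s \<omega>
    by (rule simple_value_map2[where h="(*)", OF simple_processD(7)[OF S]]) simp_all
  \<comment> \<open>The half-open intervals cover \<open>{0<..T}\<close>, and the mesh bound places
    the left end within \<open>T / real (Suc r)\<close> of s.\<close>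
  have pval: "\<exists>u\<in>{0..<s}. s - T / real (Suc r) \<le> u \<and> ?p r s \<omega> = indicator (A u) \<omega>" if s: "s \<in> {0<..T}" for r s \<omega>
  proof -
    have "\<tau> r 0 < s" "s \<le> \<tau> r (n r)" using s simple_processD(1,2)[OF S] by auto
    from simple_process_cover[of "\<tau> r" s "n r", OF this]
    obtain j where j: "j < n r" "s \<in> {\<tau> r j<..\<tau> r (Suc j)}" by blast
    have "?p r s \<omega> = \<pi> r j \<omega>" by (rule simple_value_eq[OF simple_processD(7)[OF S] j])
    moreover have "0 \<le> \<tau> r j" using simple_processD(5)[OF S, of j r] j(1) by simp
    ultimately show ?thesis
      using j mesh[OF j(1)] by (intro bexI[of _ "\<tau> r j"]) (auto simp: \<pi>_def)
  qed
  have p01: "\<bar>?p r s \<omega>\<bar> \<le> 1" for r s \<omega>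
  proof (cases "\<exists>j<n r. s \<in> {\<tau> r j<..\<tau> r (Suc j)}")
    case True
    then obtain j where j: "j < n r" "s \<in> {\<tau> r j<..\<tau> r (Suc j)}" by blast
    have "?p r s \<omega> = \<pi> r j \<omega>" by (rule simple_value_eq[OF simple_processD(7)[OF S] j])
    then show ?thesis by (simp add: \<pi>_def indicator_def)
  next
    case False
    then have "?p r s \<omega> = 0" by (intro simple_value_outside) blast
    then show ?thesis by simp
  qed
  let ?Y = "\<lambda>r \<omega>. \<integral>s. ((?p r s \<omega> - ind A (s, \<omega>)) * \<phi> s \<omega>)\<^sup>2 \<partial>timeM"
  let ?Z = "\<lambda>r \<omega>. \<integral>s. (?H r s \<omega> - \<phi> s \<omega>)\<^sup>2 \<partial>timeM"
  have mY1: "(\<lambda>x. ((sv (n r) (\<tau> r) (\<pi> r) x - ind A x) * \<phi> (fst x) (snd x))\<^sup>2) \<in> borel_measurable prodM" for r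
    by (intro borel_measurable_power borel_measurable_times borel_measurable_diff borel_measurable_sv[OF Sp] Ad(3) phi)
  have mY: "?Y r \<in> borel_measurable M" for r
    using borel_measurable_time_integral[OF mY1[of r]] by (simp add: sv_def)
  have mZ1: "(\<lambda>x. (sv (n r) (\<tau> r) (\<xi> r) x - \<phi> (fst x) (snd x))\<^sup>2) \<in> borel_measurable prodM" for r
    by (intro borel_measurable_power borel_measurable_diff borel_measurable_sv[OF S] phi)
  have mZ: "?Z r \<in> borel_measurable M" for r
    using borel_measurable_time_integral[OF mZ1[of r]] by (simp add: sv_def)
  have at_fixed: "(\<lambda>s. f (s, \<omega>)) \<in> borel_measurable timeM"
    if "f \<in> borel_measurable prodM" "\<omega> \<in> space M" for f :: "real \<times> 'w \<Rightarrow> real" and \<omega>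
    using measurable_compose[OF measurable_Pair2'[OF that(2)] that(1)[unfolded prodM_def]] .
  have convY: "conv_in_prob M ?Y (\<lambda>_. 0)"
  proof (rule conv_in_prob_AE[OF mY])
    have "AE \<omega> in M. \<omega> \<in> space M" by (rule AE_I2)
    with phi2 show "AE \<omega> in M. (\<lambda>r. ?Y r \<omega>) \<longlonglongrightarrow> 0"
    proof eventually_elim
      fix \<omega> assume i: "integrable timeM (\<lambda>s. (\<phi> s \<omega>)\<^sup>2)" and w: "\<omega> \<in> space M"
      have "(\<lambda>r. ?Y r \<omega>) \<longlonglongrightarrow> (\<integral>s. 0 \<partial>timeM)"
      proof (rule integral_dominated_convergence[where w="\<lambda>s. 4 * (\<phi> s \<omega>)\<^sup>2"])
        show "(\<lambda>s. ((?p r s \<omega> - ind A (s, \<omega>)) * \<phi> s \<omega>)\<^sup>2) \<in> borel_measurable timeM" for r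
          using at_fixed[OF mY1[of r] w] by (simp add: sv_def)
        show "integrable timeM (\<lambda>s. 4 * (\<phi> s \<omega>)\<^sup>2)" using i by simp
        \<comment> \<open>The constant 4 is the square of the crude bound 2 for a difference of two
          quantities of modulus at most 1.\<close>
        show "AE s in timeM. norm (((?p r s \<omega> - ind A (s, \<omega>)) * \<phi> s \<omega>)\<^sup>2) \<le> 4 * (\<phi> s \<omega>)\<^sup>2" for r
        proof (rule AE_I2)
          fix s
          have "\<bar>?p r s \<omega> - ind A (s, \<omega>)\<bar> \<le> \<bar>2\<bar>"
            using p01[of r s \<omega>] ind_cases[of A "(s, \<omega>)"] by auto
          then have "(?p r s \<omega> - ind A (s, \<omega>))\<^sup>2 \<le> 2\<^sup>2" by (rule sq_le_sq_of_abs_le)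
          then have "(?p r s \<omega> - ind A (s, \<omega>))\<^sup>2 * (\<phi> s \<omega>)\<^sup>2 \<le> 4 * (\<phi> s \<omega>)\<^sup>2"
            by (intro mult_right_mono) auto
          then show "norm (((?p r s \<omega> - ind A (s, \<omega>)) * \<phi> s \<omega>)\<^sup>2) \<le> 4 * (\<phi> s \<omega>)\<^sup>2"
            by (simp add: power_mult_distrib)
        qed
        have "AE s in timeM. (\<lambda>r. ?p r s \<omega> - indicator (A s) \<omega>) \<longlonglongrightarrow> 0"
          by (rule decreasing_indicator_limit[OF Ad(2) pval])
        then show "AE s in timeM. (\<lambda>r. ((?p r s \<omega> - ind A (s, \<omega>)) * \<phi> s \<omega>)\<^sup>2) \<longlonglongrightarrow> 0"
        proof (rule eventually_mono)
          fix s assume l: "(\<lambda>r. ?p r s \<omega> - indicator (A s) \<omega>) \<longlonglongrightarrow> 0"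
          from tendsto_power[OF tendsto_mult_right[OF l, of "\<phi> s \<omega>"], of 2]
          show "(\<lambda>r. ((?p r s \<omega> - ind A (s, \<omega>)) * \<phi> s \<omega>)\<^sup>2) \<longlonglongrightarrow> 0" by (simp add: ind_def)
        qed
      qed simp
      then show "(\<lambda>r. ?Y r \<omega>) \<longlonglongrightarrow> 0" by simp
    qed
  qed
  have convS: "conv_in_prob M (\<lambda>r \<omega>. (?Z r \<omega> + ?Z r \<omega>) + (?Y r \<omega> + ?Y r \<omega>)) (\<lambda>_. 0)"
    by (intro conv_in_prob_add conv convY borel_measurable_add mY mZ)
  have "conv_in_prob M (\<lambda>r \<omega>. \<integral>s. (?G r s \<omega> - ind A (s, \<omega>) * \<phi> s \<omega>)\<^sup>2 \<partial>timeM) (\<lambda>_. 0)"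
  proof (rule conv_in_prob_mono[OF convS])
    show "(\<lambda>\<omega>. (?Z r \<omega> + ?Z r \<omega>) + (?Y r \<omega> + ?Y r \<omega>)) \<in> borel_measurable M" for r
      by (intro borel_measurable_add mY mZ)
    fix r
    have "AE \<omega> in M. \<omega> \<in> space M" by (rule AE_I2)
    with phi2 sq_integrable_prodM_section[OF sq_integrable_sv[OF S[of r]]]
    show "AE \<omega> in M. \<bar>\<integral>s. (?G r s \<omega> - ind A (s, \<omega>) * \<phi> s \<omega>)\<^sup>2 \<partial>timeM\<bar> \<le> \<bar>(?Z r \<omega> + ?Z r \<omega>) + (?Y r \<omega> + ?Y r \<omega>)\<bar>"
    proof eventually_elim
      fix \<omega> assume i: "integrable timeM (\<lambda>s. (\<phi> s \<omega>)\<^sup>2)"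
        and h: "integrable timeM (\<lambda>s. (sv (n r) (\<tau> r) (\<xi> r) (s, \<omega>))\<^sup>2)" and w: "\<omega> \<in> space M"
      have "(\<lambda>s. sv (n r) (\<tau> r) (\<xi> r) (s, \<omega>)) \<in> borel_measurable timeM"
        by (rule at_fixed[OF borel_measurable_sv[OF S] w])
      then have sH: "sq_integrable timeM (\<lambda>s. ?H r s \<omega>)" using h by (simp add: sq_integrable_def sv_def)
      have "(\<lambda>s. \<phi> s \<omega>) \<in> borel_measurable timeM" using at_fixed[OF phi w] by simp
      then have sphi: "sq_integrable timeM (\<lambda>s. \<phi> s \<omega>)" using i by (rule sq_integrableI)
      have iZ: "integrable timeM (\<lambda>s. (?H r s \<omega> - \<phi> s \<omega>)\<^sup>2)"
        by (rule sq_integrableD(2)[OF sq_integrable_diff[OF sH sphi]])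
      have "(\<lambda>s. (?p r s \<omega> - ind A (s, \<omega>)) * \<phi> s \<omega>) \<in> borel_measurable timeM"
        using at_fixed[OF borel_measurable_times[OF borel_measurable_diff[OF borel_measurable_sv[OF Sp] Ad(3)] phi] w]
        by (simp add: sv_def)
      then have "sq_integrable timeM (\<lambda>s. (?p r s \<omega> - ind A (s, \<omega>)) * \<phi> s \<omega>)"
      proof (rule sq_integrable_bound[OF sq_integrable_cmult[OF sphi, of 2]])
        show "AE s in timeM. \<bar>(?p r s \<omega> - ind A (s, \<omega>)) * \<phi> s \<omega>\<bar> \<le> \<bar>2 * \<phi> s \<omega>\<bar>"
        proof (rule AE_I2)
          fix s
          have "\<bar>?p r s \<omega> - ind A (s, \<omega>)\<bar> \<le> \<bar>2\<bar>"
            using p01[of r s \<omega>] ind_cases[of A "(s, \<omega>)"] by auto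
          then show "\<bar>(?p r s \<omega> - ind A (s, \<omega>)) * \<phi> s \<omega>\<bar> \<le> \<bar>2 * \<phi> s \<omega>\<bar>"
            unfolding abs_mult by (rule mult_right_mono) simp
        qed
      qed
      then have iY: "integrable timeM (\<lambda>s. ((?p r s \<omega> - ind A (s, \<omega>)) * \<phi> s \<omega>)\<^sup>2)" by (rule sq_integrableD)
      have "(\<integral>s. (?G r s \<omega> - ind A (s, \<omega>) * \<phi> s \<omega>)\<^sup>2 \<partial>timeM) \<le>
          (\<integral>s. 2 * (?H r s \<omega> - \<phi> s \<omega>)\<^sup>2 + 2 * ((?p r s \<omega> - ind A (s, \<omega>)) * \<phi> s \<omega>)\<^sup>2 \<partial>timeM)"
      proof (rule integral_mono')
        fix s
        have "?G r s \<omega> - ind A (s, \<omega>) * \<phi> s \<omega> =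
            ?p r s \<omega> * (?H r s \<omega> - \<phi> s \<omega>) + (?p r s \<omega> - ind A (s, \<omega>)) * \<phi> s \<omega>"
          by (simp add: G algebra_simps)
        then have "(?G r s \<omega> - ind A (s, \<omega>) * \<phi> s \<omega>)\<^sup>2 \<le>
            2 * (?p r s \<omega> * (?H r s \<omega> - \<phi> s \<omega>))\<^sup>2 + 2 * ((?p r s \<omega> - ind A (s, \<omega>)) * \<phi> s \<omega>)\<^sup>2"
          by (simp only: sq_add_le)
        moreover have "(?p r s \<omega> * (?H r s \<omega> - \<phi> s \<omega>))\<^sup>2 \<le> (?H r s \<omega> - \<phi> s \<omega>)\<^sup>2"
          using p01[of r s \<omega>] by (intro sq_le_sq_of_abs_le) (simp add: abs_mult mult_left_le_one_le)
        ultimately show "(?G r s \<omega> - ind A (s, \<omega>) * \<phi> s \<omega>)\<^sup>2 \<le>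
            2 * (?H r s \<omega> - \<phi> s \<omega>)\<^sup>2 + 2 * ((?p r s \<omega> - ind A (s, \<omega>)) * \<phi> s \<omega>)\<^sup>2" by linarith
      qed (use iZ iY in simp_all)
      also have "\<dots> = (?Z r \<omega> + ?Z r \<omega>) + (?Y r \<omega> + ?Y r \<omega>)" using iZ iY by simp
      finally show "\<bar>\<integral>s. (?G r s \<omega> - ind A (s, \<omega>) * \<phi> s \<omega>)\<^sup>2 \<partial>timeM\<bar> \<le> \<bar>(?Z r \<omega> + ?Z r \<omega>) + (?Y r \<omega> + ?Y r \<omega>)\<bar>"
        by simp
    qed
  qed
  then show "conv_in_prob M (\<lambda>r \<omega>. \<integral>s. (simple_value (n r) (\<tau> r) (\<lambda>l \<omega>. indicator (A (\<tau> r l)) \<omega> * \<xi> r l \<omega>) s \<omega>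
        - ind A (s, \<omega>) * \<phi> s \<omega>)\<^sup>2 \<partial>timeM) (\<lambda>_. 0)" by (simp add: \<pi>_def)
qed

text \<open>Two kinds of convergence are obtained for one sequence: the integrands approach the
  truncated integrand in mean square, while on \<open>A t\<close> the integrals still approach the
  original \<open>I t\<close>. Everything about moments rests on this.\<close>

lemma truncated_approx:
  assumes I: "has_ito_integral M \<F> T (\<beta> k) \<phi> I" and A: "decreasing_events A"
    and sq: "sq_integrable prodM (\<lambda>x. ind A x * \<phi> (fst x) (snd x))"
  shows "\<exists>n \<tau> \<xi>. (\<forall>r. simple_process M \<F> T (n r) (\<tau> r) (\<xi> r)) \<and>
    L2_conv prodM (\<lambda>r. sv (n r) (\<tau> r) (\<xi> r)) (\<lambda>x. ind A x * \<phi> (fst x) (snd x)) \<and>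
    (\<forall>t\<in>{0..T}. conv_in_prob M
       (\<lambda>r \<omega>. indicator (A t) \<omega> * (simple_integral (n r) (\<tau> r) (\<xi> r) (\<beta> k) t \<omega> - I t \<omega>)) (\<lambda>_. 0))"
proof -
  have phi: "(\<lambda>x. \<phi> (fst x) (snd x)) \<in> borel_measurable prodM"
    using I T_pos unfolding has_ito_integral_def progressively_measurable_def
    by (intro measurable_prodM_progressive) simp
  have phi2: "AE \<omega> in M. integrable timeM (\<lambda>s. (\<phi> s \<omega>)\<^sup>2)"
    using I unfolding has_ito_integral_def integrable_timeM by blast
  have It: "I t \<in> borel_measurable M" if "t \<in> {0..T}" for t
    by (rule borel_measurable_filtration[of t])
       (use that I[unfolded has_ito_integral_def, THEN conjunct2, THEN conjunct2, THEN conjunct1] in simp_all)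
  obtain n \<tau> \<xi> where S: "\<And>r. simple_process M \<F> T (n r) (\<tau> r) (\<xi> r)"
    and c1: "conv_in_prob M (\<lambda>r \<omega>. LBINT s:{0..T}. (simple_value (n r) (\<tau> r) (\<xi> r) s \<omega> - \<phi> s \<omega>)\<^sup>2) (\<lambda>\<omega>. 0)"
    and c2: "\<And>t. t \<in> {0..T} \<Longrightarrow> conv_in_prob M (\<lambda>r. simple_integral (n r) (\<tau> r) (\<xi> r) (\<beta> k) t) (I t)"
    using I unfolding has_ito_integral_def by blast
  \<comment> \<open>The r-th grid is refined \<open>Suc r\<close> times, so that its mesh is at most
    \<open>T / real (Suc r)\<close>.\<close>
  define n' where "n' r = n r * Suc r" for r
  define \<tau>' where "\<tau>' r = refine_grid (Suc r) (\<tau> r)" for r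
  define \<xi>' where "\<xi>' r l = \<xi> r (l div Suc r)" for r l
  have ref: "simple_process M \<F> T (n' r) (\<tau>' r) (\<xi>' r)"
    "simple_value (n' r) (\<tau>' r) (\<xi>' r) s \<omega> = simple_value (n r) (\<tau> r) (\<xi> r) s \<omega>"
    "simple_integral (n' r) (\<tau>' r) (\<xi>' r) B t \<omega> = simple_integral (n r) (\<tau> r) (\<xi> r) B t \<omega>"
    "l < n' r \<Longrightarrow> \<tau>' r (Suc l) - \<tau>' r l \<le> T / real (Suc r)" for r s \<omega> B t l
    using simple_process_refine[OF S[of r], of "Suc r"] unfolding n'_def \<tau>'_def \<xi>'_def by simp_all
  let ?\<chi> = "\<lambda>r l \<omega>. indicator (A (\<tau>' r l)) \<omega> * \<xi>' r l \<omega>"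
  have "conv_in_prob M (\<lambda>r \<omega>. \<integral>s. (simple_value (n' r) (\<tau>' r) (\<xi>' r) s \<omega> - \<phi> s \<omega>)\<^sup>2 \<partial>timeM) (\<lambda>_. 0)"
    using c1 by (simp only: ref(2) integral_timeM)
  note tc = truncated_conv[OF A phi phi2 ref(1) ref(4) this]
  have "conv_in_prob M (\<lambda>r \<omega>. \<integral>s. (simple_value (n' r) (\<tau>' r) (?\<chi> r) s \<omega>
        - (\<lambda>x. ind A x * \<phi> (fst x) (snd x)) (s, \<omega>))\<^sup>2 \<partial>timeM) (\<lambda>_. 0)"
    using tc(2) by simp
  from simple_L2_approx[OF tc(1) sq this]
  obtain \<rho> \<zeta> where rho: "\<And>c. c \<le> \<rho> c" and Sz: "\<And>c. simple_process M \<F> T (n' (\<rho> c)) (\<tau>' (\<rho> c)) (\<zeta> c)"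
    and L2: "L2_conv prodM (\<lambda>c. sv (n' (\<rho> c)) (\<tau>' (\<rho> c)) (\<zeta> c)) (\<lambda>x. ind A x * \<phi> (fst x) (snd x))"
    and d: "\<And>t. t \<in> {0..T} \<Longrightarrow> conv_in_prob M
      (\<lambda>c \<omega>. simple_integral (n' (\<rho> c)) (\<tau>' (\<rho> c)) (?\<chi> (\<rho> c)) (\<beta> k) t \<omega>
         - simple_integral (n' (\<rho> c)) (\<tau>' (\<rho> c)) (\<zeta> c) (\<beta> k) t \<omega>) (\<lambda>_. 0)"
    by blast
  \<comment> \<open>A point of \<open>A t\<close> belongs to the event at every grid time up to
    \<open>t\<close>, where the indicators are therefore 1; an interval starting later has equal
    capped ends and contributes 0 in any case.\<close>
  have on_A: "simple_integral (n' r) (\<tau>' r) (?\<chi> r) (\<beta> k) t \<omega> = simple_integral (n r) (\<tau> r) (\<xi> r) (\<beta> k) t \<omega>"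
    if t: "t \<in> {0..T}" and w: "\<omega> \<in> A t" for r t \<omega>
  proof -
    have "simple_integral (n' r) (\<tau>' r) (?\<chi> r) (\<beta> k) t \<omega> = simple_integral (n' r) (\<tau>' r) (\<xi>' r) (\<beta> k) t \<omega>"
      unfolding simple_integral_def
    proof (rule sum.cong[OF refl])
      fix l assume "l \<in> {..<n' r}"
      then have l: "l < n' r" by simp
      note tl = simple_processD(3)[OF ref(1) l] simple_processD(5)[OF ref(1), of l]
      show "indicator (A (\<tau>' r l)) \<omega> * \<xi>' r l \<omega> * (\<beta> k (min t (\<tau>' r (Suc l))) \<omega> - \<beta> k (min t (\<tau>' r l)) \<omega>) =
        \<xi>' r l \<omega> * (\<beta> k (min t (\<tau>' r (Suc l))) \<omega> - \<beta> k (min t (\<tau>' r l)) \<omega>)"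
      proof (cases "\<tau>' r l \<le> t")
        case True
        then have "\<omega> \<in> A (\<tau>' r l)" using decreasing_eventsD(2)[OF A, of "\<tau>' r l" t] tl(2) l t w by auto
        then show ?thesis by simp
      next
        case False
        then have "min t (\<tau>' r (Suc l)) = min t (\<tau>' r l)" using tl(1) by simp
        then show ?thesis by (simp only:) simp
      qed
    qed
    then show ?thesis by (simp only: ref(3))
  qed
  have "conv_in_prob M (\<lambda>c \<omega>. indicator (A t) \<omega> *
      (simple_integral (n' (\<rho> c)) (\<tau>' (\<rho> c)) (\<zeta> c) (\<beta> k) t \<omega> - I t \<omega>)) (\<lambda>_. 0)" if t: "t \<in> {0..T}" for t
  proof -
    let ?a = "\<lambda>c \<omega>. simple_integral (n' (\<rho> c)) (\<tau>' (\<rho> c)) (?\<chi> (\<rho> c)) (\<beta> k) t \<omega>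
         - simple_integral (n' (\<rho> c)) (\<tau>' (\<rho> c)) (\<zeta> c) (\<beta> k) t \<omega>"
    let ?b = "\<lambda>c \<omega>. simple_integral (n (\<rho> c)) (\<tau> (\<rho> c)) (\<xi> (\<rho> c)) (\<beta> k) t \<omega> - I t \<omega>"
    have ma: "?a c \<in> borel_measurable M" for c
      by (intro borel_measurable_diff sq_integrableD(1)[OF sq_integrable_simple_integral[OF tc(1) t]]
          sq_integrableD(1)[OF sq_integrable_simple_integral[OF Sz t]])
    have mb: "?b c \<in> borel_measurable M" for c
      by (intro borel_measurable_diff sq_integrableD(1)[OF sq_integrable_simple_integral[OF S t]] It t)
    have "conv_in_prob M (\<lambda>c. simple_integral (n (\<rho> c)) (\<tau> (\<rho> c)) (\<xi> (\<rho> c)) (\<beta> k) t) (I t)"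
      by (rule conv_in_prob_subseq[OF c2[OF t] rho])
    then have cb: "conv_in_prob M ?b (\<lambda>_. 0)" by (simp add: conv_in_prob_def)
    have sa: "(\<lambda>\<omega>. \<bar>?a c \<omega>\<bar>) \<in> borel_measurable M" "(\<lambda>\<omega>. \<bar>?b c \<omega>\<bar>) \<in> borel_measurable M" for c
      by (intro borel_measurable_abs ma mb)+
    have ca: "conv_in_prob M (\<lambda>c \<omega>. \<bar>?a c \<omega>\<bar>) (\<lambda>_. 0)" "conv_in_prob M (\<lambda>c \<omega>. \<bar>?b c \<omega>\<bar>) (\<lambda>_. 0)"
      using d[OF t] cb by (simp_all add: conv_in_prob_def)
    have "conv_in_prob M (\<lambda>c \<omega>. \<bar>?a c \<omega>\<bar> + \<bar>?b c \<omega>\<bar>) (\<lambda>_. 0)"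
      by (rule conv_in_prob_add[OF ca(1) sa(1) ca(2) sa(2)])
    then show ?thesis
    proof (rule conv_in_prob_mono)
      show "(\<lambda>\<omega>. \<bar>?a c \<omega>\<bar> + \<bar>?b c \<omega>\<bar>) \<in> borel_measurable M" for c by (intro borel_measurable_add sa)
      show "AE \<omega> in M. \<bar>indicator (A t) \<omega> * (simple_integral (n' (\<rho> c)) (\<tau>' (\<rho> c)) (\<zeta> c) (\<beta> k) t \<omega> - I t \<omega>)\<bar>
          \<le> \<bar>\<bar>?a c \<omega>\<bar> + \<bar>?b c \<omega>\<bar>\<bar>" for c
      proof (rule AE_I2)
        fix \<omega>
        show "\<bar>indicator (A t) \<omega> * (simple_integral (n' (\<rho> c)) (\<tau>' (\<rho> c)) (\<zeta> c) (\<beta> k) t \<omega> - I t \<omega>)\<bar>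
          \<le> \<bar>\<bar>?a c \<omega>\<bar> + \<bar>?b c \<omega>\<bar>\<bar>"
        proof (cases "\<omega> \<in> A t")
          case True
          show ?thesis unfolding on_A[OF t True] using True by simp
        qed simp
      qed
    qed
  qed
  then show ?thesis using Sz L2 by (intro exI[of _ "\<lambda>c. n' (\<rho> c)"] exI[of _ "\<lambda>c. \<tau>' (\<rho> c)"] exI[of _ \<zeta>]) blast
qed

end

section \<open>Isometry and martingale property\<close>

lemma indicator_mult_mult: "(indicator A s * y) * (indicator A s * z) = indicator A s * (y * z :: real)"
  by (simp add: indicator_def)

context wiener_space
begin

text \<open>Fatou's lemma under convergence in probability, by way of an almost surely convergent
  subsequence.\<close>

lemma fatou_in_prob:
  assumes X: "\<And>r. sq_integrable M (X r)" and Y: "Y \<in> borel_measurable M"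
    and conv: "conv_in_prob M (\<lambda>r \<omega>. X r \<omega> - Y \<omega>) (\<lambda>_. 0)"
    and le: "\<And>r. expectation (\<lambda>\<omega>. (X r \<omega>)\<^sup>2) \<le> c r" and lim: "c \<longlonglongrightarrow> d"
  shows "sq_integrable M Y" "expectation (\<lambda>\<omega>. (Y \<omega>)\<^sup>2) \<le> d"
proof -
  note mX = sq_integrableD(1)[OF X]
  \<comment> \<open>Capping at 1 turns convergence in probability into convergence in mean, which
    yields the subsequence.\<close>
  let ?g = "\<lambda>r \<omega>. min 1 \<bar>X r \<omega> - Y \<omega>\<bar>"
  have mg: "?g r \<in> borel_measurable M" for r
    by (intro borel_measurable_min borel_measurable_const borel_measurable_abs borel_measurable_diff mX Y)
  have "(\<lambda>r. expectation (?g r)) \<longlonglongrightarrow> 0"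
  proof (rule expectation_conv_bounded[where B=1, OF mg])
    show "conv_in_prob M ?g (\<lambda>_. 0)"
      by (rule conv_in_prob_mono[OF conv]) (auto intro!: borel_measurable_diff mX Y)
  qed auto
  then have L1: "(\<lambda>r. \<integral>\<omega>. norm (?g r \<omega>) \<partial>M) \<longlonglongrightarrow> 0" by simp
  have ig: "integrable M (?g r)" for r
  proof (rule integrable_const_bound[of _ 1])
    show "AE \<omega> in M. norm (?g r \<omega>) \<le> 1" by (rule AE_I2) simp
  qed (rule mg)
  obtain \<rho> where rho: "strict_mono \<rho>" and ae: "AE \<omega> in M. (\<lambda>n. ?g (\<rho> n) \<omega>) \<longlonglongrightarrow> 0"
    using tendsto_L1_AE_subseq[OF ig L1] by blast
  have aeY: "AE \<omega> in M. (\<lambda>n. X (\<rho> n) \<omega>) \<longlonglongrightarrow> Y \<omega>"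
    using ae
  proof (rule eventually_mono)
    fix \<omega> assume l: "(\<lambda>n. ?g (\<rho> n) \<omega>) \<longlonglongrightarrow> 0"
    have "eventually (\<lambda>n. ?g (\<rho> n) \<omega> < 1) sequentially" by (rule order_tendstoD(2)[OF l]) simp
    then have "eventually (\<lambda>n. ?g (\<rho> n) \<omega> = \<bar>X (\<rho> n) \<omega> - Y \<omega>\<bar>) sequentially"
      by (rule eventually_mono) (auto simp: min_def)
    with l have "(\<lambda>n. \<bar>X (\<rho> n) \<omega> - Y \<omega>\<bar>) \<longlonglongrightarrow> 0" by (rule Lim_transform_eventually)
    then have "(\<lambda>n. X (\<rho> n) \<omega> - Y \<omega>) \<longlonglongrightarrow> 0" by (rule tendsto_rabs_zero_cancel)
    then show "(\<lambda>n. X (\<rho> n) \<omega>) \<longlonglongrightarrow> Y \<omega>" by (rule LIM_zero_cancel)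
  qed
  have "(\<integral>\<^sup>+\<omega>. ennreal ((Y \<omega>)\<^sup>2) \<partial>M) = (\<integral>\<^sup>+\<omega>. liminf (\<lambda>n. ennreal ((X (\<rho> n) \<omega>)\<^sup>2)) \<partial>M)"
  proof (rule nn_integral_cong_AE, use aeY in \<open>rule eventually_mono\<close>)
    fix \<omega> assume "(\<lambda>n. X (\<rho> n) \<omega>) \<longlonglongrightarrow> Y \<omega>"
    then have "(\<lambda>n. ennreal ((X (\<rho> n) \<omega>)\<^sup>2)) \<longlonglongrightarrow> ennreal ((Y \<omega>)\<^sup>2)"
      by (intro tendsto_ennrealI tendsto_power)
    from lim_imp_Liminf[OF _ this] show "ennreal ((Y \<omega>)\<^sup>2) = liminf (\<lambda>n. ennreal ((X (\<rho> n) \<omega>)\<^sup>2))" by simp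
  qed
  also have "\<dots> \<le> liminf (\<lambda>n. \<integral>\<^sup>+\<omega>. ennreal ((X (\<rho> n) \<omega>)\<^sup>2) \<partial>M)"
    by (rule nn_integral_liminf) (intro measurable_compose[OF _ measurable_ennreal] borel_measurable_power mX)
  also have "\<dots> = liminf (\<lambda>n. ennreal (expectation (\<lambda>\<omega>. (X (\<rho> n) \<omega>)\<^sup>2)))"
    by (subst nn_integral_eq_integral[OF sq_integrableD(2)[OF X]]) auto
  also have "\<dots> \<le> liminf (\<lambda>n. ennreal (c (\<rho> n)))"
    by (rule Liminf_mono) (auto intro!: always_eventually ennreal_leI le)
  also have "\<dots> = ennreal d"
    by (rule lim_imp_Liminf) (auto intro!: tendsto_ennrealI LIMSEQ_subseq_LIMSEQ[OF lim rho, unfolded o_def])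
  finally have nn: "(\<integral>\<^sup>+\<omega>. ennreal ((Y \<omega>)\<^sup>2) \<partial>M) \<le> ennreal d" .
  have mY2: "(\<lambda>\<omega>. (Y \<omega>)\<^sup>2) \<in> borel_measurable M" by (rule borel_measurable_power[OF Y])
  have i: "integrable M (\<lambda>\<omega>. (Y \<omega>)\<^sup>2)"
    by (rule integrableI_bounded[OF mY2]) (use nn in \<open>auto simp: less_top[symmetric] top_unique\<close>)
  show "sq_integrable M Y" by (rule sq_integrableI[OF Y i])
  \<comment> \<open>\<open>ennreal\<close> sends negative numbers to 0, so the real inequality can
    be read off only once \<open>d\<close> is known to be nonnegative.\<close>
  have d0: "0 \<le> d"
  proof (rule LIMSEQ_le_const[OF lim], intro exI[of _ 0] allI impI)
    fix r show "0 \<le> c r" by (rule order_trans[OF _ le]) simp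
  qed
  have "ennreal (expectation (\<lambda>\<omega>. (Y \<omega>)\<^sup>2)) \<le> ennreal d"
    using nn nn_integral_eq_integral[OF i] by simp
  then show "expectation (\<lambda>\<omega>. (Y \<omega>)\<^sup>2) \<le> d" using d0 by (simp add: ennreal_le_iff)
qed

lemma simple_second_moment:
  assumes S: "simple_process M \<F> T n \<tau> \<xi>" and t: "t \<in> {0..T}"
  shows "expectation (\<lambda>\<omega>. (simple_integral n \<tau> \<xi> (\<beta> k) t \<omega>)\<^sup>2) =
    (\<integral>x. (indicator {..t} (fst x) * sv n \<tau> \<xi> x) * (indicator {..t} (fst x) * sv n \<tau> \<xi> x) \<partial>prodM)"
  unfolding indicator_mult_mult using simple_isometry[OF S S t, of k k] by (simp add: power2_eq_square)

lemma L2_conv_upto: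
  assumes "L2_conv prodM X Y"
  shows "L2_conv prodM (\<lambda>r x. indicator {..t} (fst x) * X r x) (\<lambda>x. indicator {..t} (fst x) * Y x)"
proof (rule L2_conv_mult_bounded[OF assms])
  show "(\<lambda>x. indicator {..t} (fst x) :: real) \<in> borel_measurable prodM" by (rule measurable_fst_prodM) simp
qed (simp add: indicator_def)

text \<open>By the isometry the second moments of the approximants converge to the right-hand side.
  The factor \<open>indicator (A t)\<close> can only lower them, and Fatou's lemma passes to the
  limit; both steps cost equality.\<close>

lemma ito_truncated_second_moment:
  assumes I: "has_ito_integral M \<F> T (\<beta> k) \<phi> I" and A: "decreasing_events A"
    and sq: "sq_integrable prodM (\<lambda>x. ind A x * \<phi> (fst x) (snd x))" and t: "t \<in> {0..T}"
  shows "sq_integrable M (\<lambda>\<omega>. indicator (A t) \<omega> * I t \<omega>)"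
    "expectation (\<lambda>\<omega>. (indicator (A t) \<omega> * I t \<omega>)\<^sup>2) \<le>
      (\<integral>x. indicator {..t} (fst x) * (ind A x * \<phi> (fst x) (snd x))\<^sup>2 \<partial>prodM)"
proof -
  obtain n \<tau> \<xi> where S: "\<And>r. simple_process M \<F> T (n r) (\<tau> r) (\<xi> r)"
    and L2: "L2_conv prodM (\<lambda>r. sv (n r) (\<tau> r) (\<xi> r)) (\<lambda>x. ind A x * \<phi> (fst x) (snd x))"
    and conv: "conv_in_prob M (\<lambda>r \<omega>. indicator (A t) \<omega> * (simple_integral (n r) (\<tau> r) (\<xi> r) (\<beta> k) t \<omega> - I t \<omega>)) (\<lambda>_. 0)"
    using truncated_approx[OF I A sq] t by blast
  have At: "A t \<in> events" using decreasing_eventsD(1)[OF A t] sets_filtration[of t] t by auto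
  let ?X = "\<lambda>r. simple_integral (n r) (\<tau> r) (\<xi> r) (\<beta> k) t"
  have mI: "I t \<in> borel_measurable M"
    by (rule borel_measurable_filtration[of t])
       (use t I[unfolded has_ito_integral_def, THEN conjunct2, THEN conjunct2, THEN conjunct1] in simp_all)
  have iA: "(\<lambda>\<omega>. indicator (A t) \<omega> :: real) \<in> borel_measurable M" by (rule borel_measurable_indicator[OF At])
  have sqX: "sq_integrable M (?X r)" for r by (rule sq_integrable_simple_integral[OF S t])
  have le1: "\<bar>indicator (A t) \<omega> * (y::real)\<bar> \<le> \<bar>y\<bar>" for \<omega> y by (simp add: indicator_def)
  have sqAX: "sq_integrable M (\<lambda>\<omega>. indicator (A t) \<omega> * ?X r \<omega>)" for r
    by (rule sq_integrable_bound[OF sqX]) (use le1 in \<open>auto intro!: borel_measurable_times iA sq_integrableD(1)[OF sqX]\<close>)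
  have conv': "conv_in_prob M (\<lambda>r \<omega>. indicator (A t) \<omega> * ?X r \<omega> - indicator (A t) \<omega> * I t \<omega>) (\<lambda>_. 0)"
    using conv by (simp add: right_diff_distrib)
  have le: "expectation (\<lambda>\<omega>. (indicator (A t) \<omega> * ?X r \<omega>)\<^sup>2) \<le> expectation (\<lambda>\<omega>. (?X r \<omega>)\<^sup>2)" for r
    by (rule integral_mono'[OF sq_integrableD(2)[OF sqX]]) (use le1 sq_le_sq_of_abs_le in auto)
  let ?p = "\<lambda>x. indicator {..t} (fst x) * (ind A x * \<phi> (fst x) (snd x))"
  have "(\<lambda>r. expectation (\<lambda>\<omega>. (?X r \<omega>)\<^sup>2)) \<longlonglongrightarrow> (\<integral>x. ?p x * ?p x \<partial>prodM)"
    unfolding simple_second_moment[OF S t] by (rule L2_conv_inner[OF L2_conv_upto[OF L2] L2_conv_upto[OF L2]])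
  moreover have "?p x * ?p x = indicator {..t} (fst x) * (ind A x * \<phi> (fst x) (snd x))\<^sup>2" for x
    by (simp add: indicator_def power2_eq_square)
  ultimately have lim: "(\<lambda>r. expectation (\<lambda>\<omega>. (?X r \<omega>)\<^sup>2)) \<longlonglongrightarrow>
      (\<integral>x. indicator {..t} (fst x) * (ind A x * \<phi> (fst x) (snd x))\<^sup>2 \<partial>prodM)" by simp
  note F = fatou_in_prob[OF sqAX borel_measurable_times[OF iA mI] conv' le lim]
  show "sq_integrable M (\<lambda>\<omega>. indicator (A t) \<omega> * I t \<omega>)" by (rule F(1))
  show "expectation (\<lambda>\<omega>. (indicator (A t) \<omega> * I t \<omega>)\<^sup>2) \<le>
      (\<integral>x. indicator {..t} (fst x) * (ind A x * \<phi> (fst x) (snd x))\<^sup>2 \<partial>prodM)" by (rule F(2))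
qed

text \<open>The trivial truncation, through which \<open>truncated_approx\<close> speaks about the
  integral itself when \<open>\<phi>\<close> is square integrable.\<close>

lemma decreasing_events_space: "decreasing_events (\<lambda>_. space M)"
  unfolding decreasing_events_def
proof (intro conjI ballI)
  show "space M \<in> sets (\<F> s)" if "s \<in> {0..T}" for s
    using sets.top[of "\<F> s"] unfolding space_filtration[of s, OF that[unfolded atLeastAtMost_iff, THEN conjunct1]] .
  have "ind (\<lambda>_. space M) \<in> borel_measurable prodM \<longleftrightarrow> (\<lambda>x. 1 :: real) \<in> borel_measurable prodM"
    by (rule measurable_cong) (auto simp: ind_def space_prodM)
  then show "ind (\<lambda>_. space M) \<in> borel_measurable prodM" by simp
qed simp

text \<open>The isometry bounds the mean square distance of two approximants by the distances of
  their integrands to \<open>\<phi>\<close>. Letting one index tend to infinity, Fatou's lemma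
  bounds the distance of \<open>I t\<close> to the other approximant by a null sequence.\<close>

lemma ito_L2_approx:
  assumes I: "has_ito_integral M \<F> T (\<beta> k) \<phi> I"
    and sq: "sq_integrable prodM (\<lambda>x. \<phi> (fst x) (snd x))"
  shows "\<exists>n \<tau> \<xi>. (\<forall>r. simple_process M \<F> T (n r) (\<tau> r) (\<xi> r)) \<and>
    L2_conv prodM (\<lambda>r. sv (n r) (\<tau> r) (\<xi> r)) (\<lambda>x. \<phi> (fst x) (snd x)) \<and>
    (\<forall>t\<in>{0..T}. L2_conv M (\<lambda>r. simple_integral (n r) (\<tau> r) (\<xi> r) (\<beta> k) t) (I t))"
proof -
  let ?A = "\<lambda>_::real. space M" and ?\<psi> = "\<lambda>x. \<phi> (fst x) (snd x)"
  have ind1: "ind ?A x = 1" if "x \<in> space prodM" for x using that by (auto simp: ind_def space_prodM)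
  have "sq_integrable prodM (\<lambda>x. ind ?A x * ?\<psi> x)"
  proof (rule sq_integrable_bound[OF sq])
    show "(\<lambda>x. ind ?A x * ?\<psi> x) \<in> borel_measurable prodM"
      by (intro borel_measurable_times decreasing_eventsD(3)[OF decreasing_events_space] sq_integrableD(1)[OF sq])
    show "AE x in prodM. \<bar>ind ?A x * ?\<psi> x\<bar> \<le> \<bar>?\<psi> x\<bar>" by (rule AE_I2) (simp add: ind1)
  qed
  from truncated_approx[OF I decreasing_events_space this]
  obtain n \<tau> \<xi> where S: "\<And>r. simple_process M \<F> T (n r) (\<tau> r) (\<xi> r)"
    and L2': "L2_conv prodM (\<lambda>r. sv (n r) (\<tau> r) (\<xi> r)) (\<lambda>x. ind ?A x * ?\<psi> x)"
    and conv: "\<And>t. t \<in> {0..T} \<Longrightarrow> conv_in_prob M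
      (\<lambda>r \<omega>. indicator (space M) \<omega> * (simple_integral (n r) (\<tau> r) (\<xi> r) (\<beta> k) t \<omega> - I t \<omega>)) (\<lambda>_. 0)"
    by blast
  let ?v = "\<lambda>r. sv (n r) (\<tau> r) (\<xi> r)"
  let ?e = "\<lambda>r. \<integral>x. (?v r x - ?\<psi> x)\<^sup>2 \<partial>prodM"
  have "(\<integral>x. (?v r x - ind ?A x * ?\<psi> x)\<^sup>2 \<partial>prodM) = ?e r" for r
    by (rule Bochner_Integration.integral_cong) (simp_all add: ind1)
  then have e0: "?e \<longlonglongrightarrow> 0" using L2_convD(3)[OF L2'] by simp
  have L2: "L2_conv prodM ?v ?\<psi>" unfolding L2_conv_def using sq e0 sq_integrable_sv[OF S] by blast
  have sqd: "sq_integrable prodM (\<lambda>x. ?v r x - ?\<psi> x)" for r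
    by (rule sq_integrable_diff[OF sq_integrable_sv[OF S] sq])
  have "L2_conv M (\<lambda>r. simple_integral (n r) (\<tau> r) (\<xi> r) (\<beta> k) t) (I t)" if t: "t \<in> {0..T}" for t
  proof -
    let ?X = "\<lambda>r. simple_integral (n r) (\<tau> r) (\<xi> r) (\<beta> k) t"
    have sqX: "sq_integrable M (?X r)" for r by (rule sq_integrable_simple_integral[OF S t])
    have mI: "I t \<in> borel_measurable M"
      by (rule borel_measurable_filtration[of t])
         (use t I[unfolded has_ito_integral_def, THEN conjunct2, THEN conjunct2, THEN conjunct1] in simp_all)
    have diff: "expectation (\<lambda>\<omega>. (?X r \<omega> - ?X q \<omega>)\<^sup>2) \<le> 2 * ?e r + 2 * ?e q" for r q
    proof -
      let ?i = "\<lambda>x. indicator {..t} (fst x) :: real"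
      have iX: "integrable M (\<lambda>\<omega>. ?X r \<omega> * ?X q \<omega>)" for r q by (rule sq_integrable_mult[OF sqX sqX])
      have iu: "sq_integrable prodM (\<lambda>x. ?i x * ?v r x)" for r
        using L2_convD(1)[OF L2_conv_upto[OF L2]] .
      have iv: "integrable prodM (\<lambda>x. (?i x * ?v r x) * (?i x * ?v q x))" for r q
        by (rule sq_integrable_mult[OF iu iu])
      have isom: "expectation (\<lambda>\<omega>. ?X r \<omega> * ?X q \<omega>) = (\<integral>x. (?i x * ?v r x) * (?i x * ?v q x) \<partial>prodM)" for r q
        unfolding indicator_mult_mult using simple_isometry[OF S S t, of r k q k] by simp
      have "expectation (\<lambda>\<omega>. (?X r \<omega> - ?X q \<omega>)\<^sup>2) =
          expectation (\<lambda>\<omega>. ?X r \<omega> * ?X r \<omega> - 2 * (?X r \<omega> * ?X q \<omega>) + ?X q \<omega> * ?X q \<omega>)"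
        by (rule Bochner_Integration.integral_cong) (simp_all add: power2_eq_square algebra_simps)
      also have "\<dots> = expectation (\<lambda>\<omega>. ?X r \<omega> * ?X r \<omega>) - 2 * expectation (\<lambda>\<omega>. ?X r \<omega> * ?X q \<omega>)
          + expectation (\<lambda>\<omega>. ?X q \<omega> * ?X q \<omega>)" using iX by simp
      also have "\<dots> = (\<integral>x. (?i x * ?v r x) * (?i x * ?v r x) - 2 * ((?i x * ?v r x) * (?i x * ?v q x))
          + (?i x * ?v q x) * (?i x * ?v q x) \<partial>prodM)"
        unfolding isom
        by (subst Bochner_Integration.integral_add, intro Bochner_Integration.integrable_diff integrable_mult_right iv,
            rule iv, subst Bochner_Integration.integral_diff, rule iv, intro integrable_mult_right iv, simp)
      also have "\<dots> \<le> (\<integral>x. 2 * (?v r x - ?\<psi> x)\<^sup>2 + 2 * (?v q x - ?\<psi> x)\<^sup>2 \<partial>prodM)"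
      proof (rule integral_mono')
        fix x
        have eq: "(?i x * ?v r x) * (?i x * ?v r x) - 2 * ((?i x * ?v r x) * (?i x * ?v q x))
          + (?i x * ?v q x) * (?i x * ?v q x) = (?i x * (?v r x - ?v q x))\<^sup>2"
          by (simp add: power2_eq_square algebra_simps)
        also have "\<dots> \<le> (?v r x - ?v q x)\<^sup>2" by (rule sq_le_sq_of_abs_le) (simp add: indicator_def)
        also have "\<dots> \<le> 2 * (?v r x - ?\<psi> x)\<^sup>2 + 2 * (?v q x - ?\<psi> x)\<^sup>2"
          using sq_diff_le[of "?v r x" "?v q x" "?\<psi> x"] by (simp add: power2_commute)
        finally show "(?i x * ?v r x) * (?i x * ?v r x) - 2 * ((?i x * ?v r x) * (?i x * ?v q x))
          + (?i x * ?v q x) * (?i x * ?v q x) \<le> 2 * (?v r x - ?\<psi> x)\<^sup>2 + 2 * (?v q x - ?\<psi> x)\<^sup>2" .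
      qed (use sq_integrableD(2)[OF sqd] in simp_all)
      also have "\<dots> = 2 * ?e r + 2 * ?e q" using sq_integrableD(2)[OF sqd] by simp
      finally show ?thesis .
    qed
    have "conv_in_prob M (\<lambda>r \<omega>. indicator (space M) \<omega> * (?X r \<omega> - I t \<omega>)) (\<lambda>_. 0)" by (rule conv[OF t])
    then have "conv_in_prob M (\<lambda>r \<omega>. ?X r \<omega> - I t \<omega>) (\<lambda>_. 0)"
      by (rule conv_in_prob_mono)
         (auto intro!: borel_measurable_times borel_measurable_diff sq_integrableD(1)[OF sqX] mI)
    \<comment> \<open>With \<open>q\<close> fixed, the differences in r tend to \<open>I t\<close>
      minus the q-th approximant; this is the shape to which Fatou's lemma is applied.\<close>
    then have cq: "conv_in_prob M (\<lambda>r \<omega>. (?X r \<omega> - ?X q \<omega>) - (I t \<omega> - ?X q \<omega>)) (\<lambda>_. 0)" for q by simp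
    have lim: "(\<lambda>r. 2 * ?e r + 2 * ?e q) \<longlonglongrightarrow> 2 * ?e q" for q
      using tendsto_add[OF tendsto_mult[OF tendsto_const[of 2] e0] tendsto_const[of "2 * ?e q"]] by simp
    note F = fatou_in_prob[OF sq_integrable_diff[OF sqX sqX]
        borel_measurable_diff[OF mI sq_integrableD(1)[OF sqX]] cq diff lim]
    have "sq_integrable M (\<lambda>\<omega>. ?X 0 \<omega> + (I t \<omega> - ?X 0 \<omega>))" by (rule sq_integrable_add[OF sqX F(1)])
    then have sI: "sq_integrable M (I t)" by simp
    have "(\<lambda>q. expectation (\<lambda>\<omega>. (?X q \<omega> - I t \<omega>)\<^sup>2)) \<longlonglongrightarrow> 0"
    proof (rule nonneg_tendsto_0)
      show "expectation (\<lambda>\<omega>. (?X q \<omega> - I t \<omega>)\<^sup>2) \<le> 2 * ?e q" for q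
        using F(2)[of q] by (simp add: power2_commute)
      show "(\<lambda>q. 2 * ?e q) \<longlonglongrightarrow> 0" using tendsto_mult[OF tendsto_const[of 2] e0] by simp
    qed simp
    then show ?thesis unfolding L2_conv_def using sqX sI by blast
  qed
  then show ?thesis using S L2 by blast
qed

lemma ito_isometry:
  assumes I: "has_ito_integral M \<F> T (\<beta> k) \<phi> I" "sq_integrable prodM (\<lambda>x. \<phi> (fst x) (snd x))"
    and I': "has_ito_integral M \<F> T (\<beta> l) \<phi>' I'" "sq_integrable prodM (\<lambda>x. \<phi>' (fst x) (snd x))"
    and t: "t \<in> {0..T}"
  shows "sq_integrable M (I t)"
    and "expectation (\<lambda>\<omega>. I t \<omega> * I' t \<omega>) =
      (if k = l then \<integral>x. indicator {..t} (fst x) * (\<phi> (fst x) (snd x) * \<phi>' (fst x) (snd x)) \<partial>prodM else 0)"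
proof -
  obtain n \<tau> \<xi> where S: "\<And>r. simple_process M \<F> T (n r) (\<tau> r) (\<xi> r)"
    and L: "L2_conv prodM (\<lambda>r. sv (n r) (\<tau> r) (\<xi> r)) (\<lambda>x. \<phi> (fst x) (snd x))"
    and X: "L2_conv M (\<lambda>r. simple_integral (n r) (\<tau> r) (\<xi> r) (\<beta> k) t) (I t)"
    using ito_L2_approx[OF I] t by blast
  obtain n' \<tau>' \<xi>' where S': "\<And>r. simple_process M \<F> T (n' r) (\<tau>' r) (\<xi>' r)"
    and L': "L2_conv prodM (\<lambda>r. sv (n' r) (\<tau>' r) (\<xi>' r)) (\<lambda>x. \<phi>' (fst x) (snd x))"
    and X': "L2_conv M (\<lambda>r. simple_integral (n' r) (\<tau>' r) (\<xi>' r) (\<beta> l) t) (I' t)"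
    using ito_L2_approx[OF I'] t by blast
  show "sq_integrable M (I t)" by (rule L2_convD(2)[OF X])
  have "(\<lambda>r. expectation (\<lambda>\<omega>. simple_integral (n r) (\<tau> r) (\<xi> r) (\<beta> k) t \<omega> * simple_integral (n' r) (\<tau>' r) (\<xi>' r) (\<beta> l) t \<omega>))
      \<longlonglongrightarrow> (if k = l then \<integral>x. indicator {..t} (fst x) * (\<phi> (fst x) (snd x) * \<phi>' (fst x) (snd x)) \<partial>prodM else 0)"
  proof (cases "k = l")
    case True
    show ?thesis unfolding simple_isometry[OF S S' t] using True L2_conv_inner[OF L2_conv_upto[OF L] L'] by (simp add: mult.assoc)
  next
    case False
    then show ?thesis unfolding simple_isometry[OF S S' t] by simp
  qed
  from LIMSEQ_unique[OF L2_conv_inner[OF X X'] this]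
  show "expectation (\<lambda>\<omega>. I t \<omega> * I' t \<omega>) =
      (if k = l then \<integral>x. indicator {..t} (fst x) * (\<phi> (fst x) (snd x) * \<phi>' (fst x) (snd x)) \<partial>prodM else 0)" .
qed

text \<open>Grid times clamped to [s,t] leave only increments in the future of s, so
  \<open>Z\<close> is absorbed into the coefficient, and each summand is a known factor times a
  centred increment.\<close>

lemma simple_integral_martingale:
  assumes S: "simple_process M \<F> T n \<tau> \<xi>" and st: "0 \<le> s" "s \<le> t" "t \<le> T"
    and Z: "sq_integrable M Z" "Z \<in> borel_measurable (\<F> s)"
  shows "expectation (\<lambda>\<omega>. Z \<omega> * (simple_integral n \<tau> \<xi> (\<beta> k) t \<omega> - simple_integral n \<tau> \<xi> (\<beta> k) s \<omega>)) = 0"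
proof -
  note a = simple_processD[OF S]
  let ?a = "\<lambda>j. max s (min t (\<tau> j))"
  let ?f = "\<lambda>j \<omega>. (cut t (\<tau> j) (\<xi> j) \<omega> * Z \<omega>) * incr k (?a j) (?a (Suc j)) \<omega>"
  \<comment> \<open>Because \<open>s \<le> t\<close>, the difference of the paths capped at
    \<open>t\<close> and at \<open>s\<close> is an increment from \<open>s\<close> to the clamped
    time.\<close>
  have shift: "\<beta> k (min t x) \<omega> - \<beta> k (min s x) \<omega> = \<beta> k (max s (min t x)) \<omega> - \<beta> k s \<omega>" for x \<omega>
    using st by (auto simp: min_def max_def)
  have shifted: "\<xi> j \<omega> * (\<beta> k (min t (\<tau> (Suc j))) \<omega> - \<beta> k (min t (\<tau> j)) \<omega>)
        - \<xi> j \<omega> * (\<beta> k (min s (\<tau> (Suc j))) \<omega> - \<beta> k (min s (\<tau> j)) \<omega>)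
      = cut t (\<tau> j) (\<xi> j) \<omega> * incr k (?a j) (?a (Suc j)) \<omega>" if "j < n" for j \<omega>
  proof -
    have "\<xi> j \<omega> * (\<beta> k (min t (\<tau> (Suc j))) \<omega> - \<beta> k (min t (\<tau> j)) \<omega>)
        - \<xi> j \<omega> * (\<beta> k (min s (\<tau> (Suc j))) \<omega> - \<beta> k (min s (\<tau> j)) \<omega>)
      = \<xi> j \<omega> * ((\<beta> k (min t (\<tau> (Suc j))) \<omega> - \<beta> k (min s (\<tau> (Suc j))) \<omega>)
        - (\<beta> k (min t (\<tau> j)) \<omega> - \<beta> k (min s (\<tau> j)) \<omega>))" by (simp add: algebra_simps)
    also have "\<dots> = \<xi> j \<omega> * incr k (?a j) (?a (Suc j)) \<omega>" by (simp only: shift incr_def) (simp only: diff_diff_eq2 diff_add_cancel)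
    also have "\<dots> = cut t (\<tau> j) (\<xi> j) \<omega> * incr k (?a j) (?a (Suc j)) \<omega>"
    proof (cases "\<tau> j \<le> t")
      case False
      then have "min t (\<tau> j) = t" "min t (\<tau> (Suc j)) = t" using a(3)[OF that] by auto
      then show ?thesis by (simp only: incr_self mult_zero_right)
    qed (simp add: cut_def)
    finally show ?thesis .
  qed
  have "(\<lambda>\<omega>. Z \<omega> * (simple_integral n \<tau> \<xi> (\<beta> k) t \<omega> - simple_integral n \<tau> \<xi> (\<beta> k) s \<omega>)) = (\<lambda>\<omega>. \<Sum>j<n. ?f j \<omega>)"
  proof
    fix \<omega>
    have "simple_integral n \<tau> \<xi> (\<beta> k) t \<omega> - simple_integral n \<tau> \<xi> (\<beta> k) s \<omega> =
        (\<Sum>j<n. cut t (\<tau> j) (\<xi> j) \<omega> * incr k (?a j) (?a (Suc j)) \<omega>)"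
      unfolding simple_integral_def sum_subtractf[symmetric] by (rule sum.cong[OF refl]) (use shifted in simp)
    then show "Z \<omega> * (simple_integral n \<tau> \<xi> (\<beta> k) t \<omega> - simple_integral n \<tau> \<xi> (\<beta> k) s \<omega>) = (\<Sum>j<n. ?f j \<omega>)"
      by (simp only: sum_distrib_left mult_ac)
  qed
  moreover have f: "integrable M (?f j) \<and> expectation (?f j) = 0" if j: "j < n" for j
  proof -
    have b: "bounded_rv (?a j) (cut t (\<tau> j) (\<xi> j))"
    proof (rule bounded_rv_mono[OF _ _ bounded_rv_cut[OF a(4)[OF j]]])
      show "0 \<le> min t (\<tau> j)" using a(5)[of j] j st by simp
    qed simp
    have z: "Z \<in> borel_measurable (\<F> (?a j))" by (rule borel_measurable_filtration_mono[OF st(1) _ Z(2)]) simp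
    have a0: "0 \<le> ?a j" "?a j \<le> ?a (Suc j)" using st a(3)[OF j] by auto
    have "integrable M (\<lambda>\<omega>. cut t (\<tau> j) (\<xi> j) \<omega> * Z \<omega>)"
      by (rule sq_integrable_imp_integrable[OF finite_measure_axioms])
         (rule sq_integrable_bounded_rv_mult[OF a0(1) b Z(1)])
    moreover have "(\<lambda>\<omega>. cut t (\<tau> j) (\<xi> j) \<omega> * Z \<omega>) \<in> borel_measurable (\<F> (?a j))"
      by (rule borel_measurable_times[OF _ z]) (use b in \<open>simp add: bounded_rv_def\<close>)
    ultimately show ?thesis using mult_incr[OF a0] by blast
  qed
  ultimately show ?thesis by (simp add: Bochner_Integration.integral_sum)
qed

text \<open>The martingale property tested against \<open>Z\<close>, without conditional
  expectations: inner products pass to the limit in mean square.\<close>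

lemma ito_martingale:
  assumes I: "has_ito_integral M \<F> T (\<beta> k) \<phi> I" "sq_integrable prodM (\<lambda>x. \<phi> (fst x) (snd x))"
    and st: "0 \<le> s" "s \<le> t" "t \<le> T"
    and Z: "sq_integrable M Z" "Z \<in> borel_measurable (\<F> s)"
  shows "expectation (\<lambda>\<omega>. Z \<omega> * I t \<omega>) = expectation (\<lambda>\<omega>. Z \<omega> * I s \<omega>)"
proof -
  obtain n \<tau> \<xi> where S: "\<And>r. simple_process M \<F> T (n r) (\<tau> r) (\<xi> r)"
    and X: "\<And>t. t \<in> {0..T} \<Longrightarrow> L2_conv M (\<lambda>r. simple_integral (n r) (\<tau> r) (\<xi> r) (\<beta> k) t) (I t)"
    using ito_L2_approx[OF I] by blast
  have T: "t \<in> {0..T}" "s \<in> {0..T}" using st by auto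
  note c = L2_conv_inner[OF L2_conv_const[OF Z(1)] X[OF T(1)]] L2_conv_inner[OF L2_conv_const[OF Z(1)] X[OF T(2)]]
  have i: "integrable M (\<lambda>\<omega>. Z \<omega> * simple_integral (n r) (\<tau> r) (\<xi> r) (\<beta> k) u \<omega>)" if "u \<in> {0..T}" for r u
    by (rule sq_integrable_mult[OF Z(1) sq_integrable_simple_integral[OF S that]])
  have "expectation (\<lambda>\<omega>. Z \<omega> * simple_integral (n r) (\<tau> r) (\<xi> r) (\<beta> k) t \<omega>)
      = expectation (\<lambda>\<omega>. Z \<omega> * simple_integral (n r) (\<tau> r) (\<xi> r) (\<beta> k) s \<omega>)" for r
    using simple_integral_martingale[OF S st Z, of r k] i[OF T(1), of r] i[OF T(2), of r]
    by (simp add: right_diff_distrib)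
  then show ?thesis using LIMSEQ_unique[OF c(1)] c(2) by simp
qed

end

section \<open>Continuous processes\<close>

text \<open>Rounds down to the grid of step \<open>1 / real (Suc n)\<close>. The values are natural
  numbers, so that a process sampled at the rounded time is glued from countably many measurable
  pieces.\<close>

definition grid_floor :: "nat \<Rightarrow> real \<Rightarrow> nat" where
  "grid_floor n x = nat \<lfloor>real (Suc n) * x\<rfloor>"

lemma grid_floor_bounds:
  assumes "0 \<le> x"
  shows "x - 1 / real (Suc n) \<le> real (grid_floor n x) / real (Suc n)" "real (grid_floor n x) / real (Suc n) \<le> x"
proof -
  have "0 \<le> \<lfloor>real (Suc n) * x\<rfloor>" using assms by simp
  then have "real (grid_floor n x) = of_int \<lfloor>real (Suc n) * x\<rfloor>" by (simp add: grid_floor_def)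
  then have "real (Suc n) * x - 1 \<le> real (grid_floor n x)" "real (grid_floor n x) \<le> real (Suc n) * x"
    by linarith+
  note b = this
  have "x - 1 / real (Suc n) = (real (Suc n) * x - 1) / real (Suc n)" by (simp add: field_simps)
  also have "\<dots> \<le> real (grid_floor n x) / real (Suc n)" by (rule divide_right_mono[OF b(1)]) simp
  finally show "x - 1 / real (Suc n) \<le> real (grid_floor n x) / real (Suc n)" .
  have "real (grid_floor n x) / real (Suc n) \<le> (real (Suc n) * x) / real (Suc n)"
    by (rule divide_right_mono[OF b(2)]) simp
  then show "real (grid_floor n x) / real (Suc n) \<le> x" by simp
qed

lemma grid_floor_tendsto:
  assumes "0 \<le> x"
  shows "(\<lambda>n. real (grid_floor n x) / real (Suc n)) \<longlonglongrightarrow> x"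
proof (rule tendsto_sandwich[OF _ _ _ tendsto_const])
  have "(\<lambda>n. x - 1 / real (Suc n)) \<longlonglongrightarrow> x - 0"
    using LIMSEQ_inverse_real_of_nat by (intro tendsto_diff tendsto_const) (simp add: inverse_eq_divide)
  then show "(\<lambda>n. x - 1 / real (Suc n)) \<longlonglongrightarrow> x" by simp
qed (use grid_floor_bounds[OF assms] in auto)

text \<open>The function \<open>y\<close> is known only to be bounded and integrable, so the
  inequality is iterated instead of differentiated. Against the weight with doubled rate
  \<open>2 * c4\<close> each pass halves the contribution of the crude bound \<open>K\<close>, which
  therefore disappears from the conclusion; the enlarged constants are the price.\<close>

lemma gronwall_constant:
  fixes y :: "real \<Rightarrow> real"
  assumes y: "\<And>t. t \<in> {0..T} \<Longrightarrow> 0 \<le> y t \<and> y t \<le> K" and int: "set_integrable lborel {0..T} y"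
    and le: "\<And>t. t \<in> {0..T} \<Longrightarrow> y t \<le> c3 + c4 * (LBINT s:{0..t}. y s)"
    and c: "0 \<le> c3" "0 < c4" and t: "t \<in> {0..T}"
  shows "y t \<le> 2 * c3 * exp (2 * c4 * t)"
proof -
  have K: "0 \<le> K" using y[OF t] by simp
  have *: "y t \<le> (2 * c3 + K / 2 ^ n) * exp (2 * c4 * t)" if "t \<in> {0..T}" for n t
    using that
  proof (induction n arbitrary: t)
    case 0
    have "1 \<le> exp (2 * c4 * t)" using 0 c by simp
    moreover have "y t \<le> 2 * c3 + K" using y[OF 0] c by simp
    moreover have "0 \<le> 2 * c3 + K" using K c by simp
    ultimately show ?case using mult_left_mono[of 1 "exp (2 * c4 * t)" "2 * c3 + K"] by simp
  next
    case (Suc n)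
    let ?S = "2 * c3 + K / 2 ^ n"
    have S: "0 \<le> ?S" using K c by simp
    have it: "set_integrable lborel {0..t} y" by (rule set_integrable_subset[OF int]) (use Suc in auto)
    have ie: "set_integrable lborel {0..t} (\<lambda>s. ?S * exp (2 * c4 * s))"
      by (rule borel_integrable_atLeastAtMost') (intro continuous_intros)
    have E: "(LBINT s:{0..t}. ?S * exp (2 * c4 * s)) = ?S * (exp (2 * c4 * t) - 1) / (2 * c4)"
    proof -
      have "(\<integral>s. exp (2 * c4 * s) * indicator {0..t} s \<partial>lborel) =
          (\<lambda>s. exp (2 * c4 * s) / (2 * c4)) t - (\<lambda>s. exp (2 * c4 * s) / (2 * c4)) 0"
        by (rule integral_FTC_Icc_real) (use c Suc(2) in \<open>auto intro!: derivative_eq_intros simp: field_simps\<close>)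
      then have "(LBINT s:{0..t}. exp (2 * c4 * s)) = (exp (2 * c4 * t) - 1) / (2 * c4)"
        by (simp add: set_lebesgue_integral_def mult.commute diff_divide_distrib)
      then show ?thesis by (simp only: set_integral_mult_right times_divide_eq_right)
    qed
    have "(LBINT s:{0..t}. y s) \<le> (LBINT s:{0..t}. ?S * exp (2 * c4 * s))"
      by (rule set_integral_mono[OF it ie]) (use Suc in auto)
    then have "c4 * (LBINT s:{0..t}. y s) \<le> c4 * (?S * (exp (2 * c4 * t) - 1) / (2 * c4))"
      unfolding E using c by (intro mult_left_mono) auto
    also have "\<dots> = ?S / 2 * (exp (2 * c4 * t) - 1)" using c by (simp add: field_simps)
    finally have "y t \<le> c3 + ?S / 2 * (exp (2 * c4 * t) - 1)" using le[OF Suc(2)] by linarith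
    also have "\<dots> = (c3 + K / 2 ^ Suc n) * exp (2 * c4 * t) - K / 2 ^ Suc n" by (simp add: field_simps)
    also have "\<dots> \<le> (c3 + K / 2 ^ Suc n) * exp (2 * c4 * t)" using K by simp
    also have "\<dots> \<le> (2 * c3 + K / 2 ^ Suc n) * exp (2 * c4 * t)"
      using c by (intro mult_right_mono) auto
    finally show ?case .
  qed
  have "(\<lambda>n. K * (1 / 2) ^ n) \<longlonglongrightarrow> K * 0" by (intro tendsto_mult tendsto_const LIMSEQ_power_zero) simp
  then have "(\<lambda>n. (2 * c3 + K / 2 ^ n) * exp (2 * c4 * t)) \<longlonglongrightarrow> (2 * c3 + K * 0) * exp (2 * c4 * t)"
    by (intro tendsto_mult tendsto_add tendsto_const) (simp add: power_divide)
  from LIMSEQ_le_const[OF this] show ?thesis using *[OF t] by simp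
qed

context wiener_space
begin

section \<open>Time integrals of continuous paths\<close>

lemma borel_measurable_timeM_continuous:
  fixes h :: "real \<Rightarrow> real"
  assumes "continuous_on {0..T} h" shows "h \<in> borel_measurable timeM"
proof -
  have eq: "sets timeM = sets (restrict_space borel {0..T})"
    unfolding timeM_def by (rule sets_restrict_space_cong) simp
  show ?thesis
    unfolding measurable_cong_sets[OF eq refl] by (rule borel_measurable_continuous_on_restrict[OF assms])
qed

lemma sq_integrable_timeM_continuous:
  fixes h :: "real \<Rightarrow> real"
  assumes "continuous_on {0..T} h" shows "sq_integrable timeM h"
proof -
  have "bounded (h ` {0..T})" by (intro compact_imp_bounded compact_continuous_image assms) simp
  then obtain C where "\<forall>x\<in>h ` {0..T}. norm x \<le> C" unfolding bounded_iff by blast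
  then show ?thesis
    by (intro sq_integrable_bounded[OF tm.finite_measure_axioms borel_measurable_timeM_continuous[OF assms], of C])
       (auto simp: space_timeM)
qed

lemma sq_integrable_timeM_upto:
  assumes "sq_integrable timeM h" shows "sq_integrable timeM (\<lambda>s. indicator {..t} s * h s)"
proof (rule sq_integrable_bound[OF assms])
  show "(\<lambda>s. indicator {..t} s * h s) \<in> borel_measurable timeM"
    by (intro borel_measurable_times sq_integrableD(1)[OF assms] measurable_timeM) simp
  show "AE x in timeM. \<bar>indicator {..t} x * h x\<bar> \<le> \<bar>h x\<bar>" by (rule AE_I2) (simp add: indicator_def)
qed

lemma time_integral_square_le:
  assumes "sq_integrable timeM h"
  shows "(\<integral>s. h s \<partial>timeM)\<^sup>2 \<le> T * (\<integral>s. (h s)\<^sup>2 \<partial>timeM)"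
proof -
  have i: "integrable timeM h" by (rule sq_integrable_imp_integrable[OF tm.finite_measure_axioms assms])
  note i2 = sq_integrableD(2)[OF assms]
  \<comment> \<open>The time average of \<open>h\<close>. That the integral of the squared deviation
    from it is nonnegative is exactly the claim.\<close>
  let ?a = "(\<integral>s. h s \<partial>timeM) / T"
  have "0 \<le> (\<integral>s. (h s - ?a)\<^sup>2 \<partial>timeM)" by simp
  also have "\<dots> = (\<integral>s. (h s)\<^sup>2 - 2 * ?a * h s + ?a\<^sup>2 \<partial>timeM)"
    by (rule Bochner_Integration.integral_cong) (simp_all add: power2_eq_square algebra_simps)
  also have "\<dots> = (\<integral>s. (h s)\<^sup>2 \<partial>timeM) - 2 * ?a * (\<integral>s. h s \<partial>timeM) + ?a\<^sup>2 * T"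
    using i i2 by (simp add: measure_timeM)
  also have "\<dots> = (\<integral>s. (h s)\<^sup>2 \<partial>timeM) - (\<integral>s. h s \<partial>timeM)\<^sup>2 / T"
    using T_pos by (simp add: power2_eq_square field_simps)
  finally show ?thesis using T_pos by (simp add: field_simps)
qed

text \<open>Continuity is required at every point of \<open>space M\<close>, so that limits along
  grids of times exist everywhere and yield measurability on the product space.\<close>

definition cont_process :: "(real \<Rightarrow> 'w \<Rightarrow> real) \<Rightarrow> bool" where
  "cont_process X \<longleftrightarrow> (\<forall>t\<in>{0..T}. X t \<in> borel_measurable M) \<and> (\<forall>\<omega>\<in>space M. continuous_on {0..T} (\<lambda>t. X t \<omega>))"

lemma cont_processD:
  assumes "cont_process X"
  shows "t \<in> {0..T} \<Longrightarrow> X t \<in> borel_measurable M" "\<omega> \<in> space M \<Longrightarrow> continuous_on {0..T} (\<lambda>t. X t \<omega>)"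
  using assms unfolding cont_process_def by blast+

lemma cont_process_add:
  "cont_process X \<Longrightarrow> cont_process Y \<Longrightarrow> cont_process (\<lambda>t \<omega>. X t \<omega> + Y t \<omega>)"
  unfolding cont_process_def by (auto intro!: continuous_on_add borel_measurable_add)

lemma cont_process_compose:
  fixes h :: "real \<Rightarrow> real"
  assumes X: "cont_process X" and h: "continuous_on UNIV h"
  shows "cont_process (\<lambda>t \<omega>. h (X t \<omega>))"
  unfolding cont_process_def
proof (intro conjI ballI)
  show "(\<lambda>\<omega>. h (X t \<omega>)) \<in> borel_measurable M" if "t \<in> {0..T}" for t
    by (rule measurable_compose[OF cont_processD(1)[OF X that] borel_measurable_continuous_onI[OF h]])
  show "continuous_on {0..T} (\<lambda>t. h (X t \<omega>))" if "\<omega> \<in> space M" for \<omega>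
    by (rule continuous_on_compose2[OF h cont_processD(2)[OF X that]]) simp
qed

lemma cont_process_cmult: "cont_process X \<Longrightarrow> cont_process (\<lambda>t \<omega>. c * X t \<omega>)"
  by (erule cont_process_compose[where h="\<lambda>x. c * x"]) (intro continuous_intros)

lemma cont_process_diff:
  assumes "cont_process X" "cont_process Y" shows "cont_process (\<lambda>t \<omega>. X t \<omega> - Y t \<omega>)"
  using cont_process_add[OF assms(1) cont_process_cmult[OF assms(2), of "-1"]] by simp

lemma cont_process_sum:
  assumes "\<And>i. i \<in> J \<Longrightarrow> cont_process (X i)" shows "cont_process (\<lambda>t \<omega>. \<Sum>i\<in>J. X i t \<omega>)"
  unfolding cont_process_def
proof (intro conjI ballI)
  show "(\<lambda>\<omega>. \<Sum>i\<in>J. X i t \<omega>) \<in> borel_measurable M" if "t \<in> {0..T}" for t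
    by (intro borel_measurable_sum cont_processD(1)[OF assms that])
  show "continuous_on {0..T} (\<lambda>t. \<Sum>i\<in>J. X i t \<omega>)" if "\<omega> \<in> space M" for \<omega>
    by (intro continuous_on_sum cont_processD(2)[OF assms that])
qed

text \<open>By path continuity the process is the pointwise limit of its versions sampled at rounded
  times.\<close>

lemma cont_process_measurable:
  assumes X: "cont_process X"
  shows "(\<lambda>x. X (fst x) (snd x)) \<in> borel_measurable prodM"
proof (rule borel_measurable_LIMSEQ_real)
  \<comment> \<open>\<open>min T\<close> keeps every sample time inside \<open>{0..T}\<close>, even
    for indices that never occur; for s in \<open>{0..T}\<close> it has no effect.\<close>
  let ?s = "\<lambda>n s. min T (real (grid_floor n s) / real (Suc n))"
  show "(\<lambda>x. X (?s n (fst x)) (snd x)) \<in> borel_measurable prodM" for n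
  proof (rule measurable_compose_countable[where f="\<lambda>j x. X (min T (real j / real (Suc n))) (snd x)"])
    show "(\<lambda>x. X (min T (real j / real (Suc n))) (snd x)) \<in> borel_measurable prodM" for j
      by (rule measurable_snd_prodM[OF cont_processD(1)[OF X]]) (use T_pos in auto)
    have "grid_floor n \<in> borel \<rightarrow>\<^sub>M count_space UNIV"
      unfolding grid_floor_def[abs_def] by measurable
    then have "grid_floor n \<in> timeM \<rightarrow>\<^sub>M count_space UNIV"
      unfolding timeM_def by (intro measurable_restrict_space1) simp
    then show "(\<lambda>x. grid_floor n (fst x)) \<in> prodM \<rightarrow>\<^sub>M count_space UNIV"
      unfolding prodM_def by (rule measurable_compose[OF measurable_fst])
  qed
  fix x assume x: "x \<in> space prodM"
  then have s: "fst x \<in> {0..T}" "snd x \<in> space M" by (auto simp: space_prodM)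
  then have g: "?s n (fst x) = real (grid_floor n (fst x)) / real (Suc n)" for n
    using grid_floor_bounds(2)[of "fst x" n] by simp
  have "(\<lambda>n. real (grid_floor n (fst x)) / real (Suc n)) \<longlonglongrightarrow> fst x"
    using s by (intro grid_floor_tendsto) simp
  moreover have m: "\<forall>n. real (grid_floor n (fst x)) / real (Suc n) \<in> {0..T}"
    using grid_floor_bounds(2)[of "fst x"] s by (auto intro: order_trans)
  ultimately show "(\<lambda>n. X (?s n (fst x)) (snd x)) \<longlonglongrightarrow> X (fst x) (snd x)"
    unfolding g by (rule continuous_on_tendsto_compose[OF cont_processD(2)[OF X s(2)] _ s(1) always_eventually])
qed

definition bounded_events :: "nat \<Rightarrow> (nat \<Rightarrow> real \<Rightarrow> 'w \<Rightarrow> real) \<Rightarrow> real \<Rightarrow> real \<Rightarrow> 'w set" where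
  "bounded_events m X R s = {\<omega> \<in> space M. \<forall>i<m. \<forall>r\<in>{0..s}. \<bar>X i r \<omega>\<bar> \<le> R}"

text \<open>Continuity reduces the uncountable condition to the countably many times
  \<open>q n j * s\<close>. Fractions of s serve better than fixed rational times: they stay in
  \<open>{0..s}\<close>, they include s itself, and they depend continuously on s, which gives joint
  measurability.\<close>

lemma decreasing_bounded_events:
  assumes cont: "\<And>i. i < m \<Longrightarrow> cont_process (X i)"
    and adapted: "\<And>i t. i < m \<Longrightarrow> t \<in> {0..T} \<Longrightarrow> X i t \<in> borel_measurable (\<F> t)"
  shows "decreasing_events (bounded_events m X R)"
proof -
  define q where "q n j = min 1 (real j / real (Suc n))" for n j :: nat
  have q01: "0 \<le> q n j" "q n j \<le> 1" for n j by (auto simp: q_def)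
  have qT: "q n j * s \<in> {0..s}" if "0 \<le> s" for n j s
    using that q01[of n j] by (auto intro: mult_left_le_one_le)
  define Q where "Q s p \<omega> = (case p of (i, n, j) \<Rightarrow> i < m \<longrightarrow> \<bar>X i (q n j * s) \<omega>\<bar> \<le> R)" for s p \<omega>
  have eq: "(\<forall>i<m. \<forall>r\<in>{0..s}. \<bar>X i r \<omega>\<bar> \<le> R) \<longleftrightarrow> (\<forall>p. Q s p \<omega>)"
    if s: "s \<in> {0..T}" and w: "\<omega> \<in> space M" for s \<omega>
  proof
    assume "\<forall>i<m. \<forall>r\<in>{0..s}. \<bar>X i r \<omega>\<bar> \<le> R"
    then show "\<forall>p. Q s p \<omega>" using qT[of s] s by (auto simp: Q_def)
  next
    assume a: "\<forall>p. Q s p \<omega>"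
    show "\<forall>i<m. \<forall>r\<in>{0..s}. \<bar>X i r \<omega>\<bar> \<le> R"
    proof (intro allI impI ballI)
      fix i r assume i: "i < m" and r: "r \<in> {0..s}"
      have b: "\<bar>X i (q n j * s) \<omega>\<bar> \<le> R" for n j using a[rule_format, of "(i, n, j)"] i by (simp add: Q_def)
      show "\<bar>X i r \<omega>\<bar> \<le> R"
      \<comment> \<open>The ratio \<open>r / s\<close> is meaningful only for positive
        \<open>s\<close>; at 0 the single time 0 is sampled directly.\<close>
      proof (cases "s = 0")
        case True then show ?thesis using b[of 0 0] r by simp
      next
        case False
        let ?x = "r / s"
        have x: "0 \<le> ?x" "?x \<le> 1" "?x * s = r" using r False by auto
        let ?q = "\<lambda>n. q n (grid_floor n ?x)"
        have qe: "?q n = real (grid_floor n ?x) / real (Suc n)" for n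
          using grid_floor_bounds(2)[OF x(1), of n] x(2) by (simp add: q_def)
        have "(\<lambda>n. ?q n * s) \<longlonglongrightarrow> ?x * s"
          unfolding qe by (rule tendsto_mult_right[OF grid_floor_tendsto[OF x(1)]])
        then have "(\<lambda>n. ?q n * s) \<longlonglongrightarrow> r" using x by simp
        moreover have "r \<in> {0..T}" using r s by simp
        moreover have "\<forall>n. ?q n * s \<in> {0..T}"
        proof
          fix n show "?q n * s \<in> {0..T}" using qT[of s n "grid_floor n ?x"] s by auto
        qed
        ultimately have "(\<lambda>n. X i (?q n * s) \<omega>) \<longlonglongrightarrow> X i r \<omega>"
          by (rule continuous_on_tendsto_compose[OF cont_processD(2)[OF cont[OF i] w] _ _ always_eventually])
        then have "(\<lambda>n. \<bar>X i (?q n * s) \<omega>\<bar>) \<longlonglongrightarrow> \<bar>X i r \<omega>\<bar>" by (rule tendsto_rabs)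
        from LIMSEQ_le_const2[OF this] show ?thesis using b by blast
      qed
    qed
  qed
  show ?thesis
    unfolding decreasing_events_def
  proof (intro conjI ballI allI impI)
    fix s assume s: "s \<in> {0..T}"
    then have sp: "space (\<F> s) = space M" by (intro space_filtration) simp
    have "{\<omega> \<in> space (\<F> s). \<forall>p. Q s p \<omega>} \<in> sets (\<F> s)"
    proof (rule sets.sets_Collect_countable_All)
      fix p :: "nat \<times> nat \<times> nat"
      obtain i n j where p: "p = (i, n, j)" by (cases p)
      show "{\<omega> \<in> space (\<F> s). Q s p \<omega>} \<in> sets (\<F> s)"
      proof (cases "i < m")
        case False then show ?thesis by (simp add: Q_def p)
      next
        case True
        have qs: "0 \<le> q n j * s" "q n j * s \<le> s" "q n j * s \<in> {0..T}" using qT[of s n j] s by auto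
        have "X i (q n j * s) \<in> borel_measurable (\<F> s)"
          by (rule borel_measurable_filtration_mono[OF qs(1,2) adapted[OF True qs(3)]])
        then have "(\<lambda>\<omega>. \<bar>X i (q n j * s) \<omega>\<bar>) \<in> borel_measurable (\<F> s)" by (rule borel_measurable_abs)
        from borel_measurable_le[OF this borel_measurable_const[of R]] show ?thesis using True by (simp add: Q_def p)
      qed
    qed
    moreover have "bounded_events m X R s = {\<omega> \<in> space (\<F> s). \<forall>p. Q s p \<omega>}"
      unfolding bounded_events_def sp using eq[OF s] by blast
    ultimately show "bounded_events m X R s \<in> sets (\<F> s)" by simp
  next
    fix s t :: real assume "0 \<le> s" "s \<le> t" "t \<le> T"
    then show "bounded_events m X R t \<subseteq> bounded_events m X R s" by (auto simp: bounded_events_def)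
  next
    have S: "{x \<in> space prodM. \<forall>p. Q (fst x) p (snd x)} \<in> sets prodM"
    proof (rule sets.sets_Collect_countable_All)
      fix p :: "nat \<times> nat \<times> nat"
      obtain i n j where p: "p = (i, n, j)" by (cases p)
      show "{x \<in> space prodM. Q (fst x) p (snd x)} \<in> sets prodM"
      proof (cases "i < m")
        case False then show ?thesis by (simp add: Q_def p)
      next
        case True
        have qs: "q n j * s \<in> {0..T}" if "s \<in> {0..T}" for s using qT[of s n j] that by auto
        \<comment> \<open>Rescaling time by a fixed fraction keeps the paths continuous, so joint
          measurability of continuous processes applies.\<close>
        have "cont_process (\<lambda>s. X i (q n j * s))"
          unfolding cont_process_def
        proof (intro conjI ballI)
          show "X i (q n j * s) \<in> borel_measurable M" if "s \<in> {0..T}" for s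
            by (rule cont_processD(1)[OF cont[OF True] qs[OF that]])
          show "continuous_on {0..T} (\<lambda>s. X i (q n j * s) \<omega>)" if "\<omega> \<in> space M" for \<omega>
            by (rule continuous_on_compose2[OF cont_processD(2)[OF cont[OF True] that]])
               (use qs in \<open>auto intro!: continuous_intros\<close>)
        qed
        from borel_measurable_abs[OF cont_process_measurable[OF this]]
        have "(\<lambda>x. \<bar>X i (q n j * fst x) (snd x)\<bar>) \<in> borel_measurable prodM" .
        from borel_measurable_le[OF this borel_measurable_const[of R]] show ?thesis using True by (simp add: Q_def p)
      qed
    qed
    have e: "ind (bounded_events m X R) x = indicator {x \<in> space prodM. \<forall>p. Q (fst x) p (snd x)} x"
      if "x \<in> space prodM" for x
    proof -
      have "fst x \<in> {0..T}" "snd x \<in> space M" using that by (auto simp: space_prodM)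
      then show ?thesis using eq[of "fst x" "snd x"] that by (simp add: ind_def bounded_events_def indicator_def)
    qed
    show "ind (bounded_events m X R) \<in> borel_measurable prodM"
      by (subst measurable_cong[OF e]) (use S in \<open>simp_all add: borel_measurable_indicator\<close>)
  qed
qed

lemma sq_integrable_prodM_bounded_moments:
  assumes X: "X \<in> borel_measurable prodM"
    and b: "\<And>s. s \<in> {0..T} \<Longrightarrow> sq_integrable M (\<lambda>\<omega>. X (s, \<omega>))"
      "\<And>s. s \<in> {0..T} \<Longrightarrow> expectation (\<lambda>\<omega>. (X (s, \<omega>))\<^sup>2) \<le> C"
  shows "sq_integrable prodM X"
proof (rule sq_integrableI[OF X])
  have X2: "(\<lambda>x. (X x)\<^sup>2) \<in> borel_measurable (timeM \<Otimes>\<^sub>M M)"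
    using borel_measurable_power[OF X, of 2] unfolding prodM_def .
  show "integrable prodM (\<lambda>x. (X x)\<^sup>2)"
    unfolding prodM_def
  proof (rule pm.Fubini_integrable[OF X2])
    have "(\<lambda>s. \<integral>\<omega>. (X (s, \<omega>))\<^sup>2 \<partial>M) \<in> borel_measurable timeM"
      by (rule borel_measurable_lebesgue_integral) (use X2 in \<open>simp add: case_prod_beta'\<close>)
    then show "integrable timeM (\<lambda>s. \<integral>\<omega>. norm ((X (s, \<omega>))\<^sup>2) \<partial>M)"
      by (intro tm.integrable_const_bound[of _ C]) (use b in \<open>auto intro!: AE_I2 simp: space_timeM\<close>)
    show "AE s in timeM. integrable M (\<lambda>\<omega>. (X (s, \<omega>))\<^sup>2)"
      by (rule AE_I2) (use b(1) in \<open>auto simp: space_timeM dest: sq_integrableD\<close>)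
  qed
qed

end

section \<open>Moment bounds for the scheme\<close>

lemma lipschitz_square_growth:
  fixes h :: "real \<Rightarrow> real"
  assumes "L-lipschitz_on UNIV h"
  shows "\<exists>C\<ge>0. \<forall>x. (h x)\<^sup>2 \<le> C * (1 + x\<^sup>2)"
proof (intro exI[of _ "2 * (h 0)\<^sup>2 + 2 * L\<^sup>2"] conjI allI)
  fix x
  have "\<bar>h x - h 0\<bar> \<le> \<bar>L * x\<bar>"
    using lipschitz_onD[OF assms, of x 0] lipschitz_on_nonneg[OF assms] by (simp add: dist_real_def abs_mult)
  then have "(h x - h 0)\<^sup>2 \<le> (L * x)\<^sup>2" by (rule sq_le_sq_of_abs_le)
  then have "(h x)\<^sup>2 \<le> 2 * (L * x)\<^sup>2 + 2 * (h 0)\<^sup>2" using sq_add_le[of "h x - h 0" "h 0"] by simp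
  also have "\<dots> \<le> (2 * (h 0)\<^sup>2 + 2 * L\<^sup>2) * (1 + x\<^sup>2)"
  proof -
    have "(2 * (h 0)\<^sup>2 + 2 * L\<^sup>2) * (1 + x\<^sup>2) = 2 * (L * x)\<^sup>2 + 2 * (h 0)\<^sup>2 + (2 * L\<^sup>2 + 2 * (h 0 * x)\<^sup>2)"
      by (simp add: algebra_simps power_mult_distrib)
    then show ?thesis by simp
  qed
  finally show "(h x)\<^sup>2 \<le> (2 * (h 0)\<^sup>2 + 2 * L\<^sup>2) * (1 + x\<^sup>2)" .
qed simp

lemma sq_add3_le: "(x + y + z)\<^sup>2 \<le> 3 * x\<^sup>2 + 3 * y\<^sup>2 + 3 * z\<^sup>2" for x y z :: real
  using sum_squares_bound[of x y] sum_squares_bound[of x z] sum_squares_bound[of y z]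
  by (simp add: power2_eq_square algebra_simps)

text \<open>The scheme by components: \<open>B\<close> stands for the entries of the matrix A^-1 D,
  and \<open>c i k\<close> for the k-th eigenfunction at the i-th node times the root of its
  eigenvalue. The moment bounds hold for arbitrary \<open>B\<close>; symmetry enters later, through
  the energy.\<close>

locale semidiscrete_scheme = wiener_space M \<F> \<beta> T
  for M :: "'w measure" and \<F> :: "real \<Rightarrow> 'w measure" and \<beta> :: "nat \<Rightarrow> real \<Rightarrow> 'w \<Rightarrow> real" and T :: real +
  fixes m P :: nat and u v :: "nat \<Rightarrow> real \<Rightarrow> 'w \<Rightarrow> real" and I :: "nat \<Rightarrow> nat \<Rightarrow> real \<Rightarrow> 'w \<Rightarrow> real"
    and B c :: "nat \<Rightarrow> nat \<Rightarrow> real" and f g :: "real \<Rightarrow> real" and Lf Lg :: real and u0 v0 :: "nat \<Rightarrow> real"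
  assumes u_cont: "\<And>i \<omega>. i < m \<Longrightarrow> \<omega> \<in> space M \<Longrightarrow> continuous_on {0..T} (\<lambda>t. u i t \<omega>)"
    and v_cont: "\<And>i \<omega>. i < m \<Longrightarrow> \<omega> \<in> space M \<Longrightarrow> continuous_on {0..T} (\<lambda>t. v i t \<omega>)"
    and u_adapted: "\<And>i t. i < m \<Longrightarrow> t \<in> {0..T} \<Longrightarrow> u i t \<in> borel_measurable (\<F> t)"
    and v_adapted: "\<And>i t. i < m \<Longrightarrow> t \<in> {0..T} \<Longrightarrow> v i t \<in> borel_measurable (\<F> t)"
    and f_lip: "Lf-lipschitz_on UNIV f" and g_lip: "Lg-lipschitz_on UNIV g"
    and ito: "\<And>i k. i < m \<Longrightarrow> k < P \<Longrightarrow> has_ito_integral M \<F> T (\<beta> k) (\<lambda>s \<omega>. g (u i s \<omega>) * c i k) (I i k)"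
    and u_eq: "\<And>i t. i < m \<Longrightarrow> t \<in> {0..T} \<Longrightarrow> AE \<omega> in M. u i t \<omega> = u0 i + (LBINT s:{0..t}. v i s \<omega>)"
    and v_init: "\<And>i. i < m \<Longrightarrow> AE \<omega> in M. v i 0 \<omega> = v0 i"
    and v_eq: "\<And>i t. i < m \<Longrightarrow> t \<in> {0..T} \<Longrightarrow> AE \<omega> in M. v i t \<omega> = v0 i
      + (LBINT s:{0..t}. (\<Sum>j<m. B i j * u j s \<omega>) - f (u i s \<omega>)) + (\<Sum>k<P. I i k t \<omega>)"
begin

section \<open>Linear growth of the coefficients\<close>

definition drift :: "nat \<Rightarrow> real \<Rightarrow> 'w \<Rightarrow> real" where
  "drift i s \<omega> = (\<Sum>j<m. B i j * u j s \<omega>) - f (u i s \<omega>)"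

definition noise :: "nat \<Rightarrow> nat \<Rightarrow> real \<Rightarrow> 'w \<Rightarrow> real" where
  "noise i k s \<omega> = g (u i s \<omega>) * c i k"

lemma cont_u: "i < m \<Longrightarrow> cont_process (u i)"
  unfolding cont_process_def
  by (intro conjI ballI u_cont) (auto intro: borel_measurable_filtration[OF _ u_adapted])

lemma cont_v: "i < m \<Longrightarrow> cont_process (v i)"
  unfolding cont_process_def
  by (intro conjI ballI v_cont) (auto intro: borel_measurable_filtration[OF _ v_adapted])

lemma continuous_f: "continuous_on UNIV f"
  using f_lip by (rule lipschitz_on_continuous_on)

lemma continuous_g: "continuous_on UNIV g"
  using g_lip by (rule lipschitz_on_continuous_on)

lemma cont_drift:
  assumes "i < m" shows "cont_process (drift i)"
  unfolding drift_def[abs_def]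
  by (intro cont_process_diff cont_process_sum cont_process_cmult cont_u
      cont_process_compose[OF cont_u continuous_f]) (use assms in auto)

lemma cont_noise:
  assumes "i < m" shows "cont_process (noise i k)"
proof -
  have "cont_process (\<lambda>s \<omega>. c i k * g (u i s \<omega>))"
    by (intro cont_process_cmult cont_process_compose[OF cont_u continuous_g] assms)
  then show ?thesis by (simp add: noise_def[abs_def] mult.commute)
qed

definition u_sq :: "real \<times> 'w \<Rightarrow> real" where
  "u_sq x = (\<Sum>j<m. (u j (fst x) (snd x))\<^sup>2)"

lemma u_sq_member: "i < m \<Longrightarrow> (u i (fst x) (snd x))\<^sup>2 \<le> u_sq x"
  unfolding u_sq_def by (rule member_le_sum) auto

lemma u_sq_nonneg: "0 \<le> u_sq x"
  unfolding u_sq_def by (rule sum_nonneg) simp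

lemma noise_growth: "\<exists>C\<ge>0. \<forall>i<m. \<forall>k<P. \<forall>x. (noise i k (fst x) (snd x))\<^sup>2 \<le> C * (1 + u_sq x)"
proof -
  obtain C where C: "C \<ge> 0" "\<And>x. (g x)\<^sup>2 \<le> C * (1 + x\<^sup>2)" using lipschitz_square_growth[OF g_lip] by blast
  let ?S = "\<Sum>i<m. \<Sum>k<P. (c i k)\<^sup>2"
  have S: "(c i k)\<^sup>2 \<le> ?S" if "i < m" "k < P" for i k
  proof -
    have "(c i k)\<^sup>2 \<le> (\<Sum>k<P. (c i k)\<^sup>2)" by (rule member_le_sum) (use that in auto)
    also have "\<dots> \<le> ?S" by (rule member_le_sum[of i _ "\<lambda>i. \<Sum>k<P. (c i k)\<^sup>2"]) (use that in \<open>auto intro: sum_nonneg\<close>)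
    finally show ?thesis .
  qed
  have S0: "0 \<le> ?S" by (intro sum_nonneg) simp
  show ?thesis
  proof (intro exI[of _ "C * ?S"] conjI allI impI)
    show "0 \<le> C * ?S" using C S0 by simp
    fix i k x assume ik: "i < m" "k < P"
    have "(g (u i (fst x) (snd x)))\<^sup>2 \<le> C * (1 + u_sq x)"
      by (rule order_trans[OF C(2)]) (intro mult_left_mono add_left_mono u_sq_member ik C(1))
    from mult_mono[OF this S[OF ik]] show "(noise i k (fst x) (snd x))\<^sup>2 \<le> C * ?S * (1 + u_sq x)"
      using C u_sq_nonneg[of x] by (simp add: noise_def power_mult_distrib mult_ac)
  qed
qed

lemma drift_growth: "\<exists>C\<ge>0. \<forall>i<m. \<forall>x. (drift i (fst x) (snd x))\<^sup>2 \<le> C * (1 + u_sq x)"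
proof -
  obtain C where C: "C \<ge> 0" "\<And>x. (f x)\<^sup>2 \<le> C * (1 + x\<^sup>2)" using lipschitz_square_growth[OF f_lip] by blast
  let ?S = "\<Sum>i<m. \<Sum>j<m. (B i j)\<^sup>2"
  have S: "(B i k)\<^sup>2 \<le> ?S" if "i < m" "k < m" for i k
  proof -
    have "(B i k)\<^sup>2 \<le> (\<Sum>k<m. (B i k)\<^sup>2)" by (rule member_le_sum) (use that in auto)
    also have "\<dots> \<le> ?S" by (rule member_le_sum[of i _ "\<lambda>i. \<Sum>k<m. (B i k)\<^sup>2"]) (use that in \<open>auto intro: sum_nonneg\<close>)
    finally show ?thesis .
  qed
  have S0: "0 \<le> ?S" by (intro sum_nonneg) simp
  show ?thesis
  proof (intro exI[of _ "2 * (real m * ?S) + 2 * C"] conjI allI impI)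
    show "0 \<le> 2 * (real m * ?S) + 2 * C" using C S0 by simp
    fix i x assume i: "i < m"
    let ?u = "\<lambda>j. u j (fst x) (snd x)"
    have "(\<Sum>j<m. B i j * ?u j)\<^sup>2 \<le> (\<Sum>j<m. (B i j * ?u j)\<^sup>2) * real m"
      using sum_squared_le_sum_of_squares[of "\<lambda>j. B i j * ?u j" "{..<m}"] by simp
    also have "\<dots> \<le> (\<Sum>j<m. ?S * (?u j)\<^sup>2) * real m"
      by (intro mult_right_mono sum_mono) (auto simp: power_mult_distrib intro!: mult_right_mono S i)
    also have "\<dots> = real m * ?S * u_sq x" unfolding u_sq_def by (subst sum_distrib_left[symmetric]) (simp only: mult_ac)
    also have "\<dots> \<le> real m * ?S * (1 + u_sq x)" using S0 by (intro mult_left_mono) auto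
    finally have 1: "(\<Sum>j<m. B i j * ?u j)\<^sup>2 \<le> real m * ?S * (1 + u_sq x)" .
    have 2: "(f (?u i))\<^sup>2 \<le> C * (1 + u_sq x)"
      by (rule order_trans[OF C(2)]) (intro mult_left_mono add_left_mono u_sq_member i C(1))
    have "(drift i (fst x) (snd x))\<^sup>2 \<le> 2 * (\<Sum>j<m. B i j * ?u j)\<^sup>2 + 2 * (f (?u i))\<^sup>2"
      using sq_diff_le[of "\<Sum>j<m. B i j * ?u j" "f (?u i)" 0] by (simp add: drift_def)
    also have "\<dots> \<le> (2 * (real m * ?S) + 2 * C) * (1 + u_sq x)"
      using 1 2 by (simp add: distrib_right mult.assoc)
    finally show "(drift i (fst x) (snd x))\<^sup>2 \<le> (2 * (real m * ?S) + 2 * C) * (1 + u_sq x)" .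
  qed
qed

text \<open>The condition concerns U alone: by linear growth, drift and noise are bounded wherever U
  is, whereas V need not be.\<close>

definition inside :: "real \<Rightarrow> real \<Rightarrow> 'w set" where
  "inside R = bounded_events m u R"

lemma decreasing_inside: "decreasing_events (inside R)"
  unfolding inside_def by (rule decreasing_bounded_events) (use cont_u u_adapted in auto)

lemma inside_le: "\<omega> \<in> inside R s \<Longrightarrow> r \<in> {0..s} \<Longrightarrow> i < m \<Longrightarrow> \<bar>u i r \<omega>\<bar> \<le> R"
  by (auto simp: inside_def bounded_events_def)

lemma ind_inside_upto: "\<omega> \<in> inside R t \<Longrightarrow> 0 \<le> s \<Longrightarrow> s \<le> t \<Longrightarrow> t \<le> T \<Longrightarrow> ind (inside R) (s, \<omega>) = 1"
  using decreasing_eventsD(2)[OF decreasing_inside, of s t R] by (auto simp: ind_def)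

lemma inside_events: "t \<in> {0..T} \<Longrightarrow> inside R t \<in> events"
  using decreasing_eventsD(1)[OF decreasing_inside, of t R] sets_filtration[of t] by auto

lemma ind_inside_u_sq:
  assumes "x \<in> space prodM" shows "ind (inside R) x * u_sq x \<le> real m * R\<^sup>2"
proof (cases "snd x \<in> inside R (fst x)")
  case True
  have x0: "0 \<le> fst x" using assms by (auto simp: space_prodM)
  have "u_sq x \<le> (\<Sum>j<m. R\<^sup>2)"
    unfolding u_sq_def
  proof (rule sum_mono)
    fix j assume "j \<in> {..<m}"
    then have "\<bar>u j (fst x) (snd x)\<bar> \<le> \<bar>R\<bar>" using inside_le[OF True, of "fst x" j] x0 by simp
    then show "(u j (fst x) (snd x))\<^sup>2 \<le> R\<^sup>2" by (rule sq_le_sq_of_abs_le)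
  qed
  then show ?thesis using True by (simp add: ind_def)
qed (simp add: ind_def)

lemma sq_integrable_inside:
  assumes h: "h \<in> borel_measurable prodM" and C: "0 \<le> C" "\<And>x. (h x)\<^sup>2 \<le> C * (1 + u_sq x)"
  shows "sq_integrable prodM (\<lambda>x. ind (inside R) x * h x)"
proof (rule sq_integrable_bounded[OF fp.finite_measure_axioms])
  show "(\<lambda>x. ind (inside R) x * h x) \<in> borel_measurable prodM"
    by (intro borel_measurable_times decreasing_eventsD(3)[OF decreasing_inside] h)
  fix x assume x: "x \<in> space prodM"
  have "(ind (inside R) x * h x)\<^sup>2 = ind (inside R) x * (h x)\<^sup>2"
    using ind_cases[of "inside R" x] by auto
  also have "\<dots> \<le> ind (inside R) x * (C * (1 + u_sq x))"
    using C(2)[of x] ind_cases[of "inside R" x] by auto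
  also have "\<dots> = C * (ind (inside R) x + ind (inside R) x * u_sq x)" by (simp add: algebra_simps)
  also have "\<dots> \<le> C * (1 + real m * R\<^sup>2)"
    using ind_inside_u_sq[OF x, of R] ind_cases[of "inside R" x] by (intro mult_left_mono add_mono C(1)) auto
  finally show "\<bar>ind (inside R) x * h x\<bar> \<le> sqrt (C * (1 + real m * R\<^sup>2))"
    using real_le_rsqrt[of "\<bar>ind (inside R) x * h x\<bar>"] by simp
qed

lemma sq_integrable_inside_noise: "i < m \<Longrightarrow> k < P \<Longrightarrow> sq_integrable prodM (\<lambda>x. ind (inside R) x * noise i k (fst x) (snd x))"
  using noise_growth cont_process_measurable[OF cont_noise] sq_integrable_inside by blast

lemma sq_integrable_inside_drift: "i < m \<Longrightarrow> sq_integrable prodM (\<lambda>x. ind (inside R) x * drift i (fst x) (snd x))"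
  using drift_growth cont_process_measurable[OF cont_drift] sq_integrable_inside by blast

section \<open>Second moments on the truncation events\<close>

lemma integrable_prodM_upto:
  assumes "integrable prodM h" shows "integrable prodM (\<lambda>x. indicator {..t} (fst x) * h x :: real)"
proof (rule Bochner_Integration.integrable_bound[OF assms])
  show "(\<lambda>x. indicator {..t} (fst x) * h x) \<in> borel_measurable prodM"
    by (intro borel_measurable_times measurable_fst_prodM borel_measurable_integrable[OF assms]) simp
qed (simp add: indicator_def)

lemma integral_prodM_upto:
  assumes "integrable prodM (\<lambda>x. h (fst x) (snd x) :: real)"
  shows "(\<integral>x. indicator {..t} (fst x) * h (fst x) (snd x) \<partial>prodM) = (\<integral>\<omega>. \<integral>s. indicator {..t} s * h s \<omega> \<partial>timeM \<partial>M)"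
    "integrable M (\<lambda>\<omega>. \<integral>s. indicator {..t} s * h s \<omega> \<partial>timeM)"
    "(\<integral>x. indicator {..t} (fst x) * h (fst x) (snd x) \<partial>prodM) = (\<integral>s. indicator {..t} s * (\<integral>\<omega>. h s \<omega> \<partial>M) \<partial>timeM)"
  using integral_prodM[of "\<lambda>s \<omega>. indicator {..t} s * h s \<omega>", OF integrable_prodM_upto[OF assms]] by simp_all

text \<open>The equation for V is multiplied by the indicator of the event at time \<open>t\<close>.
  Of the constants, 3 comes from squaring three summands, \<open>T\<close> from Cauchy-Schwarz in
  time, and \<open>real P\<close> from squaring the sum over the noise modes; the stochastic
  integrals enter through \<open>ito_truncated_second_moment\<close>.\<close>

lemma truncated_v_moment:
  assumes i: "i < m" and t: "t \<in> {0..T}"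
  shows "sq_integrable M (\<lambda>\<omega>. indicator (inside R t) \<omega> * v i t \<omega>)"
    "expectation (\<lambda>\<omega>. (indicator (inside R t) \<omega> * v i t \<omega>)\<^sup>2) \<le> 3 * (v0 i)\<^sup>2
      + 3 * T * (\<integral>x. indicator {..t} (fst x) * (ind (inside R) x * drift i (fst x) (snd x))\<^sup>2 \<partial>prodM)
      + 3 * real P * (\<Sum>k<P. \<integral>x. indicator {..t} (fst x) * (ind (inside R) x * noise i k (fst x) (snd x))\<^sup>2 \<partial>prodM)"
proof -
  let ?A = "inside R t" and ?d = "\<lambda>s \<omega>. (ind (inside R) (s, \<omega>) * drift i s \<omega>)\<^sup>2"
  have id: "integrable prodM (\<lambda>x. ?d (fst x) (snd x))" using sq_integrableD(2)[OF sq_integrable_inside_drift[OF i, of R]] by simp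
  have ito': "has_ito_integral M \<F> T (\<beta> k) (noise i k) (I i k)" if "k < P" for k
    using ito[OF i that] by (simp add: noise_def[abs_def])
  note mom = ito_truncated_second_moment[OF ito' decreasing_inside sq_integrable_inside_noise[OF i] t]
  let ?D = "\<lambda>\<omega>. \<integral>s. indicator {..t} s * ?d s \<omega> \<partial>timeM"
  let ?N = "\<lambda>\<omega>. \<Sum>k<P. (indicator ?A \<omega> * I i k t \<omega>)\<^sup>2"
  let ?G = "\<lambda>\<omega>. 3 * (v0 i)\<^sup>2 + 3 * T * ?D \<omega> + 3 * real P * ?N \<omega>"
  note D = integral_prodM_upto[where h="?d", OF id]
  have iN: "integrable M ?N" by (rule Bochner_Integration.integrable_sum) (use sq_integrableD(2)[OF mom(1)] in auto)
  have iG: "integrable M ?G"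
    by (intro Bochner_Integration.integrable_add integrable_mult_right integrable_const D(2) iN)
  have v: "AE \<omega> in M. v i t \<omega> = v0 i + (LBINT s:{0..t}. drift i s \<omega>) + (\<Sum>k<P. I i k t \<omega>)"
    using v_eq[OF i t] by (simp add: drift_def)
  have "AE \<omega> in M. \<omega> \<in> space M" by (rule AE_I2)
  with v have le: "AE \<omega> in M. (indicator ?A \<omega> * v i t \<omega>)\<^sup>2 \<le> ?G \<omega>"
  proof eventually_elim
    fix \<omega> assume v: "v i t \<omega> = v0 i + (LBINT s:{0..t}. drift i s \<omega>) + (\<Sum>k<P. I i k t \<omega>)" and w: "\<omega> \<in> space M"
    have D0: "0 \<le> ?D \<omega>" by (intro Bochner_Integration.integral_nonneg) simp
    have N0: "0 \<le> ?N \<omega>" by (intro sum_nonneg) simp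
    show "(indicator ?A \<omega> * v i t \<omega>)\<^sup>2 \<le> ?G \<omega>"
    proof (cases "\<omega> \<in> ?A")
      case False
      then show ?thesis using D0 N0 T_pos by simp
    next
      case True
      have sd: "sq_integrable timeM (\<lambda>s. indicator {..t} s * drift i s \<omega>)"
        by (intro sq_integrable_timeM_upto sq_integrable_timeM_continuous cont_processD(2)[OF cont_drift[OF i] w])
      have "(LBINT s:{0..t}. drift i s \<omega>)\<^sup>2 \<le> T * (\<integral>s. (indicator {..t} s * drift i s \<omega>)\<^sup>2 \<partial>timeM)"
        using time_integral_square_le[OF sd] by (simp add: integral_upto[OF t])
      \<comment> \<open>Being inside at \<open>t\<close> means being inside at all earlier times, so
        along this path the drift coincides with its truncation.\<close>
      also have "(\<integral>s. (indicator {..t} s * drift i s \<omega>)\<^sup>2 \<partial>timeM) = ?D \<omega>"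
      proof (rule Bochner_Integration.integral_cong[OF refl])
        fix s assume "s \<in> space timeM"
        then show "(indicator {..t} s * drift i s \<omega>)\<^sup>2 = indicator {..t} s * ?d s \<omega>"
          using ind_inside_upto[OF True, of s] t by (auto simp: indicator_def space_timeM)
      qed
      finally have 1: "(LBINT s:{0..t}. drift i s \<omega>)\<^sup>2 \<le> T * ?D \<omega>" .
      have 2: "(\<Sum>k<P. I i k t \<omega>)\<^sup>2 \<le> real P * ?N \<omega>"
        using sum_squared_le_sum_of_squares[of "\<lambda>k. I i k t \<omega>" "{..<P}"] True by (simp add: mult.commute)
      have "(v i t \<omega>)\<^sup>2 \<le> 3 * (v0 i)\<^sup>2 + 3 * (LBINT s:{0..t}. drift i s \<omega>)\<^sup>2 + 3 * (\<Sum>k<P. I i k t \<omega>)\<^sup>2"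
        unfolding v by (rule sq_add3_le)
      also have "\<dots> \<le> ?G \<omega>" using 1 2 by (simp add: mult.assoc)
      finally show ?thesis using True by simp
    qed
  qed
  have mv: "(\<lambda>\<omega>. indicator ?A \<omega> * v i t \<omega>) \<in> borel_measurable M"
    by (intro borel_measurable_times borel_measurable_indicator inside_events t cont_processD(1)[OF cont_v[OF i]])
  have i2: "integrable M (\<lambda>\<omega>. (indicator ?A \<omega> * v i t \<omega>)\<^sup>2)"
    by (rule Bochner_Integration.integrable_bound[OF iG borel_measurable_power[OF mv]])
       (use le in \<open>auto elim!: eventually_mono\<close>)
  show "sq_integrable M (\<lambda>\<omega>. indicator ?A \<omega> * v i t \<omega>)" by (rule sq_integrableI[OF mv i2])
  have "expectation (\<lambda>\<omega>. (indicator ?A \<omega> * v i t \<omega>)\<^sup>2) \<le> expectation ?G"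
    by (rule integral_mono_AE[OF i2 iG le])
  also have "\<dots> = 3 * (v0 i)\<^sup>2 + 3 * T * expectation ?D + 3 * real P * (\<Sum>k<P. expectation (\<lambda>\<omega>. (indicator ?A \<omega> * I i k t \<omega>)\<^sup>2))"
  proof -
    have "expectation ?N = (\<Sum>k<P. expectation (\<lambda>\<omega>. (indicator ?A \<omega> * I i k t \<omega>)\<^sup>2))"
      by (rule Bochner_Integration.integral_sum) (use sq_integrableD(2)[OF mom(1)] in auto)
    then show ?thesis
      using Bochner_Integration.integral_add[OF Bochner_Integration.integrable_add[OF integrable_const[of "3 * (v0 i)\<^sup>2"] integrable_mult_right[OF D(2), of "3 * T"]] integrable_mult_right[OF iN, of "3 * real P"]]
        Bochner_Integration.integral_add[OF integrable_const[of "3 * (v0 i)\<^sup>2"] integrable_mult_right[OF D(2), of "3 * T"]]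
      by (simp add: prob_space)
  qed
  also have "\<dots> \<le> 3 * (v0 i)\<^sup>2
      + 3 * T * (\<integral>x. indicator {..t} (fst x) * (ind (inside R) x * drift i (fst x) (snd x))\<^sup>2 \<partial>prodM)
      + 3 * real P * (\<Sum>k<P. \<integral>x. indicator {..t} (fst x) * (ind (inside R) x * noise i k (fst x) (snd x))\<^sup>2 \<partial>prodM)"
  proof -
    have "expectation ?D = (\<integral>x. indicator {..t} (fst x) * (ind (inside R) x * drift i (fst x) (snd x))\<^sup>2 \<partial>prodM)"
      using D(1)[of t] by simp
    then show ?thesis
      by (simp only:) (intro add_mono order_refl mult_left_mono sum_mono mom(2); simp)
  qed
  finally show "expectation (\<lambda>\<omega>. (indicator (inside R t) \<omega> * v i t \<omega>)\<^sup>2) \<le> 3 * (v0 i)\<^sup>2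
      + 3 * T * (\<integral>x. indicator {..t} (fst x) * (ind (inside R) x * drift i (fst x) (snd x))\<^sup>2 \<partial>prodM)
      + 3 * real P * (\<Sum>k<P. \<integral>x. indicator {..t} (fst x) * (ind (inside R) x * noise i k (fst x) (snd x))\<^sup>2 \<partial>prodM)" .
qed

lemma upto_integral_le:
  assumes "sq_integrable prodM h"
  shows "(\<integral>x. indicator {..t} (fst x) * (h x)\<^sup>2 \<partial>prodM) \<le> (\<integral>x. (h x)\<^sup>2 \<partial>prodM)"
  by (rule integral_mono'[OF sq_integrableD(2)[OF assms]]) (simp_all add: indicator_def)

text \<open>V is not bounded on the truncation events; its moment bound there, uniform in time for
  each fixed \<open>R\<close>, takes the place of boundedness.\<close>

lemma sq_integrable_inside_v:
  assumes i: "i < m" shows "sq_integrable prodM (\<lambda>x. ind (inside R) x * v i (fst x) (snd x))"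
proof (rule sq_integrable_prodM_bounded_moments)
  show "(\<lambda>x. ind (inside R) x * v i (fst x) (snd x)) \<in> borel_measurable prodM"
    by (intro borel_measurable_times decreasing_eventsD(3)[OF decreasing_inside] cont_process_measurable[OF cont_v[OF i]])
  fix s assume s: "s \<in> {0..T}"
  show "sq_integrable M (\<lambda>\<omega>. ind (inside R) (s, \<omega>) * v i (fst (s, \<omega>)) (snd (s, \<omega>)))"
    using truncated_v_moment(1)[OF i s, of R] by (simp add: ind_def)
  have "expectation (\<lambda>\<omega>. (indicator (inside R s) \<omega> * v i s \<omega>)\<^sup>2) \<le> 3 * (v0 i)\<^sup>2
      + 3 * T * (\<integral>x. (ind (inside R) x * drift i (fst x) (snd x))\<^sup>2 \<partial>prodM)
      + 3 * real P * (\<Sum>k<P. \<integral>x. (ind (inside R) x * noise i k (fst x) (snd x))\<^sup>2 \<partial>prodM)"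
    by (rule order_trans[OF truncated_v_moment(2)[OF i s, of R]], intro add_mono order_refl mult_left_mono sum_mono
        upto_integral_le sq_integrable_inside_drift[OF i] sq_integrable_inside_noise[OF i]) (use T_pos in auto)
  then show "expectation (\<lambda>\<omega>. (ind (inside R) (s, \<omega>) * v i (fst (s, \<omega>)) (snd (s, \<omega>)))\<^sup>2) \<le> 3 * (v0 i)\<^sup>2
      + 3 * T * (\<integral>x. (ind (inside R) x * drift i (fst x) (snd x))\<^sup>2 \<partial>prodM)
      + 3 * real P * (\<Sum>k<P. \<integral>x. (ind (inside R) x * noise i k (fst x) (snd x))\<^sup>2 \<partial>prodM)"
    by (simp add: ind_def)
qed

text \<open>The quantity to which Gronwall's inequality is applied. No process is stopped: V is
  taken at time \<open>t\<close> itself, restricted to the event that U has stayed bounded by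
  \<open>R\<close> up to \<open>t\<close>.\<close>

definition stopped_moment :: "real \<Rightarrow> real \<Rightarrow> real" where
  "stopped_moment R t = (\<Sum>i<m. expectation (\<lambda>\<omega>. (indicator (inside R t) \<omega> * v i t \<omega>)\<^sup>2))"

lemma stopped_moment_nonneg: "0 \<le> stopped_moment R t"
  unfolding stopped_moment_def by (intro sum_nonneg Bochner_Integration.integral_nonneg) simp

lemma stopped_moment_upto:
  shows "integrable timeM (stopped_moment R)"
    "(\<integral>s. indicator {..t} s * stopped_moment R s \<partial>timeM) =
      (\<Sum>i<m. \<integral>x. indicator {..t} (fst x) * (ind (inside R) x * v i (fst x) (snd x))\<^sup>2 \<partial>prodM)"
proof -
  let ?h = "\<lambda>i s \<omega>. (indicator (inside R s) \<omega> * v i s \<omega>)\<^sup>2"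
  have ih: "integrable prodM (\<lambda>x. ?h i (fst x) (snd x))" if "i < m" for i
    using sq_integrableD(2)[OF sq_integrable_inside_v[OF that, of R]] by (simp add: ind_def)
  have it: "integrable timeM (\<lambda>s. expectation (?h i s))" if "i < m" for i
    by (rule integral_prodM(3)[OF ih[OF that]])
  show "integrable timeM (stopped_moment R)"
    unfolding stopped_moment_def[abs_def] by (rule Bochner_Integration.integrable_sum) (use it in auto)
  have "(\<integral>s. indicator {..t} s * stopped_moment R s \<partial>timeM) = (\<integral>s. (\<Sum>i<m. indicator {..t} s * expectation (?h i s)) \<partial>timeM)"
    by (simp only: stopped_moment_def sum_distrib_left)
  also have "\<dots> = (\<Sum>i<m. \<integral>s. indicator {..t} s * expectation (?h i s) \<partial>timeM)"
  proof (rule Bochner_Integration.integral_sum)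
    fix i assume "i \<in> {..<m}"
    then show "integrable timeM (\<lambda>s. indicator {..t} s * expectation (?h i s))"
      using integral_prodM(3)[of "\<lambda>s \<omega>. indicator {..t} s * ?h i s \<omega>", OF integrable_prodM_upto[OF ih]] by simp
  qed
  also have "\<dots> = (\<Sum>i<m. \<integral>x. indicator {..t} (fst x) * (ind (inside R) x * v i (fst x) (snd x))\<^sup>2 \<partial>prodM)"
  proof (rule sum.cong[OF refl])
    fix i assume "i \<in> {..<m}"
    then have "(\<integral>x. indicator {..t} (fst x) * ?h i (fst x) (snd x) \<partial>prodM) = (\<integral>s. indicator {..t} s * expectation (?h i s) \<partial>timeM)"
      by (intro integral_prodM_upto(3) ih) simp
    then show "(\<integral>s. indicator {..t} s * expectation (?h i s) \<partial>timeM) =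
      (\<integral>x. indicator {..t} (fst x) * (ind (inside R) x * v i (fst x) (snd x))\<^sup>2 \<partial>prodM)" by (simp add: ind_def)
  qed
  finally show "(\<integral>s. indicator {..t} s * stopped_moment R s \<partial>timeM) =
      (\<Sum>i<m. \<integral>x. indicator {..t} (fst x) * (ind (inside R) x * v i (fst x) (snd x))\<^sup>2 \<partial>prodM)" .
qed

text \<open>Closes the loop: the coefficients in the bound for V are controlled by U, and U is
  controlled by earlier values of V on the same event.\<close>

lemma truncated_u_moment:
  assumes s: "s \<in> {0..T}"
  shows "(\<Sum>i<m. expectation (\<lambda>\<omega>. (indicator (inside R s) \<omega> * u i s \<omega>)\<^sup>2)) \<le>
    2 * (\<Sum>i<m. (u0 i)\<^sup>2) + 2 * T * (\<integral>r. indicator {..s} r * stopped_moment R r \<partial>timeM)"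
proof -
  let ?h = "\<lambda>i r \<omega>. (ind (inside R) (r, \<omega>) * v i r \<omega>)\<^sup>2"
  have *: "expectation (\<lambda>\<omega>. (indicator (inside R s) \<omega> * u i s \<omega>)\<^sup>2) \<le>
      2 * (u0 i)\<^sup>2 + 2 * T * (\<integral>x. indicator {..s} (fst x) * (ind (inside R) x * v i (fst x) (snd x))\<^sup>2 \<partial>prodM)"
    if i: "i < m" for i
  proof -
    let ?V = "\<lambda>\<omega>. \<integral>r. indicator {..s} r * ?h i r \<omega> \<partial>timeM"
    have ih: "integrable prodM (\<lambda>x. ?h i (fst x) (snd x))"
      using sq_integrableD(2)[OF sq_integrable_inside_v[OF i, of R]] by simp
    note V = integral_prodM_upto[where h="?h i", OF ih]
    have "AE \<omega> in M. \<omega> \<in> space M" by (rule AE_I2)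
    with u_eq[OF i s] have le: "AE \<omega> in M. (indicator (inside R s) \<omega> * u i s \<omega>)\<^sup>2 \<le> 2 * (u0 i)\<^sup>2 + 2 * T * ?V \<omega>"
    proof eventually_elim
      fix \<omega> assume u: "u i s \<omega> = u0 i + (LBINT r:{0..s}. v i r \<omega>)" and w: "\<omega> \<in> space M"
      have V0: "0 \<le> ?V \<omega>" by (intro Bochner_Integration.integral_nonneg) simp
      show "(indicator (inside R s) \<omega> * u i s \<omega>)\<^sup>2 \<le> 2 * (u0 i)\<^sup>2 + 2 * T * ?V \<omega>"
      proof (cases "\<omega> \<in> inside R s")
        case False
        then show ?thesis using V0 T_pos by simp
      next
        case True
        have sv: "sq_integrable timeM (\<lambda>r. indicator {..s} r * v i r \<omega>)"
          by (intro sq_integrable_timeM_upto sq_integrable_timeM_continuous cont_processD(2)[OF cont_v[OF i] w])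
        have "(LBINT r:{0..s}. v i r \<omega>)\<^sup>2 \<le> T * (\<integral>r. (indicator {..s} r * v i r \<omega>)\<^sup>2 \<partial>timeM)"
          using time_integral_square_le[OF sv] by (simp add: integral_upto[OF s])
        also have "(\<integral>r. (indicator {..s} r * v i r \<omega>)\<^sup>2 \<partial>timeM) = ?V \<omega>"
        proof (rule Bochner_Integration.integral_cong[OF refl])
          fix r assume "r \<in> space timeM"
          then show "(indicator {..s} r * v i r \<omega>)\<^sup>2 = indicator {..s} r * ?h i r \<omega>"
            using ind_inside_upto[OF True, of r] s by (auto simp: indicator_def space_timeM)
        qed
        finally have "2 * (LBINT r:{0..s}. v i r \<omega>)\<^sup>2 \<le> 2 * T * ?V \<omega>" by simp
        then have "(u i s \<omega>)\<^sup>2 \<le> 2 * (u0 i)\<^sup>2 + 2 * T * ?V \<omega>"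
          unfolding u using sq_add_le[of "u0 i" "LBINT r:{0..s}. v i r \<omega>"] by linarith
        then show ?thesis using True by simp
      qed
    qed
    have iG: "integrable M (\<lambda>\<omega>. 2 * (u0 i)\<^sup>2 + 2 * T * ?V \<omega>)"
      by (intro Bochner_Integration.integrable_add integrable_mult_right integrable_const V(2))
    have "expectation (\<lambda>\<omega>. (indicator (inside R s) \<omega> * u i s \<omega>)\<^sup>2) \<le> expectation (\<lambda>\<omega>. 2 * (u0 i)\<^sup>2 + 2 * T * ?V \<omega>)"
    proof (rule integral_mono_AE[OF _ iG le])
      have mu: "(\<lambda>\<omega>. indicator (inside R s) \<omega> * u i s \<omega>) \<in> borel_measurable M"
        by (intro borel_measurable_times borel_measurable_indicator inside_events s cont_processD(1)[OF cont_u[OF i]])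
      show "integrable M (\<lambda>\<omega>. (indicator (inside R s) \<omega> * u i s \<omega>)\<^sup>2)"
        by (rule Bochner_Integration.integrable_bound[OF iG borel_measurable_power[OF mu]])
           (use le in \<open>auto elim!: eventually_mono\<close>)
    qed
    also have "\<dots> = 2 * (u0 i)\<^sup>2 + 2 * T * (\<integral>x. indicator {..s} (fst x) * (ind (inside R) x * v i (fst x) (snd x))\<^sup>2 \<partial>prodM)"
      using Bochner_Integration.integral_add[OF integrable_const[of "2 * (u0 i)\<^sup>2"] integrable_mult_right[OF V(2), of "2 * T"]] V(1)
      by (simp add: prob_space)
    finally show ?thesis .
  qed
  have "(\<Sum>i<m. expectation (\<lambda>\<omega>. (indicator (inside R s) \<omega> * u i s \<omega>)\<^sup>2)) \<le>
    (\<Sum>i<m. 2 * (u0 i)\<^sup>2 + 2 * T * (\<integral>x. indicator {..s} (fst x) * (ind (inside R) x * v i (fst x) (snd x))\<^sup>2 \<partial>prodM))"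
    by (rule sum_mono) (use * in auto)
  also have "\<dots> = 2 * (\<Sum>i<m. (u0 i)\<^sup>2) + 2 * T * (\<integral>r. indicator {..s} r * stopped_moment R r \<partial>timeM)"
    unfolding stopped_moment_upto(2) by (simp only: sum.distrib sum_distrib_left)
  finally show ?thesis .
qed

lemma integral_upto_mono:
  fixes h :: "real \<Rightarrow> real"
  assumes "integrable timeM h" "\<And>s. 0 \<le> h s" "s \<le> t"
  shows "(\<integral>r. indicator {..s} r * h r \<partial>timeM) \<le> (\<integral>r. indicator {..t} r * h r \<partial>timeM)"
proof (rule integral_mono')
  show "integrable timeM (\<lambda>r. indicator {..t} r * h r)"
  proof (rule Bochner_Integration.integrable_bound[OF assms(1)])
    show "(\<lambda>r. indicator {..t} r * h r) \<in> borel_measurable timeM"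
      by (intro borel_measurable_times measurable_timeM borel_measurable_integrable[OF assms(1)]) simp
  qed (simp add: indicator_def)
qed (use assms in \<open>auto simp: indicator_def\<close>)

text \<open>Linear growth in U is converted into the time integral of \<open>stopped_moment\<close>,
  the only form in which a Gronwall argument can use it.\<close>

lemma truncated_growth_bound:
  assumes h: "h \<in> borel_measurable prodM" and C: "0 \<le> C" "\<And>x. (h x)\<^sup>2 \<le> C * (1 + u_sq x)" and t: "t \<in> {0..T}"
  shows "(\<integral>x. indicator {..t} (fst x) * (ind (inside R) x * h x)\<^sup>2 \<partial>prodM) \<le>
    C * (T * (1 + 2 * (\<Sum>i<m. (u0 i)\<^sup>2)) + 2 * T * T * (\<integral>r. indicator {..t} r * stopped_moment R r \<partial>timeM))"
proof -
  let ?Y = "\<integral>r. indicator {..t} r * stopped_moment R r \<partial>timeM" and ?K = "\<Sum>i<m. (u0 i)\<^sup>2"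
  have Y0: "0 \<le> ?Y" by (intro Bochner_Integration.integral_nonneg mult_nonneg_nonneg stopped_moment_nonneg) simp
  have K0: "0 \<le> ?K" by (intro sum_nonneg) simp
  let ?k = "\<lambda>s \<omega>. 1 + (\<Sum>j<m. (indicator (inside R s) \<omega> * u j s \<omega>)\<^sup>2)"
  have su: "sq_integrable prodM (\<lambda>x. ind (inside R) x * u j (fst x) (snd x))" if "j < m" for j
    by (rule sq_integrable_inside[OF cont_process_measurable[OF cont_u[OF that]], of 1])
       (use u_sq_member[OF that] in \<open>auto intro: add_increasing\<close>)
  have iu: "integrable prodM (\<lambda>x. (indicator (inside R (fst x)) (snd x) * u j (fst x) (snd x))\<^sup>2)" if "j < m" for j
    using sq_integrableD(2)[OF su[OF that]] by (simp add: ind_def)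
  have ik: "integrable prodM (\<lambda>x. ?k (fst x) (snd x))"
    by (intro Bochner_Integration.integrable_add fp.integrable_const Bochner_Integration.integrable_sum) (use iu in auto)
  have "(\<integral>x. indicator {..t} (fst x) * (ind (inside R) x * h x)\<^sup>2 \<partial>prodM) \<le> (\<integral>x. C * ?k (fst x) (snd x) * indicator {..t} (fst x) \<partial>prodM)"
  proof (rule integral_mono')
    show "integrable prodM (\<lambda>x. C * ?k (fst x) (snd x) * indicator {..t} (fst x))"
      using integrable_prodM_upto[OF integrable_mult_right[OF ik, of C], of t] by (simp add: mult.commute)
    show "0 \<le> C * ?k (fst x) (snd x) * indicator {..t} (fst x)" for x
      by (intro mult_nonneg_nonneg C add_nonneg_nonneg sum_nonneg) auto
    show "indicator {..t} (fst x) * (ind (inside R) x * h x)\<^sup>2 \<le> C * ?k (fst x) (snd x) * indicator {..t} (fst x)" for x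
    proof -
      have "(ind (inside R) x * h x)\<^sup>2 \<le> C * ?k (fst x) (snd x)"
      proof (cases "snd x \<in> inside R (fst x)")
        case True
        then show ?thesis using C(2)[of x] by (simp add: ind_def u_sq_def)
      next
        case False
        then show ?thesis using C(1) by (simp add: ind_def)
      qed
      then show ?thesis by (simp add: indicator_def)
    qed
  qed
  also have "\<dots> = C * (\<integral>x. indicator {..t} (fst x) * ?k (fst x) (snd x) \<partial>prodM)"
    by (simp only: mult.assoc integral_mult_right_zero mult.commute[of "?k _ _"])
  also have "(\<integral>x. indicator {..t} (fst x) * ?k (fst x) (snd x) \<partial>prodM) = (\<integral>s. indicator {..t} s * expectation (?k s) \<partial>timeM)"
    by (rule integral_prodM_upto(3)[OF ik])
  \<comment> \<open>The bound for U at time s is enlarged to one independent of s; integrating it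
    over all of \<open>{0..T}\<close> supplies a further factor \<open>T\<close>.\<close>
  also have "\<dots> \<le> (\<integral>s. 1 + 2 * ?K + 2 * T * ?Y \<partial>timeM)"
  proof (rule integral_mono_AE')
    show "AE s in timeM. indicator {..t} s * expectation (?k s) \<le> 1 + 2 * ?K + 2 * T * ?Y"
      using integral_prodM(6)[OF ik] AE_space
    proof eventually_elim
      case (elim s)
      then have s: "s \<in> {0..T}" by (simp add: space_timeM)
      show ?case
      proof (cases "s \<le> t")
        case True
        have ij: "integrable M (\<lambda>\<omega>. (indicator (inside R s) \<omega> * u j s \<omega>)\<^sup>2)" if "j < m" for j
        proof (rule integrable_const_bound[of _ "R\<^sup>2"])
          show "(\<lambda>\<omega>. (indicator (inside R s) \<omega> * u j s \<omega>)\<^sup>2) \<in> borel_measurable M"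
            by (intro borel_measurable_power borel_measurable_times borel_measurable_indicator inside_events s
                cont_processD(1)[OF cont_u[OF that]])
          have "(indicator (inside R s) \<omega> * u j s \<omega>)\<^sup>2 \<le> R\<^sup>2" for \<omega>
          proof (cases "\<omega> \<in> inside R s")
            case True
            then have "\<bar>u j s \<omega>\<bar> \<le> \<bar>R\<bar>" using inside_le[OF True, of s j] s that by simp
            then show ?thesis using True sq_le_sq_of_abs_le by simp
          qed simp
          then show "AE \<omega> in M. norm ((indicator (inside R s) \<omega> * u j s \<omega>)\<^sup>2) \<le> R\<^sup>2" by simp
        qed
        have "expectation (?k s) = 1 + (\<Sum>j<m. expectation (\<lambda>\<omega>. (indicator (inside R s) \<omega> * u j s \<omega>)\<^sup>2))"
        proof -
          have "expectation (?k s) = expectation (\<lambda>_. 1) + expectation (\<lambda>\<omega>. \<Sum>j<m. (indicator (inside R s) \<omega> * u j s \<omega>)\<^sup>2)"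
            by (rule Bochner_Integration.integral_add) (use ij in \<open>auto intro!: Bochner_Integration.integrable_sum\<close>)
          also have "expectation (\<lambda>\<omega>. \<Sum>j<m. (indicator (inside R s) \<omega> * u j s \<omega>)\<^sup>2) =
              (\<Sum>j<m. expectation (\<lambda>\<omega>. (indicator (inside R s) \<omega> * u j s \<omega>)\<^sup>2))"
            by (rule Bochner_Integration.integral_sum) (use ij in auto)
          finally show ?thesis by (simp add: prob_space)
        qed
        also have "\<dots> \<le> 1 + (2 * ?K + 2 * T * (\<integral>r. indicator {..s} r * stopped_moment R r \<partial>timeM))"
          using truncated_u_moment[OF s, of R] by simp
        also have "\<dots> \<le> 1 + (2 * ?K + 2 * T * ?Y)"
          using integral_upto_mono[OF stopped_moment_upto(1) stopped_moment_nonneg True, of R] T_pos by simp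
        finally show ?thesis using True by (simp add: algebra_simps)
      next
        case False
        then show ?thesis using K0 Y0 T_pos by simp
      qed
    qed
    show "AE s in timeM. 0 \<le> 1 + 2 * ?K + 2 * T * ?Y"
      using K0 Y0 T_pos by simp
  qed simp
  also have "\<dots> = T * (1 + 2 * ?K) + 2 * T * T * ?Y" by (simp add: measure_timeM algebra_simps)
  finally show ?thesis using C(1) by (simp add: mult_left_mono)
qed

text \<open>Uniformity in \<open>R\<close> is the point: only growth constants, initial data,
  \<open>T\<close>, \<open>m\<close> and \<open>P\<close> enter \<open>c3\<close> and
  \<open>c4\<close>.\<close>

lemma truncated_moment_bound:
  "\<exists>C. \<forall>R. \<forall>i<m. \<forall>t\<in>{0..T}. expectation (\<lambda>\<omega>. (indicator (inside R t) \<omega> * v i t \<omega>)\<^sup>2) \<le> C"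
proof -
  obtain Cd where Cd: "0 \<le> Cd" "\<And>i x. i < m \<Longrightarrow> (drift i (fst x) (snd x))\<^sup>2 \<le> Cd * (1 + u_sq x)"
    using drift_growth by blast
  obtain Cn where Cn: "0 \<le> Cn" "\<And>i k x. i < m \<Longrightarrow> k < P \<Longrightarrow> (noise i k (fst x) (snd x))\<^sup>2 \<le> Cn * (1 + u_sq x)"
    using noise_growth by blast
  let ?K = "\<Sum>i<m. (u0 i)\<^sup>2"
  have K0: "0 \<le> ?K" by (intro sum_nonneg) simp
  \<comment> \<open>The first summand belongs to the drift. In the second \<open>real P\<close>
    occurs twice, once from squaring the sum over the modes and once from adding \<open>P\<close>
    equal bounds.\<close>
  define E where "E = 3 * T * Cd + 3 * real P * (real P * Cn)"
  have E0: "0 \<le> E" using Cd(1) Cn(1) T_pos by (simp add: E_def)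
  define c3 where "c3 = 3 * (\<Sum>i<m. (v0 i)\<^sup>2) + real m * (E * (T * (1 + 2 * ?K)))"
  \<comment> \<open>The summand 1 makes the rate strictly positive, as
    \<open>gronwall_constant\<close> divides by it.\<close>
  define c4 where "c4 = real m * (E * (2 * T * T)) + 1"
  have "0 \<le> (\<Sum>i<m. (v0 i)\<^sup>2)" by (intro sum_nonneg) simp
  then have c3: "0 \<le> c3" using E0 K0 T_pos by (simp add: c3_def)
  have c4: "0 < c4" using E0 T_pos by (simp add: c4_def add_nonneg_pos)
  have bound: "stopped_moment R t \<le> c3 + c4 * (LBINT s:{0..t}. stopped_moment R s)" if t: "t \<in> {0..T}" for R t
  proof -
    let ?Y = "\<integral>r. indicator {..t} r * stopped_moment R r \<partial>timeM"
    let ?Q = "T * (1 + 2 * ?K) + 2 * T * T * ?Y"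
    have Y0: "0 \<le> ?Y" by (intro Bochner_Integration.integral_nonneg mult_nonneg_nonneg stopped_moment_nonneg) simp
    have "expectation (\<lambda>\<omega>. (indicator (inside R t) \<omega> * v i t \<omega>)\<^sup>2) \<le> 3 * (v0 i)\<^sup>2 + E * ?Q" if i: "i < m" for i
    proof -
      have "expectation (\<lambda>\<omega>. (indicator (inside R t) \<omega> * v i t \<omega>)\<^sup>2) \<le> 3 * (v0 i)\<^sup>2
          + 3 * T * (Cd * ?Q) + 3 * real P * (\<Sum>k<P. Cn * ?Q)"
        by (rule order_trans[OF truncated_v_moment(2)[OF i t, of R]], intro add_mono order_refl mult_left_mono sum_mono
            truncated_growth_bound cont_process_measurable cont_drift cont_noise i Cd Cn t) (use T_pos in auto)
      then show ?thesis by (simp add: E_def algebra_simps)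
    qed
    then have "stopped_moment R t \<le> (\<Sum>i<m. 3 * (v0 i)\<^sup>2 + E * ?Q)" unfolding stopped_moment_def by (intro sum_mono) auto
    also have "\<dots> = 3 * (\<Sum>i<m. (v0 i)\<^sup>2) + real m * (E * ?Q)" by (simp add: sum.distrib sum_distrib_left)
    also have "\<dots> = c3 + real m * (E * (2 * T * T)) * ?Y" by (simp add: c3_def algebra_simps)
    also have "\<dots> \<le> c3 + c4 * ?Y" using Y0 by (intro add_left_mono mult_right_mono) (auto simp: c4_def)
    finally show ?thesis by (simp add: integral_upto[OF t])
  qed
  \<comment> \<open>A crude bound for each single \<open>R\<close> starts the Gronwall iteration. It
    may grow with \<open>R\<close>, since it leaves no trace in the conclusion.\<close>
  have K: "\<exists>K. \<forall>t\<in>{0..T}. stopped_moment R t \<le> K" for R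
  proof -
    let ?K = "\<lambda>i. 3 * (v0 i)\<^sup>2
      + 3 * T * (\<integral>x. (ind (inside R) x * drift i (fst x) (snd x))\<^sup>2 \<partial>prodM)
      + 3 * real P * (\<Sum>k<P. \<integral>x. (ind (inside R) x * noise i k (fst x) (snd x))\<^sup>2 \<partial>prodM)"
    have "expectation (\<lambda>\<omega>. (indicator (inside R t) \<omega> * v i t \<omega>)\<^sup>2) \<le> ?K i"
      if i: "i < m" and t: "t \<in> {0..T}" for i t
      by (rule order_trans[OF truncated_v_moment(2)[OF i t, of R]], intro add_mono order_refl mult_left_mono sum_mono
        upto_integral_le sq_integrable_inside_drift[OF i] sq_integrable_inside_noise[OF i]) (use T_pos in auto)
    then have "stopped_moment R t \<le> (\<Sum>i<m. ?K i)" if "t \<in> {0..T}" for t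
      unfolding stopped_moment_def using that by (intro sum_mono) auto
    then show ?thesis by blast
  qed
  show ?thesis
  proof (intro exI[of _ "2 * c3 * exp (2 * c4 * T)"] allI impI ballI)
    fix R i t assume i: "i < m" and t: "t \<in> {0..T}"
    obtain K where K: "\<And>t. t \<in> {0..T} \<Longrightarrow> stopped_moment R t \<le> K" using K[of R] by blast
    have "expectation (\<lambda>\<omega>. (indicator (inside R t) \<omega> * v i t \<omega>)\<^sup>2) \<le> stopped_moment R t"
      unfolding stopped_moment_def by (rule member_le_sum[of i "{..<m}"]) (use i in auto)
    also have "\<dots> \<le> 2 * c3 * exp (2 * c4 * t)"
      by (rule gronwall_constant[of T "stopped_moment R" K, OF _ _ bound c3 c4 t])
         (use K stopped_moment_nonneg stopped_moment_upto(1)[of R] in \<open>auto simp: integrable_timeM\<close>)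
    also have "\<dots> \<le> 2 * c3 * exp (2 * c4 * T)"
      using t c3 c4 by (intro mult_left_mono) auto
    finally show "expectation (\<lambda>\<omega>. (indicator (inside R t) \<omega> * v i t \<omega>)\<^sup>2) \<le> 2 * c3 * exp (2 * c4 * T)" .
  qed
qed

section \<open>Letting the truncation level tend to infinity\<close>

lemma inside_eventually:
  assumes w: "\<omega> \<in> space M" and t: "t \<in> {0..T}"
  shows "eventually (\<lambda>n. \<omega> \<in> inside (real n) t) sequentially"
proof -
  have "\<exists>C. \<forall>r\<in>{0..T}. \<bar>u i r \<omega>\<bar> \<le> C" if "i < m" for i
  proof -
    have "bounded ((\<lambda>r. u i r \<omega>) ` {0..T})"
      by (intro compact_imp_bounded compact_continuous_image u_cont[OF that w]) simp
    then show ?thesis unfolding bounded_iff by auto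
  qed
  then obtain C where C: "\<And>i r. i < m \<Longrightarrow> r \<in> {0..T} \<Longrightarrow> \<bar>u i r \<omega>\<bar> \<le> C i" by metis
  have "eventually (\<lambda>n. (\<Sum>i<m. \<bar>C i\<bar>) \<le> real n) sequentially"
    using eventually_ge_at_top[of "nat \<lceil>\<Sum>i<m. \<bar>C i\<bar>\<rceil>"] by (rule eventually_mono) (simp add: nat_ceiling_le_eq)
  then show ?thesis
  proof (rule eventually_mono)
    fix n assume n: "(\<Sum>i<m. \<bar>C i\<bar>) \<le> real n"
    have "\<bar>u i r \<omega>\<bar> \<le> real n" if "i < m" "r \<in> {0..t}" for i r
    proof -
      have "\<bar>u i r \<omega>\<bar> \<le> C i" using C[of i r] that t by auto
      also have "\<dots> \<le> \<bar>C i\<bar>" by simp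
      also have "\<dots> \<le> (\<Sum>i<m. \<bar>C i\<bar>)" by (rule member_le_sum[of i "{..<m}" "\<lambda>i. \<bar>C i\<bar>"]) (use that in auto)
      finally show ?thesis using n by simp
    qed
    then show "\<omega> \<in> inside (real n) t" using w by (auto simp: inside_def bounded_events_def)
  qed
qed

lemma v_moment_bound:
  "\<exists>C. \<forall>i<m. \<forall>t\<in>{0..T}. sq_integrable M (v i t) \<and> expectation (\<lambda>\<omega>. (v i t \<omega>)\<^sup>2) \<le> C"
proof -
  obtain C where C: "\<And>R i t. i < m \<Longrightarrow> t \<in> {0..T} \<Longrightarrow> expectation (\<lambda>\<omega>. (indicator (inside R t) \<omega> * v i t \<omega>)\<^sup>2) \<le> C"
    using truncated_moment_bound by blast
  have "sq_integrable M (v i t) \<and> expectation (\<lambda>\<omega>. (v i t \<omega>)\<^sup>2) \<le> C" if i: "i < m" and t: "t \<in> {0..T}" for i t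
  proof -
    let ?X = "\<lambda>n \<omega>. indicator (inside (real n) t) \<omega> * v i t \<omega>"
    note sX = truncated_v_moment(1)[OF i t]
    have mv: "v i t \<in> borel_measurable M" by (rule cont_processD(1)[OF cont_v[OF i] t])
    have conv: "conv_in_prob M (\<lambda>n \<omega>. ?X n \<omega> - v i t \<omega>) (\<lambda>_. 0)"
    proof (rule conv_in_prob_AE)
      show "(\<lambda>\<omega>. ?X n \<omega> - v i t \<omega>) \<in> borel_measurable M" for n
        by (intro borel_measurable_diff sq_integrableD(1)[OF sX] mv)
      show "AE \<omega> in M. (\<lambda>n. ?X n \<omega> - v i t \<omega>) \<longlonglongrightarrow> 0"
      proof (rule AE_I2)
        fix \<omega> assume "\<omega> \<in> space M"
        from inside_eventually[OF this t] have "eventually (\<lambda>n. ?X n \<omega> - v i t \<omega> = 0) sequentially"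
          by (rule eventually_mono) simp
        then show "(\<lambda>n. ?X n \<omega> - v i t \<omega>) \<longlonglongrightarrow> 0" by (rule tendsto_eventually)
      qed
    qed
    from fatou_in_prob[OF sX mv conv C[OF i t] tendsto_const] show ?thesis by blast
  qed
  then show ?thesis by blast
qed

end

section \<open>Second moments and the energy identity\<close>

text \<open>Makes \<open>F\<close> of a square integrable variable integrable: by the mean value
  theorem \<open>F x - F 0\<close> is \<open>x\<close> times a value of \<open>f\<close> at a point
  no further from 0, and \<open>f\<close> grows at most linearly.\<close>

lemma antiderivative_growth:
  fixes f F :: "real \<Rightarrow> real"
  assumes "L-lipschitz_on UNIV f" and F: "\<And>x. (F has_real_derivative f x) (at x)"
  shows "\<exists>C\<ge>0. \<forall>x. \<bar>F x\<bar> \<le> C * (1 + x\<^sup>2)"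
proof (intro exI[of _ "\<bar>F 0\<bar> + \<bar>f 0\<bar> + L"] conjI allI)
  have L: "0 \<le> L" by (rule lipschitz_on_nonneg[OF assms(1)])
  then show "0 \<le> \<bar>F 0\<bar> + \<bar>f 0\<bar> + L" by simp
  fix x :: real
  have "\<exists>y. \<bar>y\<bar> \<le> \<bar>x\<bar> \<and> F x - F 0 = x * f y"
  proof (cases x "0::real" rule: linorder_cases)
    case less
    from MVT2[OF less F] obtain y where "x < y" "y < 0" "F 0 - F x = (0 - x) * f y" by blast
    then show ?thesis by (intro exI[of _ y]) (auto simp: algebra_simps)
  next
    case equal then show ?thesis by auto
  next
    case greater
    from MVT2[OF greater F] obtain y where "0 < y" "y < x" "F x - F 0 = (x - 0) * f y" by blast
    then show ?thesis by (intro exI[of _ y]) auto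
  qed
  then obtain y where y: "\<bar>y\<bar> \<le> \<bar>x\<bar>" "F x - F 0 = x * f y" by blast
  have "\<bar>f y - f 0\<bar> \<le> L * \<bar>y\<bar>"
    using lipschitz_onD[OF assms(1), of y 0] by (simp add: dist_real_def)
  also have "\<dots> \<le> L * \<bar>x\<bar>" by (rule mult_left_mono[OF y(1) L])
  finally have "\<bar>f y\<bar> \<le> \<bar>f 0\<bar> + L * \<bar>x\<bar>" by linarith
  then have "\<bar>x\<bar> * \<bar>f y\<bar> \<le> \<bar>x\<bar> * (\<bar>f 0\<bar> + L * \<bar>x\<bar>)" by (rule mult_left_mono) simp
  then have 1: "\<bar>F x\<bar> \<le> \<bar>F 0\<bar> + \<bar>x\<bar> * \<bar>f 0\<bar> + L * x\<^sup>2"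
    using y(2) by (simp add: abs_mult[symmetric] algebra_simps power2_eq_square abs_mult_self_eq)
  have "\<bar>x\<bar> \<le> 1 + x\<^sup>2"
    using sum_squares_bound[of "\<bar>x\<bar>" 1] by simp
  then have "\<bar>x\<bar> * \<bar>f 0\<bar> \<le> (1 + x\<^sup>2) * \<bar>f 0\<bar>" by (rule mult_right_mono) simp
  moreover have "\<bar>F 0\<bar> \<le> (1 + x\<^sup>2) * \<bar>F 0\<bar>" "L * x\<^sup>2 \<le> (1 + x\<^sup>2) * L"
    using L by (simp_all add: algebra_simps)
  moreover have "(\<bar>F 0\<bar> + \<bar>f 0\<bar> + L) * (1 + x\<^sup>2) = (1 + x\<^sup>2) * \<bar>F 0\<bar> + (1 + x\<^sup>2) * \<bar>f 0\<bar> + (1 + x\<^sup>2) * L"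
    by (simp add: algebra_simps)
  ultimately show "\<bar>F x\<bar> \<le> (\<bar>F 0\<bar> + \<bar>f 0\<bar> + L) * (1 + x\<^sup>2)"
    using 1 by linarith
qed

context wiener_space
begin

section \<open>Pathwise calculus in time\<close>

lemma time_primitive_derivative:
  fixes h :: "real \<Rightarrow> real"
  assumes h: "continuous_on {0..T} h" and t: "t \<in> {0..T}"
  shows "((\<lambda>t. \<integral>s. indicator {..t} s * h s \<partial>timeM) has_real_derivative h t) (at t within {0..T})"
proof -
  have "((\<lambda>t. integral {0..t} h) has_vector_derivative h t) (at t within {0..T})"
    by (rule integral_has_vector_derivative[OF h t])
  then have "((\<lambda>t. \<integral>s. indicator {..t} s * h s \<partial>timeM) has_vector_derivative h t) (at t within {0..T})"
  proof (rule has_vector_derivative_transform[OF t, rotated])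
    fix x assume x: "x \<in> {0..T}"
    have "set_integrable lborel {0..x} h"
      by (rule borel_integrable_atLeastAtMost') (rule continuous_on_subset[OF h], use x in auto)
    then show "(\<integral>s. indicator {..x} s * h s \<partial>timeM) = integral {0..x} h"
      unfolding integral_upto[OF x] by (rule set_borel_integral_eq_integral(2))
  qed
  then show ?thesis by (simp add: has_real_derivative_iff_has_vector_derivative)
qed

lemma time_integral_FTC:
  fixes h :: "real \<Rightarrow> real"
  assumes \<Phi>: "\<And>s. s \<in> {0..T} \<Longrightarrow> (\<Phi> has_real_derivative h s) (at s within {0..T})"
    and h: "continuous_on {0..T} h" and t: "t \<in> {0..T}"
  shows "(\<integral>s. indicator {..t} s * h s \<partial>timeM) = \<Phi> t - \<Phi> 0"
proof -
  have "(\<integral>s. indicator {0..t} s *\<^sub>R h s \<partial>lborel) = \<Phi> t - \<Phi> 0"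
  proof (rule integral_FTC_Icc)
    show "(\<Phi> has_vector_derivative h s) (at s within {0..t})" if "0 \<le> s" "s \<le> t" for s
      using \<Phi>[of s] that t
      by (auto simp: has_real_derivative_iff_has_vector_derivative
          intro: has_vector_derivative_within_subset)
    show "continuous_on {0..t} h" by (rule continuous_on_subset[OF h]) (use t in auto)
  qed (use t in simp)
  then show ?thesis unfolding integral_upto[OF t] set_lebesgue_integral_def .
qed

lemma cont_process_const: "Z \<in> borel_measurable M \<Longrightarrow> cont_process (\<lambda>t. Z)"
  unfolding cont_process_def by simp

lemma cont_process_time_integral:
  assumes X: "cont_process X"
  shows "cont_process (\<lambda>t \<omega>. \<integral>s. indicator {..t} s * X s \<omega> \<partial>timeM)"
  unfolding cont_process_def
proof (intro conjI ballI)
  fix t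
  have "(\<lambda>x. indicator {..t} (fst x) * X (fst x) (snd x)) \<in> borel_measurable prodM"
    by (intro borel_measurable_times measurable_fst_prodM cont_process_measurable[OF X]) simp
  from borel_measurable_time_integral[OF this]
  show "(\<lambda>\<omega>. \<integral>s. indicator {..t} s * X s \<omega> \<partial>timeM) \<in> borel_measurable M" by simp
next
  fix \<omega> assume "\<omega> \<in> space M"
  from time_primitive_derivative[OF cont_processD(2)[OF X this]]
  show "continuous_on {0..T} (\<lambda>t. \<integral>s. indicator {..t} s * X s \<omega> \<partial>timeM)"
    unfolding continuous_on_eq_continuous_within by (blast intro: DERIV_continuous)
qed

text \<open>Continuous processes that agree almost surely at each time are indistinguishable, since
  countably many dense times share one null set. This lets U' = V hold along whole paths, as the
  chain rule requires.\<close>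

lemma cont_process_eq_AE:
  assumes X: "cont_process X" and Y: "cont_process Y"
    and eq: "\<And>t. t \<in> {0..T} \<Longrightarrow> AE \<omega> in M. X t \<omega> = Y t \<omega>"
  shows "AE \<omega> in M. \<forall>t\<in>{0..T}. X t \<omega> = Y t \<omega>"
proof -
  \<comment> \<open>Rational fractions of \<open>T\<close>; the cap at 1 keeps all of them in
    \<open>{0..T}\<close>.\<close>
  let ?t = "\<lambda>p. T * min 1 (real (snd p) / real (Suc (fst p)))"
  have t01: "?t p \<in> {0..T}" for p :: "nat \<times> nat"
    using T_pos by (auto intro: mult_left_le)
  have "AE \<omega> in M. \<forall>p::nat \<times> nat. X (?t p) \<omega> = Y (?t p) \<omega>"
    by (subst AE_all_countable) (use eq[OF t01] in blast)
  with AE_space show ?thesis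
  proof eventually_elim
    fix \<omega> assume w: "\<omega> \<in> space M" and a: "\<forall>p::nat \<times> nat. X (?t p) \<omega> = Y (?t p) \<omega>"
    show "\<forall>t\<in>{0..T}. X t \<omega> = Y t \<omega>"
    proof
      fix t assume t: "t \<in> {0..T}"
      let ?s = "\<lambda>n. ?t (n, grid_floor n (t / T))"
      have x: "0 \<le> t / T" "t / T \<le> 1" "T * (t / T) = t" using t T_pos by auto
      have "min 1 (real (grid_floor n (t / T)) / real (Suc n)) = real (grid_floor n (t / T)) / real (Suc n)" for n
        by (rule min_absorb2[OF order_trans[OF grid_floor_bounds(2)[OF x(1)] x(2)]])
      then have "?s n = T * (real (grid_floor n (t / T)) / real (Suc n))" for n by simp
      then have "?s \<longlonglongrightarrow> T * (t / T)"
        using tendsto_mult_left[OF grid_floor_tendsto[OF x(1)], of T] by simp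
      then have s: "?s \<longlonglongrightarrow> t" using x by simp
      have m: "\<forall>n. ?s n \<in> {0..T}" using t01 by blast
      have "(\<lambda>n. X (?s n) \<omega>) \<longlonglongrightarrow> X t \<omega>" "(\<lambda>n. Y (?s n) \<omega>) \<longlonglongrightarrow> Y t \<omega>"
        by (rule continuous_on_tendsto_compose[OF cont_processD(2)[OF X w] s t always_eventually[OF m]],
            rule continuous_on_tendsto_compose[OF cont_processD(2)[OF Y w] s t always_eventually[OF m]])
      moreover have "X (?s n) \<omega> = Y (?s n) \<omega>" for n using a by blast
      ultimately show "X t \<omega> = Y t \<omega>" using LIMSEQ_unique by simp
    qed
  qed
qed

end

context semidiscrete_scheme
begin

section \<open>Square integrability of the solution and its coefficients\<close>

lemma sq_integrable_v:
  assumes i: "i < m"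
  shows "t \<in> {0..T} \<Longrightarrow> sq_integrable M (v i t)" "sq_integrable prodM (\<lambda>x. v i (fst x) (snd x))"
proof -
  obtain C where C: "\<And>i t. i < m \<Longrightarrow> t \<in> {0..T} \<Longrightarrow> sq_integrable M (v i t) \<and> expectation (\<lambda>\<omega>. (v i t \<omega>)\<^sup>2) \<le> C"
    using v_moment_bound by blast
  show "t \<in> {0..T} \<Longrightarrow> sq_integrable M (v i t)" using C i by blast
  show "sq_integrable prodM (\<lambda>x. v i (fst x) (snd x))"
    by (rule sq_integrable_prodM_bounded_moments[OF cont_process_measurable[OF cont_v[OF i]], of C])
       (use C[OF i] in auto)
qed

text \<open>Serves both U and the drift part of V. The bound \<open>?G\<close> contains the integral
  over all of \<open>{0..T}\<close>, so a single integrable variable dominates the squares at all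
  times.\<close>

lemma sq_integrable_affine_time_integral:
  fixes a :: real
  assumes X: "cont_process X" and sX: "sq_integrable prodM (\<lambda>x. X (fst x) (snd x))"
  defines "Z \<equiv> \<lambda>t \<omega>. a + (\<integral>s. indicator {..t} s * X s \<omega> \<partial>timeM)"
  shows "\<And>t. t \<in> {0..T} \<Longrightarrow> sq_integrable M (Z t)" "sq_integrable prodM (\<lambda>x. Z (fst x) (snd x))" "cont_process Z"
proof -
  have Zc: "cont_process Z"
    unfolding Z_def by (intro cont_process_add cont_process_const cont_process_time_integral X) simp
  then show "cont_process Z" .
  let ?G = "\<lambda>\<omega>. 2 * a\<^sup>2 + 2 * T * (\<integral>s. (X s \<omega>)\<^sup>2 \<partial>timeM)"
  have V: "integrable M (\<lambda>\<omega>. \<integral>s. (X s \<omega>)\<^sup>2 \<partial>timeM)"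
    using sq_integrable_prodM_expectation(2)[OF sX] by simp
  have iG: "integrable M ?G"
    by (intro Bochner_Integration.integrable_add integrable_mult_right integrable_const V)
  have le: "(Z t \<omega>)\<^sup>2 \<le> ?G \<omega>" if w: "\<omega> \<in> space M" for t \<omega>
  proof -
    have sq: "sq_integrable timeM (\<lambda>s. X s \<omega>)"
      by (rule sq_integrable_timeM_continuous[OF cont_processD(2)[OF X w]])
    have "(\<integral>s. indicator {..t} s * X s \<omega> \<partial>timeM)\<^sup>2 \<le> T * (\<integral>s. (indicator {..t} s * X s \<omega>)\<^sup>2 \<partial>timeM)"
      by (rule time_integral_square_le[OF sq_integrable_timeM_upto[OF sq]])
    also have "(\<integral>s. (indicator {..t} s * X s \<omega>)\<^sup>2 \<partial>timeM) \<le> (\<integral>s. (X s \<omega>)\<^sup>2 \<partial>timeM)"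
      by (rule integral_mono'[OF sq_integrableD(2)[OF sq]]) (simp_all add: indicator_def)
    finally have "(\<integral>s. indicator {..t} s * X s \<omega> \<partial>timeM)\<^sup>2 \<le> T * (\<integral>s. (X s \<omega>)\<^sup>2 \<partial>timeM)"
      using T_pos by simp
    then show ?thesis
      using sq_add_le[of a "\<integral>s. indicator {..t} s * X s \<omega> \<partial>timeM"] unfolding Z_def by linarith
  qed
  have i2: "integrable M (\<lambda>\<omega>. (Z t \<omega>)\<^sup>2)" if t: "t \<in> {0..T}" for t
    by (rule Bochner_Integration.integrable_bound[OF iG borel_measurable_power[OF cont_processD(1)[OF Zc t]]])
       (use le in \<open>auto intro!: AE_I2 order_trans[OF le abs_ge_self]\<close>)
  show sM: "sq_integrable M (Z t)" if t: "t \<in> {0..T}" for t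
    by (rule sq_integrableI[OF cont_processD(1)[OF Zc t] i2[OF t]])
  show "sq_integrable prodM (\<lambda>x. Z (fst x) (snd x))"
  proof (rule sq_integrable_prodM_bounded_moments[OF cont_process_measurable[OF Zc]])
    fix s assume s: "s \<in> {0..T}"
    show "sq_integrable M (\<lambda>\<omega>. Z (fst (s, \<omega>)) (snd (s, \<omega>)))" using sM[OF s] by simp
    show "expectation (\<lambda>\<omega>. (Z (fst (s, \<omega>)) (snd (s, \<omega>)))\<^sup>2) \<le> expectation ?G"
      using integral_mono[OF i2[OF s] iG le] by simp
  qed
qed

text \<open>A version of U whose paths are differentiable in time at every sample point;
  \<open>u i\<close> agrees with it only almost surely.\<close>

definition u_int :: "nat \<Rightarrow> real \<Rightarrow> 'w \<Rightarrow> real" where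
  "u_int i t \<omega> = u0 i + (\<integral>s. indicator {..t} s * v i s \<omega> \<partial>timeM)"

text \<open>The part R of the decomposition. It carries the initial value \<open>v0 i\<close>, so
  that the remainder starts at 0 almost surely.\<close>

definition drift_int :: "nat \<Rightarrow> real \<Rightarrow> 'w \<Rightarrow> real" where
  "drift_int i t \<omega> = v0 i + (\<integral>s. indicator {..t} s * drift i s \<omega> \<partial>timeM)"

lemma u_int_facts:
  assumes i: "i < m"
  shows "\<And>t. t \<in> {0..T} \<Longrightarrow> sq_integrable M (u_int i t)" "sq_integrable prodM (\<lambda>x. u_int i (fst x) (snd x))"
    "cont_process (u_int i)"
  using sq_integrable_affine_time_integral[where a="u0 i", OF cont_v[OF i] sq_integrable_v(2)[OF i]]
  unfolding u_int_def[abs_def] by blast+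

lemma u_eq_u_int:
  assumes i: "i < m" shows "AE \<omega> in M. \<forall>t\<in>{0..T}. u i t \<omega> = u_int i t \<omega>"
proof (rule cont_process_eq_AE[OF cont_u[OF i] u_int_facts(3)[OF i]])
  fix t assume t: "t \<in> {0..T}"
  show "AE \<omega> in M. u i t \<omega> = u_int i t \<omega>"
    using u_eq[OF i t] by (simp add: u_int_def integral_upto[OF t])
qed

lemma sq_integrable_u:
  assumes i: "i < m"
  shows "t \<in> {0..T} \<Longrightarrow> sq_integrable M (u i t)" "sq_integrable prodM (\<lambda>x. u i (fst x) (snd x))"
proof -
  have eq: "AE \<omega> in M. u_int i t \<omega> = u i t \<omega>" if "t \<in> {0..T}" for t
    using u_eq_u_int[OF i] by (rule eventually_mono) (use that in simp)
  show M: "t \<in> {0..T} \<Longrightarrow> sq_integrable M (u i t)" for t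
    by (rule sq_integrable_cong_AE[OF u_int_facts(1)[OF i] cont_processD(1)[OF cont_u[OF i]] eq])
  show "sq_integrable prodM (\<lambda>x. u i (fst x) (snd x))"
  proof (rule sq_integrable_bound[OF u_int_facts(2)[OF i] cont_process_measurable[OF cont_u[OF i]]])
    have S: "{x \<in> space prodM. u_int i (fst x) (snd x) = u i (fst x) (snd x)} \<in> sets prodM"
      by (rule borel_measurable_eq[OF cont_process_measurable[OF u_int_facts(3)[OF i]] cont_process_measurable[OF cont_u[OF i]]])
    have "AE x in timeM \<Otimes>\<^sub>M M. u_int i (fst x) (snd x) = u i (fst x) (snd x)"
    proof (rule pm.AE_pair_measure)
      show "{x \<in> space (timeM \<Otimes>\<^sub>M M). u_int i (fst x) (snd x) = u i (fst x) (snd x)} \<in> sets (timeM \<Otimes>\<^sub>M M)"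
        using S unfolding prodM_def .
      show "AE s in timeM. AE \<omega> in M. u_int i (fst (s, \<omega>)) (snd (s, \<omega>)) = u i (fst (s, \<omega>)) (snd (s, \<omega>))"
        by (rule AE_I2) (use eq in \<open>simp add: space_timeM\<close>)
    qed
    then show "AE x in prodM. \<bar>u i (fst x) (snd x)\<bar> \<le> \<bar>u_int i (fst x) (snd x)\<bar>"
      unfolding prodM_def by (rule eventually_mono) simp
  qed
qed

lemma sq_integrable_growth:
  assumes h: "h \<in> borel_measurable prodM" and C: "0 \<le> C" "\<And>x. (h x)\<^sup>2 \<le> C * (1 + u_sq x)"
  shows "sq_integrable prodM h"
proof (rule sq_integrableI[OF h])
  have "integrable prodM (\<lambda>x. C * (1 + u_sq x))"
    unfolding u_sq_def
    by (intro integrable_mult_right Bochner_Integration.integrable_add fp.integrable_const Bochner_Integration.integrable_sum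
        sq_integrableD(2) sq_integrable_u(2)) simp
  then show "integrable prodM (\<lambda>x. (h x)\<^sup>2)"
    by (rule Bochner_Integration.integrable_bound[OF _ borel_measurable_power[OF h]])
       (use C(2) in \<open>auto intro!: AE_I2 order_trans[OF C(2) abs_ge_self]\<close>)
qed

lemma sq_integrable_noise: "i < m \<Longrightarrow> k < P \<Longrightarrow> sq_integrable prodM (\<lambda>x. noise i k (fst x) (snd x))"
  using noise_growth cont_process_measurable[OF cont_noise] sq_integrable_growth by blast

lemma sq_integrable_drift:
  assumes i: "i < m"
  shows "sq_integrable prodM (\<lambda>x. drift i (fst x) (snd x))" "s \<in> {0..T} \<Longrightarrow> sq_integrable M (drift i s)"
proof -
  obtain C where C: "0 \<le> C" "\<And>x. (drift i (fst x) (snd x))\<^sup>2 \<le> C * (1 + u_sq x)" using drift_growth i by blast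
  show "sq_integrable prodM (\<lambda>x. drift i (fst x) (snd x))"
    by (rule sq_integrable_growth[OF cont_process_measurable[OF cont_drift[OF i]] C])
  assume s: "s \<in> {0..T}"
  show "sq_integrable M (drift i s)"
  proof (rule sq_integrableI[OF cont_processD(1)[OF cont_drift[OF i] s]])
    have "integrable M (\<lambda>\<omega>. C * (1 + (\<Sum>j<m. (u j s \<omega>)\<^sup>2)))"
      by (intro integrable_mult_right Bochner_Integration.integrable_add integrable_const Bochner_Integration.integrable_sum
          sq_integrableD(2) sq_integrable_u(1) s) simp
    then show "integrable M (\<lambda>\<omega>. (drift i s \<omega>)\<^sup>2)"
    proof (rule Bochner_Integration.integrable_bound[OF _ borel_measurable_power[OF cont_processD(1)[OF cont_drift[OF i] s]]])
      have "(drift i s \<omega>)\<^sup>2 \<le> C * (1 + (\<Sum>j<m. (u j s \<omega>)\<^sup>2))" for \<omega>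
        using C(2)[of "(s, \<omega>)"] by (simp add: u_sq_def)
      then show "AE \<omega> in M. norm ((drift i s \<omega>)\<^sup>2) \<le> norm (C * (1 + (\<Sum>j<m. (u j s \<omega>)\<^sup>2)))"
        by (intro AE_I2) (auto intro: order_trans[OF _ abs_ge_self])
    qed
  qed
qed

lemma drift_int_facts:
  assumes i: "i < m"
  shows "\<And>t. t \<in> {0..T} \<Longrightarrow> sq_integrable M (drift_int i t)" "sq_integrable prodM (\<lambda>x. drift_int i (fst x) (snd x))"
    "cont_process (drift_int i)"
  using sq_integrable_affine_time_integral[where a="v0 i", OF cont_drift[OF i] sq_integrable_drift(1)[OF i]]
  unfolding drift_int_def[abs_def] by blast+

text \<open>The part N, defined as V - R instead of as the sum of the stochastic integrals: those
  have continuous paths only almost surely, whereas V - R is jointly measurable from the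
  outset.\<close>

definition mart :: "nat \<Rightarrow> real \<Rightarrow> 'w \<Rightarrow> real" where
  "mart i t \<omega> = v i t \<omega> - drift_int i t \<omega>"

lemma mart_facts:
  assumes i: "i < m"
  shows "\<And>t. t \<in> {0..T} \<Longrightarrow> sq_integrable M (mart i t)" "sq_integrable prodM (\<lambda>x. mart i (fst x) (snd x))"
    "\<And>t. t \<in> {0..T} \<Longrightarrow> AE \<omega> in M. mart i t \<omega> = (\<Sum>k<P. I i k t \<omega>)"
proof -
  show "sq_integrable M (mart i t)" if "t \<in> {0..T}" for t
    unfolding mart_def[abs_def] by (intro sq_integrable_diff sq_integrable_v(1) drift_int_facts(1) i that)
  show "sq_integrable prodM (\<lambda>x. mart i (fst x) (snd x))"
    unfolding mart_def by (intro sq_integrable_diff sq_integrable_v(2) drift_int_facts(2) i)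
  show "AE \<omega> in M. mart i t \<omega> = (\<Sum>k<P. I i k t \<omega>)" if t: "t \<in> {0..T}" for t
    using v_eq[OF i t] by (rule eventually_mono) (simp add: mart_def drift_int_def integral_upto[OF t] drift_def)
qed

section \<open>Covariances of the drift part and the martingale part\<close>

lemma ito_noise: "i < m \<Longrightarrow> k < P \<Longrightarrow> has_ito_integral M \<F> T (\<beta> k) (noise i k) (I i k)"
  using ito[of i k] by (simp add: noise_def[abs_def])

lemma sq_integrable_ito: "i < m \<Longrightarrow> k < P \<Longrightarrow> t \<in> {0..T} \<Longrightarrow> sq_integrable M (I i k t)"
  using ito_isometry(1)[OF ito_noise sq_integrable_noise ito_noise sq_integrable_noise] by blast

lemma borel_measurable_ito: "i < m \<Longrightarrow> k < P \<Longrightarrow> t \<in> {0..T} \<Longrightarrow> I i k t \<in> borel_measurable M"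
  using sq_integrable_ito by (blast dest: sq_integrableD)

lemma expectation_mart_mult:
  assumes i: "i < m" and t: "t \<in> {0..T}" and Z: "sq_integrable M Z"
  shows "expectation (\<lambda>\<omega>. Z \<omega> * mart i t \<omega>) = (\<Sum>k<P. expectation (\<lambda>\<omega>. Z \<omega> * I i k t \<omega>))"
proof -
  have "expectation (\<lambda>\<omega>. Z \<omega> * mart i t \<omega>) = expectation (\<lambda>\<omega>. \<Sum>k<P. Z \<omega> * I i k t \<omega>)"
  proof (rule integral_cong_AE)
    show "(\<lambda>\<omega>. Z \<omega> * mart i t \<omega>) \<in> borel_measurable M"
      by (intro borel_measurable_times sq_integrableD(1)[OF Z] sq_integrableD(1)[OF mart_facts(1)[OF i t]])
    show "(\<lambda>\<omega>. \<Sum>k<P. Z \<omega> * I i k t \<omega>) \<in> borel_measurable M"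
      by (intro borel_measurable_sum borel_measurable_times sq_integrableD(1)[OF Z] borel_measurable_ito i t) simp
    show "AE \<omega> in M. Z \<omega> * mart i t \<omega> = (\<Sum>k<P. Z \<omega> * I i k t \<omega>)"
      using mart_facts(3)[OF i t] by (rule eventually_mono) (simp add: sum_distrib_left)
  qed
  also have "\<dots> = (\<Sum>k<P. expectation (\<lambda>\<omega>. Z \<omega> * I i k t \<omega>))"
    by (rule Bochner_Integration.integral_sum, rule sq_integrable_mult[OF Z sq_integrable_ito[OF i _ t]]) simp
  finally show ?thesis .
qed

lemma mart_martingale:
  assumes i: "i < m" and st: "0 \<le> s" "s \<le> t" "t \<le> T" and Z: "sq_integrable M Z" "Z \<in> borel_measurable (\<F> s)"
  shows "expectation (\<lambda>\<omega>. Z \<omega> * mart i t \<omega>) = expectation (\<lambda>\<omega>. Z \<omega> * mart i s \<omega>)"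
proof -
  have "expectation (\<lambda>\<omega>. Z \<omega> * I i k t \<omega>) = expectation (\<lambda>\<omega>. Z \<omega> * I i k s \<omega>)" if "k < P" for k
    by (rule ito_martingale[OF ito_noise[OF i that] sq_integrable_noise[OF i that] st Z])
  then show ?thesis using expectation_mart_mult[OF i _ Z(1)] st by simp
qed

lemma mart_second_moment:
  assumes i: "i < m" and t: "t \<in> {0..T}"
  shows "expectation (\<lambda>\<omega>. mart i t \<omega> * mart i t \<omega>) =
    (\<Sum>k<P. \<integral>x. indicator {..t} (fst x) * (noise i k (fst x) (snd x))\<^sup>2 \<partial>prodM)"
proof -
  have "expectation (\<lambda>\<omega>. mart i t \<omega> * mart i t \<omega>) = (\<Sum>k<P. expectation (\<lambda>\<omega>. mart i t \<omega> * I i k t \<omega>))"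
    by (rule expectation_mart_mult[OF i t mart_facts(1)[OF i t]])
  also have "\<dots> = (\<Sum>k<P. expectation (\<lambda>\<omega>. I i k t \<omega> * mart i t \<omega>))" by (simp only: mult.commute)
  also have "\<dots> = (\<Sum>k<P. \<Sum>l<P. expectation (\<lambda>\<omega>. I i k t \<omega> * I i l t \<omega>))"
    using expectation_mart_mult[OF i t sq_integrable_ito[OF i _ t]] by (intro sum.cong refl) simp
  \<comment> \<open>Integrals against different coordinates of the noise are uncorrelated, which
    leaves the diagonal.\<close>
  also have "\<dots> = (\<Sum>k<P. \<Sum>l<P. if k = l then \<integral>x. indicator {..t} (fst x) * (noise i k (fst x) (snd x))\<^sup>2 \<partial>prodM else 0)"
  proof (intro sum.cong refl)
    fix k l assume "k \<in> {..<P}" "l \<in> {..<P}"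
    then have k: "k < P" "l < P" by auto
    from ito_isometry(2)[OF ito_noise[OF i k(1)] sq_integrable_noise[OF i k(1)] ito_noise[OF i k(2)] sq_integrable_noise[OF i k(2)] t]
    show "expectation (\<lambda>\<omega>. I i k t \<omega> * I i l t \<omega>) =
      (if k = l then \<integral>x. indicator {..t} (fst x) * (noise i k (fst x) (snd x))\<^sup>2 \<partial>prodM else 0)"
      by (simp add: power2_eq_square)
  qed
  also have "\<dots> = (\<Sum>k<P. \<integral>x. indicator {..t} (fst x) * (noise i k (fst x) (snd x))\<^sup>2 \<partial>prodM)"
    by (simp add: sum.delta)
  finally show ?thesis .
qed

lemma drift_adapted:
  assumes i: "i < m" and s: "s \<in> {0..T}" shows "drift i s \<in> borel_measurable (\<F> s)"
  unfolding drift_def[abs_def]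
  by (intro borel_measurable_diff borel_measurable_sum borel_measurable_times borel_measurable_const u_adapted
      measurable_compose[OF u_adapted borel_measurable_continuous_onI[OF continuous_f]]) (use i s in auto)

lemma drift_int_mart:
  assumes i: "i < m" and t: "t \<in> {0..T}"
  shows "expectation (\<lambda>\<omega>. drift_int i t \<omega> * mart i t \<omega>) =
    (\<integral>x. indicator {..t} (fst x) * (drift i (fst x) (snd x) * mart i (fst x) (snd x)) \<partial>prodM)"
proof -
  note sN = mart_facts(1)[OF i t]
  \<comment> \<open>The martingale property with the constant test variable 1 goes back to time 0,
    where V equals \<open>v0 i\<close> almost surely and the drift integral is over a single point.
    This disposes of the initial value in R.\<close>
  have mean: "expectation (mart i t) = 0"
  proof -
    have one: "sq_integrable M (\<lambda>_. 1)" by (simp add: sq_integrable_def)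
    have "expectation (\<lambda>\<omega>. 1 * mart i t \<omega>) = expectation (\<lambda>\<omega>. 1 * mart i 0 \<omega>)"
      by (rule mart_martingale[OF i _ _ _ one]) (use t in auto)
    also have "\<dots> = expectation (\<lambda>\<omega>. 0)"
    proof (rule integral_cong_AE)
      have z: "(0::real) \<in> {0..T}" using T_pos by simp
      show "(\<lambda>\<omega>. 1 * mart i 0 \<omega>) \<in> borel_measurable M" using sq_integrableD(1)[OF mart_facts(1)[OF i z]] by simp
      have "(LBINT s:{0..0}. drift i s \<omega>) = 0" for \<omega>
        unfolding set_lebesgue_integral_def
        by (rule integral_eq_zero_AE) (rule AE_mp[OF AE_lborel_singleton[of 0]], simp add: indicator_def)
      then show "AE \<omega> in M. 1 * mart i 0 \<omega> = 0"
        using v_init[OF i] by (auto elim!: eventually_mono simp: mart_def drift_int_def integral_upto[OF z])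
    qed simp
    finally show ?thesis by simp
  qed
  \<comment> \<open>N stays frozen at the final time \<open>t\<close> while the integrals are
    exchanged; only afterwards is it moved to the running time.\<close>
  have sN': "sq_integrable prodM (\<lambda>x. mart i t (snd x))"
    by (rule sq_integrable_prodM_bounded_moments[OF measurable_snd_prodM[OF sq_integrableD(1)[OF sN]], of "expectation (\<lambda>\<omega>. (mart i t \<omega>)\<^sup>2)"])
       (use sN in simp_all)
  have i1: "integrable prodM (\<lambda>x. drift i (fst x) (snd x) * mart i t (snd x))"
    by (rule sq_integrable_mult[OF sq_integrable_drift(1)[OF i] sN'])
  have i2: "integrable prodM (\<lambda>x. drift i (fst x) (snd x) * mart i (fst x) (snd x))"
    by (rule sq_integrable_mult[OF sq_integrable_drift(1)[OF i] mart_facts(2)[OF i]])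
  note J = integral_prodM_upto[where h="\<lambda>s \<omega>. drift i s \<omega> * mart i t \<omega>" and t=t, OF i1]
  have "expectation (\<lambda>\<omega>. drift_int i t \<omega> * mart i t \<omega>) =
      expectation (\<lambda>\<omega>. v0 i * mart i t \<omega> + (\<integral>s. indicator {..t} s * (drift i s \<omega> * mart i t \<omega>) \<partial>timeM))"
    unfolding drift_int_def by (rule Bochner_Integration.integral_cong) (simp_all add: distrib_right mult.assoc[symmetric])
  also have "\<dots> = expectation (\<lambda>\<omega>. v0 i * mart i t \<omega>) + expectation (\<lambda>\<omega>. \<integral>s. indicator {..t} s * (drift i s \<omega> * mart i t \<omega>) \<partial>timeM)"
    by (rule Bochner_Integration.integral_add[OF integrable_mult_right J(2)])
       (rule sq_integrable_imp_integrable[OF finite_measure_axioms sN])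
  also have "\<dots> = (\<integral>s. indicator {..t} s * expectation (\<lambda>\<omega>. drift i s \<omega> * mart i t \<omega>) \<partial>timeM)"
    using J(1,3) mean by simp
  \<comment> \<open>The drift at time s is known at s and hence an admissible test variable; past
    \<open>t\<close> the indicator vanishes.\<close>
  also have "\<dots> = (\<integral>s. indicator {..t} s * expectation (\<lambda>\<omega>. drift i s \<omega> * mart i s \<omega>) \<partial>timeM)"
  proof (rule Bochner_Integration.integral_cong[OF refl])
    fix s assume s: "s \<in> space timeM"
    show "indicator {..t} s * expectation (\<lambda>\<omega>. drift i s \<omega> * mart i t \<omega>) =
        indicator {..t} s * expectation (\<lambda>\<omega>. drift i s \<omega> * mart i s \<omega>)"
    proof (cases "s \<le> t")
      case True
      have "expectation (\<lambda>\<omega>. drift i s \<omega> * mart i t \<omega>) = expectation (\<lambda>\<omega>. drift i s \<omega> * mart i s \<omega>)"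
        by (rule mart_martingale[OF i _ True _ sq_integrable_drift(2)[OF i] drift_adapted[OF i]])
           (use s t in \<open>auto simp: space_timeM\<close>)
      then show ?thesis by simp
    qed simp
  qed
  also have "\<dots> = (\<integral>x. indicator {..t} (fst x) * (drift i (fst x) (snd x) * mart i (fst x) (snd x)) \<partial>prodM)"
    by (rule integral_prodM_upto(3)[OF i2, symmetric])
  finally show ?thesis .
qed

text \<open>R is differentiable along each path, so its square obeys the ordinary chain rule; Fubini
  then moves the expectation inside.\<close>

lemma drift_int_second_moment:
  assumes i: "i < m" and t: "t \<in> {0..T}"
  shows "expectation (\<lambda>\<omega>. drift_int i t \<omega> * drift_int i t \<omega>) = (v0 i)\<^sup>2 +
    2 * (\<integral>x. indicator {..t} (fst x) * (drift i (fst x) (snd x) * drift_int i (fst x) (snd x)) \<partial>prodM)"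
proof -
  have i1: "integrable prodM (\<lambda>x. drift i (fst x) (snd x) * drift_int i (fst x) (snd x))"
    by (rule sq_integrable_mult[OF sq_integrable_drift(1)[OF i] drift_int_facts(2)[OF i]])
  note J = integral_prodM_upto[where h="\<lambda>s \<omega>. drift i s \<omega> * drift_int i s \<omega>" and t=t, OF i1]
  have z: "(0::real) \<in> {0..T}" using T_pos by simp
  have "(LBINT s:{0..0}. drift i s \<omega>) = 0" for \<omega>
    unfolding set_lebesgue_integral_def
    by (rule integral_eq_zero_AE) (rule AE_mp[OF AE_lborel_singleton[of 0]], simp add: indicator_def)
  then have R0: "drift_int i 0 \<omega> = v0 i" for \<omega> by (simp add: drift_int_def integral_upto[OF z])
  have "drift_int i t \<omega> * drift_int i t \<omega> = (v0 i)\<^sup>2 + 2 * (\<integral>s. indicator {..t} s * (drift i s \<omega> * drift_int i s \<omega>) \<partial>timeM)"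
    if w: "\<omega> \<in> space M" for \<omega>
  proof -
    note c = cont_processD(2)[OF cont_drift[OF i] w] and c' = cont_processD(2)[OF drift_int_facts(3)[OF i] w]
    have "(\<integral>s. indicator {..t} s * (2 * (drift i s \<omega> * drift_int i s \<omega>)) \<partial>timeM) =
        drift_int i t \<omega> * drift_int i t \<omega> - drift_int i 0 \<omega> * drift_int i 0 \<omega>"
    proof (rule time_integral_FTC[OF _ _ t])
      show "continuous_on {0..T} (\<lambda>s. 2 * (drift i s \<omega> * drift_int i s \<omega>))"
        by (intro continuous_on_mult continuous_on_const c c')
      fix s assume s: "s \<in> {0..T}"
      have "((\<lambda>t. drift_int i t \<omega>) has_real_derivative drift i s \<omega>) (at s within {0..T})"
        unfolding drift_int_def using DERIV_add[OF DERIV_const time_primitive_derivative[OF c s], of "v0 i"] by simp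
      from DERIV_mult[OF this this]
      show "((\<lambda>t. drift_int i t \<omega> * drift_int i t \<omega>) has_real_derivative 2 * (drift i s \<omega> * drift_int i s \<omega>)) (at s within {0..T})"
        by (simp add: mult.commute)
    qed
    moreover have "(\<integral>s. indicator {..t} s * (2 * (drift i s \<omega> * drift_int i s \<omega>)) \<partial>timeM) =
        2 * (\<integral>s. indicator {..t} s * (drift i s \<omega> * drift_int i s \<omega>) \<partial>timeM)"
      by (subst integral_mult_right_zero[symmetric]) (simp only: mult.left_commute)
    ultimately show ?thesis by (simp add: R0 power2_eq_square)
  qed
  then have "expectation (\<lambda>\<omega>. drift_int i t \<omega> * drift_int i t \<omega>) =
      expectation (\<lambda>\<omega>. (v0 i)\<^sup>2 + 2 * (\<integral>s. indicator {..t} s * (drift i s \<omega> * drift_int i s \<omega>) \<partial>timeM))"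
    by (intro Bochner_Integration.integral_cong refl)
  also have "\<dots> = (v0 i)\<^sup>2 + 2 * expectation (\<lambda>\<omega>. \<integral>s. indicator {..t} s * (drift i s \<omega> * drift_int i s \<omega>) \<partial>timeM)"
    using Bochner_Integration.integral_add[OF integrable_const[of "(v0 i)\<^sup>2"] integrable_mult_right[OF J(2), of 2]]
    by (simp add: prob_space)
  finally show ?thesis using J(1) by simp
qed

lemma v_second_moment:
  assumes i: "i < m" and t: "t \<in> {0..T}"
  shows "expectation (\<lambda>\<omega>. (v i t \<omega>)\<^sup>2) = (v0 i)\<^sup>2
    + 2 * (\<integral>x. indicator {..t} (fst x) * (drift i (fst x) (snd x) * v i (fst x) (snd x)) \<partial>prodM)
    + (\<Sum>k<P. \<integral>x. indicator {..t} (fst x) * (noise i k (fst x) (snd x))\<^sup>2 \<partial>prodM)"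
proof -
  let ?R = "drift_int i" and ?N = "mart i" and ?d = "\<lambda>x. drift i (fst x) (snd x)" and ?i = "\<lambda>x. indicator {..t} (fst x) :: real"
  have s: "sq_integrable M (?R t)" "sq_integrable M (?N t)" using drift_int_facts(1)[OF i t] mart_facts(1)[OF i t] .
  have "expectation (\<lambda>\<omega>. (v i t \<omega>)\<^sup>2) = expectation (\<lambda>\<omega>. ?R t \<omega> * ?R t \<omega> + 2 * (?R t \<omega> * ?N t \<omega>) + ?N t \<omega> * ?N t \<omega>)"
    by (rule Bochner_Integration.integral_cong) (simp_all add: mart_def power2_eq_square algebra_simps)
  also have "\<dots> = expectation (\<lambda>\<omega>. ?R t \<omega> * ?R t \<omega>) + 2 * expectation (\<lambda>\<omega>. ?R t \<omega> * ?N t \<omega>) + expectation (\<lambda>\<omega>. ?N t \<omega> * ?N t \<omega>)"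
    using sq_integrable_mult[OF s(1) s(1)] sq_integrable_mult[OF s] sq_integrable_mult[OF s(2) s(2)] by simp
  also have "\<dots> = (v0 i)\<^sup>2 + 2 * ((\<integral>x. ?i x * (?d x * ?R (fst x) (snd x)) \<partial>prodM) + (\<integral>x. ?i x * (?d x * ?N (fst x) (snd x)) \<partial>prodM))
      + (\<Sum>k<P. \<integral>x. ?i x * (noise i k (fst x) (snd x))\<^sup>2 \<partial>prodM)"
    unfolding drift_int_second_moment[OF i t] drift_int_mart[OF i t] mart_second_moment[OF i t] by simp
  \<comment> \<open>The square of R contributes R' R and the cross term R' N; together they give R'
    V, in which the decomposition is no longer visible.\<close>
  also have "(\<integral>x. ?i x * (?d x * ?R (fst x) (snd x)) \<partial>prodM) + (\<integral>x. ?i x * (?d x * ?N (fst x) (snd x)) \<partial>prodM)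
      = (\<integral>x. ?i x * (?d x * ?R (fst x) (snd x)) + ?i x * (?d x * ?N (fst x) (snd x)) \<partial>prodM)"
    by (rule Bochner_Integration.integral_add[symmetric])
       (intro integrable_prodM_upto sq_integrable_mult sq_integrable_drift(1) drift_int_facts(2) mart_facts(2) i)+
  also have "\<dots> = (\<integral>x. ?i x * (?d x * v i (fst x) (snd x)) \<partial>prodM)"
    by (rule Bochner_Integration.integral_cong) (simp_all add: mart_def algebra_simps)
  finally show ?thesis .
qed

text \<open>Minus the potential energy, without the factor h. With these signs its time derivative
  is the sum over the nodes of drift times V.\<close>

definition potential :: "(real \<Rightarrow> real) \<Rightarrow> real \<Rightarrow> 'w \<Rightarrow> real" where
  "potential F t \<omega> = (\<Sum>i<m. u i t \<omega> * (\<Sum>j<m. B i j * u j t \<omega>)) / 2 - (\<Sum>i<m. F (u i t \<omega>))"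

lemma integrable_antiderivative:
  assumes F: "\<And>x. (F has_real_derivative f x) (at x)" and i: "i < m" and t: "t \<in> {0..T}"
  shows "integrable M (\<lambda>\<omega>. F (u i t \<omega>))"
proof -
  obtain C where C: "0 \<le> C" "\<And>x. \<bar>F x\<bar> \<le> C * (1 + x\<^sup>2)" using antiderivative_growth[OF f_lip F] by blast
  have cF: "continuous_on UNIV F" by (rule DERIV_continuous_on) (use F in blast)
  have "integrable M (\<lambda>\<omega>. C * (1 + (u i t \<omega>)\<^sup>2))"
    by (intro integrable_mult_right Bochner_Integration.integrable_add integrable_const sq_integrableD(2) sq_integrable_u(1) i t)
  then show ?thesis
  proof (rule Bochner_Integration.integrable_bound)
    show "(\<lambda>\<omega>. F (u i t \<omega>)) \<in> borel_measurable M"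
      by (rule cont_processD(1)[OF cont_process_compose[OF cont_u[OF i] cF] t])
    show "AE \<omega> in M. norm (F (u i t \<omega>)) \<le> norm (C * (1 + (u i t \<omega>)\<^sup>2))"
      by (rule AE_I2) (simp only: real_norm_def order_trans[OF C(2) abs_ge_self])
  qed
qed

lemma sq_integrable_linear:
  assumes t: "t \<in> {0..T}" shows "sq_integrable M (\<lambda>\<omega>. \<Sum>j<m. B i j * u j t \<omega>)"
  by (rule sq_integrable_sum, rule sq_integrable_cmult, rule sq_integrable_u(1)) (use t in auto)

lemma integrable_potential:
  assumes F: "\<And>x. (F has_real_derivative f x) (at x)" and t: "t \<in> {0..T}"
  shows "integrable M (potential F t)"
  unfolding potential_def[abs_def]
proof (intro Bochner_Integration.integrable_diff integrable_divide Bochner_Integration.integrable_sum)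
  show "integrable M (\<lambda>\<omega>. u i t \<omega> * (\<Sum>j<m. B i j * u j t \<omega>))" if "i \<in> {..<m}" for i
    using that by (intro sq_integrable_mult sq_integrable_linear t sq_integrable_u(1)) auto
  show "integrable M (\<lambda>\<omega>. F (u i t \<omega>))" if "i \<in> {..<m}" for i
    using that by (intro integrable_antiderivative[OF F _ t]) auto
qed

text \<open>Chain rule along paths, on the event where every \<open>u i\<close> coincides with its
  differentiable version throughout \<open>{0..T}\<close>.\<close>

lemma potential_change:
  assumes F: "\<And>x. (F has_real_derivative f x) (at x)" and sym: "\<And>i j. i < m \<Longrightarrow> j < m \<Longrightarrow> B i j = B j i"
    and t: "t \<in> {0..T}"
  shows "AE \<omega> in M. (\<integral>s. indicator {..t} s * (\<Sum>i<m. drift i s \<omega> * v i s \<omega>) \<partial>timeM) = potential F t \<omega> - potential F 0 \<omega>"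
proof -
  have "AE \<omega> in M. \<forall>i\<in>{..<m}. \<forall>t\<in>{0..T}. u i t \<omega> = u_int i t \<omega>"
    by (rule AE_finite_allI) (use u_eq_u_int in auto)
  with AE_space show ?thesis
  proof eventually_elim
    fix \<omega> assume w: "\<omega> \<in> space M" and eq: "\<forall>i\<in>{..<m}. \<forall>t\<in>{0..T}. u i t \<omega> = u_int i t \<omega>"
    show "(\<integral>s. indicator {..t} s * (\<Sum>i<m. drift i s \<omega> * v i s \<omega>) \<partial>timeM) = potential F t \<omega> - potential F 0 \<omega>"
    proof (rule time_integral_FTC[OF _ _ t])
      show "continuous_on {0..T} (\<lambda>s. \<Sum>i<m. drift i s \<omega> * v i s \<omega>)"
        by (intro continuous_on_sum continuous_on_mult cont_processD(2)[OF cont_drift _] cont_processD(2)[OF cont_v _] w) auto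
      fix s assume s: "s \<in> {0..T}"
      have du: "((\<lambda>t. u i t \<omega>) has_real_derivative v i s \<omega>) (at s within {0..T})" if i: "i < m" for i
      proof (rule has_field_derivative_transform_within[of _ _ _ _ 1])
        show "((\<lambda>t. u_int i t \<omega>) has_real_derivative v i s \<omega>) (at s within {0..T})"
          unfolding u_int_def
          using DERIV_add[OF DERIV_const time_primitive_derivative[OF cont_processD(2)[OF cont_v[OF i] w] s], of "u0 i"] by simp
        show "u_int i x \<omega> = u i x \<omega>" if "x \<in> {0..T}" for x using eq that i by simp
      qed (use s in auto)
      let ?L = "\<lambda>w i. \<Sum>j<m. B i j * w j"
      have dL: "((\<lambda>t. \<Sum>j<m. B i j * u j t \<omega>) has_real_derivative ?L (\<lambda>j. v j s \<omega>) i) (at s within {0..T})" for i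
        by (rule DERIV_sum, rule DERIV_cmult, rule du) simp
      have dQ: "((\<lambda>t. \<Sum>i<m. u i t \<omega> * (\<Sum>j<m. B i j * u j t \<omega>)) has_real_derivative
          (\<Sum>i<m. v i s \<omega> * ?L (\<lambda>j. u j s \<omega>) i + ?L (\<lambda>j. v j s \<omega>) i * u i s \<omega>)) (at s within {0..T})"
        by (rule DERIV_sum, rule DERIV_mult[OF du dL]) simp
      have dF: "((\<lambda>t. \<Sum>i<m. F (u i t \<omega>)) has_real_derivative (\<Sum>i<m. f (u i s \<omega>) * v i s \<omega>)) (at s within {0..T})"
        by (rule DERIV_sum, rule DERIV_chain2[OF F du]) simp
      \<comment> \<open>By symmetry of \<open>B\<close> the two halves of the derivative of the
        quadratic form agree, which absorbs the factor 1/2.\<close>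
      have "(\<Sum>i<m. ?L (\<lambda>j. v j s \<omega>) i * u i s \<omega>) = (\<Sum>i<m. \<Sum>j<m. B i j * v j s \<omega> * u i s \<omega>)"
        by (simp only: sum_distrib_right)
      also have "\<dots> = (\<Sum>j<m. \<Sum>i<m. B i j * v j s \<omega> * u i s \<omega>)" by (rule sum.swap)
      also have "\<dots> = (\<Sum>j<m. v j s \<omega> * ?L (\<lambda>i. u i s \<omega>) j)"
        unfolding sum_distrib_left by (intro sum.cong refl) (simp add: sym)
      finally have sw: "(\<Sum>i<m. ?L (\<lambda>j. v j s \<omega>) i * u i s \<omega>) = (\<Sum>i<m. v i s \<omega> * ?L (\<lambda>j. u j s \<omega>) i)" .
      have val: "(\<Sum>i<m. v i s \<omega> * ?L (\<lambda>j. u j s \<omega>) i + ?L (\<lambda>j. v j s \<omega>) i * u i s \<omega>) / 2 - (\<Sum>i<m. f (u i s \<omega>) * v i s \<omega>)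
          = (\<Sum>i<m. drift i s \<omega> * v i s \<omega>)"
        unfolding sum.distrib sw drift_def left_diff_distrib sum_subtractf by (simp add: mult.commute)
      show "((\<lambda>t. potential F t \<omega>) has_real_derivative (\<Sum>i<m. drift i s \<omega> * v i s \<omega>)) (at s within {0..T})"
        unfolding potential_def using DERIV_diff[OF DERIV_cdivide[OF dQ, of 2] dF] unfolding val .
    qed
  qed
qed

definition energy :: "real \<Rightarrow> (real \<Rightarrow> real) \<Rightarrow> real \<Rightarrow> 'w \<Rightarrow> real" where
  "energy h F t \<omega> = 1 / 2 * (\<Sum>i<m. h * (v i t \<omega>)\<^sup>2)
     - 1 / 2 * (\<Sum>i<m. h * u i t \<omega> * (\<Sum>j<m. B i j * u j t \<omega>)) + (\<Sum>i<m. h * F (u i t \<omega>))"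

lemma energy_eq: "energy h F t \<omega> = h / 2 * (\<Sum>i<m. (v i t \<omega>)\<^sup>2) - h * potential F t \<omega>"
  unfolding energy_def potential_def by (simp add: sum_distrib_left[symmetric] mult.assoc right_diff_distrib)

lemma integrable_energy:
  assumes F: "\<And>x. (F has_real_derivative f x) (at x)" and t: "t \<in> {0..T}"
  shows "integrable M (energy h F t)"
    "expectation (energy h F t) = h / 2 * (\<Sum>i<m. expectation (\<lambda>\<omega>. (v i t \<omega>)\<^sup>2)) - h * expectation (potential F t)"
proof -
  have iv: "integrable M (\<lambda>\<omega>. \<Sum>i<m. (v i t \<omega>)\<^sup>2)"
    by (intro Bochner_Integration.integrable_sum sq_integrableD(2) sq_integrable_v(1) t) simp
  note i = integrable_mult_right[OF iv, of "h / 2"] integrable_mult_right[OF integrable_potential[OF F t], of h]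
  have e: "energy h F t = (\<lambda>\<omega>. h / 2 * (\<Sum>i<m. (v i t \<omega>)\<^sup>2) - h * potential F t \<omega>)"
    by (rule ext) (rule energy_eq)
  show "integrable M (energy h F t)" unfolding e by (rule Bochner_Integration.integrable_diff[OF i])
  have "expectation (\<lambda>\<omega>. \<Sum>i<m. (v i t \<omega>)\<^sup>2) = (\<Sum>i<m. expectation (\<lambda>\<omega>. (v i t \<omega>)\<^sup>2))"
    by (rule Bochner_Integration.integral_sum) (intro sq_integrableD(2) sq_integrable_v(1) t, simp)
  then show "expectation (energy h F t) = h / 2 * (\<Sum>i<m. expectation (\<lambda>\<omega>. (v i t \<omega>)\<^sup>2)) - h * expectation (potential F t)"
    unfolding e Bochner_Integration.integral_diff[OF i] by simp
qed

text \<open>The identities for the second moments of V are summed with weight h/2. Their drift terms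
  add up to h times the change of the expected \<open>potential\<close>, which cancels against the
  potential part of the energy; the noise term remains.\<close>

lemma energy_identity:
  assumes F: "\<And>x. (F has_real_derivative f x) (at x)" and sym: "\<And>i j. i < m \<Longrightarrow> j < m \<Longrightarrow> B i j = B j i"
    and t: "t \<in> {0..T}"
  shows "integrable M (\<lambda>\<omega>. LBINT s:{0..t}. \<Sum>i<m. \<Sum>k<P. (noise i k s \<omega>)\<^sup>2)"
    and "expectation (energy h F t) = expectation (energy h F 0)
      + h / 2 * expectation (\<lambda>\<omega>. LBINT s:{0..t}. \<Sum>i<m. \<Sum>k<P. (noise i k s \<omega>)\<^sup>2)"
proof -
  have z: "(0::real) \<in> {0..T}" using T_pos by simp
  let ?W = "\<lambda>s \<omega>. \<Sum>i<m. drift i s \<omega> * v i s \<omega>" and ?S = "\<lambda>s \<omega>. \<Sum>i<m. \<Sum>k<P. (noise i k s \<omega>)\<^sup>2"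
  have iw: "integrable prodM (\<lambda>x. drift i (fst x) (snd x) * v i (fst x) (snd x))" if "i < m" for i
    by (intro sq_integrable_mult sq_integrable_drift(1) sq_integrable_v(2) that)
  have iW: "integrable prodM (\<lambda>x. ?W (fst x) (snd x))"
    by (rule Bochner_Integration.integrable_sum) (use iw in auto)
  have iN: "integrable prodM (\<lambda>x. (noise i k (fst x) (snd x))\<^sup>2)" if "i < m" "k < P" for i k
    by (intro sq_integrableD(2) sq_integrable_noise that)
  have iS: "integrable prodM (\<lambda>x. ?S (fst x) (snd x))"
    by (intro Bochner_Integration.integrable_sum) (use iN in auto)
  have W: "(\<integral>x. indicator {..t} (fst x) * ?W (fst x) (snd x) \<partial>prodM) =
      (\<Sum>i<m. \<integral>x. indicator {..t} (fst x) * (drift i (fst x) (snd x) * v i (fst x) (snd x)) \<partial>prodM)"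
    unfolding sum_distrib_left
    by (rule Bochner_Integration.integral_sum, rule integrable_prodM_upto) (use iw in auto)
  have S: "(\<integral>x. indicator {..t} (fst x) * ?S (fst x) (snd x) \<partial>prodM) =
      (\<Sum>i<m. \<Sum>k<P. \<integral>x. indicator {..t} (fst x) * (noise i k (fst x) (snd x))\<^sup>2 \<partial>prodM)"
    unfolding sum_distrib_left
    by (rule integral_double_sum, rule integrable_prodM_upto) (use iN in auto)
  note JW = integral_prodM_upto[where h="?W" and t=t, OF iW] and JS = integral_prodM_upto[where h="?S" and t=t, OF iS]
  show "integrable M (\<lambda>\<omega>. LBINT s:{0..t}. ?S s \<omega>)" using JS(2) unfolding integral_upto[OF t] .
  have "(\<integral>x. indicator {..t} (fst x) * ?W (fst x) (snd x) \<partial>prodM) = expectation (\<lambda>\<omega>. potential F t \<omega> - potential F 0 \<omega>)"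
    unfolding JW(1)
    by (rule integral_cong_AE[OF borel_measurable_integrable[OF JW(2)] _ potential_change[OF F sym t]])
       (intro borel_measurable_diff borel_measurable_integrable integrable_potential F t z)
  also have "\<dots> = expectation (potential F t) - expectation (potential F 0)"
    by (intro Bochner_Integration.integral_diff integrable_potential F t z)
  finally have pot: "(\<Sum>i<m. \<integral>x. indicator {..t} (fst x) * (drift i (fst x) (snd x) * v i (fst x) (snd x)) \<partial>prodM)
      = expectation (potential F t) - expectation (potential F 0)" unfolding W .
  have v00: "expectation (\<lambda>\<omega>. (v i 0 \<omega>)\<^sup>2) = (v0 i)\<^sup>2" if i: "i < m" for i
  proof -
    have "expectation (\<lambda>\<omega>. (v i 0 \<omega>)\<^sup>2) = expectation (\<lambda>\<omega>. (v0 i)\<^sup>2)"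
    proof (rule integral_cong_AE)
      show "(\<lambda>\<omega>. (v i 0 \<omega>)\<^sup>2) \<in> borel_measurable M"
        by (intro borel_measurable_power cont_processD(1)[OF cont_v[OF i] z])
      show "AE \<omega> in M. (v i 0 \<omega>)\<^sup>2 = (v0 i)\<^sup>2" using v_init[OF i] by (rule eventually_mono) simp
    qed simp
    then show ?thesis by (simp add: prob_space)
  qed
  have vt: "(\<Sum>i<m. expectation (\<lambda>\<omega>. (v i t \<omega>)\<^sup>2)) = (\<Sum>i<m. (v0 i)\<^sup>2)
      + 2 * (expectation (potential F t) - expectation (potential F 0))
      + expectation (\<lambda>\<omega>. LBINT s:{0..t}. ?S s \<omega>)"
  proof -
    have "(\<Sum>i<m. expectation (\<lambda>\<omega>. (v i t \<omega>)\<^sup>2)) = (\<Sum>i<m. (v0 i)\<^sup>2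
        + 2 * (\<integral>x. indicator {..t} (fst x) * (drift i (fst x) (snd x) * v i (fst x) (snd x)) \<partial>prodM)
        + (\<Sum>k<P. \<integral>x. indicator {..t} (fst x) * (noise i k (fst x) (snd x))\<^sup>2 \<partial>prodM))"
      by (rule sum.cong[OF refl], rule v_second_moment[OF _ t]) simp
    also have "\<dots> = (\<Sum>i<m. (v0 i)\<^sup>2) + 2 * (expectation (potential F t) - expectation (potential F 0))
        + (\<integral>x. indicator {..t} (fst x) * ?S (fst x) (snd x) \<partial>prodM)"
      unfolding S pot[symmetric] by (simp only: sum.distrib sum_distrib_left)
    also have "(\<integral>x. indicator {..t} (fst x) * ?S (fst x) (snd x) \<partial>prodM) = expectation (\<lambda>\<omega>. LBINT s:{0..t}. ?S s \<omega>)"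
      unfolding JS(1) integral_upto[OF t] ..
    finally show ?thesis .
  qed
  have v0sum: "(\<Sum>i<m. expectation (\<lambda>\<omega>. (v i 0 \<omega>)\<^sup>2)) = (\<Sum>i<m. (v0 i)\<^sup>2)" by (rule sum.cong) (use v00 in auto)
  show "expectation (energy h F t) = expectation (energy h F 0)
      + h / 2 * expectation (\<lambda>\<omega>. LBINT s:{0..t}. ?S s \<omega>)"
    unfolding integrable_energy(2)[OF F t] integrable_energy(2)[OF F z] vt v0sum by (simp add: algebra_simps)
qed

end

section \<open>The matrices of the scheme\<close>

lemma tridiag_carrier: "tridiag n l d u \<in> carrier_mat n n"
  by (simp add: tridiag_def)

lemma mult_mat_vec_sum:
  fixes X :: "real mat"
  assumes "X \<in> carrier_mat n k" "w \<in> carrier_vec k" "i < n"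
  shows "(X *\<^sub>v w) $ i = (\<Sum>j<k. X $$ (i, j) * w $ j)"
  using assms by (simp add: scalar_prod_def row_def atLeast0LessThan)

text \<open>Strict diagonal dominance at an entry of largest modulus b: the row of that entry would
  force 10/12 b to be at most 2/12 b.\<close>

lemma A_mat_injective:
  assumes w: "w \<in> carrier_vec (M - 1)" and z: "A_mat M *\<^sub>v w = 0\<^sub>v (M - 1)"
  shows "w = 0\<^sub>v (M - 1)"
proof (rule ccontr)
  let ?m = "M - 1" and ?X = "A_mat M"
  assume "w \<noteq> 0\<^sub>v ?m"
  then obtain i0 where i0: "i0 < ?m" "w $ i0 \<noteq> 0" using w by (metis carrier_vecD eq_vecI index_zero_vec)
  define b where "b = Max ((\<lambda>i. \<bar>w $ i\<bar>) ` {..<?m})"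
  have "b \<in> (\<lambda>i. \<bar>w $ i\<bar>) ` {..<?m}" unfolding b_def by (rule Max_in) (use i0 in auto)
  then obtain i where i: "i < ?m" "\<bar>w $ i\<bar> = b" by auto
  have le: "\<bar>w $ j\<bar> \<le> b" if "j < ?m" for j unfolding b_def by (rule Max_ge) (use that in auto)
  have b: "0 < b" using le[OF i0(1)] i0(2) by linarith
  \<comment> \<open>On \<open>nat\<close>, \<open>i - 1\<close> equals \<open>i\<close> when
    \<open>i = 0\<close>; the guard prevents a second contribution on the diagonal.\<close>
  have X: "?X $$ (i, j) = (if j = i then 10 / 12 else 0) + (if j = i - 1 then (if i = 0 then 0 else 1 / 12) else 0)
      + (if j = Suc i then 1 / 12 else 0)" if "j < ?m" for j
    using that i(1) by (auto simp: A_mat_def tridiag_def)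
  let ?e = "\<lambda>j. (if j = i - 1 then (if i = 0 then 0 else 1 / 12) * w $ j else 0) + (if j = Suc i then 1 / 12 * w $ j else 0)"
  have "0 = (\<Sum>j<?m. ?X $$ (i, j) * w $ j)"
    using mult_mat_vec_sum[of ?X ?m ?m w i] z i(1) w by (simp add: A_mat_def tridiag_carrier)
  also have "\<dots> = (\<Sum>j<?m. (if j = i then 10 / 12 * w $ j else 0) + ?e j)"
    by (rule sum.cong[OF refl]) (simp add: X distrib_right)
  also have "\<dots> = 10 / 12 * w $ i + (\<Sum>j<?m. ?e j)" using i(1) by (simp add: sum.distrib)
  finally have eq: "10 / 12 * w $ i = - (\<Sum>j<?m. ?e j)" by simp
  have "\<bar>\<Sum>j<?m. ?e j\<bar> \<le> (\<Sum>j<?m. (if j = i - 1 then 1 / 12 * b else 0) + (if j = Suc i then 1 / 12 * b else 0))"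
  proof (rule order_trans[OF sum_abs sum_mono])
    fix j assume "j \<in> {..<?m}"
    then have "\<bar>w $ j\<bar> \<le> b" using le by simp
    then show "\<bar>?e j\<bar> \<le> (if j = i - 1 then 1 / 12 * b else 0) + (if j = Suc i then 1 / 12 * b else 0)"
      using b by (auto simp: abs_mult)
  qed
  also have "\<dots> \<le> 1 / 12 * b + 1 / 12 * b"
    using b by (simp add: sum.distrib)
  finally have "\<bar>10 / 12 * w $ i\<bar> \<le> 1 / 12 * b + 1 / 12 * b" unfolding eq abs_minus_cancel .
  then have "10 / 12 * b \<le> 1 / 12 * b + 1 / 12 * b" using i(2) by (simp add: abs_mult)
  then show False using b by simp
qed

lemma A_mat_inverse:
  obtains Ai where "mat_inverse (A_mat M) = Some Ai" "Ai \<in> carrier_mat (M - 1) (M - 1)"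
    "A_mat M * Ai = 1\<^sub>m (M - 1)" "Ai * A_mat M = 1\<^sub>m (M - 1)"
proof -
  have A: "A_mat M \<in> carrier_mat (M - 1) (M - 1)" by (simp add: A_mat_def tridiag_carrier)
  have "det (A_mat M) \<noteq> 0"
    using det_0_iff_vec_prod_zero_field[OF A] A_mat_injective by blast
  from det_non_zero_imp_unit[OF A this, of "()"] have "mat_inverse (A_mat M) \<noteq> None"
    using mat_inverse(1)[OF A, of "()"] by blast
  then obtain Ai where Ai: "mat_inverse (A_mat M) = Some Ai" by blast
  from mat_inverse(2)[OF A Ai] that[OF Ai] show ?thesis by blast
qed

lemma tridiag_symmetric: "transpose_mat (tridiag n l d l) = tridiag n l d l"
  by (rule eq_matI) (auto simp: tridiag_def)

text \<open>\<open>A = 1 + h\<^sup>2/12 D\<close> commutes with \<open>D\<close>, so \<open>A\<^sup>-\<^sup>1 D = D A\<^sup>-\<^sup>1\<close> is symmetric.\<close>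

lemma AinvD_mat_symmetric:
  assumes ab: "a < b" and M: "2 \<le> M"
  shows "AinvD_mat a b M \<in> carrier_mat (M - 1) (M - 1)" "transpose_mat (AinvD_mat a b M) = AinvD_mat a b M"
proof -
  let ?m = "M - 1" and ?A = "A_mat M" and ?D = "D_mat a b M"
  have h: "mesh a b M \<noteq> 0" using ab M by (simp add: mesh_def)
  obtain Ai where Ai: "mat_inverse ?A = Some Ai" "Ai \<in> carrier_mat ?m ?m" "?A * Ai = 1\<^sub>m ?m" "Ai * ?A = 1\<^sub>m ?m"
    by (rule A_mat_inverse)
  have A: "?A \<in> carrier_mat ?m ?m" by (simp add: A_mat_def tridiag_carrier)
  have D: "?D \<in> carrier_mat ?m ?m" by (simp add: D_mat_def tridiag_carrier)
  have B: "AinvD_mat a b M = Ai * ?D" by (simp add: AinvD_mat_def Ai(1))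
  show "AinvD_mat a b M \<in> carrier_mat ?m ?m" unfolding B using Ai(2) D by simp
  \<comment> \<open>With mesh size h, the diagonal entry is 1 - 2/12 = 10/12, and off the diagonal
    h^2/12 cancels the 1/h^2 in D.\<close>
  have AD: "?A = 1\<^sub>m ?m + ((mesh a b M)\<^sup>2 / 12) \<cdot>\<^sub>m ?D"
    by (rule eq_matI) (use h in \<open>auto simp: A_mat_def D_mat_def tridiag_def\<close>)
  let ?c = "(mesh a b M)\<^sup>2 / 12"
  have cD: "?c \<cdot>\<^sub>m ?D \<in> carrier_mat ?m ?m" using D by simp
  have "?A * ?D = ?D + (?c \<cdot>\<^sub>m ?D) * ?D"
    unfolding AD using add_mult_distrib_mat[OF one_carrier_mat cD D] D by simp
  also have "(?c \<cdot>\<^sub>m ?D) * ?D = ?D * (?c \<cdot>\<^sub>m ?D)"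
    using mult_smult_assoc_mat[OF D D, of ?c] mult_smult_distrib[OF D D, of ?c] by simp
  also have "?D + ?D * (?c \<cdot>\<^sub>m ?D) = ?D * ?A"
    unfolding AD using mult_add_distrib_mat[OF D one_carrier_mat cD] D by simp
  finally have comm: "?A * ?D = ?D * ?A" .
  \<comment> \<open>The identity \<open>?A * Ai\<close> is inserted on the right; \<open>?A\<close>
    then moves past \<open>?D\<close> and cancels against \<open>Ai\<close> on the left.\<close>
  have "Ai * ?D = Ai * (?D * (?A * Ai))" using Ai D by simp
  also have "\<dots> = Ai * ((?D * ?A) * Ai)" using assoc_mult_mat[OF D A Ai(2)] by simp
  also have "\<dots> = Ai * (?A * (?D * Ai))" unfolding comm[symmetric] using assoc_mult_mat[OF A D Ai(2)] by simp
  also have "\<dots> = (Ai * ?A) * (?D * Ai)" using assoc_mult_mat[OF Ai(2) A, of "?D * Ai" ?m] D Ai(2) by simp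
  also have "\<dots> = ?D * Ai" unfolding Ai(4) using D Ai(2) by simp
  finally have AiD: "Ai * ?D = ?D * Ai" .
  have tD: "transpose_mat ?D = ?D"
    by (rule eq_matI) (auto simp: D_mat_def tridiag_def)
  have tA: "transpose_mat ?A = ?A" unfolding A_mat_def by (rule tridiag_symmetric)
  have tAi: "transpose_mat Ai \<in> carrier_mat ?m ?m" using Ai(2) by simp
  \<comment> \<open>The transpose is a left inverse of the symmetric \<open>?A\<close> and therefore
    equals \<open>Ai\<close>.\<close>
  have "transpose_mat Ai * ?A = 1\<^sub>m ?m"
    using transpose_mult[OF A Ai(2)] Ai(3) tA by simp
  then have "transpose_mat Ai * ?A * Ai = Ai" using Ai(2) by simp
  then have "transpose_mat Ai = Ai" using assoc_mult_mat[OF tAi A Ai(2)] Ai(3) tAi by simp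
  then have "transpose_mat (Ai * ?D) = ?D * Ai" using transpose_mult[OF Ai(2) D] tD by (simp only:)
  then show "transpose_mat (AinvD_mat a b M) = AinvD_mat a b M" unfolding B by (simp only: AiD)
qed

section \<open>The noise matrix and its trace\<close>

lemma noise_matrix_entry:
  assumes "i < M - 1" "k < P"
  shows "(G_mat g M w * E_mat a b M e P * Lambda_mat q P) $$ (i, k) =
    g (w $ i) * (e k (gridpt a b M (Suc i)) * sqrt (q k))"
proof -
  have E: "E_mat a b M e P \<in> carrier_mat (M - 1) P" by (simp add: E_mat_def)
  have GE: "G_mat g M w * E_mat a b M e P = Matrix.mat (M - 1) P (\<lambda>(i, j). g (w $ i) * E_mat a b M e P $$ (i, j))"
    unfolding G_mat_def by (rule mat_diag_mult_left[OF E])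
  show ?thesis
    unfolding GE Lambda_mat_def
    by (subst mat_diag_mult_right[of _ "M - 1"]) (use assms in \<open>simp_all add: E_mat_def\<close>)
qed

text \<open>The trace is the squared Frobenius norm of the matrix G E \<Lambda>, so it sums the
  squares of the stochastic integrands over all nodes and modes, which is what the isometry
  produces.\<close>

lemma noise_trace_eq:
  "noise_trace a b M P q e g w =
    (\<Sum>i<M - 1. \<Sum>k<P. (g (w $ i) * (e k (gridpt a b M (Suc i)) * sqrt (q k)))\<^sup>2)"
proof -
  let ?E = "E_mat a b M e P"
  have sq: "mat_diag n f ^\<^sub>m 2 = mat_diag n (\<lambda>i. f i * f i)" for n and f :: "nat \<Rightarrow> real"
    by (simp add: numeral_2_eq_2 mat_diag_diag)
  have E: "?E \<in> carrier_mat (M - 1) P" by (simp add: E_mat_def)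
  have GE: "G_mat g M w ^\<^sub>m 2 * ?E = Matrix.mat (M - 1) P (\<lambda>(i, j). (g (w $ i) * g (w $ i)) * ?E $$ (i, j))"
    unfolding G_mat_def sq by (rule mat_diag_mult_left[OF E])
  have GEL: "G_mat g M w ^\<^sub>m 2 * ?E * Lambda_mat q P ^\<^sub>m 2 =
      Matrix.mat (M - 1) P (\<lambda>(i, j). (g (w $ i) * g (w $ i)) * ?E $$ (i, j) * (sqrt (q j) * sqrt (q j)))"
    unfolding GE Lambda_mat_def sq
    by (subst mat_diag_mult_right[of _ "M - 1"]) (auto intro!: eq_matI)
  show ?thesis
    unfolding noise_trace_def mat_trace_def GEL
    \<comment> \<open>Keeping the product of the two square roots unsimplified makes both sides the
      same polynomial in \<open>sqrt (q k)\<close>.\<close>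
    by (simp add: scalar_prod_def E_mat_def atLeast0LessThan power2_eq_square mult_ac del: real_sqrt_mult_self)
qed

text \<open>The Bochner integral of a non-integrable function is 0 by convention; the integrability
  clauses ensure that the equation relates genuine expectations.\<close>

theorem theorem2p1:
  fixes \<P> :: "'w measure" and \<F> :: "real \<Rightarrow> 'w measure"
    and \<beta> :: "nat \<Rightarrow> real \<Rightarrow> 'w \<Rightarrow> real"
    and Q :: "(real \<Rightarrow> real) \<Rightarrow> (real \<Rightarrow> real)" and q :: "nat \<Rightarrow> real" and e :: "nat \<Rightarrow> real \<Rightarrow> real"
    and a b T :: real and M P :: nat
    and f g ft :: "real \<Rightarrow> real"
    and u0 v0 :: "real vec" and U V :: "real \<Rightarrow> 'w \<Rightarrow> real vec"
  assumes "a < b" and "T > 0" and "M \<ge> 2" and "P \<ge> 1"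
    and "prob_space \<P>" and "normal_filtration \<P> \<F>"
    and "covariance_operator a b Q q e" and "wiener_coordinates \<P> \<F> \<beta>"
    and "\<exists>L. L-lipschitz_on UNIV f" and "\<exists>L. L-lipschitz_on UNIV g"
    and "\<And>x. (ft has_real_derivative f x) (at x)"
    and "cfd_solution \<P> \<F> \<beta> T a b M P q e f g u0 v0 U V"
  shows "\<forall>t\<in>{0..T}.
     integrable \<P> (\<lambda>\<omega>. discrete_energy a b M ft (U t \<omega>) (V t \<omega>)) \<and>
     integrable \<P> (\<lambda>\<omega>. discrete_energy a b M ft (U 0 \<omega>) (V 0 \<omega>)) \<and>
     integrable \<P> (\<lambda>\<omega>. LBINT s:{0..t}. noise_trace a b M P q e g (U s \<omega>)) \<and>
     (\<integral>\<omega>. discrete_energy a b M ft (U t \<omega>) (V t \<omega>) \<partial>\<P>)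
       = (\<integral>\<omega>. discrete_energy a b M ft (U 0 \<omega>) (V 0 \<omega>) \<partial>\<P>)
         + mesh a b M / 2 * (\<integral>\<omega>. (LBINT s:{0..t}. noise_trace a b M P q e g (U s \<omega>)) \<partial>\<P>)"
proof -
  let ?m = "M - 1"
  define B where "B i j = AinvD_mat a b M $$ (i, j)" for i j
  define c where "c i k = e k (gridpt a b M (Suc i)) * sqrt (q k)" for i k
  note BC = AinvD_mat_symmetric[OF \<open>a < b\<close> \<open>M \<ge> 2\<close>]
  have B_sym: "B i j = B j i" if "i < ?m" "j < ?m" for i j
    using index_transpose_mat(1)[of j "AinvD_mat a b M" i] that BC by (simp add: B_def)
  obtain Lf where Lf: "Lf-lipschitz_on UNIV f" using assms(9) by blast
  obtain Lg where Lg: "Lg-lipschitz_on UNIV g" using assms(10) by blast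
  note sol = assms(12)[unfolded cfd_solution_def]
  have U: "U t \<omega> \<in> carrier_vec ?m" "i < ?m \<Longrightarrow> (\<lambda>\<omega>. U t \<omega> $ i) \<in> borel_measurable (\<F> t)"
    "i < ?m \<Longrightarrow> continuous_on {0..T} (\<lambda>t. U t \<omega> $ i)" if "t \<in> {0..T}" "\<omega> \<in> space \<P>" for t \<omega> i
    using sol[THEN conjunct1] that unfolding continuous_adapted_vec_process_def by blast+
  have V: "(\<lambda>\<omega>. V t \<omega> $ i) \<in> borel_measurable (\<F> t)"
    "continuous_on {0..T} (\<lambda>t. V t \<omega> $ i)" if "t \<in> {0..T}" "\<omega> \<in> space \<P>" "i < ?m" for t \<omega> i
    using sol[THEN conjunct2, THEN conjunct1] that unfolding continuous_adapted_vec_process_def by blast+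
  have init: "AE \<omega> in \<P>. U 0 \<omega> = u0 \<and> V 0 \<omega> = v0"
    using sol by blast
  obtain I where ito: "\<And>i k. i < ?m \<Longrightarrow> k < P \<Longrightarrow> has_ito_integral \<P> \<F> T (\<beta> k)
        (\<lambda>s \<omega>. (G_mat g M (U s \<omega>) * E_mat a b M e P * Lambda_mat q P) $$ (i, k)) (I i k)"
    and Veq: "\<And>t i. t \<in> {0..T} \<Longrightarrow> i < ?m \<Longrightarrow> AE \<omega> in \<P>. V t \<omega> $ i = V 0 \<omega> $ i
               + (LBINT s:{0..t}. (AinvD_mat a b M *\<^sub>v U s \<omega>) $ i)
               - (LBINT s:{0..t}. F_vec f M (U s \<omega>) $ i) + (\<Sum>k<P. I i k t \<omega>)"
    using sol by blast
  have Ueq: "AE \<omega> in \<P>. U t \<omega> $ i = U 0 \<omega> $ i + (LBINT s:{0..t}. V s \<omega> $ i)" if "t \<in> {0..T}" "i < ?m" for t i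
    using sol that by blast
  \<comment> \<open>The measurability facts above are stated under a sample point; a probability
    space supplies one.\<close>
  have ne: "\<exists>\<omega>. \<omega> \<in> space \<P>" using prob_space.not_empty[OF assms(5)] by blast
  interpret W: wiener_space \<P> \<F> \<beta> T
    by (intro wiener_space.intro wiener_space_axioms.intro assms)
  interpret S: semidiscrete_scheme \<P> \<F> \<beta> T ?m P "\<lambda>i t \<omega>. U t \<omega> $ i" "\<lambda>i t \<omega>. V t \<omega> $ i" I B c f g Lf Lg
    "\<lambda>i. u0 $ i" "\<lambda>i. v0 $ i"
  proof (unfold_locales)
    show "continuous_on {0..T} (\<lambda>t. U t \<omega> $ i)" if "i < ?m" "\<omega> \<in> space \<P>" for i \<omega>
      using U(3)[of 0 \<omega> i] that \<open>T > 0\<close> by simp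
    show "continuous_on {0..T} (\<lambda>t. V t \<omega> $ i)" if "i < ?m" "\<omega> \<in> space \<P>" for i \<omega>
      using V(2)[of 0 \<omega> i] that \<open>T > 0\<close> by simp
    show "(\<lambda>\<omega>. U t \<omega> $ i) \<in> borel_measurable (\<F> t)" if "i < ?m" "t \<in> {0..T}" for i t
      using U(2)[of t _ i] that ne by blast
    show "(\<lambda>\<omega>. V t \<omega> $ i) \<in> borel_measurable (\<F> t)" if "i < ?m" "t \<in> {0..T}" for i t
      using V(1)[of t _ i] that ne by blast
    show "Lf-lipschitz_on UNIV f" "Lg-lipschitz_on UNIV g" by fact+
    show "has_ito_integral \<P> \<F> T (\<beta> k) (\<lambda>s \<omega>. g (U s \<omega> $ i) * c i k) (I i k)" if "i < ?m" "k < P" for i k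
      using ito[OF that] unfolding noise_matrix_entry[OF that] c_def .
    show "AE \<omega> in \<P>. U t \<omega> $ i = u0 $ i + (LBINT s:{0..t}. V s \<omega> $ i)" if "i < ?m" "t \<in> {0..T}" for i t
      using Ueq[OF that(2,1)] init by eventually_elim simp
    show "AE \<omega> in \<P>. V 0 \<omega> $ i = v0 $ i" for i
      using init by eventually_elim simp
    \<comment> \<open>The two drift integrals of the scheme are merged into one; continuity of the
      path makes both integrands integrable on \<open>{0..t}\<close>.\<close>
    fix i t assume i: "i < ?m" and t: "t \<in> {0..T}"
    show "AE \<omega> in \<P>. V t \<omega> $ i = v0 $ i
        + (LBINT s:{0..t}. (\<Sum>j<?m. B i j * U s \<omega> $ j) - f (U s \<omega> $ i)) + (\<Sum>k<P. I i k t \<omega>)"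
      using Veq[OF t i] init AE_space
    proof eventually_elim
      case (elim \<omega>)
      have u: "continuous_on {0..t} (\<lambda>s. U s \<omega> $ j)" if "j < ?m" for j
        by (rule continuous_on_subset[OF U(3)[OF t elim(3) that]]) (use t in auto)
      have 1: "(LBINT s:{0..t}. (AinvD_mat a b M *\<^sub>v U s \<omega>) $ i) = (LBINT s:{0..t}. \<Sum>j<?m. B i j * U s \<omega> $ j)"
      proof (rule set_lebesgue_integral_cong)
        show "\<forall>s. s \<in> {0..t} \<longrightarrow> (AinvD_mat a b M *\<^sub>v U s \<omega>) $ i = (\<Sum>j<?m. B i j * U s \<omega> $ j)"
          using mult_mat_vec_sum[OF BC(1) U(1)[OF _ elim(3)] i] t by (auto simp: B_def)
      qed simp
      have 2: "(LBINT s:{0..t}. F_vec f M (U s \<omega>) $ i) = (LBINT s:{0..t}. f (U s \<omega> $ i))"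
        using i by (simp add: F_vec_def)
      have "(LBINT s:{0..t}. (\<Sum>j<?m. B i j * U s \<omega> $ j) - f (U s \<omega> $ i)) =
          (LBINT s:{0..t}. \<Sum>j<?m. B i j * U s \<omega> $ j) - (LBINT s:{0..t}. f (U s \<omega> $ i))"
      proof (rule set_integral_diff(2))
        show "set_integrable lborel {0..t} (\<lambda>s. \<Sum>j<?m. B i j * U s \<omega> $ j)"
          by (rule borel_integrable_atLeastAtMost') (intro continuous_on_sum continuous_on_mult continuous_on_const u, simp)
        show "set_integrable lborel {0..t} (\<lambda>s. f (U s \<omega> $ i))"
          by (rule borel_integrable_atLeastAtMost')
             (rule continuous_on_compose2[OF lipschitz_on_continuous_on[OF Lf] u[OF i]], simp)
      qed
      then show ?case using elim(1,2) 1 2 by simp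
    qed
  qed
  have en: "discrete_energy a b M ft (U t \<omega>) (V t \<omega>) = S.energy (mesh a b M) ft t \<omega>"
    if "t \<in> {0..T}" "\<omega> \<in> space \<P>" for t \<omega>
    unfolding discrete_energy_def S.energy_def
    using mult_mat_vec_sum[OF BC(1) U(1)[OF that]] by (simp add: B_def)
  have tr: "noise_trace a b M P q e g (U s \<omega>) = (\<Sum>i<?m. \<Sum>k<P. (S.noise i k s \<omega>)\<^sup>2)" for s \<omega>
    unfolding noise_trace_eq S.noise_def c_def ..
  have zero: "(0::real) \<in> {0..T}" using \<open>T > 0\<close> by simp
  have int: "integrable \<P> (\<lambda>\<omega>. discrete_energy a b M ft (U t \<omega>) (V t \<omega>))" if t: "t \<in> {0..T}" for t
    by (subst Bochner_Integration.integrable_cong[OF refl en[OF t]]) (use S.integrable_energy(1)[OF assms(11) t] in auto)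
  have ex: "(\<integral>\<omega>. discrete_energy a b M ft (U t \<omega>) (V t \<omega>) \<partial>\<P>) = W.expectation (S.energy (mesh a b M) ft t)"
    if t: "t \<in> {0..T}" for t
    by (rule Bochner_Integration.integral_cong[OF refl en[OF t]])
  show ?thesis
  proof (intro ballI conjI)
    fix t assume t: "t \<in> {0..T}"
    note id = S.energy_identity[OF assms(11) B_sym t]
    show "integrable \<P> (\<lambda>\<omega>. discrete_energy a b M ft (U t \<omega>) (V t \<omega>))"
      "integrable \<P> (\<lambda>\<omega>. discrete_energy a b M ft (U 0 \<omega>) (V 0 \<omega>))"
      by (rule int[OF t], rule int[OF zero])
    show "integrable \<P> (\<lambda>\<omega>. LBINT s:{0..t}. noise_trace a b M P q e g (U s \<omega>))"
      unfolding tr by (rule id(1))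
    show "(\<integral>\<omega>. discrete_energy a b M ft (U t \<omega>) (V t \<omega>) \<partial>\<P>)
       = (\<integral>\<omega>. discrete_energy a b M ft (U 0 \<omega>) (V 0 \<omega>) \<partial>\<P>)
         + mesh a b M / 2 * (\<integral>\<omega>. (LBINT s:{0..t}. noise_trace a b M P q e g (U s \<omega>)) \<partial>\<P>)"
      unfolding ex[OF t] ex[OF zero] tr by (rule id(2))
  qed
qed

end
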